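(* Let $(\Gamma^{(i)},\Gamma^{(e)})$ be a nested pair of Jordan curves, let $B$ be a complex Banach space, and let $K=K(\Gamma^{(i)},\Gamma^{(e)})$. Then the space $\mathcal{O}(K,B)$ is $\mathcal{H}^1$-quasianalytic relatively to $K$, and it is also quasianalytic at every point of the interior $\operatorname{int}(K)$ of $K$.
   Context: $\widehat{\mathbb{C}}=\mathbb{C}\cup\{\infty\}$ is the Riemann sphere. $\mathcal{H}^1$ is the one-dimensional Hausdorff outer measure on $\mathbb{C}$, extended to $\widehat{\mathbb{C}}$ by $\mathcal{H}^1(A)=\mathcal{H}^1(A\setminus\{\infty\})$. A Jordan curve is the image of a continuous injective map from $\mathbb{R}/\mathbb{Z}$ to $\widehat{\mathbb{C}}$. Nested pair: $(\Gamma^{(i)},\Gamma^{(e)})$ is a nested pair if $\Gamma^{(i)}$ and $\Gamma^{(e)}$ are Jordan curves contained in $\mathbb{C}$ such that (1) $\Gamma^{(i)}$ is contained in the closure of the connected component of $\widehat{\mathbb{C}}\setminus\Gamma^{(e)}$ which does not contain $\infty$; (2) $\Gamma^{(i)}$ and $\Gamma^{(e)}$ are rectifiable and $\mathcal{H}^1(\Gamma^{(i)}\cap\Gamma^{(e)})>0$. Then $K^{(e)}$ denotes the closure of the connected component of $\widehat{\mathbb{C}}\setminus\Gamma^{(e)}$ which contains $\infty$, $K^{(i)}$ denotes the closure of the connected component of $\widehat{\mathbb{C}}\setminus\Gamma^{(i)}$ which does not contain $\infty$, and $K(\Gamma^{(i)},\Gamma^{(e)})=K^{(i)}\cup K^{(e)}$.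 For $K\subset\widehat{\mathbb{C}}$ compact and $B$ a complex Banach space, $\mathcal{O}(K,B)$ is the space of functions $f:K\to B$ that are continuous on $K$ and holomorphic in the interior of $K$. Let $K'\subset K\subset\widehat{\mathbb{C}}$ and let $E$ be a linear space of functions on $K$ with values in a complex Banach space. A subset $\gamma\subset K$ is a uniqueness set for $E$ if the only function of $E$ vanishing identically on $\gamma$ is $f\equiv 0$. $E$ is $\mathcal{H}^1$-quasianalytic relatively to $K'$ if every subset of $K'$ of positive $\mathcal{H}^1$-measure is a uniqueness set for $E$. A function $f:K\to B$ admits an asymptotic expansion at a non-isolated point $q_0$ of $K$ if there is a sequence $(a_n)_{n\ge0}$ in $B$ such that for every $N\in\mathbb{N}$, $(q-q_0)^{-N}\bigl(f(q)-\sum_{n=0}^N a_n(q-q_0)^n\bigr)\to 0$ as $q\to q_0$, $q\in K$ (if $q_0=\infty$, use the coordinate $1/q$); the coefficients are then unique. If each function of $E$ admits an asymptotic expansion at $q_0$ (for instance the Taylor expansion, if it is analytic at $q_0$), $E$ is called quasianalytic at $q_0$ if the only function of $E$ with zero asymptotic expansion at $q_0$ is $f\equiv0$. *)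

theory Defs
  imports "HOL-Analysis.Analysis"
begin

class complex_banach = banach +
  fixes scaleC :: "complex \<Rightarrow> 'a \<Rightarrow> 'a" (infixr \<open>*\<^sub>C\<close> 75)
  assumes scaleC_add_right: "c *\<^sub>C (x + y) = c *\<^sub>C x + c *\<^sub>C y"
    and scaleC_add_left: "(c + d) *\<^sub>C x = c *\<^sub>C x + d *\<^sub>C x"
    and scaleC_scaleC: "c *\<^sub>C d *\<^sub>C x = (c * d) *\<^sub>C x"
    and scaleC_of_real: "complex_of_real r *\<^sub>C x = r *\<^sub>R x"
    and norm_scaleC: "norm (c *\<^sub>C x) = cmod c * norm x"

instantiation complex :: complex_banach
begin

definition scaleC_complex :: "complex \<Rightarrow> complex \<Rightarrow> complex" where
  "scaleC_complex c x = c * x"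

instance
  by standard (simp_all add: scaleC_complex_def algebra_simps norm_mult scaleR_conv_of_real)

end

type_synonym sphere_point = "complex option"

text \<open>The point at infinity is \<^term>\<open>None\<close>; a complex number \<open>z\<close> is the point \<open>Some z\<close>.\<close>

abbreviation riemann_sphere :: "sphere_point topology" where
  "riemann_sphere \<equiv> Alexandroff_compactification euclidean"

text \<open>
  \<open>local_coord p q\<close> is the value at \<open>q\<close> of the standard coordinate centred at \<open>p\<close>: it is
  \<open>q - p\<close> if \<open>p\<close> is finite, and \<open>1/q\<close> if \<open>p\<close> is the point at infinity. It is only used for \<open>q\<close> in
  a small punctured neighbourhood of \<open>p\<close>, so that its value at \<open>q = \<infinity>\<close> for finite \<open>p\<close>, and at
  \<open>q = 0\<close> for \<open>p = \<infinity>\<close>, is irrelevant.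
\<close>

fun local_coord :: "sphere_point \<Rightarrow> sphere_point \<Rightarrow> complex" where
  "local_coord (Some z) (Some w) = w - z"
| "local_coord (Some z) None = 0"
| "local_coord None (Some w) = inverse w"
| "local_coord None None = 0"

definition hausdorff1_pre :: "real \<Rightarrow> 'a::metric_space set \<Rightarrow> ennreal" where
  "hausdorff1_pre \<delta> A =
     (INF U \<in> {U :: nat \<Rightarrow> 'a set. A \<subseteq> (\<Union>i. U i) \<and> (\<forall>i. bounded (U i) \<and> diameter (U i) \<le> \<delta>)}.
        \<Sum>i. ennreal (diameter (U i)))"

definition hausdorff1 :: "'a::metric_space set \<Rightarrow> ennreal" where
  "hausdorff1 A = (SUP \<delta>\<in>{0<..}. hausdorff1_pre \<delta> A)"

definition sphere_H1 :: "sphere_point set \<Rightarrow> ennreal" where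
  "sphere_H1 A = hausdorff1 (Some -` A)"

text \<open>
  A continuous injective map on \<open>\<real>/\<int>\<close> is given by the continuous map on \<open>\<real>\<close> which it induces,
  i.e. one that identifies two reals exactly if they differ by an integer.
\<close>

definition jordan_parametrization :: "(real \<Rightarrow> sphere_point) \<Rightarrow> bool" where
  "jordan_parametrization g \<longleftrightarrow>
     continuous_map euclideanreal riemann_sphere g \<and> (\<forall>s t. g s = g t \<longleftrightarrow> s - t \<in> \<int>)"

definition jordan_curve :: "sphere_point set \<Rightarrow> bool" where
  "jordan_curve \<Gamma> \<longleftrightarrow> (\<exists>g. jordan_parametrization g \<and> \<Gamma> = range g)"

text \<open>
  Finite length over one period. For a Jordan curve the length does not depend on the injective
  parametrization.
\<close>

definition finite_length :: "(real \<Rightarrow> complex) \<Rightarrow> bool" where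
  "finite_length g \<longleftrightarrow>
     (\<exists>L. \<forall>n t. mono_on {..n} t \<and> t ` {..n} \<subseteq> {0..1} \<longrightarrow>
        (\<Sum>k<n. dist (g (t k)) (g (t (Suc k)))) \<le> L)"

definition rectifiable_jordan_curve :: "sphere_point set \<Rightarrow> bool" where
  "rectifiable_jordan_curve \<Gamma> \<longleftrightarrow>
     (\<exists>g. jordan_parametrization (Some \<circ> g) \<and> \<Gamma> = range (Some \<circ> g) \<and> finite_length g)"

text \<open>
  For a Jordan curve that avoids infinity, the Jordan curve theorem shows that exactly one component
  of the complement does not contain infinity, so that the definite description is meaningful.
\<close>

definition outer_component :: "sphere_point set \<Rightarrow> sphere_point set" where
  "outer_component \<Gamma> =
     (THE C. C \<in> connected_components_of (subtopology riemann_sphere (- \<Gamma>)) \<and> None \<in> C)"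

definition inner_component :: "sphere_point set \<Rightarrow> sphere_point set" where
  "inner_component \<Gamma> =
     (THE C. C \<in> connected_components_of (subtopology riemann_sphere (- \<Gamma>)) \<and> None \<notin> C)"

definition nested_pair :: "sphere_point set \<Rightarrow> sphere_point set \<Rightarrow> bool" where
  "nested_pair \<Gamma>i \<Gamma>e \<longleftrightarrow>
     jordan_curve \<Gamma>i \<and> jordan_curve \<Gamma>e \<and> None \<notin> \<Gamma>i \<and> None \<notin> \<Gamma>e \<and>
     \<Gamma>i \<subseteq> riemann_sphere closure_of (inner_component \<Gamma>e) \<and>
     rectifiable_jordan_curve \<Gamma>i \<and> rectifiable_jordan_curve \<Gamma>e \<and>
     sphere_H1 (\<Gamma>i \<inter> \<Gamma>e) > 0"

definition nested_compact :: "sphere_point set \<Rightarrow> sphere_point set \<Rightarrow> sphere_point set" where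
  "nested_compact \<Gamma>i \<Gamma>e =
     riemann_sphere closure_of (inner_component \<Gamma>i) \<union>
     riemann_sphere closure_of (outer_component \<Gamma>e)"

text \<open>
  Existence of the complex derivative at \<open>p\<close>, in the coordinate \<open>q - p\<close>, or \<open>1/q\<close> if \<open>p = \<infinity>\<close>.
\<close>

definition complex_differentiable_at ::
    "(sphere_point \<Rightarrow> 'b::complex_banach) \<Rightarrow> sphere_point \<Rightarrow> bool" where
  "complex_differentiable_at f p \<longleftrightarrow>
     (\<exists>D. ((\<lambda>q. inverse (local_coord p q) *\<^sub>C (f q - f p)) \<longlongrightarrow> D) (atin riemann_sphere p))"

text \<open>
  Functions on \<open>K\<close> are represented by total functions whose values outside \<open>K\<close> are arbitrary
  and play no role; accordingly, such a function is zero if it vanishes on \<open>K\<close>.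
\<close>

definition holomorphic_space :: "sphere_point set \<Rightarrow> (sphere_point \<Rightarrow> 'b::complex_banach) set" where
  "holomorphic_space K =
     {f. continuous_map (subtopology riemann_sphere K) euclidean f \<and>
         (\<forall>p \<in> riemann_sphere interior_of K. complex_differentiable_at f p)}"

definition uniqueness_set ::
    "sphere_point set \<Rightarrow> (sphere_point \<Rightarrow> 'b::complex_banach) set \<Rightarrow> sphere_point set \<Rightarrow> bool" where
  "uniqueness_set K E \<gamma> \<longleftrightarrow>
     \<gamma> \<subseteq> K \<and> (\<forall>f\<in>E. (\<forall>q\<in>\<gamma>. f q = 0) \<longrightarrow> (\<forall>q\<in>K. f q = 0))"

definition H1_quasianalytic ::
    "sphere_point set \<Rightarrow> (sphere_point \<Rightarrow> 'b::complex_banach) set \<Rightarrow> sphere_point set \<Rightarrow> bool" where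
  "H1_quasianalytic K E K' \<longleftrightarrow>
     K' \<subseteq> K \<and> (\<forall>\<gamma>. \<gamma> \<subseteq> K' \<and> sphere_H1 \<gamma> > 0 \<longrightarrow> uniqueness_set K E \<gamma>)"

definition has_asymptotic_expansion ::
    "sphere_point set \<Rightarrow> (sphere_point \<Rightarrow> 'b::complex_banach) \<Rightarrow> sphere_point \<Rightarrow> (nat \<Rightarrow> 'b) \<Rightarrow> bool" where
  "has_asymptotic_expansion K f p a \<longleftrightarrow>
     p \<in> K \<and> p \<in> riemann_sphere derived_set_of K \<and>
     (\<forall>N. ((\<lambda>q. inverse (local_coord p q ^ N) *\<^sub>C (f q - (\<Sum>n\<le>N. local_coord p q ^ n *\<^sub>C a n)))
            \<longlongrightarrow> 0) (atin_within riemann_sphere p K))"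

text \<open>
  Quasianalyticity at a point presupposes that every function of the space has an asymptotic
  expansion there; this is part of the definition.
\<close>

definition quasianalytic_at ::
    "sphere_point set \<Rightarrow> (sphere_point \<Rightarrow> 'b::complex_banach) set \<Rightarrow> sphere_point \<Rightarrow> bool" where
  "quasianalytic_at K E p \<longleftrightarrow>
     (\<forall>f\<in>E. \<exists>a. has_asymptotic_expansion K f p a) \<and>
     (\<forall>f\<in>E. has_asymptotic_expansion K f p (\<lambda>_. 0) \<longrightarrow> (\<forall>q\<in>K. f q = 0))"

end

theory Submission
  imports Defs "HOL-Complex_Analysis.Complex_Analysis"
    "HOL-Computational_Algebra.Fundamental_Theorem_Algebra"
begin

text \<open>
  By duality it suffices to treat scalar functions. The heart of the matter is that a function \<open>f\<close>
  holomorphic in a Jordan domain \<open>\<Omega>\<close> with rectifiable boundary, continuous on its closure and not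
  identically zero, vanishes only on an \<open>\<H>\<^sup>1\<close>-null subset of the boundary. No boundary behaviour of the
  Riemann map is needed: \<open>n\<close>-th roots of zero-free approximations of \<open>f\<close> are holomorphic functions
  of norm at most \<open>1\<close> that are close to \<open>1\<close> on a given compact set and close to \<open>0\<close> near the boundary zeros of \<open>f\<close>.
  Integrating them over the boundary of a union of grid squares in a rectangle whose top lies inside and
  whose bottom lies outside of \<open>\<Omega>\<close> bounds the width of the rectangle by the length of the part
  of the boundary curve in it on which \<open>f\<close> does not vanish. As almost every vertical line meets
  the curve in finitely many points, at all of which the curve crosses it, a covering argument shows that the
  zero set has a null projection on the real axis, and by rotation on the imaginary axis; for a subset of a
  rectifiable curve this means \<open>\<H>\<^sup>1\<close>-nullity. Zeros on the common part of the two curves then carry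
  the vanishing of \<open>f\<close> from one piece of \<open>K\<close> to the other.
\<close>

subsection \<open>Barriers and a two-constants estimate\<close>

text \<open>Removing zeros by reflection preserves the modulus only on one circle of the Riemann
  disc, so near a boundary zero smallness is known only on the corresponding level curve and has to
  be carried inwards. The two-constants estimate does this with a constant,
  \<open>exp (- 8 * pi)\<close>, that depends on nothing but simple connectivity. Hence the radius
  \<open>\<delta>\<close> on which the root is at most \<open>\<eta>\<close> can be fixed before the
  level curve. This order matters: the mesh of the grid is chosen after \<open>\<delta>\<close>, and
  the compact union of inner squares, on which the root must be holomorphic, is known only after the
  mesh. A root of order \<open>n\<close> suits both demands: \<open>c\<close> to the power
  \<open>1/n\<close> tends to \<open>1\<close> for any fixed \<open>c > 0\<close>, while a bound
  \<open>\<eta> ^ n\<close> near boundary zeros becomes \<open>\<eta>\<close>. All constants are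
  crude but uniform, and this is enough: in parameter space the zero set has open neighbourhoods
  exceeding it by arbitrarily little measure, and the widths found in them are paid for by this
  excess alone.\<close>

lemma disc_zero_free_poly:
  fixes p :: "complex poly"
  assumes r: "r > 0" and "p \<noteq> 0"
  shows "\<exists>q. (\<forall>w. norm w < r \<longrightarrow> poly q w \<noteq> 0) \<and> (\<forall>w. norm w = r \<longrightarrow> norm (poly q w) = norm (poly p w))
           \<and> (\<forall>w. norm w \<le> r \<longrightarrow> norm (poly p w) \<le> norm (poly q w))"
  using \<open>p \<noteq> 0\<close>
proof (induction "degree p" arbitrary: p)
  case 0
  then obtain c where "p = [:c:]" using degree_eq_zeroE by metis
  with 0 show ?case by (intro exI[of _ p]) auto
next
  case (Suc n)
  then have "\<not> constant (poly p)"
    using constant_degree[of p] by simp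
  then obtain a where "poly p a = 0" using fundamental_theorem_of_algebra by blast
  then obtain p' where p': "p = [:-a, 1:] * p'" by (metis poly_eq_0_iff_dvd dvdE)
  with Suc have "p' \<noteq> 0" "n = degree p'" by (auto simp: degree_mult_eq simp del: mult_pCons_left)
  with Suc.hyps(1) obtain q' where q': "\<And>w. norm w < r \<Longrightarrow> poly q' w \<noteq> 0"
      "\<And>w. norm w = r \<Longrightarrow> norm (poly q' w) = norm (poly p' w)"
      "\<And>w. norm w \<le> r \<Longrightarrow> norm (poly p' w) \<le> norm (poly q' w)"
    by metis
  have *: "\<exists>u. (\<forall>w. norm w < r \<longrightarrow> poly u w \<noteq> 0) \<and> (\<forall>w. norm w = r \<longrightarrow> norm (poly u w) = norm (w - a))
           \<and> (\<forall>w. norm w \<le> r \<longrightarrow> norm (w - a) \<le> norm (poly u w))"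
  proof (cases "norm a < r")
    case False
    then show ?thesis by (intro exI[of _ "[:-a,1:]"]) auto
  next
    case True
    \<comment> \<open>The root \<open>a\<close> is reflected in the circle of radius
      \<open>r\<close>: this factor is \<open>w - a\<close> divided by a Blaschke factor of the
      disc. The identity \<open>key\<close> measures the gain in modulus, which vanishes on the
      circle and is nonnegative inside.\<close>
    define u where "u = [:complex_of_real r, - cnj a / r:]"
    have u: "poly u w = (r\<^sup>2 - cnj a * w) / r" for w
      using r by (simp add: u_def field_simps power2_eq_square)
    have key: "(norm (r\<^sup>2 - cnj a * w))\<^sup>2 - (r * norm (w - a))\<^sup>2 = (r\<^sup>2 - (norm a)\<^sup>2) * (r\<^sup>2 - (norm w)\<^sup>2)" for w
      unfolding power_mult_distrib cmod_power2 by (simp add: power2_eq_square algebra_simps)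
    have nz: "poly u w \<noteq> 0" if "norm w < r" for w
    proof
      assume "poly u w = 0"
      then have "complex_of_real (r\<^sup>2) = cnj a * w" using r u by auto
      then have "norm (complex_of_real (r\<^sup>2)) = norm a * norm w" by (simp only: norm_mult complex_mod_cnj)
      moreover have "norm a * norm w < r * r" using that True by (intro mult_strict_mono') auto
      ultimately show False using r by (simp add: power2_eq_square norm_mult)
    qed
    have le: "norm (w - a) \<le> norm (poly u w)" if "norm w \<le> r" for w
    proof -
      have "0 \<le> (r\<^sup>2 - (norm a)\<^sup>2) * (r\<^sup>2 - (norm w)\<^sup>2)"
        using that True by (intro mult_nonneg_nonneg) (auto intro: power_mono)
      then have "(r * norm (w - a))\<^sup>2 \<le> (norm (r\<^sup>2 - cnj a * w))\<^sup>2" using key[of w] by linarith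
      then have "r * norm (w - a) \<le> norm (r\<^sup>2 - cnj a * w)" by (rule power2_le_imp_le) simp
      then show ?thesis using r by (simp add: u norm_divide field_simps)
    qed
    have eq: "norm (poly u w) = norm (w - a)" if "norm w = r" for w
    proof -
      have "(r * norm (w - a))\<^sup>2 = (norm (r\<^sup>2 - cnj a * w))\<^sup>2" using key[of w] that by simp
      then have "r * norm (w - a) = norm (r\<^sup>2 - cnj a * w)" using r by (subst (asm) power2_eq_iff_nonneg) auto
      then show ?thesis using r by (simp add: u norm_divide field_simps)
    qed
    show ?thesis using nz le eq by blast
  qed
  then obtain u where u: "\<And>w. norm w < r \<Longrightarrow> poly u w \<noteq> 0"
      "\<And>w. norm w = r \<Longrightarrow> norm (poly u w) = norm (w - a)"
      "\<And>w. norm w \<le> r \<Longrightarrow> norm (w - a) \<le> norm (poly u w)" by metis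
  have pw: "poly p w = (w - a) * poly p' w" for w by (simp add: p' algebra_simps)
  show ?case
    by (rule exI[of _ "u * q'"]) (auto simp: pw u q' norm_mult left_diff_distrib[symmetric] simp del: left_diff_distrib intro!: mult_mono)
qed

text \<open>Up to the factor \<open>pi * a\<close>, each real part is the Poisson kernel of the
  half-plane \<open>Re L < a\<close> with pole at height \<open>j * a\<close>, so \<open>V\<close>
  is a Riemann sum of a Poisson integral. The poles sit at distance \<open>a\<close> to the right of
  the imaginary axis, which keeps \<open>V\<close> holomorphic across it. A single term is at most
  \<open>a / \<bar>Re L\<bar>\<close>, and at most \<open>M\<close> terms with
  \<open>a * M = 2 * pi\<close> give the upper bound; on the axis a pole at height within
  \<open>a\<close> contributes \<open>1/2\<close> alone.\<close>

lemma sum_kernel_bounds: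
  fixes J :: "int set" and a :: real
  assumes J: "finite J" and a: "a > 0" and M: "card J \<le> M" "a * M = 2*pi"
  defines "V \<equiv> \<lambda>L::complex. \<Sum>j\<in>J. of_real a / (of_real a + \<i> * of_real (of_int j * a) - L)"
  shows "V holomorphic_on {L. Re L < a}"
    and "\<And>L. Re L < 0 \<Longrightarrow> Re (V L) \<le> 2*pi / \<bar>Re L\<bar>"
    and "\<And>L. Re L \<le> 0 \<Longrightarrow> 0 \<le> Re (V L)"
    and "\<And>y. (\<exists>j\<in>J. \<bar>of_int j * a - y\<bar> \<le> a) \<Longrightarrow> 1/2 \<le> Re (V (\<i> * of_real y))"
proof -
  have nz: "of_real a + \<i> * of_real (of_int j * a) - L \<noteq> 0" if "Re L < a" for L and j :: int
    using that by (auto simp: complex_eq_iff)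
  have Re: "Re (of_real a / (of_real a + \<i> * of_real (of_int j * a) - L))
     = a * (a - Re L) / ((a - Re L)^2 + (j * a - Im L)^2)" for L and j :: int
    by (simp add: Re_divide)
  show "V holomorphic_on {L. Re L < a}"
    unfolding V_def by (intro holomorphic_intros) (use nz in auto)
  show "Re (V L) \<le> 2*pi / \<bar>Re L\<bar>" if L: "Re L < 0" for L
  proof -
    have "Re (V L) \<le> (\<Sum>j\<in>J. a / \<bar>Re L\<bar>)"
      unfolding V_def Re_sum Re
    proof (intro sum_mono)
      fix j
      have p: "a - Re L > 0" "\<bar>Re L\<bar> > 0" "\<bar>Re L\<bar> \<le> a - Re L" using a L by auto
      have "a * (a - Re L) / ((a - Re L)^2 + (j * a - Im L)^2) \<le> a * (a - Re L) / ((a - Re L)^2)"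
        using p a by (intro divide_left_mono) (auto intro!: mult_nonneg_nonneg mult_pos_pos add_pos_nonneg)
      also have "\<dots> = a / (a - Re L)" using p by (simp add: power2_eq_square)
      also have "\<dots> \<le> a / \<bar>Re L\<bar>" using p a by (intro divide_left_mono mult_pos_pos) auto
      finally show "a * (a - Re L) / ((a - Re L)^2 + (j * a - Im L)^2) \<le> a / \<bar>Re L\<bar>" .
    qed
    also have "\<dots> = card J * a / \<bar>Re L\<bar>" by simp
    also have "\<dots> \<le> M * a / \<bar>Re L\<bar>" using M a by (intro divide_right_mono mult_right_mono) auto
    finally show ?thesis using M by (simp add: mult.commute)
  qed
  have pos: "0 \<le> Re (of_real a / (of_real a + \<i> * of_real (of_int j * a) - L))" if "Re L \<le> 0" for L and j :: int
    unfolding Re using a that by (intro divide_nonneg_nonneg mult_nonneg_nonneg) auto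
  then show "0 \<le> Re (V L)" if "Re L \<le> 0" for L
    unfolding V_def Re_sum using that by (intro sum_nonneg)
  show "1/2 \<le> Re (V (\<i> * of_real y))" if j: "\<exists>j\<in>J. \<bar>of_int j * a - y\<bar> \<le> a" for y
  proof -
    from j obtain j where j: "j \<in> J" "\<bar>of_int j * a - y\<bar> \<le> a" by auto
    have "(of_int j * a - y)\<^sup>2 \<le> a\<^sup>2" using j a by (metis abs_le_square_iff abs_of_pos)
    then have "1/2 \<le> a * (a - 0) / ((a - 0)^2 + (of_int j * a - y)^2)"
    proof -
      have "a\<^sup>2 + (of_int j * a - y)\<^sup>2 > 0" using a by (intro add_pos_nonneg) auto
      then show ?thesis using \<open>(of_int j * a - y)\<^sup>2 \<le> a\<^sup>2\<close> by (simp add: pos_le_divide_eq power2_eq_square)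
    qed
    also have "\<dots> = Re (of_real a / (of_real a + \<i> * of_real (of_int j * a) - \<i> * of_real y))"
      by (subst Re) simp
    also have "\<dots> \<le> Re (V (\<i> * of_real y))"
      unfolding V_def Re_sum by (rule member_le_sum) (use j J pos in auto)
    finally show ?thesis .
  qed
qed

text \<open>Passing to the logarithmic coordinate centred at \<open>p\<close>, the circle of radius \<open>\<rho>\<close> becomes the
  imaginary axis, of which a univalent logarithm covers at most length \<open>2\<pi>\<close>; a discretised Poisson
  integral over that part is a barrier at \<open>p\<close>.\<close>

lemma simply_connected_two_constants:
  fixes Q :: "complex \<Rightarrow> complex"
  assumes \<Omega>: "open \<Omega>" "simply_connected \<Omega>" "p \<notin> \<Omega>"
    and D: "open D" "bounded D" "closure D \<subseteq> \<Omega>"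
    and Q: "Q holomorphic_on \<Omega>" "\<And>z. z \<in> closure D \<Longrightarrow> norm (Q z) \<le> 1"
    and \<rho>: "\<rho> > 0" and \<epsilon>: "0 < \<epsilon>" "\<epsilon> < 1"
    and fr: "\<And>z. z \<in> frontier D \<Longrightarrow> dist z p \<le> \<rho> \<Longrightarrow> norm (Q z) \<le> \<epsilon>"
    and z: "z \<in> D" "dist z p \<le> \<rho> * exp (- 8 * pi)"
  shows "norm (Q z) \<le> sqrt \<epsilon>"
proof -
  have h1: "(\<lambda>z. (z - p) / \<rho>) holomorphic_on \<Omega>"
    using \<Omega> \<rho> by (auto intro!: holomorphic_intros)
  have h2: "(z - p) / \<rho> \<noteq> 0" if "z \<in> \<Omega>" for z
    using \<Omega> \<rho> that by auto
  obtain \<Lambda> where \<Lambda>: "\<Lambda> holomorphic_on \<Omega>" and e\<Lambda>: "\<And>z. z \<in> \<Omega> \<Longrightarrow> (z - p) / \<rho> = exp (\<Lambda> z)"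
    using simply_connected_imp_holomorphic_log[OF h1 \<Omega>(2) open_imp_locally_path_connected[OF \<Omega>(1)] h2] by blast
  have inj: "inj_on \<Lambda> \<Omega>"
  proof (rule inj_onI)
    fix x y assume "x \<in> \<Omega>" "y \<in> \<Omega>" "\<Lambda> x = \<Lambda> y"
    then have "(x - p) / \<rho> = (y - p) / \<rho>" by (simp add: e\<Lambda>)
    then show "x = y" using \<rho> by simp
  qed
  have op: "open (\<Lambda> ` \<Omega>)"
    using open_mapping_thm3[OF \<Lambda> \<Omega>(1) inj] .
  have ReL: "Re (\<Lambda> w) = ln (dist w p / \<rho>)" if "w \<in> \<Omega>" for w
  proof -
    have "exp (Re (\<Lambda> w)) = norm (exp (\<Lambda> w))" by simp
    also have "\<dots> = dist w p / \<rho>" using \<rho> by (simp add: e\<Lambda>[OF that, symmetric] norm_divide dist_norm)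
    finally show ?thesis by (metis ln_exp)
  qed
  have dpos: "dist w p > 0" if "w \<in> \<Omega>" for w using that \<Omega> by auto
  have compD: "compact (closure D)" using D by simp
  have cont: "continuous_on \<Omega> \<Lambda>" using \<Lambda> holomorphic_on_imp_continuous_on by blast
  have "compact (\<Lambda> ` closure D)" using compD cont D by (meson compact_continuous_image continuous_on_subset)
  moreover have "\<Lambda> ` closure D \<subseteq> \<Lambda> ` \<Omega>" using D by auto
  ultimately obtain e where e: "e > 0" "{x. infdist x (\<Lambda> ` closure D) \<le> e} \<subseteq> \<Lambda> ` \<Omega>"
    using compact_in_open_separated[of "\<Lambda> ` closure D" "\<Lambda> ` \<Omega>"] op z closure_subset by force
  obtain M :: nat where M: "real M > 2 * pi / e" using reals_Archimedean2 by blast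
  have M0: "real M > 0" using M e pi_gt_zero by (smt (verit) divide_pos_pos)
  \<comment> \<open>The spacing is smaller than \<open>e\<close>, so a multiple of it within
    distance \<open>a\<close> of the image of \<open>closure D\<close> is still a value of
    \<open>\<Lambda>\<close> on \<open>\<Omega>\<close>; and it divides \<open>2 * pi\<close>, so
    indices congruent modulo \<open>M\<close> give points that differ by a period of
    \<open>exp\<close>.\<close>
  define a where "a = 2 * pi / M"
  have a: "a > 0" "a < e" "a * M = 2*pi" using M M0 e by (auto simp: a_def field_simps)
  define Y where "Y = {y. \<i> * of_real y \<in> \<Lambda> ` closure D}"
  define J where "J = {j::int. \<exists>y\<in>Y. \<bar>of_int j * a - y\<bar> \<le> a}"
  have JO: "\<i> * of_real (of_int j * a) \<in> \<Lambda> ` \<Omega>" if "j \<in> J" for j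
  proof -
    obtain y where y: "y \<in> Y" "\<bar>of_int j * a - y\<bar> \<le> a" using \<open>j \<in> J\<close> by (auto simp: J_def)
    have "infdist (\<i> * of_real (of_int j * a)) (\<Lambda> ` closure D) \<le> dist (\<i> * of_real (of_int j * a)) (\<i> * of_real y)"
      using y by (intro infdist_le) (auto simp: Y_def)
    also have "\<dots> = \<bar>of_int j * a - y\<bar>"
      by (simp only: dist_norm right_diff_distrib[symmetric] norm_mult norm_ii of_real_diff[symmetric] norm_of_real mult_1)
    finally show ?thesis using e a y by force
  qed
  \<comment> \<open>Two values of \<open>\<Lambda>\<close> that differ by a period of
    \<open>exp\<close> come from the same point of \<open>\<Omega>\<close>. So each residue class
    modulo \<open>M\<close> contributes at most one pole, which is the discrete form of the
    statement that a univalent logarithm covers length at most \<open>2 * pi\<close> of the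
    axis.\<close>
  have injM: "inj_on (\<lambda>j. j mod int M) J"
  proof (rule inj_onI)
    fix j k assume jk: "j \<in> J" "k \<in> J" "j mod int M = k mod int M"
    then have "int M dvd j - k" by (simp add: mod_eq_dvd_iff)
    then obtain m where "j - k = int M * m" by (rule dvdE)
    then have m: "j = k + int M * m" by simp
    obtain u v where uv: "u \<in> \<Omega>" "v \<in> \<Omega>" "\<Lambda> u = \<i> * of_real (of_int j * a)" "\<Lambda> v = \<i> * of_real (of_int k * a)"
      using JO jk by (metis imageE)
    have "of_int j * a = of_int k * a + of_int m * (2 * pi)"
      using a by (simp add: m algebra_simps flip: a(3))
    then have "\<Lambda> u = \<Lambda> v + (of_int (2 * m) * pi) * \<i>"
      unfolding uv by (simp add: complex_eq_iff)
    then have "exp (\<Lambda> u) = exp (\<Lambda> v)" using exp_eq by blast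
    then have "(u - p) / \<rho> = (v - p) / \<rho>" using uv e\<Lambda> by metis
    then have "u = v" using \<rho> by simp
    then show "j = k" using uv a by auto
  qed
  have sub: "(\<lambda>j. j mod int M) ` J \<subseteq> {0..<int M}" using M0 by auto
  have finJ: "finite J" using injM sub by (meson finite_imageD finite_atLeastLessThan_int finite_subset)
  have cardJ: "card J \<le> M" using card_inj_on_le[OF injM sub] by simp
  define V where "V = (\<lambda>L::complex. \<Sum>j\<in>J. of_real a / (of_real a + \<i> * of_real (of_int j * a) - L))"
  have Vb: "V holomorphic_on {L. Re L < a}"
    "\<And>L. Re L < 0 \<Longrightarrow> Re (V L) \<le> 2*pi / \<bar>Re L\<bar>"
    "\<And>L. Re L \<le> 0 \<Longrightarrow> 0 \<le> Re (V L)"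
    "\<And>y. (\<exists>j\<in>J. \<bar>of_int j * a - y\<bar> \<le> a) \<Longrightarrow> 1/2 \<le> Re (V (\<i> * of_real y))"
    unfolding V_def using sum_kernel_bounds[OF finJ a(1) cardJ a(3)] by blast+
  define l where "l = ln (1/\<epsilon>)"
  have l: "l > 0" "exp (-l) = \<epsilon>" using \<epsilon> by (auto simp: l_def ln_div)
  \<comment> \<open>The exponent balances the two parts of the frontier. On the frontier of
    \<open>D\<close> the bound \<open>\<epsilon>\<close> pays for the factor \<open>exp l\<close>,
    since \<open>Re V \<ge> 0\<close>; on the circle of radius \<open>\<rho>\<close> only
    \<open>norm (Q w) \<le> 1\<close> is known, but there \<open>Re V \<ge> 1/2\<close> makes the
    factor at most \<open>1\<close>.\<close>
  define G where "G = (\<lambda>z. Q z * exp (- of_real l * (2 * V (\<Lambda> z) - 1)))"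
  have normG: "norm (G w) = norm (Q w) * exp (- l * (2 * Re (V (\<Lambda> w)) - 1))" for w
    by (simp add: G_def norm_mult)
  define S where "S = D \<inter> ball p \<rho>"
  have clS: "closure S \<subseteq> closure D \<inter> cball p \<rho>"
  proof (rule closure_minimal)
    show "S \<subseteq> closure D \<inter> cball p \<rho>" using closure_subset[of D] by (auto simp: S_def)
  qed (auto intro: closed_Int)
  have frS: "frontier S \<subseteq> (frontier D \<inter> cball p \<rho>) \<union> (closure D \<inter> sphere p \<rho>)"
  proof
    fix w assume w: "w \<in> frontier S"
    then have 1: "w \<in> closure D" "w \<in> cball p \<rho>" using clS by (auto simp: frontier_def)
    have "open S" using D by (auto simp: S_def)
    then have "w \<notin> S" using w by (auto simp: frontier_def interior_open)
    with 1 show "w \<in> (frontier D \<inter> cball p \<rho>) \<union> (closure D \<inter> sphere p \<rho>)"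
      using D(1) by (auto simp: S_def frontier_def interior_open)
  qed
  have Re0: "Re (\<Lambda> w) \<le> 0" if "w \<in> closure D \<inter> cball p \<rho>" for w
  proof -
    have "w \<in> \<Omega>" using that D by auto
    then show ?thesis using ReL[of w] dpos[of w] that \<rho> by (simp add: dist_commute)
  qed
  have holG: "G holomorphic_on ({w\<in>\<Omega>. Re (\<Lambda> w) < a})"
  proof -
    have "V \<circ> \<Lambda> holomorphic_on ({w\<in>\<Omega>. Re (\<Lambda> w) < a})"
      by (rule holomorphic_on_compose_gen[OF _ Vb(1)]) (use \<Lambda> in \<open>auto intro: holomorphic_on_subset\<close>)
    then have "(\<lambda>w. V (\<Lambda> w)) holomorphic_on ({w\<in>\<Omega>. Re (\<Lambda> w) < a})" by (simp add: o_def)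
    moreover have "Q holomorphic_on ({w\<in>\<Omega>. Re (\<Lambda> w) < a})" using Q by (auto intro: holomorphic_on_subset)
    ultimately show ?thesis unfolding G_def by (intro holomorphic_intros)
  qed
  have clS2: "closure S \<subseteq> {w\<in>\<Omega>. Re (\<Lambda> w) < a}" using clS Re0 D a by (force)
  have zD: "z \<in> \<Omega>" using z D closure_subset by auto
  have zS: "z \<in> S"
  proof -
    have "\<rho> * exp (- 8 * pi) < \<rho> * 1" using \<rho> pi_gt_zero by (intro mult_strict_left_mono) auto
    then show ?thesis using z by (auto simp: S_def dist_commute)
  qed
  have "norm (G z) \<le> 1"
  proof (rule maximum_modulus_frontier[of G S])
    show "G holomorphic_on interior S" using holG clS2 interior_subset closure_subset
      by (meson holomorphic_on_subset order_trans)
    show "continuous_on (closure S) G" using holG clS2 holomorphic_on_imp_continuous_on continuous_on_subset by blast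
    show "bounded S" unfolding S_def by (simp add: bounded_Int)
    show "z \<in> S" by fact
    fix w assume w: "w \<in> frontier S"
    then have w': "w \<in> closure D \<inter> cball p \<rho>" using frS by (auto simp: frontier_def)
    show "norm (G w) \<le> 1"
    proof (cases "w \<in> frontier D \<inter> cball p \<rho>")
      case True
      have "norm (G w) \<le> \<epsilon> * exp (- l * (2 * Re (V (\<Lambda> w)) - 1))"
        unfolding normG using True fr[of w] by (intro mult_right_mono) (auto simp: dist_commute)
      also have "\<dots> \<le> \<epsilon> * exp l"
        using l Vb(3)[OF Re0[OF w']] \<epsilon> by (intro mult_left_mono) (auto simp: mult_le_0_iff algebra_simps)
      also have "\<dots> = 1" using l(2) by (simp add: exp_minus) (metis exp_not_eq_zero left_inverse)
      finally show ?thesis .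
    next
      case False
      then have w2: "w \<in> closure D \<inter> sphere p \<rho>" using frS w by auto
      then have "w \<in> \<Omega>" using D by auto
      have "Re (\<Lambda> w) = 0" using ReL[OF \<open>w \<in> \<Omega>\<close>] w2 \<rho> by (simp add: dist_commute)
      then have Lw: "\<Lambda> w = \<i> * of_real (Im (\<Lambda> w))" by (simp add: complex_eq_iff)
      then have "Im (\<Lambda> w) \<in> Y" unfolding Y_def using w2 by (metis (no_types, lifting) IntD1 imageI mem_Collect_eq)
      moreover have "\<bar>of_int \<lfloor>Im (\<Lambda> w) / a\<rfloor> * a - Im (\<Lambda> w)\<bar> \<le> a"
      proof -
        have "of_int \<lfloor>Im (\<Lambda> w) / a\<rfloor> * a \<le> Im (\<Lambda> w) / a * a" "Im (\<Lambda> w) / a * a \<le> (of_int \<lfloor>Im (\<Lambda> w) / a\<rfloor> + 1) * a"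
          using a(1) by (intro mult_right_mono; linarith)+
        then show ?thesis using a(1) by (simp add: abs_le_iff distrib_right)
      qed
      ultimately have "1/2 \<le> Re (V (\<i> * of_real (Im (\<Lambda> w))))"
        by (intro Vb(4)) (auto simp: J_def intro!: bexI[of _ "\<lfloor>Im (\<Lambda> w) / a\<rfloor>"])
      then have "1/2 \<le> Re (V (\<Lambda> w))" using Lw by simp
      then have "norm (G w) \<le> 1 * 1"
        unfolding normG using Q(2)[of w] w2 l by (intro mult_mono) (auto simp: zero_le_mult_iff)
      then show ?thesis by simp
    qed
  qed
  have Rz: "Re (\<Lambda> z) \<le> - 8 * pi"
  proof -
    have "dist z p / \<rho> \<le> exp (- 8 * pi)" using z \<rho> by (simp add: field_simps)
    then have "ln (dist z p / \<rho>) \<le> ln (exp (- 8 * pi))" using dpos[OF zD] \<rho> by (subst ln_le_cancel_iff) auto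
    then show ?thesis using ReL[OF zD] by simp
  qed
  \<comment> \<open>The \<open>8 * pi\<close> in the choice of the inner radius turns this bound
    into \<open>1/4\<close>. Then \<open>2 * Re V - 1 \<le> -1/2\<close>, so half of the exponent
    \<open>l\<close> is retained and \<open>\<epsilon>\<close> becomes
    \<open>sqrt \<epsilon>\<close>.\<close>
  have "Re (V (\<Lambda> z)) \<le> 2*pi / \<bar>Re (\<Lambda> z)\<bar>" using Rz pi_gt_zero by (intro Vb(2)) linarith
  also have "\<dots> \<le> 2*pi / (8*pi)" using Rz pi_gt_zero by (intro frac_le) auto
  finally have "Re (V (\<Lambda> z)) \<le> 1/4" by simp
  have le: "l * (2 * Re (V (\<Lambda> z)) - 1) \<le> l * (-1/2)"
    using \<open>Re (V (\<Lambda> z)) \<le> 1/4\<close> l by (intro mult_left_mono) auto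
  have "norm (Q z) = norm (G z) * exp (l * (2 * Re (V (\<Lambda> z)) - 1))"
    unfolding normG by (simp add: mult.assoc flip: exp_add)
  also have "\<dots> \<le> 1 * exp (l * (-1/2))"
    using \<open>norm (G z) \<le> 1\<close> le by (intro mult_mono) (auto simp del: mult_minus_right)
  also have "\<dots> = sqrt \<epsilon>"
  proof -
    have "(exp (l * (-1/2)))\<^sup>2 = \<epsilon>" using l by (simp add: power2_eq_square flip: exp_add)
    then show ?thesis by (metis real_sqrt_unique exp_ge_zero mult_1)
  qed
  finally show ?thesis .
qed

subsection \<open>Peaking functions at the boundary zeros\<close>

lemma compact_subset_unit_ball:
  fixes K :: "complex set"
  assumes "compact K" "K \<subseteq> ball 0 1"
  obtains s where "0 \<le> s" "s < 1" "K \<subseteq> cball 0 s"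
proof (cases "K = {}")
  case True then show ?thesis using that[of 0] by auto
next
  case False
  then obtain x where x: "x \<in> K" "\<And>y. y \<in> K \<Longrightarrow> norm y \<le> norm x"
    using continuous_attains_sup[OF assms(1) False, of norm] by (auto intro: continuous_intros)
  have "norm x < 1" using x(1) assms(2) by auto
  then show ?thesis using x(2) by (intro that[of "norm x"]) auto
qed

text \<open>Taylor polynomials converge uniformly on smaller discs. A polynomial is wanted because
  it has finitely many roots, which can be reflected one at a time.\<close>

lemma disc_polynomial_approx:
  assumes "f holomorphic_on ball 0 1" "r < 1" "0 < r" "\<kappa> > 0"
  shows "\<exists>P :: complex poly. \<forall>w. norm w \<le> r \<longrightarrow> norm (poly P w - f w) \<le> \<kappa>"
proof -
  define a where "a = (\<lambda>n. (deriv ^^ n) f 0 / fact n)"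
  have sums: "(\<lambda>n. a n * w ^ n) sums f w" if "norm w < 1" for w
    using holomorphic_power_series[OF assms(1), of w] that by (simp add: a_def)
  have "1 \<le> conv_radius a"
  proof (rule conv_radius_geI_ex)
    fix t :: real assume "0 < t" "ereal t < 1"
    then show "\<exists>z. norm z = t \<and> summable (\<lambda>n. a n * z ^ n)"
      using sums[of "of_real t"] by (intro exI[of _ "of_real t"]) (auto simp: sums_iff)
  qed
  then have "ereal r < conv_radius a" using assms(2)
    by (metis ereal_less(3) less_le_trans)
  from powser_uniform_limit[OF this, of 0]
  have "\<forall>\<^sub>F n in sequentially. \<forall>x\<in>cball 0 r. dist (\<Sum>i<n. a i * (x - 0) ^ i) (\<Sum>i. a i * (x - 0) ^ i) < \<kappa>"
    using assms(4) uniform_limitD by blast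
  then have "\<exists>n. \<forall>x\<in>cball 0 r. dist (\<Sum>i<n. a i * x ^ i) (\<Sum>i. a i * x ^ i) < \<kappa>"
    by (auto simp: eventually_sequentially)
  then obtain n where n: "\<And>x. x\<in>cball 0 r \<Longrightarrow> dist (\<Sum>i<n. a i * x ^ i) (\<Sum>i. a i * x ^ i) < \<kappa>"
    by blast
  define P where "P = (\<Sum>i<n. monom (a i) i)"
  have "poly P w = (\<Sum>i<n. a i * w ^ i)" for w by (simp add: P_def poly_sum poly_monom)
  then show ?thesis
    using n sums assms(2) by (intro exI[of _ P]) (force simp: sums_iff dist_norm)
qed

text \<open>This is Harnack's inequality: \<open>1 - G\<close> maps into the right half-plane and
  takes the value \<open>k\<close> at the centre, so its Cayley transform based at \<open>k\<close>
  vanishes there and the Schwarz lemma applies. The constant does not depend on \<open>G\<close>, so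
  closeness to \<open>1\<close> at one point spreads to a fixed smaller disc.\<close>

lemma schwarz_near_one:
  assumes G: "G holomorphic_on ball 0 r" and r: "0 < r"
    and G1: "\<And>w. norm w < r \<Longrightarrow> norm (G w) < 1"
    and G0: "G 0 = of_real (1 - k)" and w: "norm w \<le> s" and s: "0 \<le> s" "s < r"
  shows "norm (G w - 1) \<le> k * ((r + s) / (r - s))"
proof -
  define P where "P = (\<lambda>w. 1 - G w)"
  have ReP: "Re (P w) > 0" if "norm w < r" for w
    using G1[OF that] complex_Re_le_cmod[of "G w"] by (simp add: P_def)
  have P0: "P 0 = of_real k" by (simp add: P_def G0)
  have k: "k > 0" using ReP[of 0] r by (simp add: P0)
  have nz: "P w + of_real k \<noteq> 0" if "norm w < r" for w
    using ReP[OF that] k by (auto simp: complex_eq_iff)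
  have lt: "norm (P w - of_real k) < norm (P w + of_real k)" if "norm w < r" for w
  proof -
    have "(norm (P w - of_real k))\<^sup>2 < (norm (P w + of_real k))\<^sup>2"
      using ReP[OF that] k unfolding cmod_power2 by (simp add: power2_eq_square algebra_simps)
    then show ?thesis by (rule power_less_imp_less_base) simp
  qed
  define M where "M = (\<lambda>w. (P (of_real r * w) - of_real k) / (P (of_real r * w) + of_real k))"
  have in_ball: "norm (of_real r * w) < r" if "norm w < 1" for w :: complex
    using that r by (simp add: norm_mult)
  have "(\<lambda>w. G (of_real r * w)) holomorphic_on ball 0 1"
  proof -
    have "(*) (of_real r) holomorphic_on ball 0 1" by (intro holomorphic_intros)
    then have "G \<circ> (*) (of_real r) holomorphic_on ball 0 1"
      using G by (rule holomorphic_on_compose_gen) (use in_ball in auto)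
    then show ?thesis by (simp add: o_def)
  qed
  then have "M holomorphic_on ball 0 1"
    using nz in_ball unfolding M_def P_def by (intro holomorphic_intros) auto
  moreover have "M 0 = 0" by (simp add: M_def P0)
  moreover have "norm (M w) < 1" if "norm w < 1" for w
  proof -
    have "norm (P (r * w) + of_real k) > 0" using nz[OF in_ball[OF that]] by simp
    then show ?thesis using lt[OF in_ball[OF that]] by (simp add: M_def norm_divide)
  qed
  moreover have w1: "norm (w / of_real r) < 1" using w s r by (simp add: norm_divide)
  ultimately have "norm (M (w / of_real r)) \<le> norm (w / of_real r)"
    using Schwarz_Lemma(1) by blast
  then have "norm (P w - of_real k) / norm (P w + of_real k) \<le> norm w / r"
    using r by (simp add: M_def norm_divide)
  moreover have pp: "norm (P w + of_real k) > 0" using nz[of w] w s by simp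
  ultimately have "norm (P w - of_real k) \<le> norm w / r * norm (P w + of_real k)"
    by (simp add: pos_divide_le_eq)
  also have "\<dots> \<le> s / r * (norm (P w) + k)"
    using w r s k norm_triangle_ineq[of "P w" "of_real k"] by (intro mult_mono divide_right_mono) auto
  finally have "norm (P w) - k \<le> s / r * (norm (P w) + k)"
    using norm_triangle_ineq2[of "P w" "of_real k"] k by simp
  then have "norm (P w) * (r - s) \<le> k * (r + s)" using r by (simp add: field_simps)
  then have "norm (P w) \<le> k * ((r + s) / (r - s))" using s by (simp add: field_simps)
  then show ?thesis by (simp add: P_def norm_minus_commute)
qed

text \<open>The functions are roots \<open>(q \<circ> \<psi>)\<^bsup>1/n\<^esup>\<close>, where \<open>\<psi>\<close> is a Riemann map and \<open>q\<close> a polynomial,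
  zero-free on a large disc, that approximates \<open>f \<circ> \<psi>\<inverse>\<close>; they are small near the boundary zeros by the
  two-constants estimate.\<close>

lemma simply_connected_peaking_functions:
  assumes \<Omega>: "open \<Omega>" "bounded \<Omega>" "simply_connected \<Omega>"
    and f: "continuous_on (closure \<Omega>) f" "f holomorphic_on \<Omega>" "z0 \<in> \<Omega>" "f z0 \<noteq> 0"
    and \<eta>: "0 < \<eta>" "\<eta> < 1" and C: "compact C" "C \<subseteq> \<Omega>"
  shows "\<exists>\<delta>>0. \<forall>C'. compact C' \<and> C' \<subseteq> \<Omega> \<longrightarrow>
     (\<exists>U g. open U \<and> C' \<subseteq> U \<and> C \<subseteq> U \<and> U \<subseteq> \<Omega> \<and> g holomorphic_on U \<and> (\<forall>z\<in>U. norm (g z) \<le> 1) \<and>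
        (\<forall>z\<in>U. \<forall>p\<in>frontier \<Omega>. f p = 0 \<and> dist z p \<le> \<delta> \<longrightarrow> norm (g z) \<le> \<eta>) \<and>
        (\<forall>z\<in>C. norm (g z - 1) \<le> \<eta>))"
proof -
  have "\<Omega> \<noteq> {}" "\<Omega> \<noteq> UNIV" using f \<Omega> by auto
  then obtain \<psi>0 h0 where 0: "\<psi>0 holomorphic_on \<Omega>" "h0 holomorphic_on ball 0 1"
      "\<And>z. z \<in> \<Omega> \<Longrightarrow> \<psi>0 z \<in> ball 0 1 \<and> h0 (\<psi>0 z) = z"
      "\<And>w. w \<in> ball 0 1 \<Longrightarrow> h0 w \<in> \<Omega> \<and> \<psi>0 (h0 w) = w"
    using Riemann_mapping_theorem[of \<Omega>] \<Omega> by blast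
  \<comment> \<open>A disc automorphism moves the image of \<open>z0\<close> to the centre, where
    \<open>f z0 \<noteq> 0\<close> provides the lower bound from which the Schwarz lemma
    starts.\<close>
  obtain u v where uv: "u (\<psi>0 z0) = 0" "u holomorphic_on ball 0 1" "u ` ball 0 1 \<subseteq> ball 0 1"
      "v holomorphic_on ball 0 1" "v ` ball 0 1 \<subseteq> ball 0 1"
      "\<And>z. z \<in> ball 0 1 \<Longrightarrow> u (v z) = z" "\<And>z. z \<in> ball 0 1 \<Longrightarrow> v (u z) = z"
    using ball_biholomorphism_exists[of "\<psi>0 z0"] 0(3) f(3) by metis
  define \<psi> where "\<psi> = u \<circ> \<psi>0"
  define h where "h = h0 \<circ> v"
  have \<psi>: "\<psi> holomorphic_on \<Omega>"
    unfolding \<psi>_def by (rule holomorphic_on_compose_gen[OF 0(1) uv(2)]) (use 0 in auto)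
  have h: "h holomorphic_on ball 0 1"
    unfolding h_def by (rule holomorphic_on_compose_gen[OF uv(4) 0(2)]) (use uv in auto)
  have \<psi>h: "h w \<in> \<Omega>" "\<psi> (h w) = w" if "w \<in> ball 0 1" for w
    using that 0(4) uv(5,6) by (auto simp: \<psi>_def h_def image_subset_iff)
  have h\<psi>: "\<psi> z \<in> ball 0 1" "h (\<psi> z) = z" if "z \<in> \<Omega>" for z
    using 0(3)[OF that] uv(3,7) by (auto simp: \<psi>_def h_def image_subset_iff)
  have \<psi>0: "\<psi> z0 = 0" by (simp add: \<psi>_def uv)
  have h0: "h 0 = z0" using h\<psi>[OF f(3)] \<psi>0 by simp
  have conts: "continuous_on \<Omega> \<psi>" "continuous_on (ball 0 1) h"
    using \<psi> h holomorphic_on_imp_continuous_on by auto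
  have comp: "compact (closure \<Omega>)" using \<Omega> by simp
  have "bounded (f ` closure \<Omega>)" using comp f(1) compact_continuous_image compact_imp_bounded by blast
  then obtain B where B: "B > 0" "\<And>z. z \<in> closure \<Omega> \<Longrightarrow> norm (f z) \<le> B"
    by (metis bounded_pos imageI)
  \<comment> \<open>The normalisation to modulus at most \<open>1/2\<close> leaves room for an
    approximation error of \<open>1/4\<close>: the polynomial stays below \<open>3/4\<close>, and
    its root strictly below \<open>1\<close>.\<close>
  define F where "F = (\<lambda>z. f z / of_real (2 * B))"
  have F1: "norm (F z) \<le> 1/2" if "z \<in> closure \<Omega>" for z
    using B(1) B(2)[OF that] by (simp add: F_def norm_divide norm_mult)
  have F: "continuous_on (closure \<Omega>) F" "F holomorphic_on \<Omega>" "F z0 \<noteq> 0"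
    using f B(1) unfolding F_def by (auto intro!: continuous_intros holomorphic_intros)
  have z0: "z0 \<in> closure \<Omega>" using f(3) closure_subset by blast
  define c where "c = norm (F z0) / 2"
  have c: "0 < c" "c \<le> 1/4" using F F1[OF z0] by (auto simp: c_def)
  have "compact (\<psi> ` C)" "\<psi> ` C \<subseteq> ball 0 1"
    using C conts h\<psi> by (auto intro: compact_continuous_image continuous_on_subset)
  then obtain s where s: "0 \<le> s" "s < 1" "\<psi> ` C \<subseteq> cball 0 s"
    using compact_subset_unit_ball by metis
  \<comment> \<open>The Harnack factor \<open>(r + s) / (r - s)\<close> will be at most
    \<open>4 / (1 - s)\<close>, so an error \<open>\<tau>\<close> at the centre becomes at most
    \<open>\<eta>\<close> on the image of \<open>C\<close>.\<close>
  define \<tau> where "\<tau> = \<eta> * (1 - s) / 4"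
  have \<tau>: "\<tau> > 0" using \<eta> s by (simp add: \<tau>_def)
  have "\<forall>\<^sub>F n in sequentially. dist (root n c) 1 < \<tau>"
    using LIMSEQ_root_const[OF c(1)] \<tau> unfolding tendsto_iff by blast
  then have "\<forall>\<^sub>F n in sequentially. dist (root n c) 1 < \<tau> \<and> n > 0"
    by (intro eventually_conj eventually_gt_at_top)
  then obtain n where n: "n > 0" "root n c \<ge> 1 - \<tau>"
    by (force simp: eventually_sequentially dist_real_def)
  \<comment> \<open>The square compensates the square root lost in the two-constants estimate, and
    the power \<open>n\<close> the root taken afterwards.\<close>
  define \<epsilon> where "\<epsilon> = (\<eta> ^ n)\<^sup>2"
  have \<epsilon>: "0 < \<epsilon>" "\<epsilon> < 1" "sqrt \<epsilon> = \<eta> ^ n"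
    using \<eta> n by (auto simp: \<epsilon>_def power_less_one_iff)
  have "uniformly_continuous_on (closure \<Omega>) F" using comp F compact_uniformly_continuous by blast
  then obtain \<rho>' where \<rho>': "\<rho>' > 0" "\<And>x y. x \<in> closure \<Omega> \<Longrightarrow> y \<in> closure \<Omega> \<Longrightarrow> dist x y < \<rho>' \<Longrightarrow> dist (F x) (F y) < \<epsilon>/2"
    unfolding uniformly_continuous_on_def using \<epsilon>(1) by (metis half_gt_zero dist_commute)
  define \<rho> where "\<rho> = \<rho>' / 2"
  have \<rho>: "\<rho> > 0" "\<rho> < \<rho>'" using \<rho>' by (auto simp: \<rho>_def)
  define \<delta> where "\<delta> = \<rho> * exp (- 8 * pi)"
  have "\<exists>U g. open U \<and> C' \<subseteq> U \<and> C \<subseteq> U \<and> U \<subseteq> \<Omega> \<and> g holomorphic_on U \<and> (\<forall>z\<in>U. norm (g z) \<le> 1) \<and>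
        (\<forall>z\<in>U. \<forall>p\<in>frontier \<Omega>. f p = 0 \<and> dist z p \<le> \<delta> \<longrightarrow> norm (g z) \<le> \<eta>) \<and>
        (\<forall>z\<in>C. norm (g z - 1) \<le> \<eta>)" if C': "compact C'" "C' \<subseteq> \<Omega>" for C'
  proof -
    have "compact (\<psi> ` C')" "\<psi> ` C' \<subseteq> ball 0 1"
      using C' conts h\<psi> by (auto intro: compact_continuous_image continuous_on_subset)
    then obtain s' where s': "0 \<le> s'" "s' < 1" "\<psi> ` C' \<subseteq> cball 0 s'"
      using compact_subset_unit_ball by metis
    \<comment> \<open>The radius exceeds \<open>s'\<close>, so the level set contains
      \<open>C'\<close>, while \<open>r - s \<ge> (1 - s) / 2\<close> holds however large
      \<open>s'\<close> is. No constant that enters \<open>n\<close>, \<open>\<epsilon>\<close> or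
      \<open>\<delta>\<close> depends on \<open>C'\<close>.\<close>
    define r where "r = (1 + max s s') / 2"
    have r: "0 < r" "r < 1" "s < r" "s' < r" "r - s \<ge> (1 - s) / 2"
      using s s' by (auto simp: r_def max_def)
    then have "r + s \<le> 2" by linarith
    define \<kappa> where "\<kappa> = min (\<epsilon>/2) (min c (1/4))"
    have \<kappa>: "\<kappa> > 0" "\<kappa> \<le> \<epsilon>/2" "\<kappa> \<le> c" "\<kappa> \<le> 1/4" using \<epsilon> c by (auto simp: \<kappa>_def)
    have "(F \<circ> h) holomorphic_on ball 0 1"
      by (rule holomorphic_on_compose_gen[OF h F(2)]) (use \<psi>h in auto)
    then obtain P where P: "\<And>w. norm w \<le> r \<Longrightarrow> norm (poly P w - F (h w)) \<le> \<kappa>"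
      using disc_polynomial_approx[of "F \<circ> h" r \<kappa>] r \<kappa> by (auto simp: o_def)
    have P0: "norm (poly P 0) \<ge> c"
      using P[of 0] r norm_triangle_ineq2[of "F z0" "F z0 - poly P 0"] \<kappa>(3)
      by (simp add: h0 norm_minus_commute c_def)
    then have "P \<noteq> 0" using c by auto
    then obtain q where q: "\<And>w. norm w < r \<Longrightarrow> poly q w \<noteq> 0"
      "\<And>w. norm w = r \<Longrightarrow> norm (poly q w) = norm (poly P w)"
      "\<And>w. norm w \<le> r \<Longrightarrow> norm (poly P w) \<le> norm (poly q w)"
      using disc_zero_free_poly[OF r(1), of P] by metis
    have Ph: "norm (poly P w) \<le> norm (F (h w)) + \<kappa>" if "norm w \<le> r" for w
      using P[OF that] norm_triangle_ineq2[of "poly P w" "F (h w)"] by linarith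
    have hcl: "h w \<in> closure \<Omega>" if "norm w \<le> r" for w
      using \<psi>h(1)[of w] that r closure_subset by auto
    have q1: "norm (poly q w) \<le> 3/4" if "norm w \<le> r" for w
    proof (rule maximum_modulus_frontier[of "poly q" "cball 0 r" "3/4"])
      show "\<And>z. z \<in> frontier (cball 0 r) \<Longrightarrow> norm (poly q z) \<le> 3/4"
        using q(2) Ph F1 hcl \<kappa>(4) r by (force simp: frontier_cball)
    qed (use that in \<open>auto intro!: holomorphic_intros continuous_intros\<close>)
    have "(poly q) holomorphic_on ball 0 r" by (intro holomorphic_intros)
    then obtain l where l: "l holomorphic_on ball 0 r" "\<And>w. w \<in> ball 0 r \<Longrightarrow> poly q w = exp (l w)"
      using contractible_imp_holomorphic_log[of "poly q" "ball 0 r"] q(1)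
      by (auto simp: convex_imp_contractible)
    define g1 where "g1 = (\<lambda>w. exp (l w / of_nat n))"
    have g1: "g1 w ^ n = poly q w" if "norm w < r" for w
      using l(2)[of w] that n by (simp add: g1_def flip: exp_of_nat_mult)
    \<comment> \<open>A unimodular factor makes the value at the centre real and positive, as the
      Schwarz argument requires; the branch of the root is otherwise arbitrary.\<close>
    define \<theta> where "\<theta> = cnj (g1 0) / norm (g1 0)"
    have \<theta>: "norm \<theta> = 1" by (simp add: \<theta>_def norm_divide g1_def)
    define G where "G = (\<lambda>w. \<theta> * g1 w)"
    have Gn: "norm (G w) ^ n = norm (poly q w)" if "norm w < r" for w
      using g1[OF that] by (simp add: G_def norm_mult \<theta> flip: norm_power)
    have holG: "G holomorphic_on ball 0 r"
      unfolding G_def g1_def by (intro holomorphic_intros l) (use n in auto)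
    have G1: "norm (G w) < 1" if "norm w < r" for w
    proof (rule ccontr)
      assume "\<not> norm (G w) < 1"
      then have "1 \<le> norm (G w) ^ n" by (simp add: one_le_power)
      then show False using Gn[OF that] q1[of w] that by simp
    qed
    have G0: "G 0 = of_real (1 - (1 - norm (g1 0)))"
    proof -
      have "G 0 = (g1 0 * cnj (g1 0)) / norm (g1 0)" by (simp add: G_def \<theta>_def)
      also have "\<dots> = of_real (norm (g1 0))"
        unfolding complex_norm_square[symmetric] by (simp add: g1_def power2_eq_square)
      finally show ?thesis by simp
    qed
    have "root n c \<le> root n (norm (poly q 0))"
      using n P0 q(3)[of 0] r by (intro real_root_le_mono) auto
    also have "\<dots> = norm (g1 0)" using g1[of 0] r n by (metis norm_ge_zero norm_power norm_zero real_root_power_cancel)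
    finally have g10: "1 - norm (g1 0) \<le> \<tau>" using n by linarith
    have G1near: "norm (G w - 1) \<le> \<eta>" if "norm w \<le> s" for w
    proof -
      have "norm (G w - 1) \<le> (1 - norm (g1 0)) * ((r + s) / (r - s))"
        by (rule schwarz_near_one[OF holG r(1) G1 G0 that s(1) r(3)])
      also have "\<dots> \<le> \<tau> * (2 / ((1 - s)/2))"
        using g10 \<tau> r \<open>r + s \<le> 2\<close> s by (intro mult_mono frac_le) auto
      also have "\<dots> = \<eta>" using s by (simp add: \<tau>_def field_simps)
      finally show ?thesis .
    qed
    define U where "U = {z\<in>\<Omega>. \<psi> z \<in> ball 0 r}"
    have opU: "open U"
      unfolding U_def using continuous_open_preimage[OF conts(1) \<Omega>(1) open_ball[of 0 r]]
      by (simp add: vimage_def Int_def)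
    have clU: "closure U \<subseteq> h ` cball 0 r"
    proof (rule closure_minimal)
      show "U \<subseteq> h ` cball 0 r"
      proof
        fix z assume "z \<in> U"
        then show "z \<in> h ` cball 0 r" using h\<psi>(2)[of z] by (intro image_eqI[of _ _ "\<psi> z"]) (auto simp: U_def)
      qed
      have "cball 0 r \<subseteq> ball (0::complex) 1" using r by auto
      then show "closed (h ` cball 0 r)"
        by (intro compact_imp_closed compact_continuous_image) (use conts in \<open>auto intro: continuous_on_subset\<close>)
    qed
    have clU2: "closure U \<subseteq> \<Omega>" "\<And>z. z \<in> closure U \<Longrightarrow> norm (\<psi> z) \<le> r" using clU \<psi>h r by fastforce+
    define Q where "Q = poly q \<circ> \<psi>"
    have holQ: "Q holomorphic_on \<Omega>" unfolding Q_def o_def by (intro holomorphic_intros \<psi>)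
    define g where "g = G \<circ> \<psi>"
    have gQ: "norm (g z) ^ n = norm (Q z)" if "z \<in> U" for z
      using Gn[of "\<psi> z"] that by (simp add: g_def Q_def U_def)
    have Q1: "norm (Q z) \<le> 1" if "z \<in> closure U" for z
      using q1[of "\<psi> z"] clU2(2)[OF that] by (simp add: Q_def)
    show ?thesis
    proof (intro exI[of _ U] exI[of _ g] conjI ballI impI)
      show "open U" by fact
      show "C' \<subseteq> U" "C \<subseteq> U" using C C' s' s r by (force simp: U_def)+
      show "U \<subseteq> \<Omega>" by (auto simp: U_def)
      show "g holomorphic_on U"
        unfolding g_def by (rule holomorphic_on_compose_gen[OF _ holG])
          (use \<psi> in \<open>auto simp: U_def intro: holomorphic_on_subset\<close>)
      show "norm (g z) \<le> 1" if "z \<in> U" for z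
        using G1[of "\<psi> z"] that by (simp add: g_def U_def)
      show "norm (g z - 1) \<le> \<eta>" if "z \<in> C" for z
        using G1near[of "\<psi> z"] that s(3) by (auto simp: g_def)
      fix z p assume z: "z \<in> U" and p: "p \<in> frontier \<Omega>" and pz: "f p = 0 \<and> dist z p \<le> \<delta>"
      have pO: "p \<notin> \<Omega>" "p \<in> closure \<Omega>" using p \<Omega>(1) by (auto simp: frontier_def interior_open)
      have "norm (Q z) \<le> sqrt \<epsilon>"
      proof (rule simply_connected_two_constants[OF \<Omega>(1,3) pO(1) opU _ clU2(1) holQ Q1 \<rho>(1) \<epsilon>(1,2) _ z])
        show "bounded U" using \<Omega>(2) by (rule bounded_subset) (auto simp: U_def)
        show "dist z p \<le> \<rho> * exp (- 8 * pi)" using pz by (simp add: \<delta>_def)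
        \<comment> \<open>On the frontier of \<open>U\<close> one has
          \<open>norm (\<psi> w) = r\<close>, where the zero-free polynomial has the same modulus as
          \<open>P\<close>. There it is within \<open>\<kappa> \<le> \<epsilon>/2\<close> of
          \<open>norm (F w)\<close>, which is itself below \<open>\<epsilon>/2\<close> because
          \<open>F p = 0\<close>.\<close>
        fix w assume w: "w \<in> frontier U" "dist w p \<le> \<rho>"
        then have wU: "w \<in> closure U" "w \<notin> U" using opU by (auto simp: frontier_def interior_open)
        then have "w \<in> \<Omega>" "norm (\<psi> w) = r" using clU2 by (auto simp: U_def not_less intro: antisym)
        then have "norm (Q w) \<le> norm (F w) + \<kappa>"
          using q(2)[of "\<psi> w"] Ph[of "\<psi> w"] h\<psi>(2)[of w] by (simp add: Q_def)
        moreover have "dist (F w) (F p) < \<epsilon>/2"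
          using \<rho>'(2)[of w p] \<rho> w pO \<open>w \<in> \<Omega>\<close> closure_subset by force
        ultimately show "norm (Q w) \<le> \<epsilon>" using \<kappa> pz by (simp add: F_def dist_norm)
      qed
      then have "norm (g z) ^ n \<le> \<eta> ^ n" using gQ[OF z] \<epsilon> by simp
      then show "norm (g z) \<le> \<eta>" using n \<eta> by (meson less_imp_le norm_ge_zero power_le_imp_le_base power_mono_iff)
    qed
  qed
  moreover have "\<delta> > 0" using \<rho> by (simp add: \<delta>_def)
  ultimately show ?thesis by blast
qed

subsection \<open>Cauchy's theorem on a grid of squares\<close>

text \<open>Interior edges cancel; an edge between a square inside and a square not inside the domain is
  charged to the latter.\<close>

lemma telescoping_charge:
  fixes h b :: "nat \<Rightarrow> real" and s :: "nat \<Rightarrow> bool"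
  assumes b: "\<And>j. b j \<ge> 0"
    and hb: "\<And>j. Suc j < n \<Longrightarrow> s j \<noteq> s (Suc j) \<Longrightarrow> \<bar>h (Suc j)\<bar> \<le> b (if s j then Suc j else j)"
    and n: "n > 0"
  shows "\<bar>(\<Sum>j<n. of_bool (s j) * (h j - h (Suc j))) + of_bool (s (n-1)) * h n - of_bool (s 0) * h 0\<bar>
      \<le> 2 * (\<Sum>j<n. of_bool (\<not> s j) * b j)"
proof -
  \<comment> \<open>A cell outside can be charged twice, once from each neighbour in its line. The
    claim is strengthened by one charge of the last cell, which is held back for a possible edge on
    its far side.\<close>
  have "\<bar>(\<Sum>j<n. of_bool (s j) * (h j - h (Suc j))) + of_bool (s (n-1)) * h n - of_bool (s 0) * h 0\<bar>
      \<le> 2 * (\<Sum>j<n. of_bool (\<not> s j) * b j) - of_bool (\<not> s (n-1)) * b (n-1)"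
    using n hb
  proof (induction n)
    case (Suc n)
    show ?case
    proof (cases "n = 0")
      case True
      then show ?thesis using b[of 0] by auto
    next
      case False
      then obtain k where k: "n = Suc k" using not0_implies_Suc by blast
      define X where "X = (\<Sum>j<n. of_bool (s j) * (h j - h (Suc j)))"
      define Y where "Y = (\<Sum>j<n. of_bool (\<not> s j) * b j)"
      define z where "z = of_bool (s 0) * h 0"
      have IH: "\<bar>X + of_bool (s k) * h n - z\<bar> \<le> 2 * Y - of_bool (\<not> s k) * b k"
        using False Suc k by (auto simp: X_def Y_def z_def)
      have ch: "s k \<noteq> s n \<Longrightarrow> \<bar>h n\<bar> \<le> b (if s k then n else k)" using Suc.prems(2)[of k] k by auto
      have "\<bar>X + of_bool (s n) * (h n - h (Suc n)) + of_bool (s n) * h (Suc n) - z\<bar>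
        \<le> 2 * (Y + of_bool (\<not> s n) * b n) - of_bool (\<not> s n) * b n"
      proof (cases "s k")
        case True
        show ?thesis
        proof (cases "s n")
          case True
          with IH \<open>s k\<close> show ?thesis by simp
        next
          case False
          then have "\<bar>h n\<bar> \<le> b n" using ch \<open>s k\<close> by auto
          with IH \<open>s k\<close> False show ?thesis by (simp; linarith)
        qed
      next
        case nk: False
        show ?thesis
        proof (cases "s n")
          case True
          then have "\<bar>h n\<bar> \<le> b k" using ch nk by auto
          with IH nk True show ?thesis by (simp; linarith)
        next
          case False
          with IH nk b[of n] b[of k] show ?thesis by simp
        qed
      qed
      then show ?thesis unfolding X_def Y_def z_def by (simp only: sum.lessThan_Suc diff_Suc_1)
    qed
  qed auto
  moreover have "of_bool (\<not> s (n-1)) * b (n-1) \<ge> 0" using b by simp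
  ultimately show ?thesis by linarith
qed

text \<open>By \<open>cell\<close>, the horizontal and the vertical edge differences agree on every
  counted square, so one double sum can be telescoped in two ways: along columns it leaves the top
  and bottom edges, along rows the left and right ones. Each direction charges a square at most
  twice, hence the factor \<open>4\<close>.\<close>

lemma grid_charge:
  fixes H V b :: "nat \<Rightarrow> nat \<Rightarrow> real" and s :: "nat \<Rightarrow> nat \<Rightarrow> bool"
  assumes m: "m > 0" and n: "n > 0"
    and cell: "\<And>i j. i < m \<Longrightarrow> j < n \<Longrightarrow> s i j \<Longrightarrow> H i j - H i (Suc j) = V i j - V (Suc i) j"
    and b: "\<And>i j. b i j \<ge> 0"
    and Hb: "\<And>i j. i < m \<Longrightarrow> Suc j < n \<Longrightarrow> s i j \<noteq> s i (Suc j) \<Longrightarrow> \<bar>H i (Suc j)\<bar> \<le> b i (if s i j then Suc j else j)"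
    and Vb: "\<And>i j. Suc i < m \<Longrightarrow> j < n \<Longrightarrow> s i j \<noteq> s (Suc i) j \<Longrightarrow> \<bar>V (Suc i) j\<bar> \<le> b (if s i j then Suc i else i) j"
  shows "\<bar>\<Sum>i<m. of_bool (s i (n-1)) * H i n - of_bool (s i 0) * H i 0\<bar>
     \<le> (\<Sum>j<n. of_bool (s (m-1) j) * \<bar>V m j\<bar> + of_bool (s 0 j) * \<bar>V 0 j\<bar>)
       + 4 * (\<Sum>i<m. \<Sum>j<n. of_bool (\<not> s i j) * b i j)"
proof -
  let ?B = "\<Sum>i<m. \<Sum>j<n. of_bool (\<not> s i j) * b i j"
  let ?T = "\<lambda>i. of_bool (s i (n-1)) * H i n - of_bool (s i 0) * H i 0"
  let ?W = "\<lambda>j. of_bool (s (m-1) j) * V m j - of_bool (s 0 j) * V 0 j"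
  let ?h = "\<lambda>i j. of_bool (s i j) * (H i j - H i (Suc j))"
  let ?v = "\<lambda>i j. of_bool (s i j) * (V i j - V (Suc i) j)"
  have "\<bar>\<Sum>i<m. ((\<Sum>j<n. ?h i j) + ?T i)\<bar> \<le> (\<Sum>i<m. 2 * (\<Sum>j<n. of_bool (\<not> s i j) * b i j))"
  proof (intro order.trans[OF sum_abs] sum_mono)
    fix i assume "i \<in> {..<m}"
    then show "\<bar>(\<Sum>j<n. ?h i j) + ?T i\<bar> \<le> 2 * (\<Sum>j<n. of_bool (\<not> s i j) * b i j)"
      using telescoping_charge[of "b i" n "s i" "H i"] b Hb n by (simp add: add_diff_eq)
  qed
  then have 1: "\<bar>(\<Sum>i<m. \<Sum>j<n. ?h i j) + (\<Sum>i<m. ?T i)\<bar> \<le> 2 * ?B"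
    by (simp add: sum.distrib sum_distrib_left)
  have "\<bar>\<Sum>j<n. ((\<Sum>i<m. ?v i j) + ?W j)\<bar> \<le> (\<Sum>j<n. 2 * (\<Sum>i<m. of_bool (\<not> s i j) * b i j))"
  proof (intro order.trans[OF sum_abs] sum_mono)
    fix j assume "j \<in> {..<n}"
    then show "\<bar>(\<Sum>i<m. ?v i j) + ?W j\<bar> \<le> 2 * (\<Sum>i<m. of_bool (\<not> s i j) * b i j)"
      using telescoping_charge[of "\<lambda>i. b i j" m "\<lambda>i. s i j" "\<lambda>i. V i j"] b Vb m by (simp add: add_diff_eq)
  qed
  moreover have "(\<Sum>j<n. 2 * (\<Sum>i<m. of_bool (\<not> s i j) * b i j)) = 2 * ?B"
    unfolding sum_distrib_left[symmetric] by (subst sum.swap) simp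
  moreover have "(\<Sum>j<n. ((\<Sum>i<m. ?v i j) + ?W j)) = (\<Sum>i<m. \<Sum>j<n. ?v i j) + (\<Sum>j<n. ?W j)"
    unfolding sum.distrib by (subst sum.swap) simp
  ultimately have 2: "\<bar>(\<Sum>i<m. \<Sum>j<n. ?v i j) + (\<Sum>j<n. ?W j)\<bar> \<le> 2 * ?B" by simp
  have 3: "(\<Sum>i<m. \<Sum>j<n. ?h i j) = (\<Sum>i<m. \<Sum>j<n. ?v i j)"
    using cell by (intro sum.cong) (auto simp: of_bool_def)
  have 4: "\<bar>\<Sum>j<n. ?W j\<bar> \<le> (\<Sum>j<n. of_bool (s (m-1) j) * \<bar>V m j\<bar> + of_bool (s 0 j) * \<bar>V 0 j\<bar>)"
    by (intro order.trans[OF sum_abs] sum_mono) (auto simp: of_bool_def)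
  show ?thesis using 1 2 3 4 by linarith
qed

lemma grid_cell_integral:
  fixes g :: "complex \<Rightarrow> complex"
  assumes g: "g holomorphic_on cbox (Complex x y) (Complex x' y')" and le: "x \<le> x'" "y \<le> y'"
  shows "contour_integral (linepath (Complex x y) (Complex x' y)) g - contour_integral (linepath (Complex x y') (Complex x' y')) g
       = contour_integral (linepath (Complex x y) (Complex x y')) g - contour_integral (linepath (Complex x' y) (Complex x' y')) g"
proof -
  let ?c = "cbox (Complex x y) (Complex x' y')"
  have mem: "Complex x y \<in> ?c" "Complex x' y \<in> ?c" "Complex x y' \<in> ?c" "Complex x' y' \<in> ?c"
    using le by (auto simp: in_cbox_complex_iff)
  have seg: "closed_segment a b \<subseteq> ?c" if "a \<in> ?c" "b \<in> ?c" for a b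
    using that by (simp add: closed_segment_subset convex_box)
  have cs: "continuous_on (closed_segment a b) g" if "a \<in> ?c" "b \<in> ?c" for a b
    using holomorphic_on_imp_continuous_on[OF g] seg[OF that] by (rule continuous_on_subset)
  have ci: "g contour_integrable_on linepath a b" if "a \<in> ?c" "b \<in> ?c" for a b
    using cs[OF that] by (rule contour_integrable_continuous_linepath)
  let ?p = "linepath (Complex x y) (Complex x' y) +++ linepath (Complex x' y) (Complex x' y') +++
    linepath (Complex x' y') (Complex x y') +++ linepath (Complex x y') (Complex x y)"
  have "(g has_contour_integral 0) ?p"
    using seg mem by (intro Cauchy_theorem_convex_simple[OF g]) (auto simp: path_image_join convex_box)
  then have "contour_integral ?p g = 0" by (rule contour_integral_unique)
  moreover have "contour_integral (linepath (Complex x' y') (Complex x y')) g = - contour_integral (linepath (Complex x y') (Complex x' y')) g"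
    "contour_integral (linepath (Complex x y') (Complex x y)) g = - contour_integral (linepath (Complex x y) (Complex x y')) g"
    using cs mem by (intro contour_integral_reverse_linepath; blast)+
  ultimately show ?thesis using ci mem by (simp add: algebra_simps)
qed

text \<open>On a vertical edge \<open>dz = \<i> dt\<close>, so the real part of the integral sees
  only \<open>Im g\<close>, which is small wherever \<open>g\<close> is near \<open>1\<close>. This
  is why real parts are taken throughout, and why the vertical sides of a rectangle cost almost
  nothing.\<close>

lemma vertical_edge_bound:
  fixes g :: "complex \<Rightarrow> complex"
  assumes g: "continuous_on (closed_segment (Complex x y) (Complex x y')) g" and "y < y'"
    and F: "F integrable_on {y..y'}" and gF: "\<And>t. t \<in> {y..y'} \<Longrightarrow> \<bar>Im (g (Complex x t))\<bar> \<le> F t"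
  shows "\<bar>Re (contour_integral (linepath (Complex x y) (Complex x y')) g)\<bar> \<le> integral {y..y'} F"
proof -
  have img: "Complex x ` {y..y'} \<subseteq> closed_segment (Complex x y) (Complex x y')"
    using assms(2) by (auto simp: closed_segment_same_Re closed_segment_eq_real_ivl)
  have "continuous_on {y..y'} (\<lambda>t. Complex x t)"
    unfolding Complex_eq by (intro continuous_intros)
  then have cont: "continuous_on {y..y'} (\<lambda>t. g (Complex x t))"
    using g img by (metis continuous_on_compose2)
  have "contour_integral (linepath (Complex x y) (Complex x y')) g = \<i> * integral {y..y'} (\<lambda>t. g (Complex x t))"
    using contour_integral_linepath_same_Re[of "Complex x y" x "Complex x y'" y y'] assms(2) by simp
  then have "Re (contour_integral (linepath (Complex x y) (Complex x y')) g) = - Im (integral {y..y'} (\<lambda>t. g (Complex x t)))"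
    by simp
  also have "\<dots> = - integral {y..y'} (\<lambda>t. Im (g (Complex x t)))"
    using integral_linear[OF integrable_continuous_interval[OF cont] bounded_linear_Im] by (simp add: o_def)
  finally have eq: "Re (contour_integral (linepath (Complex x y) (Complex x y')) g) = - integral {y..y'} (\<lambda>t. Im (g (Complex x t)))" .
  have "continuous_on {y..y'} (\<lambda>t. Im (g (Complex x t)))" using cont by (intro continuous_intros)
  then have "norm (integral {y..y'} (\<lambda>t. Im (g (Complex x t)))) \<le> integral {y..y'} F"
    using gF by (intro integral_norm_bound_integral F integrable_continuous_interval) auto
  then show ?thesis unfolding eq by simp
qed

text \<open>An uncounted square that shares an edge with a counted one contains points of
  \<open>\<Omega>\<close> without being contained in it, so by connectedness it meets the frontier,
  and the bound \<open>gb\<close> applies to that edge. Edges of counted squares lie in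
  \<open>U\<close>, where \<open>g\<close> is holomorphic.\<close>

lemma grid_holomorphic_bound:
  fixes g :: "complex \<Rightarrow> complex" and x1 y1 d :: real and m n :: nat and \<Omega> U :: "complex set"
    and b :: "nat \<Rightarrow> nat \<Rightarrow> real"
  defines "P \<equiv> \<lambda>i j. Complex (x1 + real i * d) (y1 + real j * d)"
  defines "cell \<equiv> \<lambda>i j. cbox (P i j) (P (Suc i) (Suc j))"
  defines "s \<equiv> \<lambda>i j. cell i j \<subseteq> \<Omega>"
  assumes d: "d > 0" and m: "m > 0" and n: "n > 0"
    and g: "g holomorphic_on U" and U: "\<And>i j. i < m \<Longrightarrow> j < n \<Longrightarrow> s i j \<Longrightarrow> cell i j \<subseteq> U"
    and b: "\<And>i j. b i j \<ge> 0"
    and gb: "\<And>i j z. i < m \<Longrightarrow> j < n \<Longrightarrow> cell i j \<inter> frontier \<Omega> \<noteq> {} \<Longrightarrow> z \<in> U \<inter> cell i j \<Longrightarrow> norm (g z) * d \<le> b i j"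
  shows "\<bar>\<Sum>i<m. of_bool (s i (n-1)) * Re (contour_integral (linepath (P i n) (P (Suc i) n)) g)
            - of_bool (s i 0) * Re (contour_integral (linepath (P i 0) (P (Suc i) 0)) g)\<bar>
     \<le> (\<Sum>j<n. of_bool (s (m-1) j) * \<bar>Re (contour_integral (linepath (P m j) (P m (Suc j))) g)\<bar>
              + of_bool (s 0 j) * \<bar>Re (contour_integral (linepath (P 0 j) (P 0 (Suc j))) g)\<bar>)
       + 4 * (\<Sum>i<m. \<Sum>j<n. of_bool (\<not> s i j) * b i j)"
proof (rule grid_charge[OF m n])
  have mem: "P i j \<in> cell i j" "P (Suc i) j \<in> cell i j" "P i (Suc j) \<in> cell i j" "P (Suc i) (Suc j) \<in> cell i j" for i j
    using d by (auto simp: cell_def P_def in_cbox_complex_iff algebra_simps)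
  have seg: "closed_segment a c \<subseteq> cell i j" if "a \<in> cell i j" "c \<in> cell i j" for a c i j
    using that unfolding cell_def by (simp add: closed_segment_subset convex_box)
  have edge: "\<bar>Re (contour_integral (linepath a c) g)\<bar> \<le> b i' j'"
    if "i < m" "j < n" "i' < m" "j' < n" "s i j" "\<not> s i' j'" "a \<in> cell i j" "c \<in> cell i j" "a \<in> cell i' j'" "c \<in> cell i' j'"
      "norm (c - a) = d" for a c i j i' j'
  proof -
    have ac: "closed_segment a c \<subseteq> cell i j" "closed_segment a c \<subseteq> cell i' j'" using seg that by blast+
    have "connected (cell i' j')" unfolding cell_def using convex_box convex_connected by blast
    moreover have "a \<in> \<Omega>" using that s_def by blast
    ultimately have fr: "cell i' j' \<inter> frontier \<Omega> \<noteq> {}"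
      using that connected_Int_frontier[of "cell i' j'" \<Omega>] unfolding s_def by blast
    have aU: "closed_segment a c \<subseteq> U" using ac U that by blast
    have "norm (contour_integral (linepath a c) g) \<le> b i' j' / d * norm (c - a)"
    proof (rule contour_integral_bound_linepath)
      show "g contour_integrable_on linepath a c"
        using holomorphic_on_imp_continuous_on[OF g] aU
        by (meson contour_integrable_continuous_linepath continuous_on_subset)
      show "0 \<le> b i' j' / d" using b d by simp
      fix z assume "z \<in> closed_segment a c"
      then have "norm (g z) * d \<le> b i' j'" using gb[OF that(3,4) fr] ac aU by blast
      then show "norm (g z) \<le> b i' j' / d" using d by (simp add: field_simps)
    qed
    then show ?thesis using abs_Re_le_cmod[of "contour_integral (linepath a c) g"] d that by simp
  qed
  show "b i j \<ge> 0" for i j by fact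
  show "Re (contour_integral (linepath (P i j) (P (Suc i) j)) g) - Re (contour_integral (linepath (P i (Suc j)) (P (Suc i) (Suc j))) g)
      = Re (contour_integral (linepath (P i j) (P i (Suc j))) g) - Re (contour_integral (linepath (P (Suc i) j) (P (Suc i) (Suc j))) g)"
    if "i < m" "j < n" "s i j" for i j
  proof -
    have "g holomorphic_on cell i j" using g U[OF that] holomorphic_on_subset by blast
    from arg_cong[OF grid_cell_integral[OF this[unfolded cell_def P_def]], of Re] d show ?thesis
      by (simp add: P_def)
  qed
  have nd: "norm (P (Suc i) j - P i j) = d" "norm (P i (Suc j) - P i j) = d" for i j
    using d by (auto simp: P_def cmod_def algebra_simps)
  show "\<bar>Re (contour_integral (linepath (P i (Suc j)) (P (Suc i) (Suc j))) g)\<bar> \<le> b i (if s i j then Suc j else j)"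
    if "i < m" "Suc j < n" "s i j \<noteq> s i (Suc j)" for i j
    using that mem[of i j] mem[of i "Suc j"] nd(1)[of i "Suc j"]
      edge[of i j i "Suc j" "P i (Suc j)" "P (Suc i) (Suc j)"] edge[of i "Suc j" i j "P i (Suc j)" "P (Suc i) (Suc j)"] by auto
  show "\<bar>Re (contour_integral (linepath (P (Suc i) j) (P (Suc i) (Suc j))) g)\<bar> \<le> b (if s i j then Suc i else i) j"
    if "Suc i < m" "j < n" "s i j \<noteq> s (Suc i) j" for i j
    using that mem[of i j] mem[of "Suc i" j] nd(2)[of "Suc i" j]
      edge[of i j "Suc i" j "P (Suc i) j" "P (Suc i) (Suc j)"] edge[of "Suc i" j i j "P (Suc i) j" "P (Suc i) (Suc j)"] by auto
qed

section \<open>Total charge of the squares near the curve, measured in the parameter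
  interval\<close>

lemma measure_near_compact:
  fixes \<gamma> :: "real \<Rightarrow> complex" and \<phi> :: "real \<Rightarrow> complex"
  assumes \<gamma>: "continuous_on {0..1} \<gamma>" and \<phi>: "continuous_on {0..1} \<phi>" and R: "closed R" "R \<noteq> {}" and \<kappa>: "\<kappa> > 0"
  shows "\<exists>e>0. measure lebesgue {t\<in>{0..1}. infdist (\<gamma> t) R \<le> e \<and> \<phi> t \<noteq> 0}
        \<le> measure lebesgue {t\<in>{0..1}. \<gamma> t \<in> R \<and> \<phi> t \<noteq> 0} + \<kappa>"
proof -
  define A where "A = (\<lambda>k::nat. {t\<in>{0..1}. infdist (\<gamma> t) R \<le> 1 / Suc k \<and> \<phi> t \<noteq> 0})"
  have cl: "closed {t\<in>{0..1}. infdist (\<gamma> t) R \<le> e}" for e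
  proof -
    have "closed ({0..1} \<inter> (\<lambda>t. infdist (\<gamma> t) R) -` {..e})"
      using \<gamma> by (intro continuous_closed_preimage continuous_on_infdist) auto
    then show ?thesis by (simp add: vimage_def Int_def)
  qed
  have cl0: "closed {t\<in>{0..1}. \<phi> t = 0}"
    using continuous_closed_preimage_constant[OF \<phi>, of 0] by auto
  have A: "A k \<in> lmeasurable" for k
  proof -
    have "A k = {t\<in>{0..1}. infdist (\<gamma> t) R \<le> 1 / Suc k} - {t\<in>{0..1}. \<phi> t = 0}" by (auto simp: A_def)
    moreover have "{t\<in>{0..1}. infdist (\<gamma> t) R \<le> 1 / Suc k} \<in> lmeasurable"
      using cl by (intro lmeasurable_compact) (auto simp: compact_eq_bounded_closed intro: bounded_subset[of "{0..1}"])
    ultimately show ?thesis using cl0 by (simp add: fmeasurable_Diff borel_closed)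
  qed
  have dec: "decseq A"
    unfolding decseq_def A_def by (auto intro: order.trans simp: frac_le)
  have Int: "(\<Inter>k. A k) = {t\<in>{0..1}. \<gamma> t \<in> R \<and> \<phi> t \<noteq> 0}"
  proof (intro equalityI subsetI)
    fix t assume t: "t \<in> (\<Inter>k. A k)"
    have "infdist (\<gamma> t) R \<le> 0"
    proof (rule field_le_epsilon)
      fix e :: real assume "e > 0"
      then obtain k where "1 / Suc k < e" using nat_approx_posE by metis
      moreover have "t \<in> A k" using t by blast
      ultimately show "infdist (\<gamma> t) R \<le> 0 + e" by (simp add: A_def)
    qed
    then have "\<gamma> t \<in> R" using R infdist_nonneg[of "\<gamma> t" R] in_closed_iff_infdist_zero[of R] by auto
    then show "t \<in> {t\<in>{0..1}. \<gamma> t \<in> R \<and> \<phi> t \<noteq> 0}" using t by (auto simp: A_def)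
  qed (auto simp: A_def)
  have "(\<lambda>k. measure lebesgue (A k)) \<longlonglongrightarrow> measure lebesgue (\<Inter>k. A k)"
  proof (rule Lim_measure_decseq)
    show "range A \<subseteq> sets lebesgue" using A by (auto dest: fmeasurableD)
    show "emeasure lebesgue (A k) \<noteq> \<infinity>" for k using fmeasurableD2[OF A] by simp
  qed fact
  then have "\<forall>\<^sub>F k in sequentially. measure lebesgue (A k) < measure lebesgue (\<Inter>k. A k) + \<kappa>"
    using \<kappa> by (intro order_tendstoD) auto
  from eventually_happens'[OF sequentially_bot this]
  obtain k where k: "measure lebesgue (A k) < measure lebesgue (\<Inter>k. A k) + \<kappa>" ..
  show ?thesis
  proof (intro exI[of _ "1 / Suc k"] conjI)
    show "measure lebesgue {t\<in>{0..1}. infdist (\<gamma> t) R \<le> 1 / Suc k \<and> \<phi> t \<noteq> 0}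
        \<le> measure lebesgue {t\<in>{0..1}. \<gamma> t \<in> R \<and> \<phi> t \<noteq> 0} + \<kappa>"
      using k unfolding Int unfolding A_def by (rule less_imp_le)
  qed simp
qed

text \<open>Once one point of \<open>X\<close> is fixed, each index of a closed cell meeting
  \<open>X\<close> lies in a window of four consecutive integers, from two below to one above the
  index of that point. The two coordinates give \<open>4 * 4\<close>.\<close>

lemma card_cells_meeting:
  fixes x1 y1 d :: real and X :: "complex set"
  assumes d: "d > 0" and X: "\<And>z w. z \<in> X \<Longrightarrow> w \<in> X \<Longrightarrow> dist z w \<le> d"
  shows "finite {(i::nat,j::nat). cbox (Complex (x1 + real i * d) (y1 + real j * d)) (Complex (x1 + real (Suc i) * d) (y1 + real (Suc j) * d)) \<inter> X \<noteq> {}}" (is "finite ?K")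
    and "card {(i::nat,j::nat). cbox (Complex (x1 + real i * d) (y1 + real j * d)) (Complex (x1 + real (Suc i) * d) (y1 + real (Suc j) * d)) \<inter> X \<noteq> {}} \<le> 16"
proof -
  have "finite ?K \<and> card ?K \<le> 16"
  proof (cases "X = {}")
    case False
    then obtain z where z: "z \<in> X" by auto
    define k where "k = \<lfloor>(Re z - x1) / d\<rfloor>"
    define l where "l = \<lfloor>(Im z - y1) / d\<rfloor>"
    have aux: "int i \<in> {\<lfloor>u / d\<rfloor> - 2..\<lfloor>u / d\<rfloor> + 1}" if "real i * d \<le> v" "v \<le> real (Suc i) * d" "\<bar>u - v\<bar> \<le> d" for i :: nat and u v :: real
    proof -
      have "(real i - 1) * d \<le> u" "u \<le> (real i + 2) * d" using that by (auto simp: algebra_simps)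
      then have "real i - 1 \<le> u / d" "u / d \<le> real i + 2" using d by (auto simp: field_simps)
      then show ?thesis by (auto simp: le_floor_iff floor_le_iff; linarith)
    qed
    have sub: "(\<lambda>(i,j). (int i, int j)) ` ?K \<subseteq> {k-2..k+1} \<times> {l-2..l+1}"
    proof
      fix p assume "p \<in> (\<lambda>(i,j). (int i, int j)) ` ?K"
      then obtain i j w where p: "p = (int i, int j)" and w: "w \<in> cbox (Complex (x1 + real i * d) (y1 + real j * d)) (Complex (x1 + real (Suc i) * d) (y1 + real (Suc j) * d))" "w \<in> X" by auto
      have "\<bar>Re z - Re w\<bar> \<le> d" "\<bar>Im z - Im w\<bar> \<le> d"
        using X[OF z w(2)] abs_Re_le_cmod[of "z - w"] abs_Im_le_cmod[of "z - w"] by (auto simp: dist_norm)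
      then have "int i \<in> {k-2..k+1} \<and> int j \<in> {l-2..l+1}"
        unfolding k_def l_def using w(1) by (intro conjI aux[of i "Re w - x1"] aux[of j "Im w - y1"]) (auto simp: in_cbox_complex_iff)
      then show "p \<in> {k-2..k+1} \<times> {l-2..l+1}" by (simp add: p)
    qed
    have inj: "inj_on (\<lambda>(i,j). (int i, int j)) ?K" by (auto simp: inj_on_def)
    have fin: "finite ({k-2..k+1} \<times> {l-2..l+1})" and c: "card ({k-2..k+1} \<times> {l-2..l+1}) = 16" by auto
    show ?thesis using card_inj_on_le[OF inj sub fin] inj_on_finite[OF inj sub fin] c by simp
  qed simp
  then show "finite ?K" "card ?K \<le> 16" by (rule conjunct1, rule conjunct2)
qed

lemma le_if_le_add_small:
  fixes a b K :: real
  assumes "\<And>\<eta>. 0 < \<eta> \<Longrightarrow> \<eta> < 1 \<Longrightarrow> a \<le> b + \<eta> * K" and K: "K > 0"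
  shows "a \<le> b"
proof (rule ccontr)
  assume "\<not> a \<le> b"
  define \<eta> where "\<eta> = min (1/2) ((a - b) / (2 * K))"
  have e: "0 < \<eta>" "\<eta> < 1" using \<open>\<not> a \<le> b\<close> K by (auto simp: \<eta>_def)
  have "\<eta> * K \<le> (a - b) / (2 * K) * K" using K by (intro mult_right_mono) (auto simp: \<eta>_def)
  also have "(a - b) / (2 * K) * K = (a - b) / 2" using K by simp
  finally have "b + \<eta> * K \<le> b + (a - b) / 2" by (rule add_left_mono)
  with assms(1)[OF e] have "a \<le> b + (a - b) / 2" by (rule order.trans)
  then show False using \<open>\<not> a \<le> b\<close> by (simp add: field_simps)
qed

lemma sum_integral_grid:
  fixes F :: "real \<Rightarrow> real"
  assumes d: "d > 0" and F: "F integrable_on {y..y + real n * d}"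
  shows "(\<Sum>j<n. integral {y + real j * d..y + real (Suc j) * d} F) = integral {y..y + real n * d} F"
  using F
proof (induction n)
  case (Suc n)
  have le: "y + real n * d \<le> y + real (Suc n) * d" "y \<le> y + real n * d" using d by (auto simp: algebra_simps)
  have "F integrable_on {y..y + real n * d}"
    using Suc.prems le by (rule_tac integrable_on_subinterval) auto
  then show ?case
    using Suc.IH Henstock_Kurzweil_Integration.integral_combine[OF le(2,1) Suc.prems] by simp
qed simp

text \<open>The curve is cut into \<open>N\<close> arcs of parameter length \<open>1 / N\<close>,
  with \<open>N\<close> about \<open>L / d\<close>, so that each arc has diameter at most
  \<open>d\<close> and meets at most \<open>16\<close> cells. Arcs lying entirely in the nonzero
  part pay \<open>d\<close> for each cell, and their number is at most \<open>N\<close> times the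
  measure of that part; every other arc pays only \<open>\<eta> * d\<close>. The constant
  \<open>32\<close> is \<open>16\<close> times the \<open>2\<close> in
  \<open>d * N \<le> 2 * L\<close>.\<close>

lemma charge_count:
  fixes \<gamma> :: "real \<Rightarrow> complex" and \<phi> :: "real \<Rightarrow> complex" and x1 y1 d L \<eta> :: real and m n :: nat
  defines "cell \<equiv> \<lambda>i j. cbox (Complex (x1 + real i * d) (y1 + real j * d)) (Complex (x1 + real (Suc i) * d) (y1 + real (Suc j) * d))"
  defines "R \<equiv> cbox (Complex x1 y1) (Complex (x1 + real m * d) (y1 + real n * d))"
  assumes d: "d > 0" and L: "L > 0" "d \<le> L" and \<eta>: "\<eta> \<ge> 0"
    and lip: "\<And>s t. s \<in> {0..1} \<Longrightarrow> t \<in> {0..1} \<Longrightarrow> dist (\<gamma> s) (\<gamma> t) \<le> L * \<bar>s - t\<bar>"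
    and \<phi>: "continuous_on {0..1} \<phi>"
    and b: "\<And>i j. b i j \<ge> 0"
      "\<And>i j t. i < m \<Longrightarrow> j < n \<Longrightarrow> t \<in> {0..1} \<Longrightarrow> \<phi> t = 0 \<Longrightarrow> (\<exists>z\<in>cell i j. dist z (\<gamma> t) \<le> d) \<Longrightarrow> b i j \<le> \<eta> * d"
      "\<And>i j. i < m \<Longrightarrow> j < n \<Longrightarrow> b i j \<le> d"
      "\<And>i j. i < m \<Longrightarrow> j < n \<Longrightarrow> cell i j \<inter> \<gamma> ` {0..1} = {} \<Longrightarrow> b i j = 0"
  shows "(\<Sum>i<m. \<Sum>j<n. b i j) \<le> 32 * L * (\<eta> + measure lebesgue {t\<in>{0..1}. infdist (\<gamma> t) R \<le> d \<and> \<phi> t \<noteq> 0})"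
proof -
  define N where "N = nat \<lceil>L / d\<rceil>"
  have Ld: "L / d \<ge> 1" using d L by simp
  have N: "real N \<ge> L / d" "real N \<le> L / d + 1" "N > 0"
    using Ld unfolding N_def by linarith+
  have NL: "L / N \<le> d" "d * N \<le> 2 * L"
  proof -
    show "L / N \<le> d" using N d by (simp add: field_simps)
    have "d * N \<le> d * (L / d + 1)" using N d by (intro mult_left_mono) auto
    also have "\<dots> = L + d" using d by (simp add: field_simps)
    finally show "d * N \<le> 2 * L" using L by simp
  qed
  define I where "I = (\<lambda>k. {real k / N..real (Suc k) / N})"
  have I01: "I k \<subseteq> {0..1}" if "k < N" for k
    using that N by (auto simp: I_def field_simps intro: order.trans)
  have Ic: "\<exists>k<N. t \<in> I k" if t: "t \<in> {0..1}" for t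
  proof (cases "t = 1")
    case True then show ?thesis using N by (intro exI[of _ "N - 1"]) (auto simp: I_def field_simps of_nat_diff)
  next
    case False
    define k where "k = nat \<lfloor>t * N\<rfloor>"
    have "t * N < N" "0 \<le> t * N" using False t N by auto
    then have "k < N" "real k \<le> t * N" "t * N \<le> real (Suc k)" unfolding k_def by linarith+
    then show ?thesis using N by (intro exI[of _ k]) (auto simp: I_def field_simps)
  qed
  have Id: "dist (\<gamma> s) (\<gamma> t) \<le> d" if "s \<in> I k" "t \<in> I k" "k < N" for s t k
  proof -
    have "\<bar>s - t\<bar> \<le> real (Suc k) / N - real k / N" using that by (auto simp: I_def abs_le_iff)
    also have "\<dots> = 1 / N" by (simp add: add_divide_distrib flip: diff_divide_distrib)
    finally have "L * \<bar>s - t\<bar> \<le> L * (1 / N)" using L by (intro mult_left_mono) auto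
    then show ?thesis using lip[of s t] that I01[of k] NL by force
  qed
  define T where "T = {t\<in>{0..1}. infdist (\<gamma> t) R \<le> d \<and> \<phi> t \<noteq> 0}"
  define K where "K = {k. k < N \<and> I k \<subseteq> T}"
  have "continuous_on {0..1} \<gamma>"
    by (rule lipschitz_on_continuous_on[of L]) (use lip L in \<open>auto simp: lipschitz_on_def dist_real_def\<close>)
  then have clT: "closed ({0..1} \<inter> (\<lambda>t. infdist (\<gamma> t) R) -` {..d})"
    by (intro continuous_closed_preimage continuous_on_infdist) auto
  have cl0: "closed {t\<in>{0..1}. \<phi> t = 0}"
    using continuous_closed_preimage_constant[OF \<phi>, of 0] by auto
  have "T = ({0..1} \<inter> (\<lambda>t. infdist (\<gamma> t) R) -` {..d}) - {t\<in>{0..1}. \<phi> t = 0}" by (auto simp: T_def)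
  moreover have "({0..1} \<inter> (\<lambda>t. infdist (\<gamma> t) R) -` {..d}) \<in> lmeasurable"
    using clT by (intro lmeasurable_compact) (auto simp: compact_eq_bounded_closed intro: bounded_subset[of "{0..1}"])
  ultimately have T: "T \<in> lmeasurable" using cl0 by (simp add: fmeasurable_Diff borel_closed)
  have "real (card K) / N \<le> measure lebesgue T"
  proof -
    \<comment> \<open>Half-open intervals, unlike the closed \<open>I k\<close>, are pairwise
      disjoint, so their measures add up exactly.\<close>
    define J where "J = (\<lambda>k. {real k / N..<real (Suc k) / N})"
    have disj: "disjoint_family_on J K"
    proof -
      have "J k \<inter> J l = {}" if "k < l" for k l
      proof -
        have "real (Suc k) / N \<le> real l / N" using that N by (intro divide_right_mono) auto
        then show ?thesis by (auto simp: J_def)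
      qed
      then show ?thesis unfolding disjoint_family_on_def by (metis Int_commute nat_neq_iff)
    qed
    have fin: "finite K" by (simp add: K_def)
    have "real k / N \<le> real (Suc k) / N" for k using N by (intro divide_right_mono) auto
    then have eJ: "J k \<in> sets lebesgue" "emeasure lebesgue (J k) \<noteq> \<infinity>" for k
      using emeasure_lborel_Ico[of "real k / N" "real (Suc k) / N"] by (auto simp: J_def)
    have mJ: "measure lebesgue (J k) = 1 / N" for k
      using N by (simp add: J_def divide_right_mono add_divide_distrib)
    have "real (card K) / N = (\<Sum>k\<in>K. measure lebesgue (J k))" by (simp add: mJ)
    also have "\<dots> = measure lebesgue (\<Union>k\<in>K. J k)"
      using disj fin eJ by (intro measure_finite_Union[symmetric]) auto
    also have "\<dots> \<le> measure lebesgue T"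
      using T by (intro measure_mono_fmeasurable) (auto simp: K_def J_def I_def)
    finally show ?thesis .
  qed
  then have cK: "real (card K) \<le> N * measure lebesgue T" using N by (simp add: field_simps)
  define G where "G = {..<m} \<times> {..<n}"
  let ?b = "\<lambda>(i,j). b i j" and ?c = "\<lambda>(i,j). cell i j"
  define M where "M = (\<lambda>k. {p\<in>G. ?c p \<inter> \<gamma> ` I k \<noteq> {}})"
  have cM: "finite (M k)" "card (M k) \<le> 16" if "k < N" for k
  proof -
    have X: "\<And>z w. z \<in> \<gamma> ` I k \<Longrightarrow> w \<in> \<gamma> ` I k \<Longrightarrow> dist z w \<le> d" using Id that by auto
    note c = card_cells_meeting[of d "\<gamma> ` I k" x1 y1, OF d X]
    have sub: "M k \<subseteq> {(i::nat,j::nat). cbox (Complex (x1 + real i * d) (y1 + real j * d)) (Complex (x1 + real (Suc i) * d) (y1 + real (Suc j) * d)) \<inter> \<gamma> ` I k \<noteq> {}}"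
      by (auto simp: M_def cell_def)
    show "finite (M k)" by (rule finite_subset[OF sub c(1)])
    show "card (M k) \<le> 16" by (rule order.trans[OF card_mono[OF c(1) sub] c(2)])
  qed
  have cellR: "cell i j \<subseteq> R" if "i < m" "j < n" for i j
  proof -
    have "real (Suc i) * d \<le> real m * d" "real (Suc j) * d \<le> real n * d" "0 \<le> real i * d" "0 \<le> real j * d"
      using that d by (auto intro!: mult_right_mono simp del: of_nat_Suc)
    then show ?thesis unfolding cell_def R_def by (auto simp: in_cbox_complex_iff)
  qed
  have Mb: "(\<Sum>p\<in>M k. ?b p) \<le> 16 * (d * (\<eta> + of_bool (k \<in> K)))" if k: "k < N" for k
  proof -
    have "?b p \<le> d * (\<eta> + of_bool (k \<in> K))" if p: "p \<in> M k" for p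
    proof -
      obtain i j s where p: "p = (i,j)" "i < m" "j < n" "s \<in> I k" "\<gamma> s \<in> cell i j"
        using p by (auto simp: M_def G_def)
      show ?thesis
      proof (cases "k \<in> K")
        case True
        have "b i j \<le> d" by (rule b(3)[OF p(2,3)])
        also have "\<dots> \<le> d * (\<eta> + 1)" using d \<eta> by simp
        finally show ?thesis using True p by simp
      next
        case False
        \<comment> \<open>Since the arc meets a cell of the rectangle and has diameter at most
          \<open>d\<close>, the point \<open>\<gamma> t\<close> is near enough to \<open>R\<close>;
          failing to be in \<open>T\<close> therefore means \<open>\<phi> t = 0\<close>, which makes
          every cell met by this arc cheap.\<close>
        then obtain t where t: "t \<in> I k" "t \<notin> T" using k by (auto simp: K_def)
        have "dist (\<gamma> s) (\<gamma> t) \<le> d" using Id[OF p(4) t(1) k] .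
        moreover have "infdist (\<gamma> t) R \<le> dist (\<gamma> t) (\<gamma> s)" using cellR[OF p(2,3)] p(5) by (intro infdist_le) auto
        ultimately have "\<phi> t = 0" using t I01[OF k] by (auto simp: T_def dist_commute)
        then have "b i j \<le> \<eta> * d"
          using b(2)[OF p(2,3), of t] \<open>dist (\<gamma> s) (\<gamma> t) \<le> d\<close> p(5) I01[OF k] t by blast
        then show ?thesis using False p by (simp add: mult.commute)
      qed
    qed
    then have "(\<Sum>p\<in>M k. ?b p) \<le> real (card (M k)) * (d * (\<eta> + of_bool (k \<in> K)))"
      by (rule sum_bounded_above)
    also have "\<dots> \<le> 16 * (d * (\<eta> + of_bool (k \<in> K)))"
      using cM[OF k] d \<eta> by (intro mult_right_mono) auto
    finally show ?thesis .
  qed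
  have "(\<Sum>i<m. \<Sum>j<n. b i j) = (\<Sum>p\<in>G. ?b p)" unfolding G_def by (simp add: sum.cartesian_product)
  also have "\<dots> \<le> (\<Sum>p\<in>G. \<Sum>k<N. of_bool (p \<in> M k) * ?b p)"
  proof (rule sum_mono)
    fix p assume pG: "p \<in> G"
    then obtain i j where p: "p = (i,j)" "i < m" "j < n" by (auto simp: G_def)
    show "?b p \<le> (\<Sum>k<N. of_bool (p \<in> M k) * ?b p)"
    proof (cases "cell i j \<inter> \<gamma> ` {0..1} = {}")
      case True
      then show ?thesis using b(4)[OF p(2,3)] by (simp add: p)
    next
      case False
      then obtain t where "t \<in> {0..1}" "\<gamma> t \<in> cell i j" by blast
      then obtain k where k: "k < N" "p \<in> M k" using Ic[of t] pG p by (force simp: M_def)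
      then have "?b p = of_bool (p \<in> M k) * ?b p" by simp
      also have "\<dots> \<le> (\<Sum>k<N. of_bool (p \<in> M k) * ?b p)"
        using k b(1) by (intro member_le_sum) (auto simp: p)
      finally show ?thesis .
    qed
  qed
  also have "\<dots> = (\<Sum>k<N. \<Sum>p\<in>G. of_bool (p \<in> M k) * ?b p)" by (rule sum.swap)
  also have "\<dots> = (\<Sum>k<N. \<Sum>p\<in>M k. ?b p)"
    by (intro sum.cong refl sum.mono_neutral_cong_right) (auto simp: M_def G_def)
  also have "\<dots> \<le> (\<Sum>k<N. 16 * (d * (\<eta> + of_bool (k \<in> K))))" using Mb by (intro sum_mono) auto
  also have "\<dots> = 16 * d * (N * \<eta> + card K)"
  proof -
    have "(\<Sum>k<N. of_bool (k \<in> K) :: real) = real (card ({..<N} \<inter> K))" by (simp add: Int_def)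
    also have "{..<N} \<inter> K = K" by (auto simp: K_def)
    finally show ?thesis by (simp add: sum.distrib flip: sum_distrib_left)
  qed
  also have "\<dots> \<le> 16 * d * (N * \<eta> + N * measure lebesgue T)" using cK d by (intro mult_left_mono add_mono) auto
  also have "\<dots> = 16 * (d * N) * (\<eta> + measure lebesgue T)" by (simp add: algebra_simps)
  also have "\<dots> \<le> 16 * (2 * L) * (\<eta> + measure lebesgue T)"
    using NL \<eta> by (intro mult_right_mono mult_left_mono) auto
  finally show ?thesis by (simp add: T_def)
qed

section \<open>The width estimate for one rectangle\<close>

lemma contour_integral_linepath_near:
  assumes g: "continuous_on (closed_segment a b) g" and "\<eta> \<ge> 0"
    and near: "\<And>z. z \<in> closed_segment a b \<Longrightarrow> norm (g z - 1) \<le> \<eta>"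
  shows "norm (contour_integral (linepath a b) g - (b - a)) \<le> \<eta> * norm (b - a)"
proof -
  have "g contour_integrable_on linepath a b" by (rule contour_integrable_continuous_linepath[OF g])
  then have "(g has_contour_integral contour_integral (linepath a b) g) (linepath a b)"
    by (rule has_contour_integral_integral)
  then have "((\<lambda>z. g z - 1) has_contour_integral (contour_integral (linepath a b) g - 1 * (b - a))) (linepath a b)"
    by (intro has_contour_integral_diff has_contour_integral_const_linepath)
  then show ?thesis using has_contour_integral_bound_linepath[OF _ assms(2) near] by simp
qed

text \<open>Closeness to \<open>1\<close> can be prescribed only on a compact subset of
  \<open>\<Omega>\<close>. Inner regularity leaves out a part of the vertical section of length at
  most \<open>\<eta>\<close>, on which the bound \<open>1\<close> for the peaking function is good
  enough.\<close>

lemma section_inner_compact: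
  assumes "open \<Omega>" "\<eta> > 0"
  obtains B where "compact B" "B \<subseteq> {t\<in>{a..b}. Complex x t \<in> \<Omega>}"
    "({t\<in>{a..b}. Complex x t \<in> \<Omega>} - B) \<in> lmeasurable"
    "measure lebesgue ({t\<in>{a..b}. Complex x t \<in> \<Omega>} - B) \<le> \<eta>"
proof -
  have "continuous_on UNIV (\<lambda>t. Complex x t)" unfolding Complex_eq by (intro continuous_intros)
  then have "open ((\<lambda>t. Complex x t) -` \<Omega>)" using assms(1) open_vimage by blast
  moreover have "{t\<in>{a..b}. Complex x t \<in> \<Omega>} = {a..b} \<inter> (\<lambda>t. Complex x t) -` \<Omega>" by auto
  ultimately have "{t\<in>{a..b}. Complex x t \<in> \<Omega>} \<in> sets lebesgue" by (simp add: borel_open)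
  then obtain T where T: "closed T" "T \<subseteq> {t\<in>{a..b}. Complex x t \<in> \<Omega>}" "({t\<in>{a..b}. Complex x t \<in> \<Omega>} - T) \<in> lmeasurable"
     "emeasure lebesgue ({t\<in>{a..b}. Complex x t \<in> \<Omega>} - T) < ennreal \<eta>"
    using sets_lebesgue_inner_closed[OF _ assms(2)] by blast
  have "bounded T" by (rule bounded_subset[of "{a..b}"]) (use T(2) in auto)
  then have "compact T" using T(1) by (simp add: compact_eq_bounded_closed)
  moreover have "measure lebesgue ({t\<in>{a..b}. Complex x t \<in> \<Omega>} - T) \<le> \<eta>"
    using T(4) assms(2) by (simp add: measure_def enn2real_leI)
  ultimately show ?thesis using T that by blast
qed

text \<open>A function close to \<open>1\<close> on the inner horizontal side has an integral near
  \<open>w\<close> over it, with nothing on the opposite side to cancel it. The constant is the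
  \<open>4\<close> of \<open>grid_charge\<close> times the \<open>32\<close> of
  \<open>charge_count\<close>. Height and width are in the integer ratio \<open>q\<close> so that
  squares of equal size fill the rectangle; the \<open>\<eta>\<close>-errors carry fixed factors and
  disappear in the limit.\<close>

lemma rectangle_width_bound:
  fixes \<gamma> :: "real \<Rightarrow> complex" and f :: "complex \<Rightarrow> complex" and x1 y1 w L :: real and q :: nat
  assumes \<Omega>: "open \<Omega>" "bounded \<Omega>" "simply_connected \<Omega>"
    and f: "continuous_on (closure \<Omega>) f" "f holomorphic_on \<Omega>" "z0 \<in> \<Omega>" "f z0 \<noteq> 0"
    and L: "L > 0"
    and lip: "\<And>s t. s \<in> {0..1} \<Longrightarrow> t \<in> {0..1} \<Longrightarrow> dist (\<gamma> s) (\<gamma> t) \<le> L * \<bar>s - t\<bar>"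
    and im: "\<gamma> ` {0..1} = frontier \<Omega>"
    and w: "w > 0" and q: "q > 0"
    and side: "(\<forall>x\<in>{x1..x1+w}. Complex x y1 \<notin> \<Omega> \<and> Complex x (y1 + q * w) \<in> \<Omega>) \<or>
               (\<forall>x\<in>{x1..x1+w}. Complex x y1 \<in> \<Omega> \<and> Complex x (y1 + q * w) \<notin> \<Omega>)"
  shows "w \<le> 128 * L * measure lebesgue {t\<in>{0..1}. \<gamma> t \<in> cbox (Complex x1 y1) (Complex (x1 + w) (y1 + q * w)) \<and> f (\<gamma> t) \<noteq> 0}"
proof -
  define R where "R = cbox (Complex x1 y1) (Complex (x1 + w) (y1 + q * w))"
  define T where "T = (\<lambda>e. {t\<in>{0..1}. infdist (\<gamma> t) R \<le> e \<and> f (\<gamma> t) \<noteq> 0})"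
  define T0 where "T0 = {t\<in>{0..1}. \<gamma> t \<in> R \<and> f (\<gamma> t) \<noteq> 0}"
  define top where "top = (\<forall>x\<in>{x1..x1+w}. Complex x y1 \<notin> \<Omega> \<and> Complex x (y1 + q * w) \<in> \<Omega>)"
  define yy where "yy = (if top then y1 + q * w else y1)"
  have cont\<gamma>: "continuous_on {0..1} \<gamma>"
    by (rule lipschitz_on_continuous_on[of L]) (use lip L in \<open>auto simp: lipschitz_on_def dist_real_def\<close>)
  have cont\<phi>: "continuous_on {0..1} (\<lambda>t. f (\<gamma> t))"
    using continuous_on_compose2[OF f(1) cont\<gamma>] im by (auto simp: frontier_def)
  have R: "closed R" "R \<noteq> {}"
  proof -
    have "Complex x1 y1 \<in> R" using w by (auto simp: R_def in_cbox_complex_iff)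
    then show "R \<noteq> {}" by blast
    show "closed R" unfolding R_def by (rule closed_cbox)
  qed
  define seg where "seg = (\<lambda>x. Complex x yy) ` {x1..x1+w}"
  have "continuous_on UNIV (\<lambda>x. Complex x yy)" unfolding Complex_eq by (intro continuous_intros)
  then have compseg: "compact seg" unfolding seg_def by (meson compact_Icc compact_continuous_image continuous_on_subset subset_UNIV)
  have seg\<Omega>: "seg \<subseteq> \<Omega>" using side by (auto simp: seg_def yy_def top_def)
  obtain e2 where e2: "e2 > 0" "(\<Union>x\<in>seg. cball x e2) \<subseteq> \<Omega>"
    using compact_subset_open_imp_cball_epsilon_subset[OF compseg \<Omega>(1) seg\<Omega>] .
  have "w \<le> 128 * L * measure lebesgue T0 + \<eta> * (w + 2 * (q * w) + 2 + 256 * L)" if \<eta>: "0 < \<eta>" "\<eta> < 1" for \<eta>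
  proof -
    obtain B0 where B0: "compact B0" "B0 \<subseteq> {t\<in>{y1..y1+q*w}. Complex x1 t \<in> \<Omega>}"
      "({t\<in>{y1..y1+q*w}. Complex x1 t \<in> \<Omega>} - B0) \<in> lmeasurable"
      "measure lebesgue ({t\<in>{y1..y1+q*w}. Complex x1 t \<in> \<Omega>} - B0) \<le> \<eta>"
      using section_inner_compact[OF \<Omega>(1) \<eta>(1)] .
    obtain B1 where B1: "compact B1" "B1 \<subseteq> {t\<in>{y1..y1+q*w}. Complex (x1+w) t \<in> \<Omega>}"
      "({t\<in>{y1..y1+q*w}. Complex (x1+w) t \<in> \<Omega>} - B1) \<in> lmeasurable"
      "measure lebesgue ({t\<in>{y1..y1+q*w}. Complex (x1+w) t \<in> \<Omega>} - B1) \<le> \<eta>"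
      using section_inner_compact[OF \<Omega>(1) \<eta>(1)] .
    define C where "C = seg \<union> Complex x1 ` B0 \<union> Complex (x1+w) ` B1"
    have contC: "continuous_on X (Complex x)" for X x unfolding Complex_eq by (intro continuous_intros)
    have C: "compact C" "C \<subseteq> \<Omega>"
    proof -
      show "compact C" unfolding C_def
        by (intro compact_Un compseg compact_continuous_image contC B0(1) B1(1))
      show "C \<subseteq> \<Omega>" using B0(2) B1(2) seg\<Omega> unfolding C_def by blast
    qed
    from simply_connected_peaking_functions[OF \<Omega> f \<eta> C]
    obtain \<delta> where \<delta>p: "\<delta> > 0 \<and> (\<forall>C'. compact C' \<and> C' \<subseteq> \<Omega> \<longrightarrow> (\<exists>U g. open U \<and> C' \<subseteq> U \<and> C \<subseteq> U \<and> U \<subseteq> \<Omega> \<and> g holomorphic_on U \<and> (\<forall>z\<in>U. norm (g z) \<le> 1) \<and>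
        (\<forall>z\<in>U. \<forall>p\<in>frontier \<Omega>. f p = 0 \<and> dist z p \<le> \<delta> \<longrightarrow> norm (g z) \<le> \<eta>) \<and>
        (\<forall>z\<in>C. norm (g z - 1) \<le> \<eta>)))" ..
    note \<delta> = conjunct1[OF \<delta>p] and peak = conjunct2[OF \<delta>p, rule_format, OF conjI]
    \<comment> \<open>The arcs counted need not lie in the rectangle, only near it. Measure is
      continuous from above, so a small enough neighbourhood costs at most another
      \<open>\<eta>\<close>.\<close>
    obtain e where e: "e > 0" "measure lebesgue (T e) \<le> measure lebesgue T0 + \<eta>"
      using measure_near_compact[OF cont\<gamma> cont\<phi> R \<eta>(1)] unfolding T_def T0_def by blast
    \<comment> \<open>With \<open>3 * d \<le> \<delta>\<close>, all points of a cell that comes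
      within \<open>d\<close> of a boundary zero are within \<open>\<delta>\<close> of it, as cells
      have diameter at most \<open>2 * d\<close>; with \<open>2 * d \<le> e2\<close>, cells touching
      the inner side lie in \<open>\<Omega>\<close>. The bounds \<open>L\<close> and
      \<open>e\<close> serve the counting of arcs.\<close>
    define d0 where "d0 = min (min (\<delta>/3) L) (min e (e2/2))"
    have d0: "d0 > 0" using \<delta> L e e2 by (simp add: d0_def)
    obtain m :: nat where m: "w / d0 < real m" using reals_Archimedean2 by blast
    have m0: "m > 0" using m w d0 by (metis divide_pos_pos gr0I less_asym of_nat_0)
    define d where "d = w / m"
    have d: "d > 0" "d \<le> d0" "real m * d = w"
      using m0 w d0 m by (auto simp: d_def field_simps)
    have dd: "3 * d \<le> \<delta>" "d \<le> L" "d \<le> e" "2 * d \<le> e2" using d(2) by (auto simp: d0_def)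
    define n where "n = q * m"
    have n0: "n > 0" using q m0 by (simp add: n_def)
    have nd: "real n * d = q * w" using d(3) by (simp add: n_def mult.assoc)
    define P where "P = (\<lambda>i j. Complex (x1 + real i * d) (y1 + real j * d))"
    define cell where "cell = (\<lambda>i j. cbox (P i j) (P (Suc i) (Suc j)))"
    define s where "s = (\<lambda>i j. cell i j \<subseteq> \<Omega>)"
    have diam: "dist z z' \<le> 2 * d" if "z \<in> cell i j" "z' \<in> cell i j" for z z' i j
    proof -
      have "\<bar>Re (z - z')\<bar> \<le> d" "\<bar>Im (z - z')\<bar> \<le> d"
        using that by (auto simp: cell_def P_def in_cbox_complex_iff abs_le_iff algebra_simps)
      then show ?thesis using cmod_le[of "z - z'"] by (simp add: dist_norm)
    qed
    \<comment> \<open>The compact set on which the peaking function has to be holomorphic is known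
      only now, after the mesh has been chosen according to \<open>\<delta>\<close>.\<close>
    define C' where "C' = (\<Union>(i,j)\<in>{(i,j). i < m \<and> j < n \<and> s i j}. cell i j)"
    have C': "compact C'" "C' \<subseteq> \<Omega>"
    proof -
      have "finite {(i,j). i < m \<and> j < n \<and> s i j}"
        by (rule finite_subset[of _ "{..<m} \<times> {..<n}"]) auto
      then show "compact C'" unfolding C'_def by (intro compact_UN) (auto simp: cell_def)
      show "C' \<subseteq> \<Omega>" by (auto simp: C'_def s_def)
    qed
    obtain U g where Ug: " open U \<and> C' \<subseteq> U \<and> C \<subseteq> U \<and> U \<subseteq> \<Omega> \<and> g holomorphic_on U \<and> (\<forall>z\<in>U. norm (g z) \<le> 1) \<and>
        (\<forall>z\<in>U. \<forall>p\<in>frontier \<Omega>. f p = 0 \<and> dist z p \<le> \<delta> \<longrightarrow> norm (g z) \<le> \<eta>) \<and>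
        (\<forall>z\<in>C. norm (g z - 1) \<le> \<eta>)"
      using peak[OF C'] by (elim exE)
    from Ug have U: "open U" "C' \<subseteq> U" "C \<subseteq> U" "U \<subseteq> \<Omega>" and g: "g holomorphic_on U"
      and g1: "z \<in> U \<Longrightarrow> norm (g z) \<le> 1"
      and gp: "z \<in> U \<Longrightarrow> p \<in> frontier \<Omega> \<Longrightarrow> f p = 0 \<Longrightarrow> dist z p \<le> \<delta> \<Longrightarrow> norm (g z) \<le> \<eta>"
      and gC: "z \<in> C \<Longrightarrow> norm (g z - 1) \<le> \<eta>" for z p
      by (simp, simp, simp, simp, simp, simp, blast, simp)
    define b where "b = (\<lambda>i j. if cell i j \<inter> frontier \<Omega> = {} then 0
        else if \<exists>t\<in>{0..1}. f (\<gamma> t) = 0 \<and> (\<exists>z\<in>cell i j. dist z (\<gamma> t) \<le> d) then \<eta> * d else d)"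
    have b0: "b i j \<ge> 0" for i j using d \<eta> by (simp add: b_def)
    have cU: "cell i j \<subseteq> U" if "i < m" "j < n" "s i j" for i j
    proof -
      have "cell i j \<subseteq> C'" using that unfolding C'_def by blast
      then show ?thesis using U by blast
    qed
    have gb: "norm (g z) * d \<le> b i j" if "i < m" "j < n" "cell i j \<inter> frontier \<Omega> \<noteq> {}" "z \<in> U \<inter> cell i j" for i j z
    proof (cases "\<exists>t\<in>{0..1}. f (\<gamma> t) = 0 \<and> (\<exists>z\<in>cell i j. dist z (\<gamma> t) \<le> d)")
      case True
      then obtain t z' where t: "t \<in> {0..1}" "f (\<gamma> t) = 0" "z' \<in> cell i j" "dist z' (\<gamma> t) \<le> d" by blast
      have "dist z (\<gamma> t) \<le> \<delta>"
        using diam[of z i j z'] dist_triangle[of z "\<gamma> t" z'] t that dd by auto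
      moreover have "\<gamma> t \<in> frontier \<Omega>" using im t by blast
      ultimately have "norm (g z) \<le> \<eta>" using gp that t by blast
      then have "norm (g z) * d \<le> \<eta> * d" using d by (intro mult_right_mono) auto
      then show ?thesis unfolding b_def if_not_P[OF that(3)] if_P[OF True] by simp
    next
      case False
      have "norm (g z) * d \<le> 1 * d" using g1[of z] that d by (intro mult_right_mono) auto
      then show ?thesis unfolding b_def if_not_P[OF that(3)] if_not_P[OF False] by simp
    qed
    have main: "\<bar>\<Sum>i<m. of_bool (s i (n-1)) * Re (contour_integral (linepath (P i n) (P (Suc i) n)) g)
            - of_bool (s i 0) * Re (contour_integral (linepath (P i 0) (P (Suc i) 0)) g)\<bar>
     \<le> (\<Sum>j<n. of_bool (s (m-1) j) * \<bar>Re (contour_integral (linepath (P m j) (P m (Suc j))) g)\<bar>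
              + of_bool (s 0 j) * \<bar>Re (contour_integral (linepath (P 0 j) (P 0 (Suc j))) g)\<bar>)
       + 4 * (\<Sum>i<m. \<Sum>j<n. of_bool (\<not> s i j) * b i j)"
      unfolding P_def s_def cell_def
      by (rule grid_holomorphic_bound[OF d(1) m0 n0 g cU[unfolded s_def cell_def P_def] b0 gb[unfolded cell_def P_def]])
    have b3: "b i j \<le> d" if "i < m" "j < n" for i j using d \<eta> by (simp add: b_def)
    have b4: "b i j = 0" if "i < m" "j < n" "cell i j \<inter> \<gamma> ` {0..1} = {}" for i j using that im by (simp add: b_def)
    have b2: "b i j \<le> \<eta> * d"
      if "i < m" "j < n" "t \<in> {0..1}" "f (\<gamma> t) = 0" "\<exists>z\<in>cell i j. dist z (\<gamma> t) \<le> d" for i j t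
    proof -
      have "\<exists>t\<in>{0..1}. f (\<gamma> t) = 0 \<and> (\<exists>z\<in>cell i j. dist z (\<gamma> t) \<le> d)" using that by blast
      then show ?thesis using d \<eta> by (simp add: b_def)
    qed
    have count: "(\<Sum>i<m. \<Sum>j<n. of_bool (\<not> s i j) * b i j) \<le> 32 * L * (2 * \<eta> + measure lebesgue T0)"
    proof -
      have "(\<Sum>i<m. \<Sum>j<n. of_bool (\<not> s i j) * b i j) \<le> (\<Sum>i<m. \<Sum>j<n. b i j)"
        using b0 by (intro sum_mono) (auto simp: of_bool_def)
      also have "\<dots> \<le> 32 * L * (\<eta> + measure lebesgue {t\<in>{0..1}. infdist (\<gamma> t) (cbox (Complex x1 y1) (Complex (x1 + real m * d) (y1 + real n * d))) \<le> d \<and> f (\<gamma> t) \<noteq> 0})"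
        by (rule charge_count[OF d(1) L dd(2) less_imp_le[OF \<eta>(1)] lip cont\<phi> b0
              b2[unfolded cell_def P_def] b3 b4[unfolded cell_def P_def]])
      also have "{t\<in>{0..1}. infdist (\<gamma> t) (cbox (Complex x1 y1) (Complex (x1 + real m * d) (y1 + real n * d))) \<le> d \<and> f (\<gamma> t) \<noteq> 0} = T d"
        by (simp add: T_def R_def nd d(3))
      also have "measure lebesgue (T d) \<le> measure lebesgue (T e)"
      proof (rule measure_mono_fmeasurable)
        show "T d \<subseteq> T e" using dd by (auto simp: T_def)
        have Teq: "T e = ({0..1} \<inter> (\<lambda>t. infdist (\<gamma> t) R) -` {..e}) - ({0..1} \<inter> (\<lambda>t. f (\<gamma> t)) -` {0})" for e
          by (auto simp: T_def)
        have cl: "closed ({0..1} \<inter> (\<lambda>t. infdist (\<gamma> t) R) -` {..e})" "closed ({0..1} \<inter> (\<lambda>t. f (\<gamma> t)) -` {0})" for e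
          using cont\<gamma> cont\<phi> by (intro continuous_closed_preimage continuous_on_infdist; auto)+
        show "T d \<in> sets lebesgue" unfolding Teq using cl by (simp add: borel_closed)
        show "T e \<in> lmeasurable" unfolding Teq using cl
          by (intro fmeasurable_Diff lmeasurable_compact)
             (auto simp: compact_eq_bounded_closed borel_closed intro: bounded_subset[of "{0..1}"])
      qed
      also note e(2)
      finally show ?thesis using L by (simp add: algebra_simps)
    qed
    \<comment> \<open>The majorant \<open>F\<close> is \<open>\<eta>\<close>, raised by
      \<open>1\<close> on the part of the section outside the compact set \<open>B\<close>.
      Integration gives \<open>\<eta>\<close> times the height plus the measure of that
      part.\<close>
    have sidesum: "(\<Sum>j<n. of_bool (S j) * \<bar>Re (contour_integral (linepath (Complex x (y1 + real j * d)) (Complex x (y1 + real (Suc j) * d))) g)\<bar>)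
       \<le> \<eta> * (q * w) + \<eta>"
      if B: "B \<subseteq> {t\<in>{y1..y1+q*w}. Complex x t \<in> \<Omega>}" "({t\<in>{y1..y1+q*w}. Complex x t \<in> \<Omega>} - B) \<in> lmeasurable"
        "measure lebesgue ({t\<in>{y1..y1+q*w}. Complex x t \<in> \<Omega>} - B) \<le> \<eta>" "Complex x ` B \<subseteq> C"
        and S: "\<And>j t. j < n \<Longrightarrow> S j \<Longrightarrow> t \<in> {y1 + real j * d..y1 + real (Suc j) * d} \<Longrightarrow> Complex x t \<in> U" for B x S
    proof -
      define A where "A = {t\<in>{y1..y1+q*w}. Complex x t \<in> \<Omega>} - B"
      define F where "F = (\<lambda>t. \<eta> + indicat_real A t)"
      have Asub: "A \<inter> {y1..y1+q*w} = A" by (auto simp: A_def)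
      have Alm: "A \<in> lmeasurable" using B(2) unfolding A_def .
      have indA: "indicat_real A integrable_on {y1..y1+q*w}"
        unfolding integrable_on_indicator Asub by (rule Alm)
      have F: "F integrable_on {y1..y1 + real n * d}"
        unfolding F_def nd using indA by (intro integrable_add integrable_const_ivl)
      have F0: "F t \<ge> 0" for t using \<eta> by (simp add: F_def)
      have "of_bool (S j) * \<bar>Re (contour_integral (linepath (Complex x (y1 + real j * d)) (Complex x (y1 + real (Suc j) * d))) g)\<bar>
         \<le> integral {y1 + real j * d..y1 + real (Suc j) * d} F" if j: "j < n" for j
      proof -
        have "real (Suc j) * d \<le> real n * d" "0 \<le> real j * d" using j d by (auto intro!: mult_right_mono simp del: of_nat_Suc)
        then have sub: "{y1 + real j * d..y1 + real (Suc j) * d} \<subseteq> {y1..y1+q*w}" using nd by auto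
        have Fj: "F integrable_on {y1 + real j * d..y1 + real (Suc j) * d}"
          using F sub unfolding nd by (rule integrable_on_subinterval)
        show ?thesis
        proof (cases "S j")
          case False
          then show ?thesis using integral_nonneg[OF Fj] F0 by simp
        next
          case True
          have "\<bar>Re (contour_integral (linepath (Complex x (y1 + real j * d)) (Complex x (y1 + real (Suc j) * d))) g)\<bar>
              \<le> integral {y1 + real j * d..y1 + real (Suc j) * d} F"
          proof (rule vertical_edge_bound[OF _ _ Fj])
            have "closed_segment (Complex x (y1 + real j * d)) (Complex x (y1 + real (Suc j) * d)) \<subseteq> U"
            proof
              fix z assume "z \<in> closed_segment (Complex x (y1 + real j * d)) (Complex x (y1 + real (Suc j) * d))"
              then have "Re z = x" "Im z \<in> {y1 + real j * d..y1 + real (Suc j) * d}"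
                using d by (auto simp: closed_segment_same_Re closed_segment_eq_real_ivl algebra_simps split: if_splits)
              then show "z \<in> U" using S[OF j True, of "Im z"] by (metis complex_surj)
            qed
            then show "continuous_on (closed_segment (Complex x (y1 + real j * d)) (Complex x (y1 + real (Suc j) * d))) g"
              by (rule continuous_on_subset[OF holomorphic_on_imp_continuous_on[OF g]])
            show "y1 + real j * d < y1 + real (Suc j) * d" using d by (simp add: algebra_simps)
            fix t assume t: "t \<in> {y1 + real j * d..y1 + real (Suc j) * d}"
            have zU: "Complex x t \<in> U" by (rule S[OF j True t])
            show "\<bar>Im (g (Complex x t))\<bar> \<le> F t"
            proof (cases "t \<in> B")
              case True
              then have "norm (g (Complex x t) - 1) \<le> \<eta>" using B(4) by (intro gC) blast
              then have "\<bar>Im (g (Complex x t))\<bar> \<le> \<eta>" using abs_Im_le_cmod[of "g (Complex x t) - 1"] by simp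
              then show ?thesis by (simp add: F_def indicator_def)
            next
              case False
              then have "t \<in> A" using t sub zU U by (auto simp: A_def)
              moreover have "\<bar>Im (g (Complex x t))\<bar> \<le> 1" using g1[OF zU] abs_Im_le_cmod[of "g (Complex x t)"] by linarith
              ultimately show ?thesis using \<eta> by (simp add: F_def)
            qed
          qed
          then show ?thesis using True by simp
        qed
      qed
      then have "(\<Sum>j<n. of_bool (S j) * \<bar>Re (contour_integral (linepath (Complex x (y1 + real j * d)) (Complex x (y1 + real (Suc j) * d))) g)\<bar>)
         \<le> (\<Sum>j<n. integral {y1 + real j * d..y1 + real (Suc j) * d} F)" by (intro sum_mono) auto
      also have "\<dots> = integral {y1..y1 + real n * d} F" by (rule sum_integral_grid[OF d(1) F])
      also have "\<dots> = \<eta> * (q * w) + measure lebesgue A"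
      proof -
        have "integral {y1..y1+q*w} F = integral {y1..y1+q*w} (\<lambda>t. \<eta>) + integral {y1..y1+q*w} (indicat_real A)"
          unfolding F_def using indA by (intro integral_add integrable_const_ivl)
        also have "integral {y1..y1+q*w} (indicat_real A) = measure lebesgue A"
          using integral_indicator[of A "{y1..y1+q*w}"] Alm by (simp add: Asub)
        finally show ?thesis using w nd by simp
      qed
      also have "\<dots> \<le> \<eta> * (q * w) + \<eta>" using B(3) by (simp add: A_def)
      finally show ?thesis .
    qed
    have Pmem: "Complex (x1 + real i * d) t \<in> cell i' j"
      if "i = i' \<or> i = Suc i'" "t \<in> {y1 + real j * d..y1 + real (Suc j) * d}" for i i' j t
      using that d by (auto simp: cell_def P_def in_cbox_complex_iff algebra_simps)
    have side1: "(\<Sum>j<n. of_bool (s (m-1) j) * \<bar>Re (contour_integral (linepath (P m j) (P m (Suc j))) g)\<bar>) \<le> \<eta> * (q * w) + \<eta>"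
      unfolding P_def d(3)
    proof (rule sidesum[OF B1(2,3,4)])
      show "Complex (x1 + w) ` B1 \<subseteq> C" by (auto simp: C_def)
      fix j t assume j: "j < n" "s (m - 1) j" "t \<in> {y1 + real j * d..y1 + real (Suc j) * d}"
      then have "Complex (x1 + real m * d) t \<in> cell (m-1) j" using m0 by (intro Pmem) auto
      then show "Complex (x1 + w) t \<in> U" using cU[of "m-1" j] j m0 by (auto simp: d(3))
    qed
    have side0: "(\<Sum>j<n. of_bool (s 0 j) * \<bar>Re (contour_integral (linepath (P 0 j) (P 0 (Suc j))) g)\<bar>) \<le> \<eta> * (q * w) + \<eta>"
      unfolding P_def of_nat_0 mult_zero_left add_0_right
    proof (rule sidesum[OF B0(2,3,4)])
      show "Complex x1 ` B0 \<subseteq> C" by (auto simp: C_def)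
      fix j t assume j: "j < n" "s 0 j" "t \<in> {y1 + real j * d..y1 + real (Suc j) * d}"
      then have "Complex (x1 + real 0 * d) t \<in> cell 0 j" by (intro Pmem) auto
      then show "Complex x1 t \<in> U" using cU[of 0 j] j m0 by auto
    qed
    have iw: "real i * d \<le> w \<and> 0 \<le> real i * d" if "i \<le> m" for i
    proof -
      have "real i * d \<le> real m * d" using that d by (intro mult_right_mono) auto
      then show ?thesis using d by simp
    qed
    have hor: "Re (contour_integral (linepath (Complex (x1 + real i * d) yy) (Complex (x1 + real (Suc i) * d) yy)) g) \<ge> d * (1 - \<eta>)"
      if i: "i < m" for i
    proof -
      have im: "real (Suc i) * d \<le> w" "0 \<le> real i * d" using iw[of i] iw[of "Suc i"] i by auto
      have sub: "closed_segment (Complex (x1 + real i * d) yy) (Complex (x1 + real (Suc i) * d) yy) \<subseteq> seg"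
      proof
        fix z assume "z \<in> closed_segment (Complex (x1 + real i * d) yy) (Complex (x1 + real (Suc i) * d) yy)"
        then have z: "Im z = yy" "Re z \<in> {x1 + real i * d..x1 + real (Suc i) * d}"
          using d by (auto simp: closed_segment_same_Im closed_segment_eq_real_ivl algebra_simps split: if_splits)
        then show "z \<in> seg" unfolding seg_def using im by (intro image_eqI[of _ _ "Re z"]) (auto simp: complex_eq_iff)
      qed
      have segU: "seg \<subseteq> U" "seg \<subseteq> C" using U by (auto simp: C_def)
      have "norm (contour_integral (linepath (Complex (x1 + real i * d) yy) (Complex (x1 + real (Suc i) * d) yy)) g
          - (Complex (x1 + real (Suc i) * d) yy - Complex (x1 + real i * d) yy)) \<le> \<eta> * norm (Complex (x1 + real (Suc i) * d) yy - Complex (x1 + real i * d) yy)"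
      proof (rule contour_integral_linepath_near)
        show "continuous_on (closed_segment (Complex (x1 + real i * d) yy) (Complex (x1 + real (Suc i) * d) yy)) g"
          using sub segU by (intro continuous_on_subset[OF holomorphic_on_imp_continuous_on[OF g]]) blast
      qed (use \<eta> gC sub segU in auto)
      also have "Complex (x1 + real (Suc i) * d) yy - Complex (x1 + real i * d) yy = of_real d"
        by (simp add: complex_eq_iff algebra_simps)
      finally have "norm (contour_integral (linepath (Complex (x1 + real i * d) yy) (Complex (x1 + real (Suc i) * d) yy)) g - of_real d) \<le> \<eta> * d"
        using d by simp
      then show ?thesis
        using abs_Re_le_cmod[of "contour_integral (linepath (Complex (x1 + real i * d) yy) (Complex (x1 + real (Suc i) * d) yy)) g - of_real d"]
        by (simp add: algebra_simps)
    qed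
    have near_seg: "s i j" if "i < m" "Complex (x1 + real i * d) yy \<in> cell i j" for i j
    proof -
      have "real i * d \<le> w" "0 \<le> real i * d" using iw[of i] \<open>i < m\<close> by auto
      then have "Complex (x1 + real i * d) yy \<in> seg" by (auto simp: seg_def)
      moreover have "cell i j \<subseteq> cball (Complex (x1 + real i * d) yy) e2"
        using diam[OF that(2)] dd by force
      ultimately show ?thesis using e2 unfolding s_def by blast
    qed
    have far: "\<not> s i j" if "i < m" "Complex (x1 + real i * d) y \<in> cell i j" "\<And>x. x \<in> {x1..x1+w} \<Longrightarrow> Complex x y \<notin> \<Omega>" for i j y
    proof -
      have "real i * d \<le> w" "0 \<le> real i * d" using iw[of i] \<open>i < m\<close> by auto
      then have "Complex (x1 + real i * d) y \<notin> \<Omega>" using that(3) by auto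
      then show ?thesis using that(2) unfolding s_def by blast
    qed
    have ysplit: "y1 + q * w = y1 + real n * d" using nd by simp
    have topcell: "Complex (x1 + real i * d) (y1 + q * w) \<in> cell i (n-1)" for i
      unfolding ysplit using n0 d by (intro Pmem) (auto simp: algebra_simps of_nat_diff)
    have botcell: "Complex (x1 + real i * d) y1 \<in> cell i 0" for i
      using d by (intro Pmem) auto
    \<comment> \<open>All squares along the inner side are counted, and each yields at least
      \<open>d * (1 - \<eta>)\<close>; none along the opposite side is counted, because each has a
      corner outside \<open>\<Omega>\<close>. Which of the two sides is the inner one affects only
      the sign.\<close>
    have lhs: "w * (1 - \<eta>) \<le> \<bar>\<Sum>i<m. of_bool (s i (n-1)) * Re (contour_integral (linepath (P i n) (P (Suc i) n)) g)
            - of_bool (s i 0) * Re (contour_integral (linepath (P i 0) (P (Suc i) 0)) g)\<bar>"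
    proof (cases top)
      case True
      then have yy: "yy = y1 + q * w" by (simp add: yy_def)
      have "of_bool (s i (n-1)) * Re (contour_integral (linepath (P i n) (P (Suc i) n)) g)
            - of_bool (s i 0) * Re (contour_integral (linepath (P i 0) (P (Suc i) 0)) g) \<ge> d * (1 - \<eta>)" if "i < m" for i
        using near_seg[OF that, of "n-1"] topcell[of i] far[OF that botcell] True hor[OF that]
        by (simp add: yy top_def P_def nd)
      then have "(\<Sum>i<m. d * (1 - \<eta>)) \<le> (\<Sum>i<m. of_bool (s i (n-1)) * Re (contour_integral (linepath (P i n) (P (Suc i) n)) g)
            - of_bool (s i 0) * Re (contour_integral (linepath (P i 0) (P (Suc i) 0)) g))"
        by (intro sum_mono) auto
      moreover have "(\<Sum>i<m. d * (1 - \<eta>)) = w * (1 - \<eta>)" using d(3) by (simp add: mult.assoc[symmetric])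
      ultimately show ?thesis by linarith
    next
      case False
      then have yy: "yy = y1" by (simp add: yy_def)
      have bot: "\<And>x. x \<in> {x1..x1+w} \<Longrightarrow> Complex x (y1 + q * w) \<notin> \<Omega>" using False side top_def by blast
      have "of_bool (s i (n-1)) * Re (contour_integral (linepath (P i n) (P (Suc i) n)) g)
            - of_bool (s i 0) * Re (contour_integral (linepath (P i 0) (P (Suc i) 0)) g) \<le> - (d * (1 - \<eta>))" if "i < m" for i
        using near_seg[OF that, of 0] botcell[of i] far[OF that topcell bot] hor[OF that]
        by (simp add: yy P_def)
      then have "(\<Sum>i<m. of_bool (s i (n-1)) * Re (contour_integral (linepath (P i n) (P (Suc i) n)) g)
            - of_bool (s i 0) * Re (contour_integral (linepath (P i 0) (P (Suc i) 0)) g)) \<le> (\<Sum>i<m. - (d * (1 - \<eta>)))"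
        by (intro sum_mono) auto
      moreover have "(\<Sum>i<m. - (d * (1 - \<eta>))) = - (w * (1 - \<eta>))" using d(3) by (simp add: mult.assoc[symmetric])
      ultimately show ?thesis by linarith
    qed
    have "w * (1 - \<eta>) \<le> 2 * (\<eta> * (q * w) + \<eta>) + 4 * (32 * L * (2 * \<eta> + measure lebesgue T0))"
      using lhs main side0 side1 count by (simp add: sum.distrib)
    then show ?thesis by (simp add: algebra_simps)
  qed
  then have "w \<le> 128 * L * measure lebesgue T0"
    by (rule le_if_le_add_small) (use w L in \<open>auto intro!: add_pos_nonneg\<close>)
  then show ?thesis by (simp add: T0_def R_def)
qed

subsection \<open>Crossings of a closed curve with a vertical line\<close>

text \<open>The path avoids a ray issuing from \<open>z\<close>, so after rotation by
  \<open>d\<close> the principal logarithm is a continuous lift along the whole path.\<close>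

lemma winding_number_slit:
  assumes a: "path a" and d: "d \<noteq> 0" and slit: "\<And>t. t \<in> {0..1} \<Longrightarrow> d * (a t - z) \<notin> \<real>\<^sub>\<le>\<^sub>0"
  shows "winding_number a z = (Ln (d * (pathfinish a - z)) - Ln (d * (pathstart a - z))) / (2 * pi * \<i>)"
proof -
  define q where "q = (\<lambda>t. Ln (d * (a t - z)) - Ln d)"
  have "path q"
    using a slit unfolding path_def q_def by (intro continuous_intros) auto
  have nz: "d * (a t - z) \<noteq> 0" if "t \<in> {0..1}" for t using slit[OF that] by force
  have "winding_number a z = winding_number (\<lambda>t. a t - z) 0" by (rule winding_number_offset)
  also have "\<dots> = winding_number (exp \<circ> q) 0"
  proof (rule winding_number_cong)
    fix t :: real assume t: "0 \<le> t" "t \<le> 1"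
    then show "a t - z = (exp \<circ> q) t" using nz[of t] d by (simp add: q_def exp_diff)
  qed
  also have "\<dots> = (pathfinish q - pathstart q) / (2 * pi * \<i>)"
    using winding_number_compose_exp[OF \<open>path q\<close>] by simp
  finally show ?thesis by (simp add: q_def pathfinish_def pathstart_def)
qed

text \<open>Parts of the curve away from \<open>\<gamma> t0\<close> contribute continuously and
  cancel in the limit. The arc through \<open>\<gamma> t0\<close> is seen from above with the
  logarithm cut upwards and from below with the logarithm cut downwards; the two branches differ by
  \<open>\<i> * pi\<close> with opposite signs at the two ends of the arc, which adds up to one full
  turn.\<close>

lemma winding_number_jump:
  assumes \<gamma>: "path \<gamma>" and t: "0 \<le> t1" "t1 < t0" "t0 < t2" "t2 \<le> 1"
    and left: "\<And>t. t1 \<le> t \<Longrightarrow> t < t0 \<Longrightarrow> Re (\<gamma> t) < Re (\<gamma> t0)"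
    and right: "\<And>t. t0 < t \<Longrightarrow> t \<le> t2 \<Longrightarrow> Re (\<gamma> t0) < Re (\<gamma> t)"
    and inj: "\<And>t. t \<in> {0..1} \<Longrightarrow> t \<noteq> t0 \<Longrightarrow> \<gamma> t \<noteq> \<gamma> t0"
  shows "((\<lambda>\<epsilon>. winding_number \<gamma> (\<gamma> t0 + \<i> * of_real \<epsilon>) - winding_number \<gamma> (\<gamma> t0 - \<i> * of_real \<epsilon>)) \<longlongrightarrow> 1) (at_right 0)"
proof -
  let ?p = "\<gamma> t0"
  let ?z1 = "\<lambda>\<epsilon>::real. ?p + \<i> * of_real \<epsilon>" and ?z2 = "\<lambda>\<epsilon>::real. ?p - \<i> * of_real \<epsilon>"
  define A where "A = \<gamma> t1 - ?p"
  define B where "B = \<gamma> t2 - ?p"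
  have AB: "Re A < 0" "0 < Re B" using left[of t1] right[of t2] t by (auto simp: A_def B_def)
  have l1: "((\<lambda>\<epsilon>. ?z1 \<epsilon>) \<longlongrightarrow> ?p) (at_right 0)" "((\<lambda>\<epsilon>. ?z2 \<epsilon>) \<longlongrightarrow> ?p) (at_right 0)"
  proof -
    have "((\<lambda>\<epsilon>. ?z1 \<epsilon>) \<longlongrightarrow> ?p + \<i> * of_real 0) (at_right 0)" "((\<lambda>\<epsilon>. ?z2 \<epsilon>) \<longlongrightarrow> ?p - \<i> * of_real 0) (at_right 0)"
      by (intro tendsto_intros)+
    then show "((\<lambda>\<epsilon>. ?z1 \<epsilon>) \<longlongrightarrow> ?p) (at_right 0)" "((\<lambda>\<epsilon>. ?z2 \<epsilon>) \<longlongrightarrow> ?p) (at_right 0)" by simp_all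
  qed
  have sub: "path (subpath u v \<gamma>)" "path_image (subpath u v \<gamma>) = \<gamma> ` {u..v}" if "0 \<le> u" "u \<le> v" "v \<le> 1" for u v
    using that \<gamma> by (auto simp: path_image_subpath)
  have rest: "((\<lambda>\<epsilon>. winding_number (subpath u v \<gamma>) (?z1 \<epsilon>) - winding_number (subpath u v \<gamma>) (?z2 \<epsilon>)) \<longlongrightarrow> 0) (at_right 0)
      \<and> (\<forall>\<^sub>F \<epsilon> in at_right 0. ?z1 \<epsilon> \<notin> \<gamma> ` {u..v} \<and> ?z2 \<epsilon> \<notin> \<gamma> ` {u..v})"
    if uv: "0 \<le> u" "u \<le> v" "v \<le> 1" "t0 \<notin> {u..v}" for u v
  proof
    have p: "?p \<notin> path_image (subpath u v \<gamma>)"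
    proof
      assume "?p \<in> path_image (subpath u v \<gamma>)"
      then obtain t where "t \<in> {u..v}" "\<gamma> t = ?p" unfolding sub(2)[OF uv(1-3)] by auto
      then show False using inj[of t] uv by auto
    qed
    have "isCont (winding_number (subpath u v \<gamma>)) ?p"
      by (rule continuous_at_winding_number[OF sub(1)[OF uv(1-3)] p])
    then have "((\<lambda>\<epsilon>. winding_number (subpath u v \<gamma>) (?z1 \<epsilon>)) \<longlongrightarrow> winding_number (subpath u v \<gamma>) ?p) (at_right 0)"
      "((\<lambda>\<epsilon>. winding_number (subpath u v \<gamma>) (?z2 \<epsilon>)) \<longlongrightarrow> winding_number (subpath u v \<gamma>) ?p) (at_right 0)"
      using l1 by (auto intro: isCont_tendsto_compose)
    from tendsto_diff[OF this]
    show "((\<lambda>\<epsilon>. winding_number (subpath u v \<gamma>) (?z1 \<epsilon>) - winding_number (subpath u v \<gamma>) (?z2 \<epsilon>)) \<longlongrightarrow> 0) (at_right 0)" by simp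
    have "closed (path_image (subpath u v \<gamma>))" using sub(1)[OF uv(1-3)] by (rule closed_path_image)
    then have "open (- path_image (subpath u v \<gamma>))" by (simp add: open_Compl)
    then have "\<forall>\<^sub>F \<epsilon> in at_right 0. ?z1 \<epsilon> \<in> - path_image (subpath u v \<gamma>)" "\<forall>\<^sub>F \<epsilon> in at_right 0. ?z2 \<epsilon> \<in> - path_image (subpath u v \<gamma>)"
      using p by (intro topological_tendstoD[OF l1(1)] topological_tendstoD[OF l1(2)]; simp)+
    then show "\<forall>\<^sub>F \<epsilon> in at_right 0. ?z1 \<epsilon> \<notin> \<gamma> ` {u..v} \<and> ?z2 \<epsilon> \<notin> \<gamma> ` {u..v}"
      unfolding sub(2)[OF uv(1-3)] by eventually_elim auto
  qed
  have arc: "t \<in> {t1..t2} \<Longrightarrow> t \<noteq> t0 \<Longrightarrow> Re (\<gamma> t) \<noteq> Re ?p" for t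
    using left[of t] right[of t] by (cases "t < t0") auto
  have notreal: "c \<notin> \<real>\<^sub>\<le>\<^sub>0" if "Im c \<noteq> 0 \<or> 0 < Re c" for c :: complex
    using that by (auto simp: complex_nonpos_Reals_iff)
  have wn1: "winding_number (subpath t1 t2 \<gamma>) (?z1 \<epsilon>) = (Ln (\<i> * (\<gamma> t2 - ?z1 \<epsilon>)) - Ln (\<i> * (\<gamma> t1 - ?z1 \<epsilon>))) / (2 * pi * \<i>)"
    and wn2: "winding_number (subpath t1 t2 \<gamma>) (?z2 \<epsilon>) = (Ln (-\<i> * (\<gamma> t2 - ?z2 \<epsilon>)) - Ln (-\<i> * (\<gamma> t1 - ?z2 \<epsilon>))) / (2 * pi * \<i>)"
    if \<epsilon>: "\<epsilon> > 0" for \<epsilon>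
  proof -
    have ran: "\<exists>t\<in>{t1..t2}. subpath t1 t2 \<gamma> s = \<gamma> t" if "s \<in> {0..1}" for s
    proof -
      have "subpath t1 t2 \<gamma> s \<in> path_image (subpath t1 t2 \<gamma>)" using that by (auto simp: path_image_def)
      then show ?thesis using sub(2)[of t1 t2] t by auto
    qed
    have p: "path (subpath t1 t2 \<gamma>)" using sub(1)[of t1 t2] t by auto
    have "\<i> * (\<gamma> t - ?z1 \<epsilon>) \<notin> \<real>\<^sub>\<le>\<^sub>0" "- \<i> * (\<gamma> t - ?z2 \<epsilon>) \<notin> \<real>\<^sub>\<le>\<^sub>0" if "t \<in> {t1..t2}" for t
      using arc[OF that] \<epsilon> by (intro notreal; cases "t = t0"; simp)+
    then show "winding_number (subpath t1 t2 \<gamma>) (?z1 \<epsilon>) = (Ln (\<i> * (\<gamma> t2 - ?z1 \<epsilon>)) - Ln (\<i> * (\<gamma> t1 - ?z1 \<epsilon>))) / (2 * pi * \<i>)"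
      "winding_number (subpath t1 t2 \<gamma>) (?z2 \<epsilon>) = (Ln (-\<i> * (\<gamma> t2 - ?z2 \<epsilon>)) - Ln (-\<i> * (\<gamma> t1 - ?z2 \<epsilon>))) / (2 * pi * \<i>)"
      using winding_number_slit[OF p, of \<i> "?z1 \<epsilon>"] winding_number_slit[OF p, of "-\<i>" "?z2 \<epsilon>"] ran by force+
  qed
  have Lnl: "((\<lambda>\<epsilon>. Ln (d * (\<gamma> u - (?p + c * of_real \<epsilon>)))) \<longlongrightarrow> Ln (d * (\<gamma> u - ?p))) (at_right 0)"
    if "Im (d * (\<gamma> u - ?p)) \<noteq> 0" for u c d
  proof -
    have "((\<lambda>\<epsilon>. d * (\<gamma> u - (?p + c * of_real \<epsilon>))) \<longlongrightarrow> d * (\<gamma> u - (?p + c * of_real 0))) (at_right 0)"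
      by (intro tendsto_intros)
    then show ?thesis using that notreal[of "d * (\<gamma> u - ?p)"] by (intro tendsto_Ln) auto
  qed
  have "((\<lambda>\<epsilon>. ((Ln (\<i> * (\<gamma> t2 - (?p + \<i> * of_real \<epsilon>))) - Ln (\<i> * (\<gamma> t1 - (?p + \<i> * of_real \<epsilon>)))) / (2 * pi * \<i>))
     - ((Ln (-\<i> * (\<gamma> t2 - (?p + (-\<i>) * of_real \<epsilon>))) - Ln (-\<i> * (\<gamma> t1 - (?p + (-\<i>) * of_real \<epsilon>)))) / (2 * pi * \<i>)))
     \<longlongrightarrow> (Ln (\<i> * B) - Ln (\<i> * A)) / (2 * pi * \<i>) - (Ln (-\<i> * B) - Ln (-\<i> * A)) / (2 * pi * \<i>)) (at_right 0)"
    unfolding A_def B_def using AB by (intro tendsto_intros Lnl) (auto simp: A_def B_def)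
  also have "(Ln (\<i> * B) - Ln (\<i> * A)) / (2 * pi * \<i>) - (Ln (-\<i> * B) - Ln (-\<i> * A)) / (2 * pi * \<i>) = 1"
  proof -
    have "Ln (- (\<i> * B)) = Ln (\<i> * B) - \<i> * pi" "Ln (- (\<i> * A)) = Ln (\<i> * A) + \<i> * pi"
      using AB by (subst Ln_minus; force)+
    then show ?thesis by (simp add: field_simps)
  qed
  finally have mid: "((\<lambda>\<epsilon>. winding_number (subpath t1 t2 \<gamma>) (?z1 \<epsilon>) - winding_number (subpath t1 t2 \<gamma>) (?z2 \<epsilon>)) \<longlongrightarrow> 1) (at_right 0)"
    by (rule Lim_transform_eventually)
      (use wn1 wn2 in \<open>auto simp: eventually_at_right_field intro!: exI[of _ 1]\<close>)
  have r1: "t0 \<notin> {0..t1}" "t0 \<notin> {t2..1}" using t by auto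
  have e1: "\<forall>\<^sub>F \<epsilon> in at_right 0. ?z1 \<epsilon> \<notin> \<gamma> ` {0..1} \<and> ?z2 \<epsilon> \<notin> \<gamma> ` {0..1}"
  proof -
    have "\<forall>\<^sub>F \<epsilon> in at_right 0. ?z1 \<epsilon> \<notin> \<gamma> ` {t1..t2} \<and> ?z2 \<epsilon> \<notin> \<gamma> ` {t1..t2}"
    proof -
      have "?z1 \<epsilon> \<notin> \<gamma> ` {t1..t2} \<and> ?z2 \<epsilon> \<notin> \<gamma> ` {t1..t2}" if "\<epsilon> > 0" for \<epsilon> :: real
      proof -
        have "?z1 \<epsilon> \<noteq> \<gamma> t \<and> ?z2 \<epsilon> \<noteq> \<gamma> t" if "t \<in> {t1..t2}" for t
          using arc[OF that] \<open>\<epsilon> > 0\<close> by (cases "t = t0") (auto simp: complex_eq_iff)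
        then show ?thesis by blast
      qed
      then show ?thesis by (auto simp: eventually_at_right_field intro!: exI[of _ 1])
    qed
    moreover have "\<forall>\<^sub>F \<epsilon> in at_right 0. ?z1 \<epsilon> \<notin> \<gamma> ` {0..t1} \<and> ?z2 \<epsilon> \<notin> \<gamma> ` {0..t1}"
      "\<forall>\<^sub>F \<epsilon> in at_right 0. ?z1 \<epsilon> \<notin> \<gamma> ` {t2..1} \<and> ?z2 \<epsilon> \<notin> \<gamma> ` {t2..1}"
      using rest[of 0 t1] rest[of t2 1] t r1 by auto
    ultimately show ?thesis
    proof eventually_elim
      case (elim \<epsilon>)
      have "{0..1} = {0..t1} \<union> {t1..t2} \<union> {t2..1}" using t by auto
      then show ?case using elim by (simp add: image_Un)
    qed
  qed
  have split: "winding_number \<gamma> z = winding_number (subpath 0 t1 \<gamma>) z + winding_number (subpath t1 t2 \<gamma>) z + winding_number (subpath t2 1 \<gamma>) z"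
    if "z \<notin> \<gamma> ` {0..1}" for z
  proof -
    have z: "z \<notin> path_image \<gamma>" using that by (simp add: path_image_def)
    have "winding_number (subpath 0 t1 \<gamma>) z + winding_number (subpath t1 t2 \<gamma>) z = winding_number (subpath 0 t2 \<gamma>) z"
      "winding_number (subpath 0 t2 \<gamma>) z + winding_number (subpath t2 1 \<gamma>) z = winding_number (subpath 0 1 \<gamma>) z"
      using t winding_number_subpath_combine[OF \<gamma> z, of 0 t1 t2] winding_number_subpath_combine[OF \<gamma> z, of 0 t2 1] by auto
    then show ?thesis by simp
  qed
  have "((\<lambda>\<epsilon>. (winding_number (subpath 0 t1 \<gamma>) (?z1 \<epsilon>) - winding_number (subpath 0 t1 \<gamma>) (?z2 \<epsilon>))
     + (winding_number (subpath t1 t2 \<gamma>) (?z1 \<epsilon>) - winding_number (subpath t1 t2 \<gamma>) (?z2 \<epsilon>))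
     + (winding_number (subpath t2 1 \<gamma>) (?z1 \<epsilon>) - winding_number (subpath t2 1 \<gamma>) (?z2 \<epsilon>))) \<longlongrightarrow> 0 + 1 + 0) (at_right 0)"
    using rest[of 0 t1] rest[of t2 1] mid t r1 by (intro tendsto_add) auto
  then have "((\<lambda>\<epsilon>. (winding_number (subpath 0 t1 \<gamma>) (?z1 \<epsilon>) - winding_number (subpath 0 t1 \<gamma>) (?z2 \<epsilon>))
     + (winding_number (subpath t1 t2 \<gamma>) (?z1 \<epsilon>) - winding_number (subpath t1 t2 \<gamma>) (?z2 \<epsilon>))
     + (winding_number (subpath t2 1 \<gamma>) (?z1 \<epsilon>) - winding_number (subpath t2 1 \<gamma>) (?z2 \<epsilon>))) \<longlongrightarrow> 1) (at_right 0)"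
    by simp
  then show ?thesis
    by (rule Lim_transform_eventually) (use e1 in \<open>eventually_elim; simp add: split\<close>)
qed

text \<open>Winding numbers are constant on the inside, on the outside and on each open half of the
  vertical segment through \<open>\<gamma> t0\<close>, which meets the curve nowhere else. If both
  ends lay in the same region, the jump across \<open>\<gamma> t0\<close> would be \<open>0\<close>
  instead of \<open>1\<close>.\<close>

lemma crossing_separates:
  assumes \<gamma>: "simple_path \<gamma>" "pathfinish \<gamma> = pathstart \<gamma>" and t: "0 \<le> t1" "t1 < t0" "t0 < t2" "t2 \<le> 1"
    and left: "\<And>t. t1 \<le> t \<Longrightarrow> t < t0 \<Longrightarrow> Re (\<gamma> t) < Re (\<gamma> t0)"
    and right: "\<And>t. t0 < t \<Longrightarrow> t \<le> t2 \<Longrightarrow> Re (\<gamma> t0) < Re (\<gamma> t)"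
    and e: "e > 0" "\<And>t. t \<in> {0..1} \<Longrightarrow> Re (\<gamma> t) = Re (\<gamma> t0) \<Longrightarrow> \<bar>Im (\<gamma> t) - Im (\<gamma> t0)\<bar> \<le> e \<Longrightarrow> t = t0"
  shows "(\<gamma> t0 + \<i> * of_real e \<in> inside (path_image \<gamma>)) \<noteq> (\<gamma> t0 - \<i> * of_real e \<in> inside (path_image \<gamma>))"
proof
  let ?p = "\<gamma> t0" and ?I = "inside (path_image \<gamma>)" and ?O = "outside (path_image \<gamma>)"
  assume same: "(?p + \<i> * of_real e \<in> ?I) = (?p - \<i> * of_real e \<in> ?I)"
  have path: "path \<gamma>" using \<gamma>(1) by (rule simple_path_imp_path)
  have off: "?p + \<i> * of_real s \<notin> path_image \<gamma>" if "0 < \<bar>s\<bar>" "\<bar>s\<bar> \<le> e" for s :: real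
  proof
    assume "?p + \<i> * of_real s \<in> path_image \<gamma>"
    then obtain t where t': "t \<in> {0..1}" "\<gamma> t = ?p + \<i> * of_real s" by (auto simp: path_image_def)
    then have "t = t0" using e(2)[of t] that by auto
    then show False using t' that by auto
  qed
  have const: "winding_number \<gamma> (?p + \<i> * of_real (c * s)) = winding_number \<gamma> (?p + \<i> * of_real (c * e))"
    if "0 < s" "s \<le> e" "\<bar>c\<bar> = 1" for s c :: real
  proof (rule winding_number_eq[OF path \<gamma>(2)])
    define S where "S = (\<lambda>r::real. ?p + \<i> * of_real (c * r)) ` {0<..e}"
    show "?p + \<i> * of_real (c * s) \<in> S" "?p + \<i> * of_real (c * e) \<in> S" using that by (auto simp: S_def)
    have "connected {0<..e}" by (simp add: is_interval_connected_1 is_interval_oc)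
    moreover have "continuous_on {0<..e} (\<lambda>r::real. ?p + \<i> * of_real (c * r))" by (intro continuous_intros)
    ultimately show "connected S" unfolding S_def by (metis connected_continuous_image)
    have "z \<notin> path_image \<gamma>" if "z \<in> S" for z
    proof -
      obtain r where r: "0 < r" "r \<le> e" "z = ?p + \<i> * of_real (c * r)" using \<open>z \<in> S\<close> by (auto simp: S_def)
      have "\<bar>c * r\<bar> = r" using \<open>\<bar>c\<bar> = 1\<close> r(1) by (simp add: abs_mult)
      then show ?thesis unfolding r(3) using r(1,2) by (intro off) auto
    qed
    then show "S \<inter> path_image \<gamma> = {}" by blast
  qed
  have Jordan: "connected ?I" "connected ?O" "?I \<inter> path_image \<gamma> = {}" "?O \<inter> path_image \<gamma> = {}" "?I \<union> ?O = - path_image \<gamma>"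
    using Jordan_inside_outside[OF \<gamma>] by auto
  have "?p + \<i> * of_real e \<in> ?I \<union> ?O" "?p - \<i> * of_real e \<in> ?I \<union> ?O"
    using off[of e] off[of "-e"] e(1) unfolding Jordan(5) by auto
  then have "(?p + \<i> * of_real e \<in> ?I \<and> ?p - \<i> * of_real e \<in> ?I) \<or> (?p + \<i> * of_real e \<in> ?O \<and> ?p - \<i> * of_real e \<in> ?O)"
    using same by blast
  then have eq: "winding_number \<gamma> (?p + \<i> * of_real e) = winding_number \<gamma> (?p - \<i> * of_real e)"
  proof (elim disjE conjE)
    assume "?p + \<i> * of_real e \<in> ?I" "?p - \<i> * of_real e \<in> ?I"
    then show ?thesis using Jordan(1,3) by (rule winding_number_eq[OF path \<gamma>(2)])
  next
    assume "?p + \<i> * of_real e \<in> ?O" "?p - \<i> * of_real e \<in> ?O"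
    then show ?thesis using Jordan(2,4) by (rule winding_number_eq[OF path \<gamma>(2)])
  qed
  have inj: "\<gamma> t \<noteq> \<gamma> t0" if "t \<in> {0..1}" "t \<noteq> t0" for t
    using e(2)[OF that(1)] that e(1) by auto
  note lim = winding_number_jump[OF path t left right inj]
  have "((\<lambda>\<epsilon>. 0) \<longlongrightarrow> (1::complex)) (at_right (0::real))"
  proof (rule Lim_transform_eventually[OF lim])
    have "winding_number \<gamma> (\<gamma> t0 + \<i> * of_real \<epsilon>) - winding_number \<gamma> (\<gamma> t0 - \<i> * of_real \<epsilon>) = 0"
      if "0 < \<epsilon>" "\<epsilon> < e" for \<epsilon> :: real
      using const[of \<epsilon> 1] const[of \<epsilon> "-1"] that eq by simp
    then show "\<forall>\<^sub>F \<epsilon> in at_right (0::real). winding_number \<gamma> (\<gamma> t0 + \<i> * of_real \<epsilon>) - winding_number \<gamma> (\<gamma> t0 - \<i> * of_real \<epsilon>) = 0"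
      using e(1) by (auto simp: eventually_at_right_field)
  qed
  then show False by (simp add: tendsto_const_iff)
qed

subsection \<open>Fibres of Lipschitz functions\<close>

text \<open>Closed intervals keep the images compact and hence Borel. The price is that shared
  endpoints are counted twice, which affects only countably many values.\<close>

definition dyadic_ivl :: "nat \<Rightarrow> nat \<Rightarrow> real set" where
  "dyadic_ivl m j = {real j / 2 ^ m..real (Suc j) / 2 ^ m}"

definition dyadic_hits :: "(real \<Rightarrow> real) \<Rightarrow> nat \<Rightarrow> real \<Rightarrow> ennreal" where
  "dyadic_hits u m x = (\<Sum>j<2 ^ m. indicator (u ` dyadic_ivl m j) x)"

text \<open>Banach's indicatrix: off the countably many values at dyadic points, the number of preimages.\<close>

definition indicatrix :: "(real \<Rightarrow> real) \<Rightarrow> real \<Rightarrow> ennreal" where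
  "indicatrix u x = (SUP m. dyadic_hits u m x)"

lemma dyadic_ivl_subset: "j < 2 ^ m \<Longrightarrow> dyadic_ivl m j \<subseteq> {0..1}"
proof -
  assume "j < 2 ^ m"
  then have "Suc j \<le> 2 ^ m" by simp
  then have "real (Suc j) \<le> 2 ^ m" by (metis of_nat_le_iff of_nat_numeral of_nat_power)
  then show ?thesis by (auto simp: dyadic_ivl_def field_simps intro: order.trans)
qed

lemma dyadic_ivl_cover:
  assumes "t \<in> {0..1}" obtains j where "j < 2 ^ m" "t \<in> dyadic_ivl m j"
proof (cases "t = 1")
  case True
  have "real (Suc (2 ^ m - 1)) = 2 ^ m" by simp
  then show ?thesis using that[of "2 ^ m - 1"] True by (simp add: dyadic_ivl_def of_nat_diff field_simps)
next
  case False
  define k where "k = nat \<lfloor>t * 2 ^ m\<rfloor>"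
  have "t * 2 ^ m < 2 ^ m" "0 \<le> t * 2 ^ m" using False assms by auto
  then have k: "real k < 2 ^ m" "real k \<le> t * 2 ^ m" "t * 2 ^ m \<le> real (Suc k)" unfolding k_def by linarith+
  then have "k < 2 ^ m" by (metis of_nat_less_iff of_nat_numeral of_nat_power)
  then show ?thesis using that[of k] k by (simp add: dyadic_ivl_def field_simps)
qed

lemma dyadic_ivl_dist: "s \<in> dyadic_ivl m j \<Longrightarrow> t \<in> dyadic_ivl m j \<Longrightarrow> \<bar>s - t\<bar> \<le> 1 / 2 ^ m"
proof -
  assume *: "s \<in> dyadic_ivl m j" "t \<in> dyadic_ivl m j"
  then have "\<bar>s - t\<bar> \<le> real (Suc j) / 2 ^ m - real j / 2 ^ m" by (auto simp: dyadic_ivl_def abs_le_iff)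
  also have "\<dots> = 1 / 2 ^ m" by (simp add: add_divide_distrib)
  finally show ?thesis .
qed

lemma dyadic_ivl_split: "dyadic_ivl m j = dyadic_ivl (Suc m) (2 * j) \<union> dyadic_ivl (Suc m) (Suc (2 * j))"
proof -
  have "real j / 2 ^ m = real (2 * j) / 2 ^ Suc m" "real (Suc j) / 2 ^ m = real (Suc (Suc (2 * j))) / 2 ^ Suc m"
    by (simp_all add: field_simps)
  moreover have "real (2 * j) / 2 ^ Suc m \<le> real (Suc (2 * j)) / 2 ^ Suc m" "real (Suc (2 * j)) / 2 ^ Suc m \<le> real (Suc (Suc (2 * j))) / 2 ^ Suc m"
    by (intro divide_right_mono; simp)+
  ultimately show ?thesis by (simp add: dyadic_ivl_def ivl_disj_un_two_touch)
qed

lemma dyadic_hits_mono: "dyadic_hits u m x \<le> dyadic_hits u (Suc m) x"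
proof -
  have "dyadic_hits u m x \<le> (\<Sum>j<2 ^ m. indicator (u ` dyadic_ivl (Suc m) (2 * j)) x + indicator (u ` dyadic_ivl (Suc m) (Suc (2 * j))) x)"
    unfolding dyadic_hits_def
    by (intro sum_mono, subst dyadic_ivl_split) (auto simp: indicator_def image_Un)
  also have "\<dots> = (\<Sum>j<2 ^ Suc m. indicator (u ` dyadic_ivl (Suc m) j) x)"
  proof -
    have "(\<Sum>j<n. g (2 * j) + g (Suc (2 * j))) = (\<Sum>j<2*n. g j)" for n and g :: "nat \<Rightarrow> ennreal"
      by (induction n) (auto simp: ac_simps)
    then show ?thesis by simp
  qed
  finally show ?thesis by (simp add: dyadic_hits_def)
qed

lemma incseq_dyadic_hits: "incseq (\<lambda>m. dyadic_hits u m)"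
  by (intro incseq_SucI) (simp add: le_fun_def dyadic_hits_mono)

context
  fixes u :: "real \<Rightarrow> real" and L :: real
  assumes L: "L > 0" and lip: "\<And>s t. s \<in> {0..1} \<Longrightarrow> t \<in> {0..1} \<Longrightarrow> \<bar>u s - u t\<bar> \<le> L * \<bar>s - t\<bar>"
begin

lemma lip_cont: "continuous_on {0..1} u"
  by (rule lipschitz_on_continuous_on[of L]) (use lip L in \<open>auto simp: lipschitz_on_def dist_real_def\<close>)

lemma compact_dyadic_image: "j < 2 ^ m \<Longrightarrow> compact (u ` dyadic_ivl m j)"
  using continuous_on_subset[OF lip_cont dyadic_ivl_subset]
  by (intro compact_continuous_image) (auto simp: dyadic_ivl_def)

lemma measurable_dyadic_hits [measurable]: "dyadic_hits u m \<in> borel_measurable borel"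
  unfolding dyadic_hits_def
  by (intro borel_measurable_sum borel_measurable_indicator) (auto intro: borel_compact compact_dyadic_image)

lemma measurable_indicatrix [measurable]: "indicatrix u \<in> borel_measurable borel"
  unfolding indicatrix_def by (intro borel_measurable_SUP) auto

lemma emeasure_dyadic_image: "j < 2 ^ m \<Longrightarrow> emeasure lborel (u ` dyadic_ivl m j) \<le> ennreal (L / 2 ^ m)"
proof -
  assume j: "j < 2 ^ m"
  have ne: "u ` dyadic_ivl m j \<noteq> {}" by (auto simp: dyadic_ivl_def divide_right_mono)
  define a where "a = Inf (u ` dyadic_ivl m j)"
  define b where "b = Sup (u ` dyadic_ivl m j)"
  note comp = compact_dyadic_image[OF j]
  have ab: "a \<in> u ` dyadic_ivl m j" "b \<in> u ` dyadic_ivl m j"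
    using closed_contains_Inf closed_contains_Sup comp ne unfolding a_def b_def
    by (auto simp: compact_imp_closed bounded_imp_bdd_above bounded_imp_bdd_below compact_imp_bounded)
  have sub: "u ` dyadic_ivl m j \<subseteq> {a..b}"
    using comp by (auto simp: a_def b_def intro!: cInf_lower cSup_upper bounded_imp_bdd_above bounded_imp_bdd_below compact_imp_bounded)
  obtain s t where st: "s \<in> dyadic_ivl m j" "t \<in> dyadic_ivl m j" "a = u s" "b = u t" using ab by auto
  have "\<bar>u t - u s\<bar> \<le> L * \<bar>t - s\<bar>" using dyadic_ivl_subset[OF j] st by (intro lip) auto
  also have "\<dots> \<le> L * (1 / 2 ^ m)" using dyadic_ivl_dist[OF st(2,1)] L by (intro mult_left_mono) auto
  finally have "b - a \<le> L / 2 ^ m" using st by simp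
  have "emeasure lborel (u ` dyadic_ivl m j) \<le> emeasure lborel {a..b}" by (intro emeasure_mono sub) simp
  also have "\<dots> \<le> ennreal (L / 2 ^ m)" using sub ne \<open>b - a \<le> L / 2 ^ m\<close> by (auto intro!: ennreal_leI)
  finally show ?thesis .
qed

text \<open>At level \<open>m\<close> there are \<open>2 ^ m\<close> images, each of measure at most
  \<open>L / 2 ^ m\<close>, so every level integrates to at most \<open>L\<close>. The levels
  increase, and monotone convergence passes to the supremum.\<close>

lemma nn_integral_indicatrix: "(\<integral>\<^sup>+ x. indicatrix u x \<partial>lborel) \<le> ennreal L"
proof -
  have 1: "(\<integral>\<^sup>+ x. dyadic_hits u m x \<partial>lborel) \<le> ennreal L" for m
  proof -
    have "(\<integral>\<^sup>+ x. dyadic_hits u m x \<partial>lborel) = (\<Sum>j<2 ^ m. \<integral>\<^sup>+ x. indicator (u ` dyadic_ivl m j) x \<partial>lborel)"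
      unfolding dyadic_hits_def
      by (intro nn_integral_sum borel_measurable_indicator) (auto intro: borel_compact compact_dyadic_image)
    also have "\<dots> = (\<Sum>j<2 ^ m. emeasure lborel (u ` dyadic_ivl m j))"
      by (intro sum.cong refl nn_integral_indicator) (auto intro: borel_compact compact_dyadic_image)
    also have "\<dots> \<le> (\<Sum>j<(2::nat) ^ m. ennreal (L / 2 ^ m))" by (intro sum_mono emeasure_dyadic_image) auto
    also have "\<dots> = ennreal (\<Sum>j<(2::nat) ^ m. L / 2 ^ m)" using L by (intro sum_ennreal) auto
    also have "(\<Sum>j<(2::nat) ^ m. L / 2 ^ m) = L" by simp
    finally show ?thesis .
  qed
  have "(\<integral>\<^sup>+ x. indicatrix u x \<partial>lborel) = (SUP m. \<integral>\<^sup>+ x. dyadic_hits u m x \<partial>lborel)"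
    unfolding indicatrix_def using incseq_dyadic_hits
    by (intro nn_integral_monotone_convergence_SUP) auto
  also have "\<dots> \<le> ennreal L" using 1 by (intro SUP_least)
  finally show ?thesis .
qed

text \<open>The indicatrix is integrable and therefore finite almost everywhere. Any
  \<open>k\<close> distinct preimages fall into different dyadic intervals once these are shorter
  than the separation of the preimages, so an infinite fibre would force the value to exceed every
  \<open>k\<close>.\<close>

lemma finite_fibre_AE: "AE x in lborel. finite {t\<in>{0..1}. u t = x}"
proof -
  have "(\<integral>\<^sup>+ x. indicatrix u x \<partial>lborel) \<noteq> \<infinity>" using nn_integral_indicatrix by (auto simp: top_unique)
  then have "AE x in lborel. indicatrix u x \<noteq> \<infinity>" by (intro nn_integral_PInf_AE) auto
  moreover have "finite {t\<in>{0..1}. u t = x}" if fin: "indicatrix u x \<noteq> \<infinity>" for x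
  proof (rule ccontr)
    assume inf: "infinite {t\<in>{0..1}. u t = x}"
    have "of_nat k \<le> indicatrix u x" for k :: nat
    proof -
      obtain F where F: "finite F" "card F = k" "F \<subseteq> {t\<in>{0..1}. u t = x}"
        using infinite_arbitrarily_large[OF inf] by blast
      obtain \<sigma> where \<sigma>: "\<sigma> > 0" "\<And>s t. s \<in> F \<Longrightarrow> t \<in> F \<Longrightarrow> s \<noteq> t \<Longrightarrow> \<sigma> \<le> dist s t"
      proof -
        have "\<exists>\<sigma>>0. \<forall>t\<in>F. t \<noteq> s \<longrightarrow> \<sigma> \<le> dist s t" for s
          using finite_set_avoid[OF F(1), of s] by auto
        then obtain \<sigma> where s: "\<And>s. \<sigma> s > 0" "\<And>s t. t \<in> F \<Longrightarrow> t \<noteq> s \<Longrightarrow> \<sigma> s \<le> dist s t" by metis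
        show ?thesis
        proof (cases "F = {}")
          case False
          have pos: "Min (\<sigma> ` F) > 0" using F(1) False s(1) by (subst Min_gr_iff) auto
          have le: "Min (\<sigma> ` F) \<le> \<sigma> s" if "s \<in> F" for s using that F(1) by (intro Min_le) auto
          show ?thesis using that[OF pos] le s(2) order.trans by metis
        qed (use that[of 1] in auto)
      qed
      obtain m where m: "(1/2) ^ m < \<sigma>" using real_arch_pow_inv[OF \<sigma>(1), of "1/2"] by auto
      have "\<exists>j. j < 2 ^ m \<and> t \<in> dyadic_ivl m j" if "t \<in> F" for t
        using dyadic_ivl_cover[of t m] that F(3) by blast
      then obtain j where j: "\<And>t. t \<in> F \<Longrightarrow> j t < 2 ^ m \<and> t \<in> dyadic_ivl m (j t)" by metis
      have inj: "inj_on j F"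
      proof (rule inj_onI, rule ccontr)
        fix s t assume st: "s \<in> F" "t \<in> F" "j s = j t" "s \<noteq> t"
        have "\<sigma> \<le> \<bar>s - t\<bar>" using \<sigma>(2)[OF st(1,2,4)] by (simp add: dist_real_def)
        also have "\<dots> \<le> 1 / 2 ^ m" using j[OF st(1)] j[OF st(2)] st(3) by (intro dyadic_ivl_dist[of _ _ "j s"]) auto
        finally show False using m by (simp add: power_divide)
      qed
      have "of_nat k = (\<Sum>i\<in>j ` F. 1 :: ennreal)" using F inj by (simp add: card_image)
      also have "\<dots> \<le> (\<Sum>i\<in>j ` F. indicator (u ` dyadic_ivl m i) x)"
      proof (rule sum_mono)
        fix i assume "i \<in> j ` F"
        then obtain t where t: "t \<in> F" "i = j t" by auto
        then have "x \<in> u ` dyadic_ivl m i" using j[OF t(1)] F(3) by auto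
        then show "(1::ennreal) \<le> indicator (u ` dyadic_ivl m i) x" by simp
      qed
      also have "\<dots> \<le> dyadic_hits u m x" unfolding dyadic_hits_def using j by (intro sum_mono2) auto
      also have "\<dots> \<le> indicatrix u x" unfolding indicatrix_def by (rule SUP_upper) simp
      finally show ?thesis .
    qed
    then have "indicatrix u x = \<infinity>" using ennreal_Ex_less_of_nat[of "indicatrix u x"] by (metis infinity_ennreal_def not_le top.not_eq_extremum)
    then show False using fin by simp
  qed
  ultimately show ?thesis by (elim AE_mp) simp
qed

lemma null_image_cover:
  assumes E: "compact E" "E \<subseteq> {0..1}" "negligible (u ` E)" and \<kappa>: "\<kappa> > 0"
  shows "\<exists>A. open A \<and> u ` E \<subseteq> A \<and> (\<forall>m J. J \<subseteq> {..<2 ^ m} \<and> (\<forall>j\<in>J. u ` dyadic_ivl m j \<subseteq> A) \<longrightarrow>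
            (\<Sum>j\<in>J. measure lborel (u ` dyadic_ivl m j)) \<le> \<kappa>)"
proof (cases "E = {}")
  case True
  have "J = {}" if "\<forall>j\<in>J. u ` dyadic_ivl m j \<subseteq> {}" for J m
    using that by (auto simp: dyadic_ivl_def divide_right_mono)
  then show ?thesis using True \<kappa> by (intro exI[of _ "{}"]) (metis (no_types) image_empty less_imp_le open_empty order_refl sum.empty)
next
  case False
  define K where "K = u ` E"
  have K: "compact K" "K \<noteq> {}" unfolding K_def
    using E False lip_cont by (auto intro: compact_continuous_image continuous_on_subset)
  define \<nu> where "\<nu> = density lborel (indicatrix u)"
  have sets\<nu>: "sets \<nu> = sets borel" by (simp add: \<nu>_def)
  have em\<nu>: "emeasure \<nu> A = (\<integral>\<^sup>+ x. indicatrix u x * indicator A x \<partial>lborel)" if "A \<in> sets borel" for A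
    unfolding \<nu>_def using that by (intro emeasure_density) auto
  define A where "A = (\<lambda>k::nat. {x. infdist x K < 1 / Suc k})"
  have opA: "open (A k)" for k
    unfolding A_def by (intro open_Collect_less continuous_intros)
  have KA: "K \<subseteq> A k" for k by (auto simp: A_def)
  have dec: "decseq A" unfolding decseq_def A_def by (auto intro: less_le_trans simp: frac_le)
  have Int: "(\<Inter>k. A k) = K"
  proof (intro equalityI subsetI)
    fix x assume x: "x \<in> (\<Inter>k. A k)"
    have "infdist x K \<le> 0"
    proof (rule field_le_epsilon)
      fix e :: real assume "e > 0"
      then obtain k where "1 / Suc k < e" using nat_approx_posE by metis
      moreover have "x \<in> A k" using x by blast
      ultimately show "infdist x K \<le> 0 + e" by (simp add: A_def)
    qed
    then show "x \<in> K" using K in_closed_iff_infdist_zero[of K x] infdist_nonneg[of x K] compact_imp_closed by force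
  qed (use KA in blast)
  have fin: "emeasure \<nu> B \<noteq> \<infinity>" for B
  proof (cases "B \<in> sets borel")
    case True
    have "emeasure \<nu> B \<le> (\<integral>\<^sup>+ x. indicatrix u x \<partial>lborel)"
      unfolding em\<nu>[OF True] by (intro nn_integral_mono) (auto simp: indicator_def)
    then show ?thesis using nn_integral_indicatrix by (auto simp: top_unique)
  qed (simp add: emeasure_notin_sets sets\<nu>)
  have "K \<in> null_sets lborel"
    using E(3) K unfolding K_def[symmetric] by (simp add: negligible_iff_null_sets null_sets_completion_iff borel_compact)
  then have "emeasure \<nu> K = 0"
    unfolding em\<nu>[OF borel_compact[OF K(1)]] by (intro nn_integral_null_set[THEN trans]) auto
  moreover have "(\<lambda>k. emeasure \<nu> (A k)) \<longlonglongrightarrow> emeasure \<nu> (\<Inter>k. A k)"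
    using fin dec opA by (intro Lim_emeasure_decseq) (auto simp: sets\<nu>)
  ultimately have "(\<lambda>k. emeasure \<nu> (A k)) \<longlonglongrightarrow> 0" by (simp only: Int)
  then have "\<forall>\<^sub>F k in sequentially. emeasure \<nu> (A k) < ennreal \<kappa>"
    using \<kappa> by (intro order_tendstoD) auto
  from eventually_happens'[OF sequentially_bot this] obtain k where k: "emeasure \<nu> (A k) < ennreal \<kappa>" ..
  have "(\<Sum>j\<in>J. measure lborel (u ` dyadic_ivl m j)) \<le> \<kappa>"
    if J: "J \<subseteq> {..<2 ^ m}" "\<forall>j\<in>J. u ` dyadic_ivl m j \<subseteq> A k" for m J
  proof -
    have finJ: "finite J" using J(1) by (rule finite_subset) simp
    have bor: "u ` dyadic_ivl m j \<in> sets lborel" if "j \<in> J" for j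
      using that J(1) by (auto intro: borel_compact compact_dyadic_image)
    have "ennreal (\<Sum>j\<in>J. measure lborel (u ` dyadic_ivl m j)) = (\<Sum>j\<in>J. ennreal (measure lborel (u ` dyadic_ivl m j)))"
      by (intro sum_ennreal[symmetric]) simp
    also have "\<dots> = (\<Sum>j\<in>J. emeasure lborel (u ` dyadic_ivl m j))"
    proof (intro sum.cong refl emeasure_eq_ennreal_measure[symmetric])
      fix j assume "j \<in> J"
      then have "j < 2 ^ m" using J by auto
      then show "emeasure lborel (u ` dyadic_ivl m j) \<noteq> top" using emeasure_dyadic_image[of j m] by (auto simp: top_unique)
    qed
    also have "\<dots> = (\<Sum>j\<in>J. \<integral>\<^sup>+ x. indicator (u ` dyadic_ivl m j) x \<partial>lborel)"
      using bor by (intro sum.cong refl nn_integral_indicator[symmetric])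
    also have "\<dots> = (\<integral>\<^sup>+ x. (\<Sum>j\<in>J. indicator (u ` dyadic_ivl m j) x) \<partial>lborel)"
      using bor by (intro nn_integral_sum[symmetric] borel_measurable_indicator)
    also have "\<dots> \<le> (\<integral>\<^sup>+ x. indicatrix u x * indicator (A k) x \<partial>lborel)"
    proof (rule nn_integral_mono)
      fix x
      show "(\<Sum>j\<in>J. indicator (u ` dyadic_ivl m j) x) \<le> indicatrix u x * indicator (A k) x"
      proof (cases "x \<in> A k")
        case True
        have "(\<Sum>j\<in>J. indicator (u ` dyadic_ivl m j) x) \<le> dyadic_hits u m x"
          unfolding dyadic_hits_def using J by (intro sum_mono2) auto
        also have "\<dots> \<le> indicatrix u x" unfolding indicatrix_def by (rule SUP_upper) simp
        finally show ?thesis using True by simp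
      next
        case False
        have "(\<Sum>j\<in>J. indicator (u ` dyadic_ivl m j) x) = (0::ennreal)"
          using False J(2) by (intro sum.neutral) (auto simp: indicator_def)
        then show ?thesis by simp
      qed
    qed
    also have "\<dots> = emeasure \<nu> (A k)" using em\<nu>[of "A k"] opA by (simp add: borel_open)
    also have "\<dots> \<le> ennreal \<kappa>" using k by simp
    finally show ?thesis using \<kappa> by (simp add: ennreal_le_iff)
  qed
  then show ?thesis
    by (intro exI[of _ "A k"] conjI opA KA[of k, unfolded K_def] allI impI; elim conjE)
qed

end

text \<open>A local maximum value is the supremum of \<open>u\<close> over some interval with
  rational endpoints, and there are only countably many of these intervals. The maxima need not be
  strict, so the set of maximum points may be uncountable.\<close>

lemma countable_local_max_values:
  fixes u :: "real \<Rightarrow> real"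
  shows "countable {u t | t. \<exists>a b. a < t \<and> t < b \<and> (\<forall>s\<in>{a..b}. u s \<le> u t)}" (is "countable ?V")
proof (rule countable_subset)
  show "?V \<subseteq> (\<lambda>(a,b). Sup (u ` {of_rat a..of_rat b})) ` (UNIV :: (rat \<times> rat) set)"
  proof clarify
    fix t a b :: real assume t: "a < t" "t < b" "\<forall>s\<in>{a..b}. u s \<le> u t"
    obtain a' b' where ab: "a < real_of_rat a'" "real_of_rat a' < t" "t < real_of_rat b'" "real_of_rat b' < b"
      using of_rat_dense[OF t(1)] of_rat_dense[OF t(2)] by blast
    have "Sup (u ` {of_rat a'..of_rat b'}) = u t"
      using ab t by (intro cSup_eq_maximum) auto
    then show "u t \<in> (\<lambda>(a,b). Sup (u ` {of_rat a..of_rat b})) ` (UNIV :: (rat \<times> rat) set)"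
      by (intro image_eqI[of _ _ "(a',b')"]) auto
  qed
qed simp

lemma countable_local_min_values:
  fixes u :: "real \<Rightarrow> real"
  shows "countable {u t | t. \<exists>a b. a < t \<and> t < b \<and> (\<forall>s\<in>{a..b}. u t \<le> u s)}" (is "countable ?V")
proof -
  let ?W = "{- u t | t. \<exists>a b. a < t \<and> t < b \<and> (\<forall>s\<in>{a..b}. - u s \<le> - u t)}"
  have "?V \<subseteq> uminus ` ?W"
  proof clarify
    fix t a b :: real assume "a < t" "t < b" "\<forall>s\<in>{a..b}. u t \<le> u s"
    then have "- u t \<in> ?W" by auto
    then show "u t \<in> uminus ` ?W" by (intro image_eqI[of _ _ "- u t"]) simp_all
  qed
  then show ?thesis by (rule countable_subset) (intro countable_image countable_local_max_values)
qed

subsection \<open>Null sets of one-dimensional Hausdorff measure\<close>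

lemma hausdorff1_zero_iff:
  "hausdorff1 A = 0 \<longleftrightarrow> (\<forall>\<delta>>0. \<forall>\<kappa>>0. \<exists>U :: nat \<Rightarrow> _. A \<subseteq> (\<Union>i. U i) \<and> (\<forall>i. bounded (U i) \<and> diameter (U i) \<le> \<delta>) \<and>
     (\<Sum>i. ennreal (diameter (U i))) \<le> ennreal \<kappa>)" (is "_ \<longleftrightarrow> ?R")
proof
  assume 0: "hausdorff1 A = 0"
  show ?R
  proof (intro allI impI)
    fix \<delta> \<kappa> :: real assume "\<delta> > 0" "\<kappa> > 0"
    have "hausdorff1_pre \<delta> A \<le> hausdorff1 A" unfolding hausdorff1_def using \<open>\<delta> > 0\<close> by (intro SUP_upper) auto
    then have "hausdorff1_pre \<delta> A < ennreal \<kappa>" using 0 \<open>\<kappa> > 0\<close> by simp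
    then obtain U where "U \<in> {U :: nat \<Rightarrow> _. A \<subseteq> (\<Union>i. U i) \<and> (\<forall>i. bounded (U i) \<and> diameter (U i) \<le> \<delta>)}"
       "(\<Sum>i. ennreal (diameter (U i))) < ennreal \<kappa>"
      unfolding hausdorff1_pre_def INF_less_iff by blast
    then show "\<exists>U :: nat \<Rightarrow> _. A \<subseteq> (\<Union>i. U i) \<and> (\<forall>i. bounded (U i) \<and> diameter (U i) \<le> \<delta>) \<and>
     (\<Sum>i. ennreal (diameter (U i))) \<le> ennreal \<kappa>"
      by (intro exI[of _ U]) (simp add: less_imp_le)
  qed
next
  assume R: ?R
  have "hausdorff1_pre \<delta> A \<le> 0" if "\<delta> > 0" for \<delta>
  proof (rule ennreal_le_epsilon)
    fix \<kappa> :: real assume "\<kappa> > 0"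
    with R \<open>\<delta> > 0\<close> obtain U :: "nat \<Rightarrow> _" where U: "A \<subseteq> (\<Union>i. U i)" "\<forall>i. bounded (U i) \<and> diameter (U i) \<le> \<delta>"
       "(\<Sum>i. ennreal (diameter (U i))) \<le> ennreal \<kappa>" by blast
    have "hausdorff1_pre \<delta> A \<le> (\<Sum>i. ennreal (diameter (U i)))"
      unfolding hausdorff1_pre_def using U(1,2) by (intro INF_lower) simp
    then show "hausdorff1_pre \<delta> A \<le> 0 + ennreal \<kappa>" using U(3) by simp
  qed
  then have "hausdorff1 A \<le> 0" unfolding hausdorff1_def by (intro SUP_least) auto
  then show "hausdorff1 A = 0" by simp
qed

lemma hausdorff1_mono: "A \<subseteq> B \<Longrightarrow> hausdorff1 A \<le> hausdorff1 B"
  unfolding hausdorff1_def hausdorff1_pre_def by (intro SUP_mono' INF_superset_mono) auto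

lemma hausdorff1_zero_Un:
  assumes "hausdorff1 A = 0" "hausdorff1 B = 0"
  shows "hausdorff1 (A \<union> B) = 0"
  unfolding hausdorff1_zero_iff
proof (intro allI impI)
  fix \<delta> \<kappa> :: real assume \<delta>: "\<delta> > 0" and \<kappa>: "\<kappa> > 0"
  then have "\<kappa>/2 > 0" by simp
  obtain V :: "nat \<Rightarrow> _" where V: "A \<subseteq> (\<Union>i. V i)" "\<forall>i. bounded (V i) \<and> diameter (V i) \<le> \<delta>"
       "(\<Sum>i. ennreal (diameter (V i))) \<le> ennreal (\<kappa>/2)"
    using assms(1)[unfolded hausdorff1_zero_iff, rule_format, OF \<delta> \<open>\<kappa>/2 > 0\<close>] by blast
  obtain W :: "nat \<Rightarrow> _" where W: "B \<subseteq> (\<Union>i. W i)" "\<forall>i. bounded (W i) \<and> diameter (W i) \<le> \<delta>"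
       "(\<Sum>i. ennreal (diameter (W i))) \<le> ennreal (\<kappa>/2)"
    using assms(2)[unfolded hausdorff1_zero_iff, rule_format, OF \<delta> \<open>\<kappa>/2 > 0\<close>] by blast
  define U where "U = (\<lambda>i. if even i then V (i div 2) else W (i div 2))"
  have UV: "U (2 * i) = V i" and UW: "U (Suc (2 * i)) = W i" for i by (auto simp: U_def)
  let ?d = "\<lambda>X. ennreal (diameter X)"
  have part: "(\<Sum>i<2*n. ?d (U i)) = (\<Sum>i<n. ?d (V i)) + (\<Sum>i<n. ?d (W i))" for n
    by (induction n) (auto simp: UV UW add_ac)
  have "(\<Sum>i. ?d (U i)) \<le> ennreal \<kappa>"
    unfolding suminf_eq_SUP
  proof (rule SUP_least)
    fix n
    have "(\<Sum>i<n. ?d (U i)) \<le> (\<Sum>i<2*n. ?d (U i))" by (intro sum_mono2) auto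
    also have "\<dots> \<le> (\<Sum>i. ?d (V i)) + (\<Sum>i. ?d (W i))"
      unfolding part by (intro add_mono sum_le_suminf) auto
    also have "\<dots> \<le> ennreal (\<kappa>/2) + ennreal (\<kappa>/2)" by (intro add_mono V(3) W(3))
    also have "\<dots> = ennreal \<kappa>" using \<kappa> by (simp flip: ennreal_plus)
    finally show "(\<Sum>i<n. ?d (U i)) \<le> ennreal \<kappa>" .
  qed
  moreover have "A \<union> B \<subseteq> (\<Union>i. U i)"
  proof
    fix x assume "x \<in> A \<union> B"
    then obtain i where "x \<in> V i \<or> x \<in> W i" using V(1) W(1) by blast
    then have "x \<in> U (2 * i) \<or> x \<in> U (Suc (2 * i))" by (simp only: UV UW)
    then show "x \<in> (\<Union>i. U i)" by blast
  qed
  moreover have "\<forall>i. bounded (U i) \<and> diameter (U i) \<le> \<delta>" using V(2) W(2) by (simp add: U_def)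
  ultimately show "\<exists>U :: nat \<Rightarrow> _. A \<union> B \<subseteq> (\<Union>i. U i) \<and> (\<forall>i. bounded (U i) \<and> diameter (U i) \<le> \<delta>) \<and>
     (\<Sum>i. ennreal (diameter (U i))) \<le> ennreal \<kappa>" by blast
qed

lemma hausdorff1_countable:
  assumes "countable A" shows "hausdorff1 A = 0"
  unfolding hausdorff1_zero_iff
proof (intro allI impI)
  fix \<delta> \<kappa> :: real assume "\<delta> > 0" "\<kappa> > 0"
  then show "\<exists>U :: nat \<Rightarrow> _. A \<subseteq> (\<Union>i. U i) \<and> (\<forall>i. bounded (U i) \<and> diameter (U i) \<le> \<delta>) \<and>
     (\<Sum>i. ennreal (diameter (U i))) \<le> ennreal \<kappa>"
    using subset_range_from_nat_into[OF assms]
    by (intro exI[of _ "\<lambda>i. {from_nat_into A i}"]) auto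
qed

lemma hausdorff1_zero_lipschitz_image:
  fixes f :: "'a::metric_space \<Rightarrow> 'b::metric_space"
  assumes A: "hausdorff1 A = 0" and C: "C > 0"
    and lip: "\<And>x y. x \<in> A \<Longrightarrow> y \<in> A \<Longrightarrow> dist (f x) (f y) \<le> C * dist x y"
  shows "hausdorff1 (f ` A) = 0"
  unfolding hausdorff1_zero_iff
proof (intro allI impI)
  fix \<delta> \<kappa> :: real assume \<delta>: "\<delta> > 0" and \<kappa>: "\<kappa> > 0"
  then have "\<delta> / C > 0" "\<kappa> / C > 0" using C by auto
  from A[unfolded hausdorff1_zero_iff, rule_format, OF this]
  obtain V :: "nat \<Rightarrow> _" where V: "A \<subseteq> (\<Union>i. V i)" "\<And>i. bounded (V i)" "\<And>i. diameter (V i) \<le> \<delta> / C"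
       "(\<Sum>i. ennreal (diameter (V i))) \<le> ennreal (\<kappa> / C)" by blast
  \<comment> \<open>The covering sets may reach beyond \<open>A\<close>, where no Lipschitz bound is
    available.\<close>
  define U where "U = (\<lambda>i. f ` (V i \<inter> A))"
  have d: "dist x y \<le> C * diameter (V i)" if "x \<in> U i" "y \<in> U i" for x y i
  proof -
    obtain a b where ab: "a \<in> V i" "a \<in> A" "b \<in> V i" "b \<in> A" "x = f a" "y = f b"
      using \<open>x \<in> U i\<close> \<open>y \<in> U i\<close> unfolding U_def by blast
    have "dist x y \<le> C * dist a b" using lip ab by simp
    also have "\<dots> \<le> C * diameter (V i)"
      using diameter_bounded_bound[OF V(2) ab(1,3)] C by (intro mult_left_mono) auto
    finally show ?thesis .
  qed
  have dV: "diameter (V i) \<ge> 0" for i by (rule diameter_ge_0[OF V(2)])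
  have dU: "diameter (U i) \<le> C * diameter (V i)" for i
  proof (cases "U i = {}")
    case True
    then show ?thesis using dV C by simp
  next
    case False
    have "(SUP (x,y)\<in>U i \<times> U i. dist x y) \<le> C * diameter (V i)"
      using d False by (intro cSUP_least) auto
    then show ?thesis using False by (simp add: diameter_def)
  qed
  have "bounded (U i)" for i
    unfolding bounded_two_points using d by blast
  moreover have "diameter (U i) \<le> \<delta>" for i
  proof -
    have "C * diameter (V i) \<le> C * (\<delta> / C)" using V(3) C by (intro mult_left_mono) auto
    then show ?thesis using dU[of i] C by simp
  qed
  moreover have "f ` A \<subseteq> (\<Union>i. U i)" using V(1) unfolding U_def by blast
  moreover have "(\<Sum>i. ennreal (diameter (U i))) \<le> ennreal \<kappa>"
  proof -
    have "(\<Sum>i. ennreal (diameter (U i))) \<le> (\<Sum>i. ennreal C * ennreal (diameter (V i)))"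
      using dU C dV by (intro suminf_le) (auto simp flip: ennreal_mult intro!: ennreal_leI)
    also have "\<dots> = ennreal C * (\<Sum>i. ennreal (diameter (V i)))" by simp
    also have "\<dots> \<le> ennreal C * ennreal (\<kappa> / C)" by (intro mult_left_mono V(4)) simp
    also have "\<dots> = ennreal \<kappa>" using C \<kappa> by (simp flip: ennreal_mult)
    finally show ?thesis .
  qed
  ultimately show "\<exists>U :: nat \<Rightarrow> _. f ` A \<subseteq> (\<Union>i. U i) \<and> (\<forall>i. bounded (U i) \<and> diameter (U i) \<le> \<delta>) \<and>
     (\<Sum>i. ennreal (diameter (U i))) \<le> ennreal \<kappa>" by blast
qed

text \<open>For general sets two null projections do not suffice: the product of two Cantor sets of
  ratio \<open>1/4\<close> is a counterexample. On a curve, a short arc is connected, so its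
  diameter is at most the sum of the lengths of its two projections. The arcs that meet
  \<open>E\<close> have projections in small neighbourhoods of the null sets, and
  \<open>null_image_cover\<close> bounds the sum of these lengths with multiplicity.\<close>

lemma hausdorff1_null_projections:
  fixes \<gamma> :: "real \<Rightarrow> complex"
  assumes L: "L > 0" and lip: "\<And>s t. s \<in> {0..1} \<Longrightarrow> t \<in> {0..1} \<Longrightarrow> dist (\<gamma> s) (\<gamma> t) \<le> L * \<bar>s - t\<bar>"
    and E: "compact E" "E \<subseteq> {0..1}" and null: "negligible ((\<lambda>t. Re (\<gamma> t)) ` E)" "negligible ((\<lambda>t. Im (\<gamma> t)) ` E)"
  shows "hausdorff1 (\<gamma> ` E) = 0"
  unfolding hausdorff1_zero_iff
proof (intro allI impI)
  fix \<delta> \<kappa> :: real assume \<delta>: "\<delta> > 0" and \<kappa>: "\<kappa> > 0"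
  let ?I = dyadic_ivl
  have lipRe: "\<bar>Re (\<gamma> s) - Re (\<gamma> t)\<bar> \<le> L * \<bar>s - t\<bar>" and lipIm: "\<bar>Im (\<gamma> s) - Im (\<gamma> t)\<bar> \<le> L * \<bar>s - t\<bar>"
    if "s \<in> {0..1}" "t \<in> {0..1}" for s t
    using lip[OF that] abs_Re_le_cmod[of "\<gamma> s - \<gamma> t"] abs_Im_le_cmod[of "\<gamma> s - \<gamma> t"] by (auto simp: dist_norm)
  define small where "small = (\<lambda>(u::real \<Rightarrow> real) A. \<forall>m J. J \<subseteq> {..<2 ^ m} \<and> (\<forall>j\<in>J. u ` ?I m j \<subseteq> A) \<longrightarrow>
            (\<Sum>j\<in>J. measure lborel (u ` ?I m j)) \<le> \<kappa>/2)"
  define near where "near = (\<lambda>(u::real \<Rightarrow> real) A \<sigma>. \<forall>s\<in>E. \<forall>t\<in>{0..1}. \<bar>s - t\<bar> \<le> \<sigma> \<longrightarrow> u t \<in> A)"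
  have key: "\<exists>A \<sigma>. \<sigma> > 0 \<and> small u A \<and> near u A \<sigma>"
    if u: "\<And>s t. s \<in> {0..1} \<Longrightarrow> t \<in> {0..1} \<Longrightarrow> \<bar>u s - u t\<bar> \<le> L * \<bar>s - t\<bar>" and neg: "negligible (u ` E)" for u :: "real \<Rightarrow> real"
  proof -
    have "\<kappa>/2 > 0" using \<kappa> by simp
    from null_image_cover[OF L u E neg this]
    obtain A where A: "open A" "u ` E \<subseteq> A" "\<forall>m J. J \<subseteq> {..<2 ^ m} \<and> (\<forall>j\<in>J. u ` ?I m j \<subseteq> A) \<longrightarrow>
            (\<Sum>j\<in>J. measure lborel (u ` ?I m j)) \<le> \<kappa>/2" by blast
    have "continuous_on {0..1} u" by (rule lip_cont[OF L u])
    then have "compact (u ` E)" using E by (intro compact_continuous_image) (auto intro: continuous_on_subset)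
    from compact_subset_open_imp_cball_epsilon_subset[OF this A(1,2)]
    obtain e where e: "e > 0" "(\<Union>x\<in>u ` E. cball x e) \<subseteq> A" .
    have "u t \<in> A" if "s \<in> E" "t \<in> {0..1}" "\<bar>s - t\<bar> \<le> e / L" for s t
    proof -
      have "\<bar>u s - u t\<bar> \<le> L * \<bar>s - t\<bar>" using u that E by auto
      also have "\<dots> \<le> L * (e / L)" using that L by (intro mult_left_mono) auto
      finally have "u t \<in> cball (u s) e" using L by (simp add: dist_real_def)
      then show ?thesis using e(2) that(1) by blast
    qed
    moreover have "e / L > 0" using e(1) L by simp
    ultimately show ?thesis using A(3) unfolding small_def near_def
      by (intro exI[of _ A] exI[of _ "e / L"] conjI ballI impI)
  qed
  from key[OF lipRe null(1)] obtain A \<sigma> where A0: "\<sigma> > 0" "small (\<lambda>t. Re (\<gamma> t)) A" "near (\<lambda>t. Re (\<gamma> t)) A \<sigma>" by blast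
  note A = A0(1) A0(2)[unfolded small_def, rule_format, OF conjI] A0(3)[unfolded near_def, rule_format]
  from key[OF lipIm null(2)] obtain B \<tau> where B0: "\<tau> > 0" "small (\<lambda>t. Im (\<gamma> t)) B" "near (\<lambda>t. Im (\<gamma> t)) B \<tau>" by blast
  note B = B0(1) B0(2)[unfolded small_def, rule_format, OF conjI] B0(3)[unfolded near_def, rule_format]
  define r where "r = min (min \<sigma> \<tau>) (\<delta> / L)"
  have "r > 0" using A(1) B(1) \<delta> L by (simp add: r_def)
  then obtain m where m': "(1/2) ^ m < r" using real_arch_pow_inv[of r "1/2"] by auto
  have m: "1 / 2 ^ m \<le> \<sigma>" "1 / 2 ^ m \<le> \<tau>" "L * (1 / 2 ^ m) \<le> \<delta>"
    using m' L by (auto simp: r_def power_divide field_simps)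
  define J where "J = {j. j < 2 ^ m \<and> ?I m j \<inter> E \<noteq> {}}"
  define U where "U = (\<lambda>j. if j \<in> J then \<gamma> ` ?I m j else {})"
  have Jsub: "J \<subseteq> {..<2 ^ m}" by (auto simp: J_def)
  have JA: "(\<lambda>t. Re (\<gamma> t)) ` ?I m j \<subseteq> A" "(\<lambda>t. Im (\<gamma> t)) ` ?I m j \<subseteq> B" if "j \<in> J" for j
  proof -
    obtain s where s: "s \<in> ?I m j" "s \<in> E" "j < 2 ^ m" using \<open>j \<in> J\<close> by (auto simp: J_def)
    have "\<bar>s - t\<bar> \<le> \<sigma>" "\<bar>s - t\<bar> \<le> \<tau>" "t \<in> {0..1}" if "t \<in> ?I m j" for t
      using dyadic_ivl_dist[OF s(1) that] m dyadic_ivl_subset[OF s(3)] that by auto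
    then show "(\<lambda>t. Re (\<gamma> t)) ` ?I m j \<subseteq> A" "(\<lambda>t. Im (\<gamma> t)) ` ?I m j \<subseteq> B"
      using A(3)[OF s(2)] B(3)[OF s(2)] by auto
  qed
  have diamd: "dist (\<gamma> s) (\<gamma> t) \<le> \<delta>" if "s \<in> ?I m j" "t \<in> ?I m j" "j \<in> J" for s t j
  proof -
    have "j < 2 ^ m" using \<open>j \<in> J\<close> by (simp add: J_def)
    then have "dist (\<gamma> s) (\<gamma> t) \<le> L * \<bar>s - t\<bar>" using that dyadic_ivl_subset[of j m] by (intro lip) auto
    also have "\<dots> \<le> L * (1 / 2 ^ m)" using dyadic_ivl_dist[OF that(1,2)] L by (intro mult_left_mono) auto
    finally show ?thesis using m(3) by simp
  qed
  \<comment> \<open>The image of an interval is connected and contains the whole segment between two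
    of its values, so its measure dominates the oscillation.\<close>
  have var: "\<bar>u s - u t\<bar> \<le> measure lborel (u ` ?I m j)"
    if u: "\<And>s t. s \<in> {0..1} \<Longrightarrow> t \<in> {0..1} \<Longrightarrow> \<bar>u s - u t\<bar> \<le> L * \<bar>s - t\<bar>" and st: "s \<in> ?I m j" "t \<in> ?I m j" and j: "j \<in> J"
    for u :: "real \<Rightarrow> real" and s t j
  proof -
    have j': "j < 2 ^ m" using j Jsub by auto
    have cont: "continuous_on (?I m j) u" using lip_cont[OF L u] dyadic_ivl_subset[OF j'] continuous_on_subset by blast
    have "connected (u ` ?I m j)"
      by (intro connected_continuous_image[OF cont]) (simp add: dyadic_ivl_def)
    then have "closed_segment (u s) (u t) \<subseteq> u ` ?I m j"
      using st by (intro closed_segment_subset) (auto simp: is_interval_connected_1 is_interval_convex)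
    moreover have "u ` ?I m j \<in> fmeasurable lborel"
    proof (rule fmeasurableI)
      show "u ` ?I m j \<in> sets lborel" using compact_dyadic_image[OF L u j'] by (auto intro: borel_compact)
      show "emeasure lborel (u ` ?I m j) < \<infinity>" using emeasure_dyadic_image[OF L u j'] by (simp add: le_less_trans)
    qed
    moreover have "closed_segment (u s) (u t) \<in> sets lborel" by (simp add: closed_segment_eq_real_ivl)
    ultimately have "measure lborel (closed_segment (u s) (u t)) \<le> measure lborel (u ` ?I m j)"
      by (intro measure_mono_fmeasurable)
    then show ?thesis by (auto simp: closed_segment_eq_real_ivl abs_real_def split: if_splits)
  qed
  have dU: "diameter (U j) \<le> measure lborel ((\<lambda>t. Re (\<gamma> t)) ` ?I m j) + measure lborel ((\<lambda>t. Im (\<gamma> t)) ` ?I m j)"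
    if j: "j \<in> J" for j
    using j unfolding U_def
  proof (simp, intro diameter_le)
    fix x y assume "x \<in> \<gamma> ` ?I m j" "y \<in> \<gamma> ` ?I m j"
    then obtain s t where st: "s \<in> ?I m j" "t \<in> ?I m j" "x = \<gamma> s" "y = \<gamma> t" by auto
    have "norm (x - y) \<le> \<bar>Re (\<gamma> s) - Re (\<gamma> t)\<bar> + \<bar>Im (\<gamma> s) - Im (\<gamma> t)\<bar>"
      using cmod_le[of "x - y"] st by simp
    then show "norm (x - y) \<le> measure lborel ((\<lambda>t. Re (\<gamma> t)) ` ?I m j) + measure lborel ((\<lambda>t. Im (\<gamma> t)) ` ?I m j)"
      using var[OF lipRe st(1,2) j] var[OF lipIm st(1,2) j] by linarith
  qed simp
  have "\<gamma> ` E \<subseteq> (\<Union>i. U i)"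
  proof clarify
    fix t assume t: "t \<in> E"
    then have "t \<in> {0..1}" using E by auto
    then obtain j where "j < 2 ^ m" "t \<in> ?I m j" by (rule dyadic_ivl_cover)
    then show "\<gamma> t \<in> (\<Union>i. U i)" using t by (intro UN_I[of j]) (auto simp: U_def J_def)
  qed
  moreover have "bounded (U i) \<and> diameter (U i) \<le> \<delta>" for i
  proof (cases "i \<in> J")
    case True
    have "\<forall>x\<in>U i. \<forall>y\<in>U i. dist x y \<le> \<delta>" using diamd True by (auto simp: U_def)
    then show ?thesis using \<delta> unfolding bounded_two_points
      by (intro conjI diameter_le exI[of _ \<delta>]) (auto simp: dist_norm)
  qed (use \<delta> in \<open>simp add: U_def\<close>)
  moreover have "(\<Sum>i. ennreal (diameter (U i))) \<le> ennreal \<kappa>"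
  proof -
    have finJ: "finite J" using Jsub by (rule finite_subset) simp
    have "(\<Sum>i. ennreal (diameter (U i))) = (\<Sum>i\<in>J. ennreal (diameter (U i)))"
      using finJ by (intro suminf_finite) (auto simp: U_def)
    also have "\<dots> \<le> (\<Sum>j\<in>J. ennreal (measure lborel ((\<lambda>t. Re (\<gamma> t)) ` ?I m j) + measure lborel ((\<lambda>t. Im (\<gamma> t)) ` ?I m j)))"
      using dU by (intro sum_mono ennreal_leI)
    also have "\<dots> = ennreal (\<Sum>j\<in>J. measure lborel ((\<lambda>t. Re (\<gamma> t)) ` ?I m j) + measure lborel ((\<lambda>t. Im (\<gamma> t)) ` ?I m j))"
      by (intro sum_ennreal) simp
    also have "\<dots> \<le> ennreal \<kappa>"
      using A(2)[OF Jsub] B(2)[OF Jsub] JA by (intro ennreal_leI) (simp add: sum.distrib)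
    finally show ?thesis .
  qed
  ultimately show "\<exists>U :: nat \<Rightarrow> _. \<gamma> ` E \<subseteq> (\<Union>i. U i) \<and> (\<forall>i. bounded (U i) \<and> diameter (U i) \<le> \<delta>) \<and>
     (\<Sum>i. ennreal (diameter (U i))) \<le> ennreal \<kappa>" by blast
qed

subsection \<open>Boundary zeros of holomorphic functions in a Jordan domain\<close>

lemma constant_sign_left:
  fixes u :: "real \<Rightarrow> real"
  assumes u: "continuous_on {a..<b} u" "a < b" and ne: "\<And>t. a \<le> t \<Longrightarrow> t < b \<Longrightarrow> u t \<noteq> x"
  shows "(\<forall>t\<in>{a..<b}. u t < x) \<or> (\<forall>t\<in>{a..<b}. x < u t)"
proof (rule ccontr)
  assume "\<not> ?thesis"
  then obtain s t where st: "s \<in> {a..<b}" "t \<in> {a..<b}" "x \<le> u s" "u t \<le> x" by force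
  have "connected (u ` {a..<b})" by (intro connected_continuous_image u(1)) (simp add: is_interval_connected_1[symmetric] is_interval_co)
  then have "x \<in> u ` {a..<b}" using st connectedD_interval[of "u ` {a..<b}" "u t" "u s" x] by blast
  then show False using ne by (metis atLeastLessThan_iff imageE)
qed

lemma constant_sign_right:
  fixes u :: "real \<Rightarrow> real"
  assumes u: "continuous_on {a<..b} u" "a < b" and ne: "\<And>t. a < t \<Longrightarrow> t \<le> b \<Longrightarrow> u t \<noteq> x"
  shows "(\<forall>t\<in>{a<..b}. u t < x) \<or> (\<forall>t\<in>{a<..b}. x < u t)"
proof (rule ccontr)
  assume "\<not> ?thesis"
  then obtain s t where st: "s \<in> {a<..b}" "t \<in> {a<..b}" "x \<le> u s" "u t \<le> x" by force
  have "connected (u ` {a<..b})" by (intro connected_continuous_image u(1)) (simp add: is_interval_connected_1[symmetric] is_interval_oc)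
  then have "x \<in> u ` {a<..b}" using st connectedD_interval[of "u ` {a<..b}" "u t" "u s" x] by blast
  then show False using ne by (metis greaterThanAtMost_iff imageE)
qed

text \<open>A finite fibre isolates \<open>t0\<close>, so
  \<open>Re (\<gamma> t) - Re (\<gamma> t0)\<close> has a constant sign on each side of it. Equal
  signs would make the value a local extremum, so the curve passes from one side of the vertical
  line to the other; a passage from right to left is treated by reversing the path. The height
  \<open>e\<close> stays below the distance to the other points of the curve on the line.\<close>

lemma crossing_at_isolated_point:
  fixes \<gamma> :: "real \<Rightarrow> complex"
  assumes \<gamma>: "simple_path \<gamma>" "pathfinish \<gamma> = pathstart \<gamma>" and t0: "0 < t0" "t0 < 1"
    and fin: "finite {t\<in>{0..1}. Re (\<gamma> t) = Re (\<gamma> t0)}"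
    and nmax: "Re (\<gamma> t0) \<notin> {Re (\<gamma> t) | t. \<exists>a b. a < t \<and> t < b \<and> (\<forall>s\<in>{a..b}. Re (\<gamma> s) \<le> Re (\<gamma> t))}"
    and nmin: "Re (\<gamma> t0) \<notin> {Re (\<gamma> t) | t. \<exists>a b. a < t \<and> t < b \<and> (\<forall>s\<in>{a..b}. Re (\<gamma> t) \<le> Re (\<gamma> s))}"
  shows "\<exists>e>0. (\<forall>t\<in>{0..1}. Re (\<gamma> t) = Re (\<gamma> t0) \<longrightarrow> \<bar>Im (\<gamma> t) - Im (\<gamma> t0)\<bar> \<le> e \<longrightarrow> t = t0) \<and>
     (\<gamma> t0 + \<i> * of_real e \<in> inside (path_image \<gamma>)) \<noteq> (\<gamma> t0 - \<i> * of_real e \<in> inside (path_image \<gamma>))"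
proof -
  define x where "x = Re (\<gamma> t0)"
  define F where "F = {t\<in>{0..1}. Re (\<gamma> t) = x}"
  have F: "finite F" using fin by (simp add: F_def x_def)
  have cont: "continuous_on {0..1} (\<lambda>t. Re (\<gamma> t))"
    using simple_path_imp_path[OF \<gamma>(1)] by (auto simp: path_def intro!: continuous_intros)
  obtain d where d: "d > 0" "\<And>t. t \<in> F \<Longrightarrow> t \<noteq> t0 \<Longrightarrow> d \<le> dist t0 t"
    using finite_set_avoid[OF F, of t0] by auto
  define r where "r = min (d/2) (min t0 (1 - t0) / 2)"
  have r: "r > 0" "r < d" "0 \<le> t0 - r" "t0 + r \<le> 1" using d(1) t0 by (auto simp: r_def min_def field_simps)
  define t1 where "t1 = t0 - r"
  define t2 where "t2 = t0 + r"
  have t12: "0 \<le> t1" "t1 < t0" "t0 < t2" "t2 \<le> 1" using r by (auto simp: t1_def t2_def)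
  have ne: "Re (\<gamma> t) \<noteq> x" if "t \<in> {t1..t2}" "t \<noteq> t0" for t
  proof
    assume "Re (\<gamma> t) = x"
    then have "t \<in> F" using that t12 by (auto simp: F_def)
    then have "d \<le> dist t0 t" using d(2) that by blast
    then show False using that r by (auto simp: t1_def t2_def dist_real_def)
  qed
  have left: "(\<forall>t\<in>{t1..<t0}. Re (\<gamma> t) < x) \<or> (\<forall>t\<in>{t1..<t0}. x < Re (\<gamma> t))"
    using ne t12 by (intro constant_sign_left continuous_on_subset[OF cont]) auto
  have right: "(\<forall>t\<in>{t0<..t2}. Re (\<gamma> t) < x) \<or> (\<forall>t\<in>{t0<..t2}. x < Re (\<gamma> t))"
    using ne t12 by (intro constant_sign_right continuous_on_subset[OF cont]) auto
  have notmax: "\<not> ((\<forall>t\<in>{t1..<t0}. Re (\<gamma> t) < x) \<and> (\<forall>t\<in>{t0<..t2}. Re (\<gamma> t) < x))"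
  proof
    assume *: "(\<forall>t\<in>{t1..<t0}. Re (\<gamma> t) < x) \<and> (\<forall>t\<in>{t0<..t2}. Re (\<gamma> t) < x)"
    have "Re (\<gamma> s) \<le> Re (\<gamma> t0)" if "s \<in> {t1..t2}" for s
      using * that by (cases "s < t0"; cases "s = t0") (auto simp: x_def less_imp_le)
    then show False using nmax t12 by blast
  qed
  have notmin: "\<not> ((\<forall>t\<in>{t1..<t0}. x < Re (\<gamma> t)) \<and> (\<forall>t\<in>{t0<..t2}. x < Re (\<gamma> t)))"
  proof
    assume *: "(\<forall>t\<in>{t1..<t0}. x < Re (\<gamma> t)) \<and> (\<forall>t\<in>{t0<..t2}. x < Re (\<gamma> t))"
    have "Re (\<gamma> t0) \<le> Re (\<gamma> s)" if "s \<in> {t1..t2}" for s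
      using * that by (cases "s < t0"; cases "s = t0") (auto simp: x_def less_imp_le)
    then show False using nmin t12 by blast
  qed
  obtain d' where d': "d' > 0" "\<And>y. y \<in> (\<lambda>t. Im (\<gamma> t)) ` F \<Longrightarrow> y \<noteq> Im (\<gamma> t0) \<Longrightarrow> d' \<le> dist (Im (\<gamma> t0)) y"
    using finite_set_avoid[of "(\<lambda>t. Im (\<gamma> t)) ` F" "Im (\<gamma> t0)"] F by auto
  define e where "e = d' / 2"
  have e: "e > 0" "e < d'" using d' by (auto simp: e_def)
  have uniq: "t = t0" if "t \<in> {0..1}" "Re (\<gamma> t) = Re (\<gamma> t0)" "\<bar>Im (\<gamma> t) - Im (\<gamma> t0)\<bar> \<le> e" for t
  proof -
    have "t \<in> F" using that by (simp add: F_def x_def)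
    have "Im (\<gamma> t) = Im (\<gamma> t0)"
    proof (rule ccontr)
      assume "Im (\<gamma> t) \<noteq> Im (\<gamma> t0)"
      then have "d' \<le> dist (Im (\<gamma> t0)) (Im (\<gamma> t))" using d'(2) \<open>t \<in> F\<close> by blast
      then show False using that(3) e by (simp add: dist_real_def abs_minus_commute)
    qed
    then have "\<gamma> t = \<gamma> t0" using that(2) by (simp add: complex_eq_iff)
    then show ?thesis
      using \<gamma>(1) that(1) t0 unfolding simple_path_def loop_free_def by force
  qed
  have "(\<gamma> t0 + \<i> * of_real e \<in> inside (path_image \<gamma>)) \<noteq> (\<gamma> t0 - \<i> * of_real e \<in> inside (path_image \<gamma>))"
  proof (cases "\<forall>t\<in>{t1..<t0}. Re (\<gamma> t) < x")
    case True
    then have R: "\<forall>t\<in>{t0<..t2}. x < Re (\<gamma> t)" using notmax right by blast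
    show ?thesis
      by (rule crossing_separates[OF \<gamma> t12 _ _ e(1) uniq]) (use True R in \<open>auto simp: x_def\<close>)
  next
    case False
    then have Lf: "\<forall>t\<in>{t1..<t0}. x < Re (\<gamma> t)" using left by blast
    then have R: "\<forall>t\<in>{t0<..t2}. Re (\<gamma> t) < x" using notmin right by blast
    define g where "g = reversepath \<gamma>"
    have g: "simple_path g" "pathfinish g = pathstart g" "path_image g = path_image \<gamma>"
      using \<gamma> by (auto simp: g_def simple_path_reversepath)
    have gt: "g t = \<gamma> (1 - t)" for t by (simp add: g_def reversepath_def)
    have "(g (1 - t0) + \<i> * of_real e \<in> inside (path_image g)) \<noteq> (g (1 - t0) - \<i> * of_real e \<in> inside (path_image g))"
    proof (rule crossing_separates[OF g(1,2), of "1 - t2" "1 - t0" "1 - t1"])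
      show "Re (g t) < Re (g (1 - t0))" if "1 - t2 \<le> t" "t < 1 - t0" for t using R that by (simp add: gt x_def)
      show "Re (g (1 - t0)) < Re (g t)" if "1 - t0 < t" "t \<le> 1 - t1" for t using Lf that by (simp add: gt x_def)
      show "t = 1 - t0" if "t \<in> {0..1}" "Re (g t) = Re (g (1 - t0))" "\<bar>Im (g t) - Im (g (1 - t0))\<bar> \<le> e" for t
        using uniq[of "1 - t"] that by (simp add: gt)
    qed (use t12 e in auto)
    then show ?thesis by (simp add: gt g(3))
  qed
  then show ?thesis using e(1) uniq by blast
qed

text \<open>The two endpoints of the vertical segment lie in different open regions, so the
  horizontal sides of a thin box do too, which is the situation of
  \<open>rectangle_width_bound\<close>. Thinness also forces all parameters of the curve in the box
  into the given neighbourhood \<open>V\<close> of \<open>t0\<close>. The bound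
  \<open>h \<le> 1\<close> is there for the Vitali covering lemma.\<close>

lemma zero_set_local_width:
  fixes \<gamma> :: "real \<Rightarrow> complex" and f :: "complex \<Rightarrow> complex"
  assumes \<gamma>: "simple_path \<gamma>" "pathfinish \<gamma> = pathstart \<gamma>"
    and L: "L > 0" and lip: "\<And>s t. s \<in> {0..1} \<Longrightarrow> t \<in> {0..1} \<Longrightarrow> dist (\<gamma> s) (\<gamma> t) \<le> L * \<bar>s - t\<bar>"
    and f: "continuous_on (closure (inside (path_image \<gamma>))) f" "f holomorphic_on inside (path_image \<gamma>)"
      "z0 \<in> inside (path_image \<gamma>)" "f z0 \<noteq> 0"
    and V: "open V" "t0 \<in> V" and t0: "0 < t0" "t0 < 1"
    and e: "e > 0" "\<And>t. t\<in>{0..1} \<Longrightarrow> Re (\<gamma> t) = Re (\<gamma> t0) \<Longrightarrow> \<bar>Im (\<gamma> t) - Im (\<gamma> t0)\<bar> \<le> e \<Longrightarrow> t = t0"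
     "(\<gamma> t0 + \<i> * of_real e \<in> inside (path_image \<gamma>)) \<noteq> (\<gamma> t0 - \<i> * of_real e \<in> inside (path_image \<gamma>))"
  shows "\<exists>h. 0 < h \<and> h \<le> 1 \<and> 2 * h \<le> 128 * L * measure lebesgue
      {t\<in>{0..1}. \<gamma> t \<in> cbox (Complex (Re (\<gamma> t0) - h) (Im (\<gamma> t0) - e)) (Complex (Re (\<gamma> t0) + h) (Im (\<gamma> t0) + e)) \<and> f (\<gamma> t) \<noteq> 0}
     \<and> (\<forall>t\<in>{0..1}. \<gamma> t \<in> cbox (Complex (Re (\<gamma> t0) - h) (Im (\<gamma> t0) - e)) (Complex (Re (\<gamma> t0) + h) (Im (\<gamma> t0) + e)) \<longrightarrow> t \<in> V)"
proof -
  let ?\<Omega> = "inside (path_image \<gamma>)"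
  define x where "x = Re (\<gamma> t0)"
  define y where "y = Im (\<gamma> t0)"
  have \<gamma>t0: "\<gamma> t0 = Complex x y" by (simp add: x_def y_def)
  have J: "open ?\<Omega>" "bounded ?\<Omega>" "open (outside (path_image \<gamma>))" "frontier ?\<Omega> = path_image \<gamma>"
     "?\<Omega> \<union> outside (path_image \<gamma>) = - path_image \<gamma>" "?\<Omega> \<inter> outside (path_image \<gamma>) = {}"
    using Jordan_inside_outside[OF \<gamma>] by auto
  have cont: "continuous_on {0..1} \<gamma>" using simple_path_imp_path[OF \<gamma>(1)] by (simp add: path_def)
  have stable: "\<exists>h0>0. \<forall>x'. \<bar>x' - x\<bar> \<le> h0 \<longrightarrow> (Complex x' y' \<in> ?\<Omega>) = (Complex x y' \<in> ?\<Omega>)"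
    if "Complex x y' \<notin> path_image \<gamma>" for y'
  proof -
    define U where "U = (if Complex x y' \<in> ?\<Omega> then ?\<Omega> else outside (path_image \<gamma>))"
    have "Complex x y' \<in> ?\<Omega> \<union> outside (path_image \<gamma>)" using that unfolding J(5) by simp
    then have "Complex x y' \<in> ?\<Omega> \<or> Complex x y' \<in> outside (path_image \<gamma>)" by (rule UnE) blast+
    then have "open U" "Complex x y' \<in> U" using J(1,3) by (auto simp: U_def)
    then obtain h0 where h0: "h0 > 0" "cball (Complex x y') h0 \<subseteq> U" using open_contains_cball by blast
    have "(Complex x' y' \<in> ?\<Omega>) = (Complex x y' \<in> ?\<Omega>)" if "\<bar>x' - x\<bar> \<le> h0" for x'
    proof -
      have "Complex x' y' \<in> cball (Complex x y') h0" using that by (simp add: dist_norm cmod_def abs_minus_commute)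
      then have "Complex x' y' \<in> U" using h0(2) by blast
      moreover have "Complex x' y' \<notin> ?\<Omega> \<or> Complex x' y' \<notin> outside (path_image \<gamma>)" using J(6) by blast
      ultimately show ?thesis by (auto simp: U_def split: if_splits)
    qed
    then show ?thesis using h0(1) by blast
  qed
  have off: "Complex x (y + s) \<notin> path_image \<gamma>" if "\<bar>s\<bar> = e" for s
  proof
    assume "Complex x (y + s) \<in> path_image \<gamma>"
    then obtain t where t: "t \<in> {0..1}" "\<gamma> t = Complex x (y + s)" unfolding path_image_def by (metis imageE)
    then have "t = t0" using e(2)[of t] that by (simp add: x_def y_def)
    then show False using t that e(1) by (simp add: \<gamma>t0)
  qed
  obtain h1 where h1: "h1 > 0" "\<And>x'. \<bar>x' - x\<bar> \<le> h1 \<Longrightarrow> (Complex x' (y + e) \<in> ?\<Omega>) = (Complex x (y + e) \<in> ?\<Omega>)"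
    using stable[OF off[of e]] e(1) by auto
  obtain h2 where h2: "h2 > 0" "\<And>x'. \<bar>x' - x\<bar> \<le> h2 \<Longrightarrow> (Complex x' (y - e) \<in> ?\<Omega>) = (Complex x (y - e) \<in> ?\<Omega>)"
    using stable[OF off[of "-e"]] e(1) by auto
  \<comment> \<open>These are the parameters outside \<open>V\<close> whose points lie in the
    horizontal strip of the box. By uniqueness of \<open>t0\<close> none of them lies over
    \<open>x\<close>, so compactness keeps them at a positive horizontal distance
    \<open>h3\<close>.\<close>
  define D where "D = ({0..1} \<inter> (\<lambda>t. \<bar>Im (\<gamma> t) - y\<bar>) -` {..e}) - V"
  have "closed ({0..1} \<inter> (\<lambda>t. \<bar>Im (\<gamma> t) - y\<bar>) -` {..e})"
    by (intro continuous_closed_preimage continuous_intros cont; auto)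
  then have "compact ({0..1} \<inter> (\<lambda>t. \<bar>Im (\<gamma> t) - y\<bar>) -` {..e})"
    by (auto simp: compact_eq_bounded_closed intro: bounded_subset[of "{0..1}"])
  then have compD: "compact D" unfolding D_def using V(1) by (rule compact_diff)
  have "\<exists>h3>0. \<forall>t\<in>D. h3 \<le> \<bar>Re (\<gamma> t) - x\<bar>"
  proof (cases "D = {}")
    case False
    have "continuous_on D (\<lambda>t. \<bar>Re (\<gamma> t) - x\<bar>)"
      by (intro continuous_intros continuous_on_subset[OF cont]) (auto simp: D_def)
    then obtain t where t: "t \<in> D" "\<And>s. s \<in> D \<Longrightarrow> \<bar>Re (\<gamma> t) - x\<bar> \<le> \<bar>Re (\<gamma> s) - x\<bar>"
      using continuous_attains_inf[OF compD False] by blast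
    have "Re (\<gamma> t) \<noteq> x"
    proof
      assume "Re (\<gamma> t) = x"
      then have "t = t0" using t(1) e(2)[of t] by (auto simp: D_def x_def y_def)
      then show False using t(1) V(2) by (simp add: D_def)
    qed
    then show ?thesis using t(2) by (intro exI[of _ "\<bar>Re (\<gamma> t) - x\<bar>"]) auto
  qed (auto intro: exI[of _ 1])
  then obtain h3 where h3: "h3 > 0" "\<And>t. t \<in> D \<Longrightarrow> h3 \<le> \<bar>Re (\<gamma> t) - x\<bar>" by blast
  define h4 where "h4 = min (min h1 h2) (min (h3/2) 1)"
  have h4: "h4 > 0" using h1 h2 h3 by (simp add: h4_def)
  obtain q :: nat where q: "e / h4 < real q" using reals_Archimedean2 by blast
  have q0: "q > 0" using q e(1) h4 by (metis divide_pos_pos gr0I less_asym of_nat_0)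
  \<comment> \<open>The height \<open>2 * e\<close> of the box has to be an integer multiple of its
    width \<open>2 * h\<close>.\<close>
  define h where "h = e / q"
  have h: "h > 0" "h \<le> h4" "real q * h = e" using q q0 e(1) h4 by (auto simp: h_def field_simps)
  have hh: "h \<le> h1" "h \<le> h2" "h < h3" "h \<le> 1" using h h3(1) by (auto simp: h4_def)
  have p: "\<gamma> t0 + \<i> * of_real e = Complex x (y + e)" "\<gamma> t0 - \<i> * of_real e = Complex x (y - e)"
    by (auto simp: complex_eq_iff x_def y_def)
  have box: "Complex (x - h + 2 * h) (y - e + real q * (2 * h)) = Complex (x + h) (y + e)"
    using h(3) by (simp add: algebra_simps)
  have "2 * h \<le> 128 * L * measure lebesgue {t\<in>{0..1}. \<gamma> t \<in> cbox (Complex (x - h) (y - e)) (Complex (x - h + 2 * h) (y - e + real q * (2 * h))) \<and> f (\<gamma> t) \<noteq> 0}"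
  proof (rule rectangle_width_bound[OF J(1,2) simply_connected_inside_simple_path[OF \<gamma>(1)] f L lip])
    show "\<gamma> ` {0..1} = frontier ?\<Omega>" using J(4) by (simp add: path_image_def)
    show "0 < 2 * h" "0 < q" using h q0 by auto
    have ye: "y - e + real q * (2 * h) = y + e" using h(3) by (simp add: algebra_simps)
    have st: "(Complex x' (y + e) \<in> ?\<Omega>) = (Complex x (y + e) \<in> ?\<Omega>)" "(Complex x' (y - e) \<in> ?\<Omega>) = (Complex x (y - e) \<in> ?\<Omega>)"
      if "x' \<in> {x - h..x - h + 2 * h}" for x'
      using that hh by (auto intro!: h1(2) h2(2))
    show "(\<forall>x'\<in>{x - h..x - h + 2 * h}. Complex x' (y - e) \<notin> ?\<Omega> \<and> Complex x' (y - e + real q * (2 * h)) \<in> ?\<Omega>) \<or>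
          (\<forall>x'\<in>{x - h..x - h + 2 * h}. Complex x' (y - e) \<in> ?\<Omega> \<and> Complex x' (y - e + real q * (2 * h)) \<notin> ?\<Omega>)"
      unfolding ye using st e(3) unfolding p by blast
  qed
  moreover have "t \<in> V" if t: "t \<in> {0..1}" "\<gamma> t \<in> cbox (Complex (x - h) (y - e)) (Complex (x + h) (y + e))" for t
  proof (rule ccontr)
    assume "t \<notin> V"
    then have "t \<in> D" using t by (auto simp: D_def in_cbox_complex_iff abs_le_iff)
    then have "h3 \<le> \<bar>Re (\<gamma> t) - x\<bar>" by (rule h3(2))
    then show False using t hh by (auto simp: in_cbox_complex_iff abs_real_def split: if_splits)
  qed
  ultimately show ?thesis using h(1) hh(4) unfolding box x_def[symmetric] y_def[symmetric] by blast
qed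

text \<open>Choose an open \<open>V\<close> around the zero parameters \<open>E\<close> with
  \<open>V - E\<close> of tiny measure. Over almost every value \<open>x\<close> there is an
  interval whose length is at most \<open>128 * L\<close> times the measure of those parameters in
  \<open>V - E\<close> that lie over it. Intervals made disjoint by Vitali's lemma have disjoint
  parameter sets, so their total length is controlled by the measure of
  \<open>V - E\<close>.\<close>

lemma zero_set_projection_negligible:
  fixes \<gamma> :: "real \<Rightarrow> complex" and f :: "complex \<Rightarrow> complex"
  assumes \<gamma>: "simple_path \<gamma>" "pathfinish \<gamma> = pathstart \<gamma>"
    and L: "L > 0" and lip: "\<And>s t. s \<in> {0..1} \<Longrightarrow> t \<in> {0..1} \<Longrightarrow> dist (\<gamma> s) (\<gamma> t) \<le> L * \<bar>s - t\<bar>"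
    and f: "continuous_on (closure (inside (path_image \<gamma>))) f" "f holomorphic_on inside (path_image \<gamma>)"
      "z0 \<in> inside (path_image \<gamma>)" "f z0 \<noteq> 0"
  shows "negligible ((\<lambda>t. Re (\<gamma> t)) ` {t\<in>{0..1}. f (\<gamma> t) = 0})"
proof -
  let ?\<Omega> = "inside (path_image \<gamma>)"
  define E where "E = {t\<in>{0..1}. f (\<gamma> t) = 0}"
  define u where "u = (\<lambda>t. Re (\<gamma> t))"
  define B1 where "B1 = {x. \<not> finite {t\<in>{0..1}. u t = x}}"
  define B2 where "B2 = {u t | t. \<exists>a b. a < t \<and> t < b \<and> (\<forall>s\<in>{a..b}. u s \<le> u t)}"
  define B3 where "B3 = {u t | t. \<exists>a b. a < t \<and> t < b \<and> (\<forall>s\<in>{a..b}. u t \<le> u s)}"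
  \<comment> \<open>Discarded are the values with infinite fibre, the local extreme values, and
    \<open>u 0\<close>, because the crossing argument needs a parameter in the open interval.
    Together they form a null set.\<close>
  define X where "X = u ` E - (B1 \<union> B2 \<union> B3 \<union> {u 0})"
  have lipu: "\<bar>u s - u t\<bar> \<le> L * \<bar>s - t\<bar>" if "s \<in> {0..1}" "t \<in> {0..1}" for s t
    using lip[OF that] abs_Re_le_cmod[of "\<gamma> s - \<gamma> t"] by (auto simp: dist_norm u_def)
  have "negligible B1"
  proof -
    have "AE x in lborel. finite {t\<in>{0..1}. u t = x}" by (rule finite_fibre_AE[OF L lipu])
    then have "AE x in lebesgue. finite {t\<in>{0..1}. u t = x}" by (rule AE_completion)
    then have "AE x in lebesgue. x \<notin> B1" by (simp add: B1_def)
    then obtain N where "N \<in> null_sets lebesgue" "{x \<in> space lebesgue. \<not> x \<notin> B1} \<subseteq> N"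
      unfolding eventually_ae_filter by blast
    then have "negligible N" "B1 \<subseteq> N" by (auto simp: negligible_iff_null_sets)
    then show ?thesis by (rule negligible_subset)
  qed
  moreover have "negligible B2" "negligible B3"
    unfolding B2_def B3_def
    using countable_local_max_values[of u] countable_local_min_values[of u]
      countable_imp_null_set_lborel null_sets_completionI negligible_iff_null_sets by blast+
  ultimately have negB: "negligible (B1 \<union> B2 \<union> B3 \<union> {u 0})" by (intro negligible_Un negligible_sing)
  have cont\<gamma>: "continuous_on {0..1} \<gamma>" using simple_path_imp_path[OF \<gamma>(1)] by (simp add: path_def)
  have "path_image \<gamma> \<subseteq> closure ?\<Omega>"
    using Jordan_inside_outside[OF \<gamma>] by (auto simp: frontier_def)
  then have "continuous_on {0..1} (\<lambda>t. f (\<gamma> t))"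
    by (intro continuous_on_compose2[OF f(1) cont\<gamma>]) (auto simp: path_image_def)
  then have clE: "closed E"
    unfolding E_def using continuous_closed_preimage_constant[of "{0..1}" "\<lambda>t. f (\<gamma> t)" 0] by auto
  have "negligible X"
    unfolding negligible_outer_le
  proof (intro allI impI)
    fix \<kappa> :: real assume \<kappa>: "\<kappa> > 0"
    \<comment> \<open>The constant is the \<open>128\<close> of the width estimate times the
      \<open>5\<close> by which Vitali's lemma enlarges the intervals.\<close>
    define \<kappa>' where "\<kappa>' = \<kappa> / (640 * L)"
    have \<kappa>': "\<kappa>' > 0" using \<kappa> L by (simp add: \<kappa>'_def)
    obtain V where V: "open V" "E \<subseteq> V" "V - E \<in> lmeasurable" "emeasure lebesgue (V - E) < ennreal \<kappa>'"
      using sets_lebesgue_outer_open[of E \<kappa>'] clE \<kappa>' by (auto simp: borel_closed)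
    have mV: "measure lebesgue (V - E) \<le> \<kappa>'"
      using V(4) \<kappa>' by (simp add: measure_def enn2real_leI)
    define S where "S = (\<lambda>x h. {t\<in>{0..1}. \<bar>u t - x\<bar> \<le> h} \<inter> (V - E))"
    have S: "S x h \<in> lmeasurable" for x h
    proof -
      have "continuous_on {0..1} u" by (rule lip_cont[OF L lipu])
      have "closed ({0..1} \<inter> (\<lambda>t. \<bar>u t - x\<bar>) -` {..h})"
        using \<open>continuous_on {0..1} u\<close> by (intro continuous_closed_preimage continuous_intros; auto)
      then have "{t\<in>{0..1}. \<bar>u t - x\<bar> \<le> h} \<in> sets lebesgue" by (simp add: borel_closed vimage_def Int_def)
      then show ?thesis unfolding S_def using V(3) by (metis fmeasurable_Int_fmeasurable Int_commute)
    qed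
    have "\<exists>h. 0 < h \<and> h \<le> 1 \<and> 2 * h \<le> 128 * L * measure lebesgue (S x h)" if x: "x \<in> X" for x
    proof -
      obtain t0 where t0: "t0 \<in> E" "x = u t0" and xB: "x \<notin> B1" "x \<notin> B2" "x \<notin> B3" "x \<noteq> u 0"
        using x by (auto simp: X_def)
      have "t0 \<noteq> 0" using t0 xB by auto
      moreover have "t0 \<noteq> 1" using t0 xB \<gamma>(2) by (auto simp: u_def pathfinish_def pathstart_def)
      ultimately have t01: "0 < t0" "t0 < 1" using t0(1) by (auto simp: E_def)
      obtain e where e: "e > 0" "\<forall>t\<in>{0..1}. Re (\<gamma> t) = Re (\<gamma> t0) \<longrightarrow> \<bar>Im (\<gamma> t) - Im (\<gamma> t0)\<bar> \<le> e \<longrightarrow> t = t0"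
         "(\<gamma> t0 + \<i> * of_real e \<in> ?\<Omega>) \<noteq> (\<gamma> t0 - \<i> * of_real e \<in> ?\<Omega>)"
        using crossing_at_isolated_point[OF \<gamma> t01] xB unfolding t0(2) B1_def B2_def B3_def u_def by blast
      have "t0 \<in> V" using V(2) t0(1) by blast
      from zero_set_local_width[OF \<gamma> L lip f V(1) this t01 e(1) e(2)[rule_format] e(3)]
      obtain h where h: "0 < h" "h \<le> 1" "2 * h \<le> 128 * L * measure lebesgue
         {t\<in>{0..1}. \<gamma> t \<in> cbox (Complex (Re (\<gamma> t0) - h) (Im (\<gamma> t0) - e)) (Complex (Re (\<gamma> t0) + h) (Im (\<gamma> t0) + e)) \<and> f (\<gamma> t) \<noteq> 0}"
        "\<forall>t\<in>{0..1}. \<gamma> t \<in> cbox (Complex (Re (\<gamma> t0) - h) (Im (\<gamma> t0) - e)) (Complex (Re (\<gamma> t0) + h) (Im (\<gamma> t0) + e)) \<longrightarrow> t \<in> V"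
        by blast
      let ?T = "{t\<in>{0..1}. \<gamma> t \<in> cbox (Complex (Re (\<gamma> t0) - h) (Im (\<gamma> t0) - e)) (Complex (Re (\<gamma> t0) + h) (Im (\<gamma> t0) + e)) \<and> f (\<gamma> t) \<noteq> 0}"
      have "measure lebesgue ?T \<le> measure lebesgue (S x h)"
      proof (rule measure_mono_fmeasurable[OF _ _ S])
        show "?T \<subseteq> S x h"
          using h(4) by (auto simp: S_def E_def t0(2) u_def in_cbox_complex_iff abs_le_iff)
        have "closed ({0..1} \<inter> \<gamma> -` cbox (Complex (Re (\<gamma> t0) - h) (Im (\<gamma> t0) - e)) (Complex (Re (\<gamma> t0) + h) (Im (\<gamma> t0) + e)))"
          by (intro continuous_closed_preimage cont\<gamma>; auto)
        moreover have "?T = ({0..1} \<inter> \<gamma> -` cbox (Complex (Re (\<gamma> t0) - h) (Im (\<gamma> t0) - e)) (Complex (Re (\<gamma> t0) + h) (Im (\<gamma> t0) + e))) - E"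
          by (auto simp: E_def)
        ultimately show "?T \<in> sets lebesgue" using clE by (simp add: borel_closed)
      qed
      then have "2 * h \<le> 128 * L * measure lebesgue (S x h)"
        using h(3) L by (intro order.trans[OF h(3)] mult_left_mono) auto
      then show ?thesis using h(1,2) by blast
    qed
    then obtain r where r: "\<And>x. x \<in> X \<Longrightarrow> 0 < r x \<and> r x \<le> 1" "\<And>x. x \<in> X \<Longrightarrow> 2 * r x \<le> 128 * L * measure lebesgue (S x (r x))"
      by metis
    have "X \<subseteq> (\<Union>i\<in>X. cball i (r i))" using r(1) by force
    from Vitali_covering_lemma_cballs[OF this r(1)]
    obtain C where C: "countable C" "C \<subseteq> X" "pairwise (\<lambda>i j. disjnt (cball i (r i)) (cball j (r j))) C"
      "X \<subseteq> (\<Union>i\<in>C. cball i (5 * r i))" by blast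
    have bound: "measure lebesgue (\<Union>i\<in>I. cball i (5 * r i)) \<le> \<kappa>" if I: "I \<subseteq> C" "finite I" for I
    proof -
      have rI: "0 < r i" "2 * r i \<le> 128 * L * measure lebesgue (S i (r i))" if "i \<in> I" for i
        using r that I C(2) by blast+
      have "measure lebesgue (\<Union>i\<in>I. cball i (5 * r i)) \<le> (\<Sum>i\<in>I. measure lebesgue (cball i (5 * r i)))"
        using I(2) by (intro measure_UNION_le) auto
      also have "\<dots> = (\<Sum>i\<in>I. 10 * r i)"
        using rI(1) by (intro sum.cong refl) (simp add: cball_eq_atLeastAtMost less_imp_le)
      also have "\<dots> \<le> (\<Sum>i\<in>I. 640 * L * measure lebesgue (S i (r i)))"
        using rI(2) by (intro sum_mono) force
      also have "\<dots> = 640 * L * (\<Sum>i\<in>I. measure lebesgue (S i (r i)))" by (simp add: sum_distrib_left)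
      also have "(\<Sum>i\<in>I. measure lebesgue (S i (r i))) = measure lebesgue (\<Union>i\<in>I. S i (r i))"
      proof (rule measure_finite_Union[symmetric, OF I(2)])
        show "(\<lambda>i. S i (r i)) ` I \<subseteq> sets lebesgue" using S fmeasurableD by blast
        show "emeasure lebesgue (S i (r i)) \<noteq> \<infinity>" for i using fmeasurableD2[OF S] by simp
        show "disjoint_family_on (\<lambda>i. S i (r i)) I"
          unfolding disjoint_family_on_def
        proof (intro ballI impI)
          fix i j assume ij: "i \<in> I" "j \<in> I" "i \<noteq> j"
          then have "cball i (r i) \<inter> cball j (r j) = {}" using C(3) I(1) unfolding pairwise_def disjnt_def by blast
          moreover have "u t \<in> cball i (r i) \<inter> cball j (r j)" if "t \<in> S i (r i) \<inter> S j (r j)" for t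
            using that by (auto simp: S_def dist_real_def abs_minus_commute)
          ultimately show "S i (r i) \<inter> S j (r j) = {}" by blast
        qed
      qed
      also have "\<dots> \<le> measure lebesgue (V - E)"
      proof (rule measure_mono_fmeasurable[OF _ _ V(3)])
        show "(\<Union>i\<in>I. S i (r i)) \<subseteq> V - E" unfolding S_def by blast
        show "(\<Union>i\<in>I. S i (r i)) \<in> sets lebesgue" using fmeasurableD[OF S] by (intro sets.finite_UN[OF I(2)])
      qed
      also have "\<dots> \<le> \<kappa>'" by (rule mV)
      also have "640 * L * \<kappa>' = \<kappa>" using L by (simp add: \<kappa>'_def)
      finally show ?thesis using L by simp
    qed
    show "\<exists>T. X \<subseteq> T \<and> T \<in> lmeasurable \<and> measure lebesgue T \<le> \<kappa>"
      using C(4) fmeasurable_UN_bound[OF C(1) _ bound] measure_UN_bound[OF C(1) _ bound]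
      by (intro exI[of _ "\<Union>i\<in>C. cball i (5 * r i)"]) auto
  qed
  then have "negligible (X \<union> (B1 \<union> B2 \<union> B3 \<union> {u 0}))" using negB by (rule negligible_Un)
  then have "negligible (u ` E)" by (rule negligible_subset) (auto simp: X_def)
  then show ?thesis by (simp add: u_def E_def)
qed

text \<open>A component that starts in the open set \<open>J\<close> cannot reach the open set
  \<open>K\<close> and so stays bounded, while every point of the connected unbounded
  \<open>K\<close> lies in an unbounded component. Connectedness of \<open>J\<close> is not assumed,
  which makes the criterion convenient for images of a Jordan domain under rotation and
  inversion.\<close>

lemma inside_eqI:
  assumes J: "open J" "open K" "connected K" "bounded J" "\<not> bounded K" "J \<inter> K = {}" "J \<union> K = - S"
  shows "inside S = J"
proof -
  have 1: "x \<in> inside S" if x: "x \<in> J" for x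
  proof -
    let ?C = "connected_component_set (- S) x"
    have "x \<in> - S" using x J(7) by blast
    then have "x \<in> ?C" by simp
    have "connected ?C" "?C \<subseteq> J \<union> K" using J(7) connected_component_subset by auto
    then have "J \<inter> ?C = {} \<or> K \<inter> ?C = {}"
      using J(1,2,6) by (intro connectedD) auto
    then have "?C \<subseteq> J" using \<open>x \<in> ?C\<close> x \<open>?C \<subseteq> J \<union> K\<close> by blast
    then have "bounded ?C" using J(4) bounded_subset by blast
    then show ?thesis using \<open>x \<in> - S\<close> by (simp add: inside_def)
  qed
  have 2: "x \<notin> inside S" if x: "x \<in> K" for x
  proof -
    have "K \<subseteq> connected_component_set (- S) x" using x J(3,7) by (intro connected_component_maximal) auto
    then have "\<not> bounded (connected_component_set (- S) x)" using J(5) bounded_subset by blast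
    then show ?thesis by (simp add: inside_def)
  qed
  have "inside S \<subseteq> J \<union> K" unfolding J(7) by (auto simp: inside_def)
  then show ?thesis using 1 2 by blast
qed

lemma inside_mult_unit:
  fixes \<gamma> :: "real \<Rightarrow> complex"
  assumes \<gamma>: "simple_path \<gamma>" "pathfinish \<gamma> = pathstart \<gamma>" and c: "norm c = 1"
  shows "inside (path_image (\<lambda>t. c * \<gamma> t)) = (\<lambda>z. c * z) ` inside (path_image \<gamma>)"
proof (rule inside_eqI[where K = "(\<lambda>z. c * z) ` outside (path_image \<gamma>)"])
  note J = Jordan_inside_outside[OF \<gamma>]
  have c0: "c \<noteq> 0" using c by auto
  have op: "open ((\<lambda>z. c * z) ` X)" if "open X" for X
  proof -
    have "(\<lambda>z. c * z) ` X = (\<lambda>z. z / c) -` X"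
      using c0 by (force simp: image_iff)
    then show ?thesis using that c0 by (simp add: open_vimage continuous_on_divide)
  qed
  have inj: "inj (\<lambda>z. c * z)" using c0 by (simp add: inj_def)
  have bd: "bounded ((\<lambda>z. c * z) ` X) \<longleftrightarrow> bounded X" for X
    using c by (simp add: bounded_iff norm_mult)
  show "open ((\<lambda>z. c * z) ` inside (path_image \<gamma>))" "open ((\<lambda>z. c * z) ` outside (path_image \<gamma>))"
    "bounded ((\<lambda>z. c * z) ` inside (path_image \<gamma>))" "\<not> bounded ((\<lambda>z. c * z) ` outside (path_image \<gamma>))"
    using J op bd by blast+
  have "connected (outside (path_image \<gamma>))" using J by blast
  then show "connected ((\<lambda>z. c * z) ` outside (path_image \<gamma>))"
    by (intro connected_continuous_image continuous_intros)
  show "(\<lambda>z. c * z) ` inside (path_image \<gamma>) \<inter> (\<lambda>z. c * z) ` outside (path_image \<gamma>) = {}"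
    unfolding image_Int[OF inj, symmetric] by simp
  have "path_image (\<lambda>t. c * \<gamma> t) = (\<lambda>z. c * z) ` path_image \<gamma>" by (auto simp: path_image_def)
  moreover have "bij (\<lambda>z. c * z)"
    by (rule bijI[OF inj]) (use c0 in \<open>auto simp: surj_def intro!: exI[of _ "_ / c"]\<close>)
  ultimately show "(\<lambda>z. c * z) ` inside (path_image \<gamma>) \<union> (\<lambda>z. c * z) ` outside (path_image \<gamma>) = - path_image (\<lambda>t. c * \<gamma> t)"
    unfolding image_Un[symmetric] by (simp add: bij_image_Compl_eq)
qed

theorem jordan_domain_zero_set_null:
  fixes \<gamma> :: "real \<Rightarrow> complex" and f :: "complex \<Rightarrow> complex"
  assumes \<gamma>: "simple_path \<gamma>" "pathfinish \<gamma> = pathstart \<gamma>"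
    and L: "L > 0" and lip: "\<And>s t. s \<in> {0..1} \<Longrightarrow> t \<in> {0..1} \<Longrightarrow> dist (\<gamma> s) (\<gamma> t) \<le> L * \<bar>s - t\<bar>"
    and f: "continuous_on (closure (inside (path_image \<gamma>))) f" "f holomorphic_on inside (path_image \<gamma>)"
      "z0 \<in> inside (path_image \<gamma>)" "f z0 \<noteq> 0"
  shows "hausdorff1 {z \<in> path_image \<gamma>. f z = 0} = 0"
proof -
  let ?\<Omega> = "inside (path_image \<gamma>)"
  define E where "E = {t\<in>{0..1}. f (\<gamma> t) = 0}"
  have Re: "negligible ((\<lambda>t. Re (\<gamma> t)) ` E)"
    unfolding E_def by (rule zero_set_projection_negligible[OF \<gamma> L lip f])
  \<comment> \<open>Since \<open>Re (- \<i> * w) = Im w\<close>, the projection lemma for the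
    rotated curve and the function \<open>f (\<i> * z)\<close> yields the projection of the same
    parameters to the imaginary axis.\<close>
  have "negligible ((\<lambda>t. Re (- \<i> * \<gamma> t)) ` {t\<in>{0..1}. f (\<i> * (- \<i> * \<gamma> t)) = 0})"
  proof (rule zero_set_projection_negligible[where f = "\<lambda>z. f (\<i> * z)" and ?z0.0 = "- \<i> * z0" and L = L])
    have eq: "inside (path_image (\<lambda>t. - \<i> * \<gamma> t)) = (\<lambda>z. - \<i> * z) ` ?\<Omega>"
      by (rule inside_mult_unit[OF \<gamma>]) simp
    have inv: "\<i> * (- \<i> * z) = z" for z by (simp flip: mult.assoc)
    show "simple_path (\<lambda>t. - \<i> * \<gamma> t)"
      using simple_path_linear_image_eq[of "\<lambda>z. - \<i> * z" \<gamma>] \<gamma>(1)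
      by (simp add: o_def inj_def linear_iff algebra_simps)
    show "pathfinish (\<lambda>t. - \<i> * \<gamma> t) = pathstart (\<lambda>t. - \<i> * \<gamma> t)"
      using \<gamma>(2) by (simp add: pathfinish_def pathstart_def)
    show "L > 0" by fact
    show "dist (- \<i> * \<gamma> s) (- \<i> * \<gamma> t) \<le> L * \<bar>s - t\<bar>" if "s \<in> {0..1}" "t \<in> {0..1}" for s t
      using lip[OF that] by (simp only: dist_norm right_diff_distrib[symmetric] norm_mult norm_minus_cancel norm_ii mult_1)
    have sub: "(\<lambda>z. \<i> * z) ` closure ((\<lambda>z. - \<i> * z) ` ?\<Omega>) \<subseteq> closure ?\<Omega>"
    proof -
      have "(\<lambda>z. \<i> * z) ` closure ((\<lambda>z. - \<i> * z) ` ?\<Omega>) \<subseteq> closure ((\<lambda>z. \<i> * z) ` (\<lambda>z. - \<i> * z) ` ?\<Omega>)"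
        by (intro closure_bounded_linear_image_subset bounded_linear_mult_right)
      then show ?thesis by (simp add: image_image inv)
    qed
    show "continuous_on (closure (inside (path_image (\<lambda>t. - \<i> * \<gamma> t)))) (\<lambda>z. f (\<i> * z))"
      unfolding eq by (rule continuous_on_compose2[OF f(1) _ sub]) (intro continuous_intros)
    show "(\<lambda>z. f (\<i> * z)) holomorphic_on inside (path_image (\<lambda>t. - \<i> * \<gamma> t))"
    proof -
      have "f \<circ> (\<lambda>z. \<i> * z) holomorphic_on (\<lambda>z. - \<i> * z) ` ?\<Omega>"
        by (rule holomorphic_on_compose_gen[OF _ f(2)]) (auto intro!: holomorphic_intros simp flip: mult.assoc)
      then show ?thesis unfolding eq by (simp add: o_def)
    qed
    show "- \<i> * z0 \<in> inside (path_image (\<lambda>t. - \<i> * \<gamma> t))" unfolding eq using f(3) by blast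
    show "f (\<i> * (- \<i> * z0)) \<noteq> 0" unfolding inv by (rule f(4))
  qed
  then have Im: "negligible ((\<lambda>t. Im (\<gamma> t)) ` E)" by (simp add: E_def flip: mult.assoc)
  have cont\<gamma>: "continuous_on {0..1} \<gamma>" using simple_path_imp_path[OF \<gamma>(1)] by (simp add: path_def)
  have "path_image \<gamma> \<subseteq> closure ?\<Omega>"
    using Jordan_inside_outside[OF \<gamma>] by (auto simp: frontier_def)
  then have "continuous_on {0..1} (\<lambda>t. f (\<gamma> t))"
    by (intro continuous_on_compose2[OF f(1) cont\<gamma>]) (auto simp: path_image_def)
  then have "closed E"
    unfolding E_def using continuous_closed_preimage_constant[of "{0..1}" "\<lambda>t. f (\<gamma> t)" 0] by auto
  moreover have E01: "E \<subseteq> {0..1}" by (auto simp: E_def)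
  moreover have "bounded E" by (rule bounded_subset[OF _ E01]) simp
  ultimately have "compact E" by (simp add: compact_eq_bounded_closed)
  have "hausdorff1 (\<gamma> ` E) = 0" by (rule hausdorff1_null_projections[OF L lip \<open>compact E\<close> E01 Re Im])
  moreover have "\<gamma> ` E = {z \<in> path_image \<gamma>. f z = 0}" by (auto simp: E_def path_image_def)
  ultimately show ?thesis by simp
qed

subsection \<open>Reparametrization of rectifiable curves\<close>

text \<open>Partitions are weakly monotone, so repeated points are allowed. Hence cutting a
  partition off at a point by \<open>min\<close> or \<open>max\<close> again gives an admissible
  one, with no case distinction on where the point falls.\<close>

definition variation_sums :: "(real \<Rightarrow> complex) \<Rightarrow> real \<Rightarrow> real \<Rightarrow> real set" where
  "variation_sums g a b = {\<Sum>k<n. dist (g (t k)) (g (t (Suc k))) | n t. mono_on {..n::nat} t \<and> t ` {..n} \<subseteq> {a..b}}"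

definition variation :: "(real \<Rightarrow> complex) \<Rightarrow> real \<Rightarrow> real \<Rightarrow> real" where
  "variation g a b = Sup (variation_sums g a b)"

lemma variation_sumsI:
  "mono_on {..n} t \<Longrightarrow> t ` {..n} \<subseteq> {a..b} \<Longrightarrow> (\<Sum>k<n. dist (g (t k)) (g (t (Suc k)))) \<in> variation_sums g a b"
  unfolding variation_sums_def by blast

lemma variation_sums_mono: "a' \<le> a \<Longrightarrow> b \<le> b' \<Longrightarrow> variation_sums g a b \<subseteq> variation_sums g a' b'"
  unfolding variation_sums_def by (force simp: subset_iff)

lemma mono_on_min_const: "mono_on A t \<Longrightarrow> mono_on A (\<lambda>k. min (t k) (b::real))"
  unfolding mono_on_def by (auto intro: min.coboundedI1 min.coboundedI2)

lemma mono_on_max_const: "mono_on A t \<Longrightarrow> mono_on A (\<lambda>k. max (t k) (b::real))"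
  unfolding mono_on_def by (auto intro: max.coboundedI1 max.coboundedI2)

text \<open>A monotone sequence with two values jumps at most once. The induction records whether
  the jump has happened yet: as long as the last value is \<open>x\<close>, the sum is
  \<open>0\<close>.\<close>

lemma sum_dist_two_values:
  fixes t :: "nat \<Rightarrow> real"
  assumes "mono_on {..n} t" "t ` {..n} \<subseteq> {x, y}" "x \<le> y"
  shows "(\<Sum>k<n. dist (g (t k)) (g (t (Suc k)))) \<le> (dist (g x) (g y) :: real)"
proof -
  have "(\<Sum>k<n. dist (g (t k)) (g (t (Suc k)))) \<le> (if t n = x then 0 else dist (g x) (g y))"
    using assms(1,2)
  proof (induction n)
    case (Suc n)
    have IH: "(\<Sum>k<n. dist (g (t k)) (g (t (Suc k)))) \<le> (if t n = x then 0 else dist (g x) (g y))"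
    proof (rule Suc.IH)
      show "mono_on {..n} t" using Suc.prems(1) by (rule mono_on_subset) auto
      show "t ` {..n} \<subseteq> {x, y}" using image_mono[of "{..n}" "{..Suc n}" t] Suc.prems(2) by (meson atMost_subset_iff le_SucI order.refl order.trans)
    qed
    have "t n \<le> t (Suc n)" using Suc.prems(1) by (auto simp: mono_on_def)
    moreover have "t k = x \<or> t k = y" if "k \<le> Suc n" for k
      using subsetD[OF Suc.prems(2) imageI[of k "{..Suc n}" t]] that by auto
    then have "t n = x \<or> t n = y" "t (Suc n) = x \<or> t (Suc n) = y" by auto
    ultimately show ?case using IH assms(3) by (auto simp: dist_commute split: if_splits)
  qed simp
  then show ?thesis by (auto split: if_splits intro: order.trans)
qed

context
  fixes g :: "real \<Rightarrow> complex"
  assumes fin: "finite_length g"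
begin

lemma bdd_variation: "0 \<le> a \<Longrightarrow> b \<le> 1 \<Longrightarrow> bdd_above (variation_sums g a b)"
proof -
  assume "0 \<le> a" "b \<le> 1"
  then have sub: "variation_sums g a b \<subseteq> variation_sums g 0 1" by (rule variation_sums_mono)
  obtain M where "\<forall>n t. mono_on {..n} t \<and> t ` {..n} \<subseteq> {0..1} \<longrightarrow> (\<Sum>k<n. dist (g (t k)) (g (t (Suc k)))) \<le> M"
    using fin unfolding finite_length_def by blast
  then have "bdd_above (variation_sums g 0 1)"
    unfolding variation_sums_def by (intro bdd_aboveI[of _ M]) blast
  then show ?thesis using sub by (rule bdd_above_mono)
qed

lemma variation_upper: "0 \<le> a \<Longrightarrow> b \<le> 1 \<Longrightarrow> x \<in> variation_sums g a b \<Longrightarrow> x \<le> variation g a b"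
  unfolding variation_def using bdd_variation by (intro cSup_upper)

lemma variation_nonempty: "a \<le> b \<Longrightarrow> variation_sums g a b \<noteq> {}"
  using variation_sumsI[of 0 "\<lambda>_. a" a b g] by (auto simp: mono_on_def)

lemma variation_approx:
  assumes "a \<le> b" "e > 0"
  obtains n t where "mono_on {..n} t" "t ` {..n} \<subseteq> {a..b}" "variation g a b - e < (\<Sum>k<n. dist (g (t k)) (g (t (Suc k))))"
proof -
  have "\<exists>x\<in>variation_sums g a b. variation g a b - e < x"
    using less_cSupD[OF variation_nonempty[OF assms(1)], of "variation g a b - e"] assms(2)
    unfolding variation_def by auto
  then show ?thesis using that unfolding variation_sums_def by blast
qed

text \<open>Only an increment that straddles \<open>b\<close> changes, and there the point
  \<open>g b\<close> is inserted by the triangle inequality.\<close>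

lemma sum_dist_split:
  fixes t :: "nat \<Rightarrow> real"
  assumes "mono_on {..n} t"
  shows "(\<Sum>k<n. dist (g (t k)) (g (t (Suc k)))) \<le>
    (\<Sum>k<n. dist (g (min (t k) b)) (g (min (t (Suc k)) b))) + (\<Sum>k<n. dist (g (max (t k) b)) (g (max (t (Suc k)) b)))"
  unfolding sum.distrib[symmetric]
proof (rule sum_mono)
  fix k assume "k \<in> {..<n}"
  then have "t k \<le> t (Suc k)" using assms by (auto simp: mono_on_def)
  then show "dist (g (t k)) (g (t (Suc k))) \<le> dist (g (min (t k) b)) (g (min (t (Suc k)) b)) + dist (g (max (t k) b)) (g (max (t (Suc k)) b))"
    by (auto simp: min_def max_def dist_triangle)
qed

lemma variation_add:
  assumes "0 \<le> a" "a \<le> b" "b \<le> c" "c \<le> 1"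
  shows "variation g a c = variation g a b + variation g b c"
proof (rule antisym)
  show "variation g a c \<le> variation g a b + variation g b c"
    unfolding variation_def[of g a c]
  proof (rule cSup_least)
    show "variation_sums g a c \<noteq> {}" using assms by (intro variation_nonempty) auto
    fix x assume "x \<in> variation_sums g a c"
    then obtain n t where t: "mono_on {..n} t" "t ` {..n} \<subseteq> {a..c}" "x = (\<Sum>k<n. dist (g (t k)) (g (t (Suc k))))"
      unfolding variation_sums_def by blast
    have "(\<Sum>k<n. dist (g (min (t k) b)) (g (min (t (Suc k)) b))) \<le> variation g a b"
      using t(2) assms by (intro variation_upper variation_sumsI mono_on_min_const t(1) image_subsetI) force+
    moreover have "(\<Sum>k<n. dist (g (max (t k) b)) (g (max (t (Suc k)) b))) \<le> variation g b c"
      using t(2) assms by (intro variation_upper variation_sumsI mono_on_max_const t(1) image_subsetI) force+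
    ultimately show "x \<le> variation g a b + variation g b c" using sum_dist_split[OF t(1), of b] t(3) by linarith
  qed
  show "variation g a b + variation g b c \<le> variation g a c"
  proof (rule field_le_epsilon)
    fix e :: real assume "e > 0"
    then have e2: "e/2 > 0" by simp
    obtain n t where t: "mono_on {..n} t" "t ` {..n} \<subseteq> {a..b}" "variation g a b - e/2 < (\<Sum>k<n. dist (g (t k)) (g (t (Suc k))))"
      using variation_approx[OF assms(2) e2] .
    obtain m s where s: "mono_on {..m} s" "s ` {..m} \<subseteq> {b..c}" "variation g b c - e/2 < (\<Sum>k<m. dist (g (s k)) (g (s (Suc k))))"
      using variation_approx[OF assms(3) e2] .
    \<comment> \<open>The concatenation of two nearly optimal partitions has one extra link, from
      \<open>t n\<close> to \<open>s 0\<close>; its nonnegative length is simply dropped.\<close>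
    define r where "r = (\<lambda>k. if k \<le> n then t k else s (k - Suc n))"
    have tb: "t k \<in> {a..b}" if "k \<le> n" for k using t(2) that by auto
    have sb: "s k \<in> {b..c}" if "k \<le> m" for k using s(2) that by auto
    have "r i \<le> r j" if ij: "i \<le> j" "j \<le> Suc n + m" for i j
    proof (cases "j \<le> n")
      case True then show ?thesis using t(1) ij by (auto simp: r_def mono_on_def)
    next
      case j: False
      show ?thesis
      proof (cases "i \<le> n")
        case True
        have "j - Suc n \<le> m" using ij by simp
        from tb[OF True] sb[OF this] show ?thesis using True j by (simp add: r_def)
      next
        case False
        have "i - Suc n \<le> j - Suc n" "i - Suc n \<le> m" "j - Suc n \<le> m" using ij by auto
        then have "s (i - Suc n) \<le> s (j - Suc n)" using s(1) unfolding mono_on_def by blast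
        then show ?thesis using j False by (simp add: r_def)
      qed
    qed
    then have r1: "mono_on {..Suc n + m} r" by (auto simp: mono_on_def)
    have r2: "r ` {..Suc n + m} \<subseteq> {a..c}"
    proof (rule image_subsetI)
      fix k assume "k \<in> {..Suc n + m}"
      then have "k - Suc n \<le> m" by simp
      then show "r k \<in> {a..c}" using tb[of k] sb[of "k - Suc n"] assms by (cases "k \<le> n") (simp_all add: r_def)
    qed
    have "(\<Sum>k<Suc n + m. dist (g (r k)) (g (r (Suc k)))) \<le> variation g a c"
      using assms by (intro variation_upper variation_sumsI r1 r2) auto
    moreover have "(\<Sum>k<Suc n + m. dist (g (r k)) (g (r (Suc k)))) =
      (\<Sum>k<n. dist (g (t k)) (g (t (Suc k)))) + dist (g (t n)) (g (s 0)) + (\<Sum>k<m. dist (g (s k)) (g (s (Suc k))))"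
    proof -
      have "(\<Sum>k<Suc n + m. dist (g (r k)) (g (r (Suc k)))) = (\<Sum>k<Suc n. dist (g (r k)) (g (r (Suc k)))) + (\<Sum>k<m. dist (g (r (Suc n + k))) (g (r (Suc (Suc n + k)))))"
        by (induction m) auto
      also have "(\<Sum>k<m. dist (g (r (Suc n + k))) (g (r (Suc (Suc n + k))))) = (\<Sum>k<m. dist (g (s k)) (g (s (Suc k))))"
        by (intro sum.cong) (auto simp: r_def)
      also have "(\<Sum>k<Suc n. dist (g (r k)) (g (r (Suc k)))) = (\<Sum>k<n. dist (g (t k)) (g (t (Suc k)))) + dist (g (t n)) (g (s 0))"
        by (auto simp: r_def intro!: sum.cong)
      finally show ?thesis .
    qed
    ultimately show "variation g a b + variation g b c \<le> variation g a c + e"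
      using t(3) s(3) zero_le_dist[of "g (t n)" "g (s 0)"] by linarith
  qed
qed

lemma dist_le_variation:
  assumes "0 \<le> a" "a \<le> b" "b \<le> 1" shows "dist (g a) (g b) \<le> variation g a b"
proof -
  have "(\<lambda>k::nat. if k = 0 then a else b) ` {..Suc 0} \<subseteq> {a..b}" by (rule image_subsetI) (use assms in auto)
  moreover have "mono_on {..Suc 0} (\<lambda>k::nat. if k = 0 then a else b)" using assms by (auto simp: mono_on_def)
  ultimately show ?thesis
    using variation_upper[OF assms(1,3) variation_sumsI[of "Suc 0" "\<lambda>k. if k = 0 then a else b" a b]] by simp
qed

lemma variation_nonneg: "0 \<le> a \<Longrightarrow> a \<le> b \<Longrightarrow> b \<le> 1 \<Longrightarrow> 0 \<le> variation g a b"
  using dist_le_variation[of a b] zero_le_dist[of "g a" "g b"] by linarith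

lemma finite_gap_left: "finite (F :: real set) \<Longrightarrow> \<exists>d>0. \<forall>x\<in>F. x < s \<longrightarrow> x < s - d"
proof -
  assume F: "finite F"
  obtain d where d: "d > 0" "\<forall>x\<in>F. x \<noteq> s \<longrightarrow> d \<le> dist s x" using finite_set_avoid[OF F, of s] by auto
  then show ?thesis by (intro exI[of _ "d/2"]) (force simp: dist_real_def)
qed

lemma finite_gap_right: "finite (F :: real set) \<Longrightarrow> \<exists>d>0. \<forall>x\<in>F. s < x \<longrightarrow> s + d < x"
proof -
  assume F: "finite F"
  obtain d where d: "d > 0" "\<forall>x\<in>F. x \<noteq> s \<longrightarrow> d \<le> dist s x" using finite_set_avoid[OF F, of s] by auto
  then show ?thesis by (intro exI[of _ "d/2"]) (force simp: dist_real_def)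
qed

text \<open>Take a nearly optimal partition of \<open>{0..s}\<close>. Its finitely many points leave
  a gap to the left of \<open>s\<close>, so for \<open>s'\<close> in the gap the part cut off at
  \<open>s'\<close> takes only the values \<open>s'\<close> and \<open>s\<close> and contributes at
  most \<open>dist (g s') (g s)\<close>. Continuity of \<open>g\<close> makes this small; the right
  side is treated in the same way from \<open>{s..1}\<close>.\<close>

lemma continuous_variation:
  assumes g: "continuous_on {0..1} g"
  shows "continuous_on {0..1} (variation g 0)"
  unfolding continuous_on_iff
proof (intro ballI allI impI)
  fix s e :: real assume s: "s \<in> {0..1}" and e: "e > 0"
  have e3: "e/3 > 0" using e by simp
  obtain d0 where d0: "d0 > 0" "\<And>s'. s' \<in> {0..1} \<Longrightarrow> dist s' s < d0 \<Longrightarrow> dist (g s') (g s) < e/3"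
    using g s e3 unfolding continuous_on_iff by blast
  obtain n t where t: "mono_on {..n} t" "t ` {..n} \<subseteq> {0..s}" "variation g 0 s - e/3 < (\<Sum>k<n. dist (g (t k)) (g (t (Suc k))))"
    using variation_approx[of 0 s "e/3"] s e3 by auto
  obtain m r where r: "mono_on {..m} r" "r ` {..m} \<subseteq> {s..1}" "variation g s 1 - e/3 < (\<Sum>k<m. dist (g (r k)) (g (r (Suc k))))"
    using variation_approx[of s 1 "e/3"] s e3 by auto
  obtain d1 where d1: "d1 > 0" "\<forall>x\<in>t ` {..n}. x < s \<longrightarrow> x < s - d1" using finite_gap_left[of "t ` {..n}" s] by auto
  obtain d2 where d2: "d2 > 0" "\<forall>x\<in>r ` {..m}. s < x \<longrightarrow> s + d2 < x" using finite_gap_right[of "r ` {..m}" s] by auto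
  have left: "variation g s' s < e" if s': "s' \<in> {0..1}" "s' \<le> s" "s - s' < d0" "s - s' < d1" for s'
  proof -
    have A: "(\<Sum>k<n. dist (g (min (t k) s')) (g (min (t (Suc k)) s'))) \<le> variation g 0 s'"
      using t(2) s' s by (intro variation_upper variation_sumsI mono_on_min_const t(1) image_subsetI) force+
    have "(\<lambda>k. max (t k) s') ` {..n} \<subseteq> {s', s}"
    proof (rule image_subsetI)
      fix k assume k: "k \<in> {..n}"
      have "t k \<le> s" "t k < s \<longrightarrow> t k < s - d1" using subsetD[OF t(2) imageI[OF k]] d1(2) k by auto
      then show "max (t k) s' \<in> {s', s}" using s' by (auto simp: max_def)
    qed
    moreover have "mono_on {..n} (\<lambda>k. max (t k) s')" using t(1) by (rule mono_on_max_const)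
    ultimately have "(\<Sum>k<n. dist (g (max (t k) s')) (g (max (t (Suc k)) s'))) \<le> dist (g s') (g s)"
      using s' by (intro sum_dist_two_values[of n "\<lambda>k. max (t k) s'"])
    also have "\<dots> < e/3" using s' by (intro d0(2)) (auto simp: dist_real_def)
    finally have "variation g 0 s < variation g 0 s' + e/3 + e/3" using A t(3) sum_dist_split[OF t(1), of s'] by linarith
    then show ?thesis using variation_add[of 0 s' s] s' s e by auto
  qed
  have right: "variation g s s' < e" if s': "s' \<in> {0..1}" "s \<le> s'" "s' - s < d0" "s' - s < d2" for s'
  proof -
    have A: "(\<Sum>k<m. dist (g (max (r k) s')) (g (max (r (Suc k)) s'))) \<le> variation g s' 1"
      using r(2) s' s by (intro variation_upper variation_sumsI mono_on_max_const r(1) image_subsetI) force+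
    have "(\<lambda>k. min (r k) s') ` {..m} \<subseteq> {s, s'}"
    proof (rule image_subsetI)
      fix k assume k: "k \<in> {..m}"
      have "s \<le> r k" "s < r k \<longrightarrow> s + d2 < r k" using subsetD[OF r(2) imageI[OF k]] d2(2) k by auto
      then show "min (r k) s' \<in> {s, s'}" using s' by (auto simp: min_def)
    qed
    moreover have "mono_on {..m} (\<lambda>k. min (r k) s')" using r(1) by (rule mono_on_min_const)
    ultimately have "(\<Sum>k<m. dist (g (min (r k) s')) (g (min (r (Suc k)) s'))) \<le> dist (g s) (g s')"
      using s' by (intro sum_dist_two_values[of m "\<lambda>k. min (r k) s'"])
    also have "\<dots> < e/3" using d0(2)[of s'] s' by (auto simp: dist_real_def dist_commute)
    finally have "variation g s 1 < variation g s' 1 + e/3 + e/3" using A r(3) sum_dist_split[OF r(1), of s'] by linarith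
    then show ?thesis using variation_add[of s s' 1] s' s e by auto
  qed
  show "\<exists>d>0. \<forall>s'\<in>{0..1}. dist s' s < d \<longrightarrow> dist (variation g 0 s') (variation g 0 s) < e"
  proof (intro exI[of _ "min d0 (min d1 d2)"] conjI ballI impI)
    show "min d0 (min d1 d2) > 0" using d0 d1 d2 by simp
    fix s' assume s': "s' \<in> {0..1}" "dist s' s < min d0 (min d1 d2)"
    show "dist (variation g 0 s') (variation g 0 s) < e"
    proof (cases "s' \<le> s")
      case True
      then show ?thesis using left[of s'] s' s variation_add[of 0 s' s] variation_nonneg[of s' s] by (auto simp: dist_real_def)
    next
      case False
      then show ?thesis using right[of s'] s' s variation_add[of 0 s s'] variation_nonneg[of s s'] by (auto simp: dist_real_def)
    qed
  qed
qed

text \<open>The new parameter is proportional to \<open>W s\<close>, the old parameter plus the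
  length travelled. The length term makes \<open>\<gamma>\<close> Lipschitz, because increments of
  \<open>W\<close> dominate those of \<open>g\<close>; the summand \<open>s\<close> makes
  \<open>W\<close> strictly increasing at once, and its continuity supplies an inverse on the whole
  interval.\<close>

lemma lipschitz_reparametrization:
  assumes g: "continuous_on UNIV g" and inj: "\<And>s t. g s = g t \<longleftrightarrow> s - t \<in> \<int>"
  shows "\<exists>\<gamma> L. simple_path \<gamma> \<and> pathfinish \<gamma> = pathstart \<gamma> \<and> L > 0 \<and>
     (\<forall>s\<in>{0..1}. \<forall>t\<in>{0..1}. dist (\<gamma> s) (\<gamma> t) \<le> L * \<bar>s - t\<bar>) \<and> path_image \<gamma> = range g"
proof -
  define W where "W = (\<lambda>s. s + variation g 0 s)"
  have g01: "continuous_on {0..1} g" using g by (rule continuous_on_subset) simp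
  have contW: "continuous_on {0..1} W" unfolding W_def by (intro continuous_intros continuous_variation g01)
  have Wdiff: "W t - W s \<ge> t - s" "W t - W s \<ge> dist (g s) (g t)" if "0 \<le> s" "s \<le> t" "t \<le> 1" for s t
    using variation_add[of 0 s t] variation_nonneg[of s t] dist_le_variation[of s t] that by (auto simp: W_def)
  define M where "M = W 1"
  have W0: "W 0 = 0"
  proof -
    have "variation g 0 0 + variation g 0 0 = variation g 0 0" using variation_add[of 0 0 0] by simp
    then show ?thesis by (simp add: W_def)
  qed
  have "1 - 0 \<le> W 1 - W 0" by (rule Wdiff(1)) auto
  then have M: "M \<ge> 1" unfolding M_def W0 by simp
  have injW: "s = t" if "s \<in> {0..1}" "t \<in> {0..1}" "W s = W t" for s t
  proof (rule linorder_cases[of s t])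
    assume "s < t"
    then have "t - s \<le> W t - W s" using that(1,2) by (intro Wdiff(1)) auto
    then show ?thesis using that(3) \<open>s < t\<close> by linarith
  next
    assume "t < s"
    then have "s - t \<le> W s - W t" using that(1,2) by (intro Wdiff(1)) auto
    then show ?thesis using that(3) \<open>t < s\<close> by linarith
  qed
  have "\<exists>s\<in>{0..1}. W s = M * \<tau>" if "\<tau> \<in> {0..1}" for \<tau>
  proof -
    have "M * \<tau> \<le> M * 1" using that M by (intro mult_left_mono) auto
    then have "W 0 \<le> M * \<tau>" "M * \<tau> \<le> W 1" using that M W0 by (auto simp: M_def)
    then have "\<exists>x\<ge>0. x \<le> 1 \<and> W x = M * \<tau>" by (intro IVT' contW) auto
    then show ?thesis by auto
  qed
  then obtain \<sigma> where \<sigma>: "\<And>\<tau>. \<tau> \<in> {0..1} \<Longrightarrow> \<sigma> \<tau> \<in> {0..1}" "\<And>\<tau>. \<tau> \<in> {0..1} \<Longrightarrow> W (\<sigma> \<tau>) = M * \<tau>" by metis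
  define \<gamma> where "\<gamma> = g \<circ> \<sigma>"
  have lip: "dist (\<gamma> s) (\<gamma> t) \<le> M * \<bar>s - t\<bar>" if "s \<in> {0..1}" "t \<in> {0..1}" for s t
  proof -
    have "dist (\<gamma> s) (\<gamma> t) \<le> \<bar>W (\<sigma> s) - W (\<sigma> t)\<bar>"
      using Wdiff(2)[of "\<sigma> s" "\<sigma> t"] Wdiff(2)[of "\<sigma> t" "\<sigma> s"] \<sigma>(1)[OF that(1)] \<sigma>(1)[OF that(2)]
      by (cases "\<sigma> s \<le> \<sigma> t") (auto simp: \<gamma>_def dist_commute)
    also have "\<dots> = M * \<bar>s - t\<bar>" using \<sigma>(2)[OF that(1)] \<sigma>(2)[OF that(2)] M by (simp add: abs_mult flip: right_diff_distrib)
    finally show ?thesis .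
  qed
  have \<sigma>01: "\<sigma> 0 = 0" "\<sigma> 1 = 1"
  proof -
    have 0: "(0::real) \<in> {0..1}" and 1: "(1::real) \<in> {0..1}" by auto
    show "\<sigma> 0 = 0" by (rule injW[OF \<sigma>(1)[OF 0] 0]) (simp add: \<sigma>(2)[OF 0] W0)
    show "\<sigma> 1 = 1" by (rule injW[OF \<sigma>(1)[OF 1] 1]) (simp add: \<sigma>(2)[OF 1] M_def)
  qed
  have \<sigma>inj: "s = t" if "s \<in> {0..1}" "t \<in> {0..1}" "\<sigma> s = \<sigma> t" for s t
  proof -
    have "M * s = M * t" using \<sigma>(2)[OF that(1)] \<sigma>(2)[OF that(2)] unfolding that(3) by (rule trans[OF sym])
    then show ?thesis using M by simp
  qed
  have g01': "g 0 = g 1" using inj[of 0 1] by (metis Ints_1 Ints_minus diff_0)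
  have path: "path \<gamma>" unfolding path_def
    by (rule lipschitz_on_continuous_on[of M]) (use lip M in \<open>auto simp: lipschitz_on_def dist_real_def\<close>)
  have "simple_path \<gamma>"
    unfolding simple_path_def loop_free_def
  proof (intro conjI path ballI impI)
    fix s t :: real assume st: "s \<in> {0..1}" "t \<in> {0..1}" "\<gamma> s = \<gamma> t"
    then have "\<sigma> s - \<sigma> t \<in> \<int>" using inj by (simp add: \<gamma>_def)
    then obtain k where k: "\<sigma> s - \<sigma> t = of_int k" by (auto simp: Ints_def)
    have "- 1 \<le> \<sigma> s - \<sigma> t" "\<sigma> s - \<sigma> t \<le> 1" using \<sigma>(1)[OF st(1)] \<sigma>(1)[OF st(2)] by auto
    then have "k \<in> {-1, 0, 1}" unfolding k by auto
    then have "\<sigma> s = \<sigma> t \<or> (\<sigma> s = 0 \<and> \<sigma> t = 1) \<or> (\<sigma> s = 1 \<and> \<sigma> t = 0)"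
      using k \<sigma>(1)[OF st(1)] \<sigma>(1)[OF st(2)] by auto
    then show "s = t \<or> s = 0 \<and> t = 1 \<or> s = 1 \<and> t = 0"
      using \<sigma>inj[OF st(1,2)] \<sigma>inj[OF st(1), of 0] \<sigma>inj[OF st(1), of 1] \<sigma>inj[OF st(2), of 0] \<sigma>inj[OF st(2), of 1] \<sigma>01 by force
  qed
  moreover have "pathfinish \<gamma> = pathstart \<gamma>" by (simp add: pathfinish_def pathstart_def \<gamma>_def \<sigma>01 g01')
  moreover have "path_image \<gamma> = range g"
  proof (intro equalityI subsetI)
    fix z assume "z \<in> range g"
    then obtain s where s: "z = g s" by auto
    define s' where "s' = frac s"
    have s': "s' \<in> {0..1}" "g s = g s'"
    proof -
      show "s' \<in> {0..1}" using frac_lt_1[of s] by (simp add: s'_def)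
      show "g s = g s'" using inj[of s s'] by (simp add: s'_def frac_def)
    qed
    define \<tau> where "\<tau> = W s' / M"
    have "s' - 0 \<le> W s' - W 0" "1 - s' \<le> W 1 - W s'" using s'(1) by (intro Wdiff(1); simp)+
    then have "0 \<le> W s'" "W s' \<le> M" using s'(1) unfolding W0 M_def by auto
    then have \<tau>: "\<tau> \<in> {0..1}" using M by (auto simp: \<tau>_def)
    have "W (\<sigma> \<tau>) = W s'" unfolding \<sigma>(2)[OF \<tau>] using M by (simp add: \<tau>_def)
    then have "\<sigma> \<tau> = s'" by (rule injW[OF \<sigma>(1)[OF \<tau>] s'(1)])
    then have "z = \<gamma> \<tau>" by (simp add: \<gamma>_def s s')
    then show "z \<in> path_image \<gamma>" using \<tau> by (auto simp: path_image_def)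
  qed (auto simp: path_image_def \<gamma>_def)
  ultimately show ?thesis using M lip by (intro exI[of _ \<gamma>] exI[of _ M]) auto
qed

end

text \<open>The unbounded exterior becomes a punctured neighbourhood of \<open>0\<close>, so adding
  \<open>0\<close>, the image of infinity, leaves an open bounded set. The interior without
  \<open>a\<close> stays connected, since removing a point does not disconnect a connected open
  plane set, and becomes unbounded because it accumulates at \<open>a\<close>.\<close>

lemma inside_inversion:
  fixes \<gamma> :: "real \<Rightarrow> complex"
  assumes \<gamma>: "simple_path \<gamma>" "pathfinish \<gamma> = pathstart \<gamma>" and a: "a \<in> inside (path_image \<gamma>)"
  shows "inside (path_image (\<lambda>t. inverse (\<gamma> t - a))) = {w. w = 0 \<or> a + inverse w \<in> outside (path_image \<gamma>)}"
proof (rule inside_eqI[where K = "{w. w \<noteq> 0 \<and> a + inverse w \<in> inside (path_image \<gamma>)}"])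
  let ?I = "inside (path_image \<gamma>)" and ?O = "outside (path_image \<gamma>)"
  have J: "open ?I" "connected ?I" "open ?O" "bounded ?I" "?I \<inter> ?O = {}"
    "?I \<union> ?O = - path_image \<gamma>" using Jordan_inside_outside[OF \<gamma>] by blast+
  have op: "open {w. w \<noteq> 0 \<and> a + inverse w \<in> X}" if "open X" for X
  proof -
    have "open (- {0} \<inter> (\<lambda>w. a + inverse w) -` X)"
      using that by (intro continuous_open_preimage continuous_intros) auto
    then show ?thesis by (simp add: Int_def vimage_def)
  qed
  have "bounded (path_image \<gamma>)" using simple_path_imp_path[OF \<gamma>(1)] by (rule bounded_path_image)
  then have "bounded (?I \<union> path_image \<gamma>)" using J(4) by simp
  then obtain B where B: "B > 0" "\<And>z. z \<in> ?I \<union> path_image \<gamma> \<Longrightarrow> norm (z - a) \<le> B"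
  proof -
    assume *: "\<And>B. B > 0 \<Longrightarrow> (\<And>z. z \<in> ?I \<union> path_image \<gamma> \<Longrightarrow> norm (z - a) \<le> B) \<Longrightarrow> thesis"
    obtain b where b: "b > 0" "\<forall>z\<in>?I \<union> path_image \<gamma>. norm z \<le> b"
      using \<open>bounded (?I \<union> path_image \<gamma>)\<close> bounded_pos by metis
    show thesis
    proof (rule *[of "b + norm a"])
      show "b + norm a > 0" using b by (simp add: add_pos_nonneg)
      fix z assume "z \<in> ?I \<union> path_image \<gamma>"
      then show "norm (z - a) \<le> b + norm a" using b norm_triangle_ineq4[of z a] by force
    qed
  qed
  have near0: "a + inverse w \<in> ?O" if "w \<noteq> 0" "norm w < 1 / B" for w
  proof -
    have "B < norm (inverse w)"
    proof -
      have "B * norm w < 1" "norm w > 0" using that B(1) by (auto simp: field_simps)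
      then show ?thesis by (simp add: norm_inverse inverse_eq_divide norm_divide pos_less_divide_eq)
    qed
    then have "a + inverse w \<notin> ?I \<union> path_image \<gamma>" using B(2)[of "a + inverse w"] by auto
    then show ?thesis using J(6) by blast
  qed
  have eq: "{w. w = 0 \<or> a + inverse w \<in> ?O} = {w. w \<noteq> 0 \<and> a + inverse w \<in> ?O} \<union> ball 0 (1/B)"
  proof (rule set_eqI)
    fix w show "w \<in> {w. w = 0 \<or> a + inverse w \<in> ?O} \<longleftrightarrow> w \<in> {w. w \<noteq> 0 \<and> a + inverse w \<in> ?O} \<union> ball 0 (1/B)"
      using near0[of w] B(1) by (cases "w = 0") auto
  qed
  show "open {w. w = 0 \<or> a + inverse w \<in> ?O}" unfolding eq by (intro open_Un op J(3) open_ball)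
  show "open {w. w \<noteq> 0 \<and> a + inverse w \<in> ?I}" by (rule op[OF J(1)])
  have img: "{w. w \<noteq> 0 \<and> a + inverse w \<in> ?I} = (\<lambda>z. inverse (z - a)) ` (?I - {a})"
  proof (intro equalityI subsetI)
    fix w assume "w \<in> {w. w \<noteq> 0 \<and> a + inverse w \<in> ?I}"
    then show "w \<in> (\<lambda>z. inverse (z - a)) ` (?I - {a})" by (intro image_eqI[of _ _ "a + inverse w"]) auto
  qed auto
  have "connected (?I - {a})" using J(1,2) by (intro connected_open_delete) auto
  then show "connected {w. w \<noteq> 0 \<and> a + inverse w \<in> ?I}"
    unfolding img by (intro connected_continuous_image continuous_intros) auto
  obtain r where r: "r > 0" "ball a r \<subseteq> ?I" using J(1) a open_contains_ball by blast
  show "bounded {w. w = 0 \<or> a + inverse w \<in> ?O}"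
  proof (rule boundedI[of _ "1 / r"])
    fix w assume w: "w \<in> {w. w = 0 \<or> a + inverse w \<in> ?O}"
    show "norm w \<le> 1 / r"
    proof (cases "w = 0")
      case False
      then have "a + inverse w \<notin> ball a r" using w r(2) J(5) by blast
      then have "r \<le> 1 / norm w" by (simp add: dist_norm norm_inverse inverse_eq_divide norm_divide)
      then have "r * norm w \<le> 1" using False by (simp add: pos_le_divide_eq)
      then show ?thesis using r(1) by (simp add: pos_le_divide_eq mult.commute)
    qed (use r in simp)
  qed
  show "\<not> bounded {w. w \<noteq> 0 \<and> a + inverse w \<in> ?I}"
  proof
    assume "bounded {w. w \<noteq> 0 \<and> a + inverse w \<in> ?I}"
    then obtain b where b: "b > 0" "\<And>w. w \<noteq> 0 \<Longrightarrow> a + inverse w \<in> ?I \<Longrightarrow> norm w \<le> b"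
      unfolding bounded_pos by auto
    define w where "w = complex_of_real (b + 2 / r)"
    have bw: "norm w = b + 2 / r" using b r unfolding w_def norm_of_real by simp
    have "1 / r > 0" "2 / r = 1 / r + 1 / r" using r(1) by auto
    then have nw: "norm w > b" "norm w > 1 / r" using b(1) unfolding bw by linarith+
    then have "w \<noteq> 0" using b by auto
    moreover have "a + inverse w \<in> ball a r"
    proof -
      have "1 < r * norm w" using nw(2) r(1) by (simp add: pos_divide_less_eq mult.commute)
      then have "1 / norm w < r" using \<open>w \<noteq> 0\<close> by (simp add: pos_divide_less_eq)
      then show ?thesis by (simp add: dist_norm norm_inverse inverse_eq_divide norm_divide)
    qed
    ultimately show False using b(2)[of w] r(2) nw(1) by force
  qed
  show "{w. w = 0 \<or> a + inverse w \<in> ?O} \<inter> {w. w \<noteq> 0 \<and> a + inverse w \<in> ?I} = {}" using J(5) by blast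
  have pim: "w \<in> path_image (\<lambda>t. inverse (\<gamma> t - a)) \<longleftrightarrow> w \<noteq> 0 \<and> a + inverse w \<in> path_image \<gamma>" for w
  proof
    assume "w \<in> path_image (\<lambda>t. inverse (\<gamma> t - a))"
    then obtain t where t: "t \<in> {0..1}" "w = inverse (\<gamma> t - a)" by (auto simp: path_image_def)
    have "\<gamma> t \<in> path_image \<gamma>" using t(1) by (auto simp: path_image_def)
    then have "\<gamma> t \<noteq> a" using a inside_no_overlap[of "path_image \<gamma>"] by blast
    then show "w \<noteq> 0 \<and> a + inverse w \<in> path_image \<gamma>" using t \<open>\<gamma> t \<in> path_image \<gamma>\<close> by simp
  next
    assume w: "w \<noteq> 0 \<and> a + inverse w \<in> path_image \<gamma>"
    then obtain t where t: "t \<in> {0..1}" "a + inverse w = \<gamma> t" by (auto simp: path_image_def)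
    then have "w = inverse (\<gamma> t - a)" by (metis add_diff_cancel_left' inverse_inverse_eq)
    then show "w \<in> path_image (\<lambda>t. inverse (\<gamma> t - a))" using t by (auto simp: path_image_def)
  qed
  show "{w. w = 0 \<or> a + inverse w \<in> ?O} \<union> {w. w \<noteq> 0 \<and> a + inverse w \<in> ?I} = - path_image (\<lambda>t. inverse (\<gamma> t - a))"
  proof (rule set_eqI)
    fix w
    have "a + inverse w \<in> ?I \<or> a + inverse w \<in> ?O \<longleftrightarrow> a + inverse w \<notin> path_image \<gamma>" using J(6) by blast
    then show "w \<in> {w. w = 0 \<or> a + inverse w \<in> ?O} \<union> {w. w \<noteq> 0 \<and> a + inverse w \<in> ?I} \<longleftrightarrow> w \<in> - path_image (\<lambda>t. inverse (\<gamma> t - a))"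
      using pim[of w] by blast
  qed
qed

subsection \<open>Functionals on complex Banach spaces\<close>

text \<open>Only an inequality is required for scaling, since it passes directly to infima. Equality
  is recovered by scaling back.\<close>

definition sublinear :: "('a::real_vector \<Rightarrow> real) \<Rightarrow> bool" where
  "sublinear p \<longleftrightarrow> (\<forall>x y. p (x + y) \<le> p x + p y) \<and> (\<forall>s>0. \<forall>x. p (s *\<^sub>R x) \<le> s * p x)"

lemma sublinear_add: "sublinear p \<Longrightarrow> p (x + y) \<le> p x + p y"
  and sublinear_scale: "sublinear p \<Longrightarrow> s > 0 \<Longrightarrow> p (s *\<^sub>R x) \<le> s * p x"
  by (auto simp: sublinear_def)

lemma sublinear_scale_eq: "sublinear p \<Longrightarrow> s > 0 \<Longrightarrow> p (s *\<^sub>R x) = s * p x"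
proof (rule antisym)
  assume p: "sublinear p" and s: "s > 0"
  show "p (s *\<^sub>R x) \<le> s * p x" using p s by (rule sublinear_scale)
  have "p ((1/s) *\<^sub>R (s *\<^sub>R x)) \<le> (1/s) * p (s *\<^sub>R x)" using p s by (intro sublinear_scale) auto
  then show "s * p x \<le> p (s *\<^sub>R x)" using s by (simp add: field_simps)
qed

lemma sublinear_0: assumes "sublinear p" shows "p 0 = 0"
  using sublinear_scale_eq[OF assms, of 2 0] by simp

lemma sublinear_minus: "sublinear p \<Longrightarrow> - p (- x) \<le> p x"
  using sublinear_add[of p x "- x"] sublinear_0[of p] by simp

text \<open>The infimum lowers \<open>p\<close> as far as needed to make it additive along
  \<open>x\<close>: taking \<open>t = 1\<close> at \<open>- x\<close> gives \<open>- p x\<close>. It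
  stays finite because \<open>- p (- y)\<close> bounds it from below. This is the one-step
  modification in the proof of the Hahn-Banach theorem by minimal sublinear functionals.\<close>

lemma sublinear_tilt:
  fixes p :: "'a::real_vector \<Rightarrow> real"
  assumes p: "sublinear p"
  defines "q \<equiv> \<lambda>x y. INF t\<in>{0..}. p (y + t *\<^sub>R x) - t * p x"
  shows "sublinear (q x)" "q x y \<le> p y" "q x (- x) \<le> - p x"
proof -
  have qd: "q x y = (INF t\<in>{0..}. p (y + t *\<^sub>R x) - t * p x)" for y by (simp add: q_def)
  have pt: "p (t *\<^sub>R x) = t * p x" if "t \<ge> 0" for t
    using that sublinear_scale_eq[OF p] sublinear_0[OF p] by (cases "t = 0") auto
  have lower: "- p (- y) \<le> p (y + t *\<^sub>R x) - t * p x" if "t \<ge> 0" for t y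
    using sublinear_add[OF p, of "y + t *\<^sub>R x" "- y"] pt[OF that] by simp
  have bdd: "bdd_below ((\<lambda>t. p (y + t *\<^sub>R x) - t * p x) ` {0..})" for y
    using lower by (intro bdd_belowI[of _ "- p (- y)"]) auto
  have le: "q x y \<le> p (y + t *\<^sub>R x) - t * p x" if "t \<ge> 0" for t y
    unfolding qd using that by (intro cINF_lower bdd) auto
  show "q x y \<le> p y" using le[of 0 y] by simp
  show "q x (- x) \<le> - p x" using le[of 1 "- x"] sublinear_0[OF p] by simp
  show "sublinear (q x)"
    unfolding sublinear_def
  proof (intro conjI allI impI)
    fix y z
    show "q x (y + z) \<le> q x y + q x z"
    proof -
      have "q x (y + z) - (p (z + u *\<^sub>R x) - u * p x) \<le> q x y" if u: "u \<ge> 0" for u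
        unfolding qd[of y]
      proof (rule cINF_greatest)
        fix t :: real assume t: "t \<in> {0..}"
        have "q x (y + z) \<le> p ((y + z) + (t + u) *\<^sub>R x) - (t + u) * p x" using t u by (intro le) auto
        also have "(y + z) + (t + u) *\<^sub>R x = (y + t *\<^sub>R x) + (z + u *\<^sub>R x)" by (simp add: scaleR_add_left)
        finally show "q x (y + z) - (p (z + u *\<^sub>R x) - u * p x) \<le> p (y + t *\<^sub>R x) - t * p x"
          using sublinear_add[OF p, of "y + t *\<^sub>R x" "z + u *\<^sub>R x"] by (simp add: algebra_simps)
      qed simp
      then have "q x (y + z) - q x y \<le> q x z"
        unfolding qd[of z] by (intro cINF_greatest) (auto simp: algebra_simps)
      then show ?thesis by simp
    qed
  next
    fix s :: real and y assume s: "s > 0"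
    have "q x (s *\<^sub>R y) / s \<le> q x y"
      unfolding qd[of y]
    proof (rule cINF_greatest)
      fix t :: real assume t: "t \<in> {0..}"
      have "q x (s *\<^sub>R y) \<le> p (s *\<^sub>R y + (s * t) *\<^sub>R x) - (s * t) * p x" using t s by (intro le) auto
      also have "s *\<^sub>R y + (s * t) *\<^sub>R x = s *\<^sub>R (y + t *\<^sub>R x)" by (simp add: scaleR_add_right)
      also have "p \<dots> = s * p (y + t *\<^sub>R x)" by (rule sublinear_scale_eq[OF p s])
      finally have "q x (s *\<^sub>R y) \<le> (p (y + t *\<^sub>R x) - t * p x) * s" by (simp add: algebra_simps)
      then show "q x (s *\<^sub>R y) / s \<le> p (y + t *\<^sub>R x) - t * p x" using s by (simp add: pos_divide_le_eq)
    qed simp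
    then show "q x (s *\<^sub>R y) \<le> s * q x y" using s by (simp add: pos_divide_le_eq mult.commute)
  qed
qed

text \<open>Zorn's lemma applies because the pointwise infimum of a chain below \<open>p\<close> is
  bounded below by \<open>- p (- y)\<close> and is again sublinear.\<close>

lemma ex_minimal_sublinear:
  fixes p :: "'a::real_vector \<Rightarrow> real"
  assumes p: "sublinear p"
  shows "\<exists>m. sublinear m \<and> (\<forall>y. m y \<le> p y) \<and> (\<forall>q. sublinear q \<and> (\<forall>y. q y \<le> m y) \<longrightarrow> q = m)"
proof -
  define A where "A = {q. sublinear q \<and> (\<forall>y. q y \<le> p y)}"
  \<comment> \<open>The order is reversed, so the maximal element delivered by Zorn's lemma is a
    minimal functional.\<close>
  define P where "P = (\<lambda>(q::'a \<Rightarrow> real) r. r \<le> q)"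
  have "\<exists>m\<in>A. \<forall>a\<in>A. P m a \<longrightarrow> a = m"
  proof (rule predicate_Zorn)
    show "partial_order_on A (relation_of P A)"
      by (rule partial_order_on_relation_ofI) (auto simp: P_def)
    fix C assume C: "C \<in> Chains (relation_of P A)"
    then have CA: "C \<subseteq> A" by (auto simp: Chains_def relation_of_def)
    have lin: "q \<le> r \<or> r \<le> q" if "q \<in> C" "r \<in> C" for q r
      using C that by (auto simp: Chains_def relation_of_def P_def)
    show "\<exists>u\<in>A. \<forall>a\<in>C. P a u"
    proof (cases "C = {}")
      case True
      then show ?thesis using p by (auto simp: A_def)
    next
      case False
      define u where "u = (\<lambda>y. INF q\<in>C. q y)"
      have qA: "sublinear q" "q y \<le> p y" if "q \<in> C" for q y using CA that by (auto simp: A_def)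
      have "- p (- y) \<le> q y" if "q \<in> C" for q y
        using sublinear_minus[OF qA(1)[OF that], of y] qA(2)[OF that, of "- y"] by simp
      then have bdd: "bdd_below ((\<lambda>q. q y) ` C)" for y by (intro bdd_belowI[of _ "- p (- y)"]) auto
      have uq: "u y \<le> q y" if "q \<in> C" for q y unfolding u_def using that bdd by (intro cINF_lower)
      have "sublinear u"
        unfolding sublinear_def
      proof (intro conjI allI impI)
        fix y z
        \<comment> \<open>Subadditivity of an infimum fails for arbitrary families. In a chain, the
          smaller of \<open>q\<close> and \<open>r\<close> can be used at both arguments.\<close>
        have *: "u (y + z) - r z \<le> q y" if qr: "q \<in> C" "r \<in> C" for q r
        proof (cases "q \<le> r")
          case True
          have "u (y + z) \<le> q y + q z" using uq[OF qr(1), of "y + z"] sublinear_add[OF qA(1)[OF qr(1)], of y z] by linarith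
          then show ?thesis using True by (simp add: le_fun_def) (smt (verit))
        next
          case False
          then have "r \<le> q" using lin qr by blast
          have "u (y + z) \<le> r y + r z" using uq[OF qr(2), of "y + z"] sublinear_add[OF qA(1)[OF qr(2)], of y z] by linarith
          then show ?thesis using \<open>r \<le> q\<close> by (simp add: le_fun_def) (smt (verit))
        qed
        have "u (y + z) - r z \<le> u y" if "r \<in> C" for r
          unfolding u_def[of] using * that False by (intro cINF_greatest) (auto simp: u_def)
        then have "u (y + z) - u y \<le> u z"
          using False unfolding u_def by (intro cINF_greatest) (auto simp: algebra_simps)
        then show "u (y + z) \<le> u y + u z" by simp
      next
        fix s :: real and y assume s: "s > 0"
        have "u (s *\<^sub>R y) / s \<le> q y" if "q \<in> C" for q
          using uq[OF that, of "s *\<^sub>R y"] sublinear_scale[OF qA(1)[OF that] s, of y] s by (simp add: pos_divide_le_eq mult.commute)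
        then have "u (s *\<^sub>R y) / s \<le> u y" using False unfolding u_def by (intro cINF_greatest) auto
        then show "u (s *\<^sub>R y) \<le> s * u y" using s by (simp add: pos_divide_le_eq mult.commute)
      qed
      moreover have "u y \<le> p y" for y using False uq qA(2) order.trans by blast
      ultimately have "u \<in> A" by (simp add: A_def)
      then show ?thesis using uq by (auto simp: P_def le_fun_def)
    qed
  qed
  then obtain m where m: "m \<in> A" "\<And>a. a \<in> A \<Longrightarrow> a \<le> m \<Longrightarrow> a = m" by (auto simp: P_def)
  have "q = m" if q: "sublinear q" "\<forall>y. q y \<le> m y" for q
  proof (rule m(2))
    show "q \<le> m" using q(2) by (simp add: le_fun_def)
    have "q y \<le> p y" for y using q(2) m(1) order.trans unfolding A_def by blast
    then show "q \<in> A" using q(1) by (simp add: A_def)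
  qed
  then show ?thesis using m(1) by (intro exI[of _ m]) (auto simp: A_def)
qed

text \<open>A minimal functional coincides with each of its tilts, hence is odd, hence linear.
  Taking it below the norm tilted along \<open>x\<close> forces its value at \<open>- x\<close> to
  be at most \<open>- norm x\<close>, which gives equality at \<open>x\<close>.\<close>

lemma real_norming_functional:
  fixes x :: "'a::real_normed_vector"
  shows "\<exists>g :: 'a \<Rightarrow> real. linear g \<and> (\<forall>y. g y \<le> norm y) \<and> g x = norm x"
proof -
  have n: "sublinear (norm :: 'a \<Rightarrow> real)" by (auto simp: sublinear_def norm_triangle_ineq)
  note t = sublinear_tilt[OF n, where x = x]
  obtain m where m: "sublinear m" "\<And>y. m y \<le> (INF t\<in>{0..}. norm (y + t *\<^sub>R x) - t * norm x)"
     "\<And>q. sublinear q \<Longrightarrow> (\<And>y. q y \<le> m y) \<Longrightarrow> q = m"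
    using ex_minimal_sublinear[OF t(1)] by blast
  have odd: "m (- z) = - m z" for z
  proof (rule antisym)
    have eq: "(\<lambda>y. INF t\<in>{0..}. m (y + t *\<^sub>R z) - t * m z) = m"
      by (rule m(3)[OF sublinear_tilt(1)[OF m(1)] sublinear_tilt(2)[OF m(1)]])
    show "m (- z) \<le> - m z" using sublinear_tilt(3)[OF m(1), where x = z] unfolding fun_cong[OF eq, of "- z"] .
    show "- m z \<le> m (- z)" using sublinear_minus[OF m(1), of "- z"] by simp
  qed
  have add: "m (y + z) = m y + m z" for y z
    using sublinear_add[OF m(1), of y z] sublinear_add[OF m(1), of "- y" "- z"] odd[of "y + z"] odd[of y] odd[of z] by simp
  have scale: "m (s *\<^sub>R y) = s *\<^sub>R m y" for s y
  proof (cases s "0::real" rule: linorder_cases)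
    case less
    then show ?thesis using sublinear_scale_eq[OF m(1), of "- s" y] odd[of "s *\<^sub>R y"] by simp
  next
    case equal then show ?thesis using sublinear_0[OF m(1)] by simp
  next
    case greater then show ?thesis using sublinear_scale_eq[OF m(1)] by simp
  qed
  have "linear m" using add scale by (intro linearI)
  moreover have le: "m y \<le> norm y" for y using m(2)[of y] t(2)[where y = y] by linarith
  moreover have "m x = norm x" using m(2)[of "- x"] t(3) odd[of x] le[of x] by linarith
  ultimately show ?thesis by blast
qed

text \<open>The bound \<open>1\<close> on the functional is part of the notion, so that estimates
  obtained for all functionals are uniform and return as estimates of the norm.\<close>

definition cfunctional :: "('b::complex_banach \<Rightarrow> complex) \<Rightarrow> bool" where
  "cfunctional \<phi> \<longleftrightarrow> (\<forall>x y. \<phi> (x + y) = \<phi> x + \<phi> y) \<and> (\<forall>c x. \<phi> (c *\<^sub>C x) = c * \<phi> x) \<and> (\<forall>x. norm (\<phi> x) \<le> norm x)"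

lemma scaleC_simps [simp]:
  fixes x :: "'b::complex_banach"
  shows "1 *\<^sub>C x = x" "0 *\<^sub>C x = 0" "c *\<^sub>C (0::'b) = 0"
  using scaleC_of_real[of 1 x] scaleC_of_real[of 0 x] norm_scaleC[of c "0::'b"] by auto

lemma scaleC_scaleR: "c *\<^sub>C (r *\<^sub>R (x::'b::complex_banach)) = r *\<^sub>R (c *\<^sub>C x)"
  by (simp add: scaleC_of_real[symmetric] scaleC_scaleC mult.commute)

text \<open>This is the complexification of Bohnenblust and Sobczyk:
  \<open>g y - \<i> * g (\<i> y)\<close> is complex linear, and rotating \<open>y\<close> so that
  its value becomes real and nonnegative reduces the norm bound to that of \<open>g\<close>. At
  \<open>x\<close> the real part already exhausts the norm, so the imaginary part is
  \<open>0\<close>.\<close>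

lemma complex_norming_functional:
  fixes x :: "'b::complex_banach"
  shows "\<exists>\<phi>. cfunctional \<phi> \<and> \<phi> x = of_real (norm x)"
proof -
  obtain g :: "'b \<Rightarrow> real" where g: "linear g" "\<And>y. g y \<le> norm y" "g x = norm x"
    using real_norming_functional[of x] by blast
  define \<phi> where "\<phi> = (\<lambda>y. Complex (g y) (- g (\<i> *\<^sub>C y)))"
  have add: "\<phi> (y + z) = \<phi> y + \<phi> z" for y z
    by (simp add: \<phi>_def scaleC_add_right linear_add[OF g(1)] complex_eq_iff)
  have sc: "\<phi> (c *\<^sub>C y) = c * \<phi> y" for c y
  proof -
    have 1: "c *\<^sub>C y = Re c *\<^sub>R y + Im c *\<^sub>R (\<i> *\<^sub>C y)"
    proof -
      have "c *\<^sub>C y = (of_real (Re c) + of_real (Im c) * \<i>) *\<^sub>C y"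
        by (rule arg_cong[where f = "\<lambda>c. c *\<^sub>C y"]) (simp add: complex_eq_iff)
      then show ?thesis by (simp only: scaleC_add_left scaleC_scaleC[symmetric] scaleC_of_real)
    qed
    have 2: "\<i> *\<^sub>C (\<i> *\<^sub>C y) = - y"
      using scaleC_of_real[of "-1" y] by (simp add: scaleC_scaleC)
    show ?thesis
      unfolding 1 by (simp add: \<phi>_def scaleC_add_right scaleC_scaleR 2 linear_add[OF g(1)] linear_cmul[OF g(1)] linear_neg[OF g(1)] linear_diff[OF g(1)] complex_eq_iff)
  qed
  have nb: "norm (\<phi> y) \<le> norm y" for y
  proof (cases "\<phi> y = 0")
    case False
    define c where "c = cnj (\<phi> y) / norm (\<phi> y)"
    have c: "norm c = 1" using False by (simp add: c_def norm_divide)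
    have "c * \<phi> y = of_real (norm (\<phi> y))"
      using complex_norm_square[of "\<phi> y"] False by (simp add: c_def field_simps power2_eq_square)
    then have "norm (\<phi> y) = Re (\<phi> (c *\<^sub>C y))" by (simp add: sc)
    also have "\<dots> = g (c *\<^sub>C y)" by (simp add: \<phi>_def)
    also have "\<dots> \<le> norm y" using g(2)[of "c *\<^sub>C y"] c by (simp add: norm_scaleC)
    finally show ?thesis .
  qed simp
  have "Re (\<phi> x) = norm x" by (simp add: \<phi>_def g(3))
  moreover have "Im (\<phi> x) = 0"
  proof -
    have "(norm x)\<^sup>2 + (Im (\<phi> x))\<^sup>2 \<le> (norm x)\<^sup>2"
      using power_mono[OF nb[of x], of 2] \<open>Re (\<phi> x) = norm x\<close> by (simp add: cmod_power2)
    then show ?thesis by simp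
  qed
  ultimately have "\<phi> x = of_real (norm x)" by (simp add: complex_eq_iff)
  then show ?thesis using add sc nb by (auto simp: cfunctional_def)
qed

lemma cfunctional_bounded_linear: "cfunctional \<phi> \<Longrightarrow> bounded_linear \<phi>"
  unfolding cfunctional_def
proof (intro bounded_linear_intro[of _ 1])
  assume \<phi>: "(\<forall>x y. \<phi> (x + y) = \<phi> x + \<phi> y) \<and> (\<forall>c x. \<phi> (c *\<^sub>C x) = c * \<phi> x) \<and> (\<forall>x. norm (\<phi> x) \<le> norm x)"
  show "\<phi> (r *\<^sub>R x) = r *\<^sub>R \<phi> x" for r x
  proof -
    have "\<phi> (of_real r *\<^sub>C x) = of_real r * \<phi> x" using \<phi> by blast
    then show ?thesis by (simp only: scaleC_of_real scaleR_conv_of_real)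
  qed
qed auto

lemma zero_if_cfunctionals_zero:
  fixes x :: "'b::complex_banach"
  assumes "\<And>\<phi>. cfunctional \<phi> \<Longrightarrow> \<phi> x = 0" shows "x = 0"
  using complex_norming_functional[of x] assms by (metis norm_eq_zero of_real_eq_0_iff)

lemma norm_le_if_cfunctionals:
  fixes x :: "'b::complex_banach"
  assumes "\<And>\<phi>. cfunctional \<phi> \<Longrightarrow> norm (\<phi> x) \<le> B" shows "norm x \<le> B"
  using complex_norming_functional[of x] assms by (metis norm_of_real abs_norm_cancel)

lemma cfunctionalD:
  assumes "cfunctional \<phi>"
  shows "\<phi> (x + y) = \<phi> x + \<phi> y" "\<phi> (c *\<^sub>C x) = c * \<phi> x" "norm (\<phi> x) \<le> norm x" "\<phi> 0 = 0" "\<phi> (x - y) = \<phi> x - \<phi> y"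
    "\<phi> (sum f A) = (\<Sum>i\<in>A. \<phi> (f i))"
  using assms linear_0 linear_diff linear_sum bounded_linear.linear[OF cfunctional_bounded_linear[OF assms]]
  by (auto simp: cfunctional_def)

text \<open>Cauchy's estimates make the tail a geometric series of ratio at most \<open>1/2\<close>,
  whence the factor \<open>2\<close>. The function enters only through its maximum \<open>M\<close>
  on the circle, so the bound is the same for all functionals applied to one vector-valued
  function.\<close>

lemma taylor_remainder_bound:
  fixes h :: "complex \<Rightarrow> complex"
  assumes h: "h holomorphic_on ball p R" and r: "0 < r" "r < R"
    and M: "\<And>z. norm (z - p) = r \<Longrightarrow> norm (h z) \<le> M" and z: "norm (z - p) \<le> r / 2"
  shows "norm (h z - (\<Sum>n\<le>N. (z - p) ^ n * ((deriv ^^ n) h p / fact n))) \<le> 2 * M * (norm (z - p) / r) ^ Suc N"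
proof -
  define c where "c = (\<lambda>n. (deriv ^^ n) h p / fact n)"
  define s where "s = norm (z - p) / r"
  have s: "0 \<le> s" "s \<le> 1/2" using z r by (auto simp: s_def)
  have "norm (h (p + of_real r)) \<le> M" using r by (intro M) simp
  then have "M \<ge> 0" using norm_ge_zero order.trans by blast
  have "h holomorphic_on ball p r" "continuous_on (cball p r) h"
    using h r by (auto intro!: holomorphic_on_imp_continuous_on intro: holomorphic_on_subset)
  then have cn: "norm (c n) \<le> M / r ^ n" for n
    using Cauchy_inequality[of h p r M n] M r by (auto simp: c_def norm_divide divide_le_eq norm_minus_commute mult.commute)
  have tm: "norm (c n * (z - p) ^ n) \<le> M * s ^ n" for n
  proof -
    have "norm (c n * (z - p) ^ n) \<le> M / r ^ n * norm (z - p) ^ n"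
      unfolding norm_mult norm_power using cn by (intro mult_right_mono) auto
    then show ?thesis by (simp add: s_def power_divide)
  qed
  have "(\<lambda>n. c n * (z - p) ^ n) sums h z"
    using holomorphic_power_series[OF h, of z] z r by (auto simp: c_def dist_norm norm_minus_commute)
  then have sm: "summable (\<lambda>n. c n * (z - p) ^ n)" "h z = (\<Sum>n. c n * (z - p) ^ n)" by (auto simp: sums_iff)
  have "h z - (\<Sum>n\<le>N. (z - p) ^ n * c n) = (\<Sum>n. c (n + Suc N) * (z - p) ^ (n + Suc N))"
    unfolding sm(2) suminf_split_initial_segment[OF sm(1), of "Suc N"] by (simp add: lessThan_Suc_atMost mult.commute)
  also have "norm \<dots> \<le> (\<Sum>n. M * s ^ Suc N * s ^ n)"
  proof (rule norm_suminf_le)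
    show "norm (c (n + Suc N) * (z - p) ^ (n + Suc N)) \<le> M * s ^ Suc N * s ^ n" for n
      using tm[of "n + Suc N"] by (simp add: power_add mult_ac)
    show "summable (\<lambda>n. M * s ^ Suc N * s ^ n)" using s by (intro summable_mult summable_geometric) auto
  qed
  also have "\<dots> = M * s ^ Suc N * (1 / (1 - s))"
    using s by (subst suminf_mult) (auto intro!: summable_geometric simp: suminf_geometric)
  also have "\<dots> \<le> M * s ^ Suc N * 2"
    using s \<open>M \<ge> 0\<close> by (intro mult_left_mono) (auto simp: field_simps)
  finally show ?thesis by (simp add: c_def s_def mult_ac)
qed

text \<open>Holomorphy is known only after applying functionals. The coefficients are defined as
  vector-valued Cauchy integrals, which needs only continuity of \<open>f\<close>; functionals send
  them to the scalar Taylor coefficients, and the uniform remainder bound becomes a bound in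
  norm.\<close>

lemma cfunctional_taylor:
  fixes f :: "complex \<Rightarrow> 'b::complex_banach"
  assumes cont: "continuous_on (ball p R) f" and R: "R > 0"
    and hol: "\<And>\<phi>. cfunctional \<phi> \<Longrightarrow> (\<lambda>z. \<phi> (f z)) holomorphic_on ball p R"
  shows "\<exists>a. \<forall>N. ((\<lambda>z. inverse ((z - p) ^ N) *\<^sub>C (f z - (\<Sum>n\<le>N. (z - p) ^ n *\<^sub>C a n))) \<longlongrightarrow> 0) (at p)"
proof -
  define r where "r = R / 2"
  have r: "0 < r" "r < R" using R by (auto simp: r_def)
  define e where "e = (\<lambda>t::real. of_real r * exp (2 * of_real pi * \<i> * of_real t))"
  have ne: "norm (e t) = r" for t using r by (simp add: e_def norm_mult)
  have e0: "e t \<noteq> 0" for t using ne[of t] r by auto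
  have circ: "circlepath p r t = p + e t" for t by (simp add: circlepath e_def)
  have conte: "continuous_on {0..1} e" unfolding e_def by (intro continuous_intros)
  have pe: "p + e t \<in> ball p R" for t using ne r by (simp add: dist_norm)
  have contf: "continuous_on {0..1} (\<lambda>t. f (p + e t))"
    by (rule continuous_on_compose2[OF cont]) (use pe in \<open>auto intro!: continuous_intros conte\<close>)
  have contC: "continuous_on {0..1} (\<lambda>t. inverse (e t ^ n) *\<^sub>C f (p + e t))" for n
  proof -
    have "bounded_bilinear (scaleC :: complex \<Rightarrow> 'b \<Rightarrow> 'b)"
    proof
      show "\<exists>K. \<forall>a b. norm (a *\<^sub>C (b::'b)) \<le> norm a * norm b * K" by (rule exI[of _ 1]) (simp add: norm_scaleC)
      show "(r *\<^sub>R a) *\<^sub>C b = r *\<^sub>R (a *\<^sub>C (b::'b))" for r a b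
        by (simp only: scaleR_conv_of_real scaleC_scaleC[symmetric]) (simp only: scaleC_of_real)
    qed (simp_all only: scaleC_add_left scaleC_add_right scaleC_scaleR)
    moreover have "continuous_on {0..1} (\<lambda>t. inverse (e t ^ n))"
      by (intro continuous_intros conte) (use e0 in auto)
    ultimately show ?thesis using contf by (rule bounded_bilinear.continuous_on)
  qed
  \<comment> \<open>In Cauchy's formula the kernel has exponent \<open>Suc n\<close>, but
    \<open>dz\<close> contributes a factor \<open>2 * pi * \<i> * e t\<close>, which cancels one
    power and the constant in front.\<close>
  define a where "a = (\<lambda>n. integral {0..1} (\<lambda>t. inverse (e t ^ n) *\<^sub>C f (p + e t)))"
  have coeff: "\<phi> (a n) = (deriv ^^ n) (\<lambda>z. \<phi> (f z)) p / fact n" if \<phi>: "cfunctional \<phi>" for \<phi> n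
  proof -
    let ?h = "\<lambda>z. \<phi> (f z)"
    have "\<phi> (a n) = integral {0..1} (\<phi> \<circ> (\<lambda>t. inverse (e t ^ n) *\<^sub>C f (p + e t)))"
      unfolding a_def using integral_linear[OF integrable_continuous_interval[OF contC] cfunctional_bounded_linear[OF \<phi>]] by simp
    also have "\<dots> = integral {0..1} (\<lambda>t. ?h (p + e t) / e t ^ n)"
      by (simp add: o_def cfunctionalD(2)[OF \<phi>] field_simps)
    finally have 1: "\<phi> (a n) = integral {0..1} (\<lambda>t. ?h (p + e t) / e t ^ n)" .
    have "?h holomorphic_on ball p r" "continuous_on (cball p r) ?h"
      using hol[OF \<phi>] r by (auto intro!: holomorphic_on_imp_continuous_on intro: holomorphic_on_subset)
    then have "((\<lambda>u. ?h u / (u - p) ^ Suc n) has_contour_integral (2 * pi * \<i>) / fact n * (deriv ^^ n) ?h p) (circlepath p r)"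
      using Cauchy_has_contour_integral_higher_derivative_circlepath[of p r ?h p n] r by simp
    then have "((\<lambda>t. ?h (p + e t) / e t ^ Suc n * (2 * pi * \<i> * e t)) has_integral (2 * pi * \<i>) / fact n * (deriv ^^ n) ?h p) {0..1}"
      unfolding has_contour_integral_def
      by (rule has_integral_eq[rotated]) (simp add: vector_derivative_circlepath01 circ e_def mult_ac)
    then have "((\<lambda>t. (?h (p + e t) / e t ^ Suc n * (2 * pi * \<i> * e t)) / (2 * pi * \<i>)) has_integral ((2 * pi * \<i>) / fact n * (deriv ^^ n) ?h p) / (2 * pi * \<i>)) {0..1}"
      by (rule has_integral_divide)
    then have "((\<lambda>t. ?h (p + e t) / e t ^ n) has_integral (deriv ^^ n) ?h p / fact n) {0..1}"
      using e0 by (simp add: field_simps)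
    then show ?thesis unfolding 1 by (rule integral_unique)
  qed
  have "compact ((\<lambda>t. f (p + e t)) ` {0..1})" using contf by (rule compact_continuous_image) simp
  then have "bounded ((\<lambda>t. f (p + e t)) ` {0..1})" by (rule compact_imp_bounded)
  then obtain M where M: "M > 0" "\<And>t. t \<in> {0..1} \<Longrightarrow> norm (f (p + e t)) \<le> M"
    by (auto simp: bounded_pos)
  have Mz: "norm (f z) \<le> M" if z: "norm (z - p) = r" for z
  proof -
    have "z \<in> path_image (circlepath p r)" using z r by (simp add: path_image_circlepath dist_norm norm_minus_commute)
    then obtain t where "t \<in> {0..1}" "z = p + e t" by (auto simp: path_image_def circ)
    then show ?thesis using M by simp
  qed
  have rem: "norm (f z - (\<Sum>n\<le>N. (z - p) ^ n *\<^sub>C a n)) \<le> 2 * M * (norm (z - p) / r) ^ Suc N"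
    if z: "norm (z - p) \<le> r / 2" for z N
  proof (rule norm_le_if_cfunctionals)
    fix \<phi> :: "'b \<Rightarrow> complex" assume \<phi>: "cfunctional \<phi>"
    have "norm (\<phi> (f z)) \<le> M" if "norm (z - p) = r" for z
      using cfunctionalD(3)[OF \<phi>, of "f z"] Mz[OF that] by linarith
    from taylor_remainder_bound[OF hol[OF \<phi>] r this z, of N]
    show "norm (\<phi> (f z - (\<Sum>n\<le>N. (z - p) ^ n *\<^sub>C a n))) \<le> 2 * M * (norm (z - p) / r) ^ Suc N"
      by (simp only: cfunctionalD[OF \<phi>] coeff[OF \<phi>])
  qed
  have "((\<lambda>z. inverse ((z - p) ^ N) *\<^sub>C (f z - (\<Sum>n\<le>N. (z - p) ^ n *\<^sub>C a n))) \<longlongrightarrow> 0) (at p)" for N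
  proof (rule Lim_null_comparison)
    have "norm (inverse ((z - p) ^ N) *\<^sub>C (f z - (\<Sum>n\<le>N. (z - p) ^ n *\<^sub>C a n))) \<le> (2 * M / r ^ Suc N) * norm (z - p)"
      if z: "z \<noteq> p" "dist z p < r / 2" for z
    proof -
      have nz: "norm (z - p) ^ N > 0" using z by simp
      have "norm (inverse ((z - p) ^ N) *\<^sub>C (f z - (\<Sum>n\<le>N. (z - p) ^ n *\<^sub>C a n))) \<le> inverse (norm (z - p) ^ N) * (2 * M * (norm (z - p) / r) ^ Suc N)"
        unfolding norm_scaleC norm_inverse norm_power using z by (intro mult_left_mono rem) (auto simp: dist_norm)
      also have "\<dots> = (2 * M / r ^ Suc N) * norm (z - p)"
        using nz by (simp add: power_divide field_simps)
      finally show ?thesis .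
    qed
    then show "\<forall>\<^sub>F z in at p. norm (inverse ((z - p) ^ N) *\<^sub>C (f z - (\<Sum>n\<le>N. (z - p) ^ n *\<^sub>C a n))) \<le> (2 * M / r ^ Suc N) * norm (z - p)"
      unfolding eventually_at using r by (intro exI[of _ "r/2"]) auto
    have "((\<lambda>z. (2 * M / r ^ Suc N) * norm (z - p)) \<longlongrightarrow> (2 * M / r ^ Suc N) * norm (p - p)) (at p)"
      by (intro tendsto_intros)
    then show "((\<lambda>z. (2 * M / r ^ Suc N) * norm (z - p)) \<longlongrightarrow> 0) (at p)" by simp
  qed
  then show ?thesis by blast
qed

text \<open>A nonconstant \<open>h\<close> with \<open>h p = 0\<close> factors as
  \<open>(z - p) ^ n * g z\<close> with \<open>g p \<noteq> 0\<close>, which contradicts flatness of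
  order \<open>n\<close>.\<close>

lemma flat_holomorphic_zero:
  fixes h :: "complex \<Rightarrow> complex"
  assumes h: "h holomorphic_on ball p R" and R: "R > 0"
    and flat: "\<And>N. ((\<lambda>z. inverse ((z - p) ^ N) * h z) \<longlongrightarrow> 0) (at p)" and z: "z \<in> ball p R"
  shows "h z = 0"
proof -
  have p: "p \<in> ball p R" using R by simp
  have "isCont h p" using holomorphic_on_imp_continuous_on[OF h] p by (simp add: continuous_on_eq_continuous_at)
  then have "(h \<longlongrightarrow> h p) (at p)" by (simp add: isCont_def)
  moreover have "(h \<longlongrightarrow> 0) (at p)" using flat[of 0] by simp
  ultimately have hp: "h p = 0" using tendsto_unique[of "at p"] by simp
  have "h constant_on ball p R"
  proof (rule ccontr)
    assume "\<not> h constant_on ball p R"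
    then obtain g r n where g: "0 < n" "0 < r" "ball p r \<subseteq> ball p R" "g holomorphic_on ball p r"
      "\<And>w. w \<in> ball p r \<Longrightarrow> h w = (w - p) ^ n * g w" "\<And>w. w \<in> ball p r \<Longrightarrow> g w \<noteq> 0"
      using holomorphic_factor_zero_nonconstant[OF h open_ball connected_ball p hp] by metis
    have "isCont g p" using holomorphic_on_imp_continuous_on[OF g(4)] g(2) by (simp add: continuous_on_eq_continuous_at)
    then have "(g \<longlongrightarrow> g p) (at p)" by (simp add: isCont_def)
    moreover have "(g \<longlongrightarrow> 0) (at p)"
    proof (rule Lim_transform_eventually[OF flat[of n]])
      show "\<forall>\<^sub>F z in at p. inverse ((z - p) ^ n) * h z = g z"
        unfolding eventually_at using g(2,5) by (intro exI[of _ r]) (auto simp: dist_commute)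
    qed
    ultimately have "g p = 0" using tendsto_unique[of "at p"] by simp
    then show False using g(2,6) by auto
  qed
  then show ?thesis using hp p z unfolding constant_on_def by metis
qed

subsection \<open>Charts of the Riemann sphere\<close>

text \<open>This is the inverse of the coordinate \<open>1 / (z - a)\<close>. The choice
  \<open>a = 0\<close> is the standard coordinate at infinity, while an \<open>a\<close> inside a
  curve makes the exterior correspond to a bounded set.\<close>

definition inv_chart :: "complex \<Rightarrow> complex \<Rightarrow> sphere_point" where
  "inv_chart a u = (if u = 0 then None else Some (a + inverse u))"

text \<open>It inverts \<open>local_coord P\<close> near \<open>P\<close> and turns limits at a
  point of the sphere into limits at \<open>0\<close> in the plane.\<close>

definition chart :: "sphere_point \<Rightarrow> complex \<Rightarrow> sphere_point" where
  "chart P u = (case P of Some p \<Rightarrow> Some (p + u) | None \<Rightarrow> inv_chart 0 u)"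

lemma chart_simps: "chart (Some p) u = Some (p + u)" "chart None u = inv_chart 0 u"
  by (simp_all add: chart_def)

lemma local_coord_chart [simp]: "local_coord P (chart P u) = u"
  by (cases P) (simp_all add: chart_def inv_chart_def)

lemma chart_0 [simp]: "chart P 0 = P"
  by (cases P) (simp_all add: chart_def inv_chart_def)

lemma chart_inj: "chart P u = P \<Longrightarrow> u = 0"
  by (cases P) (auto simp: chart_def inv_chart_def split: if_splits)

lemma openin_sphere_iff:
  "openin riemann_sphere V \<longleftrightarrow> open (Some -` V) \<and> (None \<in> V \<longrightarrow> (\<exists>B>0. \<forall>z. B < norm z \<longrightarrow> Some z \<in> V))"
proof
  assume "openin riemann_sphere V"
  then consider U where "open U" "V = Some ` U" | C where "compact C" "V = insert None (Some ` (UNIV - C))"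
    unfolding openin_Alexandroff_compactification by auto
  then show "open (Some -` V) \<and> (None \<in> V \<longrightarrow> (\<exists>B>0. \<forall>z. B < norm z \<longrightarrow> Some z \<in> V))"
  proof cases
    case 1
    moreover have "Some -` Some ` U = U" by auto
    ultimately show ?thesis by auto
  next
    case 2
    have eq: "Some -` V = - C" using 2(2) by auto
    obtain B where "B > 0" "\<And>z. z \<in> C \<Longrightarrow> norm z \<le> B" using compact_imp_bounded[OF 2(1)] by (auto simp: bounded_pos)
    then have "\<forall>z. B < norm z \<longrightarrow> Some z \<in> V" using 2(2) by force
    then show ?thesis using \<open>B > 0\<close> eq 2(1) by (auto simp: open_Compl compact_imp_closed)
  qed
next
  assume V: "open (Some -` V) \<and> (None \<in> V \<longrightarrow> (\<exists>B>0. \<forall>z. B < norm z \<longrightarrow> Some z \<in> V))"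
  show "openin riemann_sphere V"
  proof (cases "None \<in> V")
    case False
    then have "V = Some ` (Some -` V)" by (auto simp: image_iff) (metis not_None_eq)
    then show ?thesis using V by (metis openin_Alexandroff_compactification_image_Some open_openin)
  next
    case True
    define C where "C = - (Some -` V)"
    obtain B where B: "\<And>z. B < norm z \<Longrightarrow> Some z \<in> V" using V True by blast
    have "bounded C" unfolding bounded_iff C_def using B by (intro exI[of _ B]) force
    then have "compact C" using V by (simp add: C_def compact_eq_bounded_closed closed_Compl)
    moreover have "V = insert None (Some ` (UNIV - C))"
    proof (rule set_eqI)
      fix q show "q \<in> V \<longleftrightarrow> q \<in> insert None (Some ` (UNIV - C))" using True by (cases q) (auto simp: C_def)
    qed
    ultimately show ?thesis
      unfolding openin_Alexandroff_compactification by (intro disjI2 exI[of _ C]) (auto simp: compact_imp_closed)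
  qed
qed

lemma continuous_map_inv_chart: "continuous_map euclidean riemann_sphere (inv_chart a)"
  unfolding continuous_map_def
proof (intro conjI allI impI)
  fix V assume "openin riemann_sphere V"
  then have V: "open (Some -` V)" "None \<in> V \<Longrightarrow> \<exists>B>0. \<forall>z. B < norm z \<longrightarrow> Some z \<in> V"
    by (auto simp: openin_sphere_iff)
  have "open (- {0} \<inter> (\<lambda>u. a + inverse u) -` (Some -` V))"
    using V(1) by (intro continuous_open_preimage continuous_intros) auto
  then have op: "open {u. u \<noteq> 0 \<and> Some (a + inverse u) \<in> V}" by (simp add: Int_def vimage_def)
  have "open {u. inv_chart a u \<in> V}"
  proof (cases "None \<in> V")
    case False
    then have "{u. inv_chart a u \<in> V} = {u. u \<noteq> 0 \<and> Some (a + inverse u) \<in> V}" by (auto simp: inv_chart_def)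
    then show ?thesis using op by simp
  next
    case True
    then obtain B where B: "B > 0" "\<And>z. B < norm z \<Longrightarrow> Some z \<in> V" using V(2) by blast
    define r where "r = 1 / (B + norm a)"
    have pos: "B + norm a > 0" using B(1) by (simp add: add_pos_nonneg)
    have near: "Some (a + inverse u) \<in> V" if "u \<noteq> 0" "norm u < r" for u
    proof (rule B(2))
      have "norm u * (B + norm a) < 1" using that(2) pos by (simp add: r_def pos_less_divide_eq)
      then have "B + norm a < 1 / norm u" using that(1) by (simp add: pos_less_divide_eq mult.commute)
      also have "\<dots> = norm (inverse u)" by (simp add: norm_inverse inverse_eq_divide norm_divide)
      also have "\<dots> \<le> norm (a + inverse u) + norm a" using norm_triangle_ineq4[of "a + inverse u" a] by simp
      finally show "B < norm (a + inverse u)" by simp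
    qed
    have "{u. inv_chart a u \<in> V} = {u. u \<noteq> 0 \<and> Some (a + inverse u) \<in> V} \<union> ball 0 r"
    proof (rule set_eqI)
      fix u show "u \<in> {u. inv_chart a u \<in> V} \<longleftrightarrow> u \<in> {u. u \<noteq> 0 \<and> Some (a + inverse u) \<in> V} \<union> ball 0 r"
        using near[of u] True pos by (cases "u = 0") (auto simp: inv_chart_def r_def)
    qed
    then show ?thesis using op by (simp add: open_Un)
  qed
  then show "openin euclidean {x \<in> topspace euclidean. inv_chart a x \<in> V}" by simp
qed (auto simp: inv_chart_def)

lemma continuous_map_chart: "continuous_map euclidean riemann_sphere (chart P)"
proof (cases P)
  case None
  have "chart P = inv_chart 0" unfolding None by (rule ext) (simp add: chart_simps)
  then show ?thesis using continuous_map_inv_chart by simp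
next
  case (Some p)
  have "continuous_map euclidean euclidean (\<lambda>u. p + u)" by (simp add: continuous_intros)
  then have "continuous_map euclidean riemann_sphere (Some \<circ> (\<lambda>u. p + u))"
    using continuous_map_Some by (rule continuous_map_compose)
  moreover have "chart P = Some \<circ> (\<lambda>u. p + u)" unfolding Some by (rule ext) (simp add: chart_simps)
  ultimately show ?thesis by simp
qed

text \<open>One direction is continuity of the chart. For the other, the punctured disc of radius
  \<open>r\<close> parametrises an explicit punctured neighbourhood: a disc around a finite point,
  the set \<open>1 / r < norm z\<close> at infinity.\<close>

lemma eventually_atin_chart:
  "eventually Q (atin riemann_sphere P) \<longleftrightarrow> eventually (\<lambda>u. Q (chart P u)) (at 0)"
proof
  assume "eventually Q (atin riemann_sphere P)"
  then obtain U where U: "openin riemann_sphere U" "P \<in> U" "\<And>x. x \<in> U - {P} \<Longrightarrow> Q x"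
    unfolding eventually_atin by (cases P) auto
  have "openin euclidean {x \<in> topspace euclidean. chart P x \<in> U}"
    using continuous_map_chart U(1) by (rule openin_continuous_map_preimage)
  then have "open {x. chart P x \<in> U}" by simp
  moreover have "0 \<in> {x. chart P x \<in> U}" using U(2) by simp
  ultimately obtain r where r: "r > 0" "ball 0 r \<subseteq> {x. chart P x \<in> U}" by (rule openE)
  show "eventually (\<lambda>u. Q (chart P u)) (at 0)"
  proof -
    have "Q (chart P u)" if "u \<noteq> 0" "norm u < r" for u :: complex
    proof -
      have "chart P u \<in> U" using that r(2) by auto
      then show ?thesis using U(3) chart_inj[of P u] that(1) by blast
    qed
    then show ?thesis unfolding eventually_at using r(1) by (intro exI[of _ r]) (auto simp: dist_norm)
  qed
next
  assume "eventually (\<lambda>u. Q (chart P u)) (at 0)"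
  then obtain r where r: "r > 0" "\<And>u. u \<noteq> 0 \<Longrightarrow> norm u < r \<Longrightarrow> Q (chart P u)"
    unfolding eventually_at by (auto simp: dist_norm)
  have "\<exists>U. openin riemann_sphere U \<and> P \<in> U \<and> (\<forall>x\<in>U - {P}. Q x)"
  proof (cases P)
    case None
    define U where "U = insert None (Some ` {z::complex. 1 / r < norm z})"
    have vim: "Some -` U = {z. 1 / r < norm z}" by (auto simp: U_def)
    have "open {z::complex. 1 / r < norm z}" by (intro open_Collect_less continuous_intros)
    moreover have "1 / r > 0" using r(1) by simp
    ultimately have "openin riemann_sphere U"
      unfolding openin_sphere_iff vim by (intro conjI impI exI[of _ "1/r"]) (auto simp: U_def)
    moreover have "Q x" if x: "x \<in> U - {P}" for x
    proof -
      obtain z where z: "x = Some z" "1 / r < norm z" using x None by (auto simp: U_def)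
      have "norm z > 0" using z(2) \<open>1 / r > 0\<close> by linarith
      then have "z \<noteq> 0" by auto
      have "1 < r * norm z" using z(2) r(1) by (simp add: pos_divide_less_eq mult.commute)
      then have "norm (inverse z) < r" using \<open>norm z > 0\<close> by (simp add: norm_inverse inverse_eq_divide norm_divide pos_divide_less_eq)
      moreover have "chart P (inverse z) = x" using None z \<open>z \<noteq> 0\<close> by (simp add: chart_simps inv_chart_def)
      ultimately show ?thesis using r(2)[of "inverse z"] \<open>z \<noteq> 0\<close> by simp
    qed
    ultimately show ?thesis using None by (intro exI[of _ U]) (auto simp: U_def)
  next
    case (Some p)
    have "Q x" if x: "x \<in> Some ` ball p r - {P}" for x
    proof -
      obtain z where z: "x = Some z" "z \<in> ball p r" using x by blast
      then have "z \<noteq> p" using x Some by auto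
      then show ?thesis using r(2)[of "z - p"] Some z by (simp add: chart_simps dist_norm norm_minus_commute)
    qed
    then show ?thesis using Some r(1) by (intro exI[of _ "Some ` ball p r"]) auto
  qed
  then show "eventually Q (atin riemann_sphere P)" unfolding eventually_atin by blast
qed

lemma tendsto_atin_chart:
  "((\<lambda>q. g q) \<longlongrightarrow> l) (atin riemann_sphere P) \<longleftrightarrow> ((\<lambda>u. g (chart P u)) \<longlongrightarrow> l) (at 0)"
  unfolding tendsto_def eventually_atin_chart ..

lemma atin_within_interior:
  assumes "P \<in> X interior_of K" shows "atin_within X P K = atin X P"
proof (rule filter_eqI)
  fix Q
  have P: "P \<in> topspace X" by (rule subsetD[OF interior_of_subset_topspace assms])
  have int: "openin X (X interior_of K)" "X interior_of K \<subseteq> K" by (auto simp: interior_of_subset)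
  show "eventually Q (atin_within X P K) \<longleftrightarrow> eventually Q (atin X P)"
  proof
    assume "eventually Q (atin_within X P K)"
    then obtain T where T: "openin X T" "P \<in> T" "\<forall>x\<in>T. x \<in> K \<and> x \<noteq> P \<longrightarrow> Q x"
      unfolding eventually_atin_within using P by blast
    then have "openin X (T \<inter> X interior_of K)" "P \<in> T \<inter> X interior_of K" "\<forall>x\<in>T \<inter> X interior_of K - {P}. Q x"
      using int assms by (auto intro: openin_Int)
    then show "eventually Q (atin X P)" unfolding eventually_atin by blast
  next
    assume "eventually Q (atin X P)"
    then show "eventually Q (atin_within X P K)" unfolding eventually_atin_within eventually_atin by blast
  qed
qed

section \<open>Functions of the space, read in charts\<close>

lemma continuous_on_chart_compose:
  assumes f: "continuous_map (subtopology riemann_sphere K) euclidean f" and m: "continuous_map euclidean riemann_sphere m"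
    and sub: "m ` X \<subseteq> K"
  shows "continuous_on X (\<lambda>z. f (m z))"
proof -
  have "continuous_map (top_of_set X) riemann_sphere m" using m by (rule continuous_map_from_subtopology)
  then have "continuous_map (top_of_set X) (subtopology riemann_sphere K) m"
    using sub by (simp add: continuous_map_in_subtopology image_subset_iff_funcset)
  then have "continuous_map (top_of_set X) euclidean (f \<circ> m)" using f by (rule continuous_map_compose)
  then show ?thesis by (simp add: o_def)
qed

lemma holomorphic_spaceD:
  assumes "f \<in> holomorphic_space K"
  shows "continuous_map (subtopology riemann_sphere K) euclidean f"
    "p \<in> riemann_sphere interior_of K \<Longrightarrow> complex_differentiable_at f p"
  using assms by (simp_all add: holomorphic_space_def)

lemma cfunctional_compose:
  fixes f :: "sphere_point \<Rightarrow> 'b::complex_banach"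
  assumes \<phi>: "cfunctional \<phi>" and f: "f \<in> holomorphic_space K"
  shows "(\<lambda>q. \<phi> (f q)) \<in> holomorphic_space K"
proof -
  have cont: "continuous_on UNIV \<phi>" using cfunctional_bounded_linear[OF \<phi>] by (rule linear_continuous_on)
  have "continuous_map (subtopology riemann_sphere K) euclidean (\<phi> \<circ> f)"
    using holomorphic_spaceD(1)[OF f] cont by (intro continuous_map_compose[of _ euclidean]) simp_all
  moreover have "complex_differentiable_at (\<lambda>q. \<phi> (f q)) p" if pK: "p \<in> riemann_sphere interior_of K" for p
  proof -
    obtain D where D: "((\<lambda>q. inverse (local_coord p q) *\<^sub>C (f q - f p)) \<longlongrightarrow> D) (atin riemann_sphere p)"
      using holomorphic_spaceD(2)[OF f pK] unfolding complex_differentiable_at_def ..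
    have "isCont \<phi> D" using cont by (simp add: continuous_on_eq_continuous_at)
    from isCont_tendsto_compose[OF this D]
    have "((\<lambda>q. inverse (local_coord p q) *\<^sub>C (\<phi> (f q) - \<phi> (f p))) \<longlongrightarrow> \<phi> D) (atin riemann_sphere p)"
      by (simp only: cfunctionalD[OF \<phi>] scaleC_complex_def)
    then show ?thesis unfolding complex_differentiable_at_def by blast
  qed
  ultimately show ?thesis by (simp add: holomorphic_space_def o_def)
qed

lemma chart_field_differentiable:
  fixes h :: "sphere_point \<Rightarrow> complex"
  assumes "complex_differentiable_at h P"
  shows "(\<lambda>u. h (chart P u)) field_differentiable (at 0)"
proof -
  obtain D where "((\<lambda>u. inverse u *\<^sub>C (h (chart P u) - h P)) \<longlongrightarrow> D) (at 0)"
    using assms unfolding complex_differentiable_at_def tendsto_atin_chart local_coord_chart by blast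
  then have "((\<lambda>u. (h (chart P (0 + u)) - h (chart P 0)) / u) \<longlongrightarrow> D) (at 0)"
    by (simp add: scaleC_complex_def field_simps)
  then have "((\<lambda>u. h (chart P u)) has_field_derivative D) (at 0)" by (simp add: DERIV_def)
  then show ?thesis by (auto simp: field_differentiable_def)
qed

lemma finite_field_differentiable:
  fixes h :: "sphere_point \<Rightarrow> complex"
  assumes "complex_differentiable_at h (Some z)"
  shows "(\<lambda>w. h (Some w)) field_differentiable (at z)"
proof -
  have "(\<lambda>u. h (chart (Some z) u)) field_differentiable (at (z - z))"
    using chart_field_differentiable[OF assms] by simp
  moreover have "(\<lambda>w. w - z) field_differentiable (at z)" by (intro derivative_intros)
  ultimately have "((\<lambda>u. h (chart (Some z) u)) \<circ> (\<lambda>w. w - z)) field_differentiable (at z)"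
    by (intro field_differentiable_compose)
  then show ?thesis by (simp add: o_def chart_simps)
qed

text \<open>Differentiability at infinity is defined in the coordinate \<open>1/q\<close>, whereas
  \<open>inv_chart a\<close> is centred at \<open>a\<close>. The transition map is
  \<open>u / (1 + a * u)\<close>, holomorphic near \<open>0\<close>; away from \<open>0\<close> the
  chart rule for finite points suffices.\<close>

lemma inv_chart_field_differentiable:
  fixes h :: "sphere_point \<Rightarrow> complex"
  assumes h: "complex_differentiable_at h (inv_chart a w)"
  shows "(\<lambda>u. h (inv_chart a u)) field_differentiable (at w)"
proof (cases "w = 0")
  case False
  have "(\<lambda>z. h (Some z)) field_differentiable (at (a + inverse w))"
    using finite_field_differentiable[of h "a + inverse w"] h False by (simp add: inv_chart_def)
  moreover have "(\<lambda>u. a + inverse u) field_differentiable (at w)" using False by (intro derivative_intros) auto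
  ultimately have fd: "((\<lambda>z. h (Some z)) \<circ> (\<lambda>u. a + inverse u)) field_differentiable (at w)"
    by (intro field_differentiable_compose)
  show ?thesis
  proof (rule field_differentiable_transform_within[OF _ _ _ fd])
    show "0 < norm w" "w \<in> UNIV" using False by auto
    fix u assume "dist u w < norm w"
    then have "u \<noteq> 0" by (auto simp: dist_norm)
    then show "((\<lambda>z. h (Some z)) \<circ> (\<lambda>u. a + inverse u)) u = h (inv_chart a u)" by (simp add: inv_chart_def)
  qed
next
  case True
  have "(\<lambda>u. h (chart None u)) field_differentiable (at (0 / (1 + a * 0)))"
    using chart_field_differentiable[of h None] h True by (simp add: inv_chart_def)
  moreover have "(\<lambda>u. u / (1 + a * u)) field_differentiable (at 0)" by (intro derivative_intros) auto
  ultimately have fd: "((\<lambda>u. h (chart None u)) \<circ> (\<lambda>u. u / (1 + a * u))) field_differentiable (at 0)"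
    by (intro field_differentiable_compose)
  have eq: "h (inv_chart a u) = ((\<lambda>u. h (chart None u)) \<circ> (\<lambda>u. u / (1 + a * u))) u" if "norm u < 1 / (1 + norm a)" for u
  proof -
    have pos: "1 + norm a > 0" by (simp add: add_pos_nonneg)
    have "norm (a * u) < 1"
    proof -
      have "norm u * (1 + norm a) < 1" using that pos by (simp add: pos_less_divide_eq)
      moreover have "norm (a * u) \<le> norm u * (1 + norm a)" by (simp add: norm_mult algebra_simps)
      ultimately show ?thesis by linarith
    qed
    have nz: "1 + a * u \<noteq> 0"
    proof
      assume "1 + a * u = 0"
      then have "norm (a * u) = norm (- 1 :: complex)" by (metis add_eq_0_iff)
      then show False using \<open>norm (a * u) < 1\<close> by simp
    qed
    have "inv_chart a u = chart None (u / (1 + a * u))"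
    proof (cases "u = 0")
      case False
      then have "inverse (u / (1 + a * u)) = a + inverse u" using nz by (simp add: field_simps)
      then show ?thesis using False nz by (simp add: chart_simps inv_chart_def)
    qed (simp add: chart_simps inv_chart_def)
    then show ?thesis by simp
  qed
  show ?thesis
    unfolding True
  proof (rule field_differentiable_transform_within[OF _ _ _ fd])
    show "0 < 1 / (1 + norm a)" by (simp add: add_pos_nonneg)
    fix u :: complex assume "dist u 0 < 1 / (1 + norm a)"
    then show "((\<lambda>u. h (chart None u)) \<circ> (\<lambda>u. u / (1 + a * u))) u = h (inv_chart a u)"
      using eq[of u] by (simp add: dist_norm)
  qed simp
qed

lemma holomorphic_space_inv_chart:
  fixes h :: "sphere_point \<Rightarrow> complex"
  assumes h: "h \<in> holomorphic_space K" and X: "open X" "inv_chart a ` X \<subseteq> riemann_sphere interior_of K"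
  shows "(\<lambda>u. h (inv_chart a u)) holomorphic_on X"
  unfolding holomorphic_on_def
proof
  fix w assume "w \<in> X"
  then have "complex_differentiable_at h (inv_chart a w)" using X(2) by (intro holomorphic_spaceD(2)[OF h]) blast
  then show "(\<lambda>u. h (inv_chart a u)) field_differentiable at w within X"
    by (rule field_differentiable_at_within[OF inv_chart_field_differentiable])
qed

lemma holomorphic_space_finite:
  fixes h :: "sphere_point \<Rightarrow> complex"
  assumes h: "h \<in> holomorphic_space K" and X: "open X" "Some ` X \<subseteq> riemann_sphere interior_of K"
  shows "(\<lambda>u. h (Some u)) holomorphic_on X"
  unfolding holomorphic_on_def
proof
  fix w assume "w \<in> X"
  then have "complex_differentiable_at h (Some w)" using X(2) by (intro holomorphic_spaceD(2)[OF h]) blast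
  then show "(\<lambda>u. h (Some u)) field_differentiable at w within X"
    by (rule field_differentiable_at_within[OF finite_field_differentiable])
qed

lemma holomorphic_space_chart:
  fixes h :: "sphere_point \<Rightarrow> complex"
  assumes h: "h \<in> holomorphic_space K" and X: "open X" "chart P ` X \<subseteq> riemann_sphere interior_of K"
  shows "(\<lambda>u. h (chart P u)) holomorphic_on X"
proof (cases P)
  case None
  have "chart P = inv_chart 0" unfolding None by (rule ext) (simp add: chart_simps)
  then show ?thesis using holomorphic_space_inv_chart[OF h X(1), of 0] X(2) by simp
next
  case (Some p)
  have "(\<lambda>u. h (chart P u)) field_differentiable at w within X" if w: "w \<in> X" for w
  proof -
    have "chart P w \<in> riemann_sphere interior_of K" using X(2) w by blast
    then have "complex_differentiable_at h (Some (p + w))"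
      unfolding Some chart_simps by (rule holomorphic_spaceD(2)[OF h])
    then have "(\<lambda>z. h (Some z)) field_differentiable (at (p + w))" by (rule finite_field_differentiable)
    moreover have "(\<lambda>u. p + u) field_differentiable (at w)" by (intro derivative_intros)
    ultimately have "((\<lambda>z. h (Some z)) \<circ> (\<lambda>u. p + u)) field_differentiable (at w)" by (intro field_differentiable_compose)
    then show ?thesis by (simp add: Some o_def chart_simps field_differentiable_at_within)
  qed
  then show ?thesis unfolding holomorphic_on_def by blast
qed

lemma interior_chart_ball:
  assumes "P \<in> riemann_sphere interior_of K"
  obtains r where "r > 0" "chart P ` ball 0 r \<subseteq> riemann_sphere interior_of K"
proof -
  have "openin euclidean {x \<in> topspace euclidean. chart P x \<in> riemann_sphere interior_of K}"
    using continuous_map_chart by (rule openin_continuous_map_preimage) simp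
  then have "open {x. chart P x \<in> riemann_sphere interior_of K}" by simp
  moreover have "0 \<in> {x. chart P x \<in> riemann_sphere interior_of K}" using assms by simp
  ultimately obtain r where "r > 0" "ball 0 r \<subseteq> {x. chart P x \<in> riemann_sphere interior_of K}" by (rule openE)
  then show ?thesis using that by blast
qed

subsection \<open>Jordan curves in the Riemann sphere\<close>

lemma closure_within_zero_set:
  fixes h :: "sphere_point \<Rightarrow> complex"
  assumes h: "continuous_map (subtopology riemann_sphere K) euclidean h"
    and A: "\<And>q. q \<in> A \<Longrightarrow> h q = 0" "riemann_sphere closure_of A \<subseteq> K" and q: "q \<in> riemann_sphere closure_of A"
  shows "h q = 0"
proof -
  have "closedin (subtopology riemann_sphere K) {x \<in> topspace (subtopology riemann_sphere K). h x \<in> {0}}"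
    using h by (rule closedin_continuous_map_preimage) simp
  moreover have "topspace (subtopology riemann_sphere K) = K" by (auto simp: UNIV_option_conv[symmetric])
  ultimately obtain T where T: "closedin riemann_sphere T" "{x \<in> K. h x \<in> {0}} = T \<inter> K"
    unfolding closedin_subtopology by auto
  have "A \<subseteq> riemann_sphere closure_of A" by (rule closure_of_subset) (auto simp: UNIV_option_conv[symmetric])
  then have "A \<subseteq> T \<inter> K" using A unfolding T(2)[symmetric] by auto
  then have "riemann_sphere closure_of A \<subseteq> T" using T(1) by (intro closure_of_minimal) auto
  then have "q \<in> T \<inter> K" using q A(2) by blast
  then show ?thesis unfolding T(2)[symmetric] by simp
qed

section \<open>The two complementary components of a Jordan curve on the sphere\<close>

lemma component_of_partition:
  assumes C: "C \<in> connected_components_of X" and con: "connectedin X A" "connectedin X B"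
    and op: "openin X A" "openin X B" and cover: "topspace X \<subseteq> A \<union> B" and disj: "A \<inter> B = {}"
  shows "C = A \<or> C = B"
proof -
  have Cc: "connectedin X C" "C \<noteq> {}" "C \<subseteq> A \<union> B"
    using C cover connectedin_connected_components_of nonempty_connected_components_of connected_components_of_subset
    by (blast, blast, fast)
  have max: "S \<subseteq> C" if "connectedin X S" "S \<inter> C \<noteq> {}" for S
    using connected_components_of_maximal[OF C that(1)] that(2) by (auto simp: disjnt_def)
  have "\<not> (A \<inter> C \<noteq> {} \<and> B \<inter> C \<noteq> {})"
  proof
    assume "A \<inter> C \<noteq> {} \<and> B \<inter> C \<noteq> {}"
    moreover have "A \<inter> B \<inter> C = {}" using disj by blast
    ultimately show False using Cc(1,3) op unfolding connectedin by blast
  qed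
  then show ?thesis using max[OF con(1)] max[OF con(2)] Cc(2,3) disj by blast
qed

context
  fixes \<gamma> :: "real \<Rightarrow> complex"
  assumes \<gamma>: "simple_path \<gamma>" "pathfinish \<gamma> = pathstart \<gamma>"
begin

private lemma jordan: "open (inside (path_image \<gamma>))" "connected (inside (path_image \<gamma>))" "inside (path_image \<gamma>) \<noteq> {}"
    "open (outside (path_image \<gamma>))" "connected (outside (path_image \<gamma>))" "\<not> bounded (outside (path_image \<gamma>))"
    "bounded (inside (path_image \<gamma>))" "frontier (inside (path_image \<gamma>)) = path_image \<gamma>" "frontier (outside (path_image \<gamma>)) = path_image \<gamma>"
    "\<And>z. z \<in> path_image \<gamma> \<or> z \<in> inside (path_image \<gamma>) \<or> z \<in> outside (path_image \<gamma>)"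
    "inside (path_image \<gamma>) \<inter> outside (path_image \<gamma>) = {}" "compact (path_image \<gamma>)"
  using Jordan_inside_outside[OF \<gamma>] compact_simple_path_image[OF \<gamma>(1)] by (blast+)

abbreviation (input) "In \<equiv> Some ` inside (path_image \<gamma>)"
abbreviation (input) "Out \<equiv> insert None (Some ` outside (path_image \<gamma>))"

lemma openin_In: "openin riemann_sphere In" using jordan(1) by simp

lemma outside_contains_large: "\<exists>B>0. \<forall>z. B < norm z \<longrightarrow> z \<in> outside (path_image \<gamma>)"
proof -
  have "bounded (inside (path_image \<gamma>) \<union> path_image \<gamma>)" using jordan(7,12) by (simp add: compact_imp_bounded)
  then obtain B where B: "B > 0" "\<And>z. z \<in> inside (path_image \<gamma>) \<union> path_image \<gamma> \<Longrightarrow> norm z \<le> B"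
    unfolding bounded_pos by blast
  have "z \<in> outside (path_image \<gamma>)" if "B < norm z" for z
  proof -
    have "z \<notin> inside (path_image \<gamma>) \<union> path_image \<gamma>" using B(2)[of z] that by auto
    then show ?thesis using jordan(10)[of z] by blast
  qed
  then show ?thesis using B(1) by blast
qed

lemma openin_Out: "openin riemann_sphere Out"
  unfolding openin_sphere_iff
proof (intro conjI impI)
  have "Some -` Out = outside (path_image \<gamma>)" by auto
  then show "open (Some -` Out)" using jordan(4) by simp
  show "\<exists>B>0. \<forall>z. B < norm z \<longrightarrow> Some z \<in> Out" using outside_contains_large by blast
qed

lemma None_closure_Out: "None \<in> riemann_sphere closure_of (Some ` outside (path_image \<gamma>))"
  unfolding in_closure_of
proof (intro conjI allI impI)
  fix T assume T: "None \<in> T \<and> openin riemann_sphere T"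
  then obtain B where B: "\<And>z. B < norm z \<Longrightarrow> Some z \<in> T" unfolding openin_sphere_iff by blast
  have "\<exists>z\<in>outside (path_image \<gamma>). B < norm z" using jordan(6) unfolding bounded_iff by (meson not_le)
  then show "\<exists>y. y \<in> Some ` outside (path_image \<gamma>) \<and> y \<in> T" using B by blast
qed simp

lemma connectedin_In: "connectedin riemann_sphere In"
  using connectedin_continuous_map_image[OF continuous_map_Some, of euclidean "inside (path_image \<gamma>)"] jordan(2) by simp

text \<open>The outside is unbounded, so infinity lies in its closure, and adding points of the
  closure preserves connectedness.\<close>

lemma connectedin_Out: "connectedin riemann_sphere Out"
proof (rule connectedin_intermediate_closure_of)
  show "connectedin riemann_sphere (Some ` outside (path_image \<gamma>))"
    using connectedin_continuous_map_image[OF continuous_map_Some, of euclidean "outside (path_image \<gamma>)"] jordan(5) by simp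
  show "Some ` outside (path_image \<gamma>) \<subseteq> Out" by blast
  have "Some ` outside (path_image \<gamma>) \<subseteq> riemann_sphere closure_of (Some ` outside (path_image \<gamma>))"
    by (rule closure_of_subset) auto
  then show "Out \<subseteq> riemann_sphere closure_of (Some ` outside (path_image \<gamma>))" using None_closure_Out by blast
qed

lemma In_Out_partition: "In \<union> Out = - (Some ` path_image \<gamma>)" "In \<inter> Out = {}"
proof -
  have "q \<in> In \<union> Out \<longleftrightarrow> q \<notin> Some ` path_image \<gamma>" for q
  proof (cases q)
    case (Some z)
    have "z \<notin> inside (path_image \<gamma>) \<inter> path_image \<gamma>" "z \<notin> outside (path_image \<gamma>) \<inter> path_image \<gamma>"
      by (simp_all add: inside_no_overlap outside_no_overlap)
    then show ?thesis using jordan(10)[of z] Some by blast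
  qed auto
  then show "In \<union> Out = - (Some ` path_image \<gamma>)" by blast
  show "In \<inter> Out = {}" using jordan(11) by blast
qed

lemma component_cases:
  assumes C: "C \<in> connected_components_of (subtopology riemann_sphere (- (Some ` path_image \<gamma>)))"
  shows "C = In \<or> C = Out"
proof -
  let ?X = "subtopology riemann_sphere (- (Some ` path_image \<gamma>))"
  have sub: "In \<subseteq> - (Some ` path_image \<gamma>)" "Out \<subseteq> - (Some ` path_image \<gamma>)" using In_Out_partition(1) by blast+
  have con: "connectedin ?X In" "connectedin ?X Out"
    unfolding connectedin_subtopology using sub connectedin_In connectedin_Out by blast+
  have op: "openin ?X In" "openin ?X Out"
    unfolding openin_subtopology
    by (rule exI[of _ In], use openin_In sub(1) in blast) (rule exI[of _ Out], use openin_Out sub(2) in blast)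
  have "topspace ?X \<subseteq> In \<union> Out" unfolding In_Out_partition(1) topspace_subtopology by blast
  then show ?thesis by (rule component_of_partition[OF C con op _ In_Out_partition(2)])
qed

lemma inner_outer_component:
  "inner_component (Some ` path_image \<gamma>) = In" "outer_component (Some ` path_image \<gamma>) = Out"
proof -
  let ?X = "subtopology riemann_sphere (- (Some ` path_image \<gamma>))"
  have ex: "\<exists>C\<in>connected_components_of ?X. q \<in> C" if "q \<in> In \<union> Out" for q
  proof -
    have "q \<in> topspace ?X" using that unfolding In_Out_partition(1) by (cases q) auto
    then show ?thesis using Union_connected_components_of[of ?X] by blast
  qed
  obtain z where z: "z \<in> inside (path_image \<gamma>)" using jordan(3) by blast
  have 1: "In \<in> connected_components_of ?X"
    using ex[of "Some z"] z component_cases In_Out_partition(2) by blast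
  have 2: "Out \<in> connected_components_of ?X"
    using ex[of None] component_cases In_Out_partition(2) by blast
  show "inner_component (Some ` path_image \<gamma>) = In"
    unfolding inner_component_def by (rule the_equality) (use 1 component_cases in blast)+
  show "outer_component (Some ` path_image \<gamma>) = Out"
    unfolding outer_component_def by (rule the_equality) (use 2 component_cases in blast)+
qed

lemma closure_In:
  "Some ` closure (inside (path_image \<gamma>)) \<subseteq> riemann_sphere closure_of In"
  "riemann_sphere closure_of In \<subseteq> Some ` (inside (path_image \<gamma>) \<union> path_image \<gamma>)"
proof -
  show "Some ` closure (inside (path_image \<gamma>)) \<subseteq> riemann_sphere closure_of In"
    using continuous_map_image_closure_subset[OF continuous_map_Some, of euclidean "inside (path_image \<gamma>)"] by simp
  have "inside (path_image \<gamma>) \<union> path_image \<gamma> = closure (inside (path_image \<gamma>))"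
    using jordan(8) by (metis closure_Un_frontier)
  then have "compact (inside (path_image \<gamma>) \<union> path_image \<gamma>)" using jordan(7) by simp
  then have "closedin riemann_sphere (Some ` (inside (path_image \<gamma>) \<union> path_image \<gamma>))"
    by (simp add: compact_imp_closed)
  then show "riemann_sphere closure_of In \<subseteq> Some ` (inside (path_image \<gamma>) \<union> path_image \<gamma>)"
    by (intro closure_of_minimal) auto
qed

lemma closure_Out:
  "Some ` closure (outside (path_image \<gamma>)) \<subseteq> riemann_sphere closure_of Out"
  "riemann_sphere closure_of Out \<subseteq> insert None (Some ` (outside (path_image \<gamma>) \<union> path_image \<gamma>))"
proof -
  have "Some ` closure (outside (path_image \<gamma>)) \<subseteq> riemann_sphere closure_of (Some ` outside (path_image \<gamma>))"
    using continuous_map_image_closure_subset[OF continuous_map_Some, of euclidean "outside (path_image \<gamma>)"] by simp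
  also have "\<dots> \<subseteq> riemann_sphere closure_of Out" by (rule closure_of_mono) blast
  finally show "Some ` closure (outside (path_image \<gamma>)) \<subseteq> riemann_sphere closure_of Out" .
  have "closedin riemann_sphere (topspace riemann_sphere - In)" by (rule closedin_diff[OF closedin_topspace openin_In])
  moreover have "Out \<subseteq> topspace riemann_sphere - In" using In_Out_partition(2) by (auto simp: UNIV_option_conv[symmetric])
  ultimately have "riemann_sphere closure_of Out \<subseteq> topspace riemann_sphere - In" by (intro closure_of_minimal)
  also have "\<dots> \<subseteq> insert None (Some ` (outside (path_image \<gamma>) \<union> path_image \<gamma>))"
  proof
    fix q assume "q \<in> topspace riemann_sphere - In"
    then show "q \<in> insert None (Some ` (outside (path_image \<gamma>) \<union> path_image \<gamma>))" using jordan(10) by (cases q) auto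
  qed
  finally show "riemann_sphere closure_of Out \<subseteq> insert None (Some ` (outside (path_image \<gamma>) \<union> path_image \<gamma>))" .
qed

lemma path_image_closures:
  "Some ` path_image \<gamma> \<subseteq> riemann_sphere closure_of In" "Some ` path_image \<gamma> \<subseteq> riemann_sphere closure_of Out"
proof -
  have "path_image \<gamma> \<subseteq> closure (inside (path_image \<gamma>))" "path_image \<gamma> \<subseteq> closure (outside (path_image \<gamma>))"
    using jordan(8,9) unfolding frontier_def by blast+
  then show "Some ` path_image \<gamma> \<subseteq> riemann_sphere closure_of In" "Some ` path_image \<gamma> \<subseteq> riemann_sphere closure_of Out"
    using closure_In(1) closure_Out(1) by blast+
qed

lemma boundary_zeros_inside:
  fixes h :: "sphere_point \<Rightarrow> complex"
  assumes h: "h \<in> holomorphic_space K" and K: "riemann_sphere closure_of In \<subseteq> K"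
    and lip: "L > 0" "\<And>s t. s \<in> {0..1} \<Longrightarrow> t \<in> {0..1} \<Longrightarrow> dist (\<gamma> s) (\<gamma> t) \<le> L * \<bar>s - t\<bar>"
    and pos: "hausdorff1 {z \<in> path_image \<gamma>. h (Some z) = 0} \<noteq> 0" and z: "z \<in> inside (path_image \<gamma>)"
  shows "h (Some z) = 0"
proof (rule ccontr)
  assume nz: "h (Some z) \<noteq> 0"
  have "continuous_on (closure (inside (path_image \<gamma>))) (\<lambda>z. h (Some z))"
    using closure_In(1) K by (intro continuous_on_chart_compose[OF holomorphic_spaceD(1)[OF h]] continuous_map_Some) blast
  moreover have "(\<lambda>z. h (Some z)) holomorphic_on inside (path_image \<gamma>)"
  proof (rule holomorphic_space_finite[OF h jordan(1)])
    have "In \<subseteq> K" using closure_of_subset[of In riemann_sphere] K by auto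
    then show "In \<subseteq> riemann_sphere interior_of K" using openin_In by (rule interior_of_maximal)
  qed
  ultimately have "hausdorff1 {z \<in> path_image \<gamma>. h (Some z) = 0} = 0"
    using z nz by (intro jordan_domain_zero_set_null[OF \<gamma> lip, where f = "\<lambda>z. h (Some z)"])
  then show False using pos by simp
qed

text \<open>The exterior of the curve becomes a bounded Jordan domain under inversion at an interior point.\<close>

lemma boundary_zeros_outside:
  fixes h :: "sphere_point \<Rightarrow> complex"
  assumes h: "h \<in> holomorphic_space K" and K: "riemann_sphere closure_of Out \<subseteq> K"
    and lip: "L > 0" "\<And>s t. s \<in> {0..1} \<Longrightarrow> t \<in> {0..1} \<Longrightarrow> dist (\<gamma> s) (\<gamma> t) \<le> L * \<bar>s - t\<bar>"
    and pos: "hausdorff1 {z \<in> path_image \<gamma>. h (Some z) = 0} \<noteq> 0" and q: "z \<in> outside (path_image \<gamma>)"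
  shows "h (Some z) = 0"
proof (rule ccontr)
  assume nz: "h (Some z) \<noteq> 0"
  obtain a where a: "a \<in> inside (path_image \<gamma>)" using jordan(3) by blast
  define g where "g = (\<lambda>t. inverse (\<gamma> t - a))"
  obtain r where r: "r > 0" "ball a r \<subseteq> inside (path_image \<gamma>)" using jordan(1) a open_contains_ball by blast
  have far: "r \<le> norm (z - a)" if "z \<in> path_image \<gamma>" for z
  proof -
    have "z \<notin> ball a r" using r(2) that inside_no_overlap[of "path_image \<gamma>"] by blast
    then show ?thesis by (simp add: dist_norm norm_minus_commute)
  qed
  have far\<gamma>: "r \<le> norm (\<gamma> t - a)" if "t \<in> {0..1}" for t using far[of "\<gamma> t"] that by (simp add: path_image_def)
  have ne: "\<gamma> t \<noteq> a" if "t \<in> {0..1}" for t using far\<gamma>[OF that] r(1) by auto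
  \<comment> \<open>The curve keeps distance at least \<open>r\<close> from \<open>a\<close>, so
    inversion is Lipschitz on it with constant \<open>1 / r\<^sup>2\<close> and the inverted curve
    is again Lipschitz.\<close>
  have inv_dist: "dist (inverse u) (inverse v) \<le> (1/r\<^sup>2) * dist u v" if "r \<le> norm u" "r \<le> norm v" for u v :: complex
  proof -
    have nz: "u \<noteq> 0" "v \<noteq> 0" using that r(1) by auto
    have "inverse u - inverse v = (v - u) * (inverse u * inverse v)" using nz by (simp add: field_simps)
    then have "dist (inverse u) (inverse v) = norm (v - u) * (inverse (norm u) * inverse (norm v))"
      by (simp add: dist_norm norm_mult norm_inverse)
    also have "\<dots> \<le> norm (v - u) * (inverse r * inverse r)"
      using that r(1) by (intro mult_left_mono mult_mono le_imp_inverse_le) auto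
    finally show ?thesis by (simp add: dist_norm norm_minus_commute power2_eq_square field_simps)
  qed
  have g: "simple_path g" "pathfinish g = pathstart g"
  proof -
    have "path g" using simple_path_imp_path[OF \<gamma>(1)] ne unfolding path_def g_def by (intro continuous_intros) auto
    moreover have "loop_free g"
      unfolding loop_free_def
    proof (intro ballI impI)
      fix s t assume st: "s \<in> {0..1}" "t \<in> {0..1}" "g s = g t"
      then have "\<gamma> s = \<gamma> t" by (simp add: g_def)
      then show "s = t \<or> s = 0 \<and> t = 1 \<or> s = 1 \<and> t = 0"
        using \<gamma>(1) st(1,2) unfolding simple_path_def loop_free_def by blast
    qed
    ultimately show "simple_path g" by (simp add: simple_path_def)
    show "pathfinish g = pathstart g" using \<gamma>(2) by (simp add: g_def pathfinish_def pathstart_def)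
  qed
  have in_g: "inside (path_image g) = {w. w = 0 \<or> a + inverse w \<in> outside (path_image \<gamma>)}"
    unfolding g_def by (rule inside_inversion[OF \<gamma> a])
  have pg: "path_image g = (\<lambda>z. inverse (z - a)) ` path_image \<gamma>" by (auto simp: g_def path_image_def)
  have pg_inv: "inv_chart a w = Some (a + inverse w)" "a + inverse w \<in> path_image \<gamma>" "w \<noteq> 0" "norm (w) \<le> 1 / r" if "w \<in> path_image g" for w
  proof -
    obtain z where z: "z \<in> path_image \<gamma>" "w = inverse (z - a)" using \<open>w \<in> path_image g\<close> pg by blast
    have "z \<noteq> a" using far[OF z(1)] r(1) by auto
    then show w0: "w \<noteq> 0" by (simp add: z)
    then show "inv_chart a w = Some (a + inverse w)" by (simp add: inv_chart_def)
    show "a + inverse w \<in> path_image \<gamma>" using z by simp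
    show "norm w \<le> 1 / r" using far[OF z(1)] r(1) by (simp add: z norm_inverse inverse_eq_divide norm_divide frac_le)
  qed
  have Jg: "open (inside (path_image g))" "frontier (inside (path_image g)) = path_image g"
    using Jordan_inside_outside[OF g] by blast+
  have OutK: "Out \<subseteq> K" using closure_of_subset[of Out riemann_sphere] K by auto
  have into: "inv_chart a ` inside (path_image g) \<subseteq> Out" unfolding in_g by (auto simp: inv_chart_def)
  have "closure (inside (path_image g)) = inside (path_image g) \<union> path_image g" using Jg(2) by (metis closure_Un_frontier)
  moreover have "inv_chart a ` path_image g \<subseteq> K" using pg_inv(1,2) path_image_closures(2) K by force
  ultimately have sub: "inv_chart a ` closure (inside (path_image g)) \<subseteq> K" using order_trans[OF into OutK] by (simp only: image_Un Un_subset_iff simp_thms)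
  have cont: "continuous_on (closure (inside (path_image g))) (\<lambda>w. h (inv_chart a w))"
    by (rule continuous_on_chart_compose[OF holomorphic_spaceD(1)[OF h] continuous_map_inv_chart sub])
  have hol: "(\<lambda>w. h (inv_chart a w)) holomorphic_on inside (path_image g)"
  proof (rule holomorphic_space_inv_chart[OF h Jg(1)])
    have "Out \<subseteq> riemann_sphere interior_of K" using OutK openin_Out by (rule interior_of_maximal)
    then show "inv_chart a ` inside (path_image g) \<subseteq> riemann_sphere interior_of K" using into by blast
  qed
  have za: "z \<noteq> a" using a q jordan(11) by blast
  define w0 where "w0 = inverse (z - a)"
  have w0: "w0 \<in> inside (path_image g)" "h (inv_chart a w0) \<noteq> 0"
    using za q nz unfolding in_g by (simp_all add: w0_def inv_chart_def)
  have lg: "dist (g s) (g t) \<le> (1/r\<^sup>2 * L) * \<bar>s - t\<bar>" if "s \<in> {0..1}" "t \<in> {0..1}" for s t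
  proof -
    have "dist (g s) (g t) \<le> 1/r\<^sup>2 * dist (\<gamma> s - a) (\<gamma> t - a)"
      unfolding g_def using that by (intro inv_dist far\<gamma>)
    also have "\<dots> = 1/r\<^sup>2 * dist (\<gamma> s) (\<gamma> t)" by (simp add: dist_norm)
    also have "\<dots> \<le> 1/r\<^sup>2 * (L * \<bar>s - t\<bar>)" using lip(2)[OF that] by (intro mult_left_mono) auto
    finally show ?thesis by (simp add: mult_ac)
  qed
  have null: "hausdorff1 {w \<in> path_image g. h (inv_chart a w) = 0} = 0"
    by (rule jordan_domain_zero_set_null[OF g _ lg cont hol w0]) (use r(1) lip(1) in auto)
  obtain b where b: "b > 0" "\<And>z. z \<in> path_image \<gamma> \<Longrightarrow> norm (z - a) \<le> b"
  proof -
    have "bounded ((\<lambda>z. z - a) ` path_image \<gamma>)" using compact_imp_bounded[OF jordan(12)] by (rule bounded_translation_minus)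
    then show ?thesis using that unfolding bounded_pos by blast
  qed
  \<comment> \<open>The curve also stays within distance \<open>b\<close> of \<open>a\<close>, so
    the way back is Lipschitz with constant \<open>b\<^sup>2\<close> and maps the null set of zeros
    to a null set on the original curve.\<close>
  have "hausdorff1 ((\<lambda>w. a + inverse w) ` {w \<in> path_image g. h (inv_chart a w) = 0}) = 0"
  proof (rule hausdorff1_zero_lipschitz_image[OF null])
    show "b\<^sup>2 > 0" using b(1) by simp
    fix u v assume uv: "u \<in> {w \<in> path_image g. h (inv_chart a w) = 0}" "v \<in> {w \<in> path_image g. h (inv_chart a w) = 0}"
    have "norm (inverse u) \<le> b" "norm (inverse v) \<le> b" "u \<noteq> 0" "v \<noteq> 0"
      using uv b(2)[of "a + inverse u"] b(2)[of "a + inverse v"] pg_inv[of u] pg_inv[of v] by auto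
    moreover from this have "inverse u - inverse v = (v - u) * (inverse u * inverse v)" by (simp add: field_simps)
    then have "dist (a + inverse u) (a + inverse v) = norm (v - u) * (norm (inverse u) * norm (inverse v))"
      by (simp add: dist_norm norm_mult)
    moreover have "b \<ge> 0" using \<open>norm (inverse u) \<le> b\<close> norm_ge_zero order_trans by blast
    ultimately have "dist (a + inverse u) (a + inverse v) \<le> norm (v - u) * (b * b)"
      by (simp only:) (intro mult_left_mono mult_mono; simp)
    then show "dist (a + inverse u) (a + inverse v) \<le> b\<^sup>2 * dist u v"
      by (simp add: dist_norm norm_minus_commute power2_eq_square mult_ac)
  qed
  moreover have "{z \<in> path_image \<gamma>. h (Some z) = 0} \<subseteq> (\<lambda>w. a + inverse w) ` {w \<in> path_image g. h (inv_chart a w) = 0}"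
  proof
    fix y assume y: "y \<in> {z \<in> path_image \<gamma>. h (Some z) = 0}"
    have "y \<noteq> a" using far[of y] y r(1) by auto
    then show "y \<in> (\<lambda>w. a + inverse w) ` {w \<in> path_image g. h (inv_chart a w) = 0}"
      using y pg by (intro image_eqI[of _ _ "inverse (y - a)"]) (auto simp: inv_chart_def)
  qed
  then have "hausdorff1 {z \<in> path_image \<gamma>. h (Some z) = 0}
      \<le> hausdorff1 ((\<lambda>w. a + inverse w) ` {w \<in> path_image g. h (inv_chart a w) = 0})"
    by (rule hausdorff1_mono)
  ultimately show False using pos by simp
qed

end

subsection \<open>Nested pairs\<close>

lemma Jordan_curve_lipschitz:
  assumes "rectifiable_jordan_curve \<Gamma>"
  obtains \<gamma> L where "simple_path \<gamma>" "pathfinish \<gamma> = pathstart \<gamma>" "L > 0"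
    "\<forall>s\<in>{0..1}. \<forall>t\<in>{0..1}. dist (\<gamma> s) (\<gamma> t) \<le> L * \<bar>s - t\<bar>" "\<Gamma> = Some ` path_image \<gamma>"
proof -
  obtain g where g: "jordan_parametrization (Some \<circ> g)" "\<Gamma> = range (Some \<circ> g)" "finite_length g"
    using assms unfolding rectifiable_jordan_curve_def by blast
  have c: "continuous_map euclideanreal riemann_sphere (Some \<circ> g)" and inj: "\<And>s t. g s = g t \<longleftrightarrow> s - t \<in> \<int>"
    using g(1) by (simp_all add: jordan_parametrization_def)
  have "continuous_on UNIV g"
    unfolding continuous_on_open_vimage[OF open_UNIV]
  proof (intro allI impI)
    fix U :: "complex set" assume "open U"
    then have "openin riemann_sphere (Some ` U)" by simp
    then have "openin euclideanreal {x \<in> topspace euclideanreal. (Some \<circ> g) x \<in> Some ` U}"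
      by (rule openin_continuous_map_preimage[OF c])
    moreover have "{x \<in> topspace euclideanreal. (Some \<circ> g) x \<in> Some ` U} = g -` U \<inter> UNIV" by auto
    ultimately show "open (g -` U \<inter> UNIV)" by simp
  qed
  from lipschitz_reparametrization[OF g(3) this inj]
  obtain \<gamma> L where "simple_path \<gamma>" "pathfinish \<gamma> = pathstart \<gamma>" "L > 0"
    "\<forall>s\<in>{0..1}. \<forall>t\<in>{0..1}. dist (\<gamma> s) (\<gamma> t) \<le> L * \<bar>s - t\<bar>" "path_image \<gamma> = range g" by blast
  then show thesis using g(2) by (intro that[of \<gamma> L]) auto
qed

lemma hausdorff1_nonzero_mono: "A \<subseteq> B \<Longrightarrow> hausdorff1 A \<noteq> 0 \<Longrightarrow> hausdorff1 B \<noteq> 0"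
  using hausdorff1_mono[of A B] by auto

lemma open_imp_fsigma:
  fixes S :: "complex set"
  assumes "open S" "S \<noteq> {}" shows "fsigma S"
proof -
  obtain D where D: "countable D" "\<And>X. X \<in> D \<Longrightarrow> \<exists>a b. X = cbox a b" "\<Union>D = S"
    by (rule open_countable_Union_open_cbox[OF assms(1)]) blast
  then have "D \<noteq> {}" using assms(2) by auto
  have "closed (from_nat_into D n)" for n
    using D(2)[OF from_nat_into[OF \<open>D \<noteq> {}\<close>, of n]] by auto
  then have "fsigma (\<Union>(range (from_nat_into D)))" by (rule fsigma.intros)
  then show ?thesis using range_from_nat_into[OF \<open>D \<noteq> {}\<close> D(1)] D(3) by simp
qed

text \<open>Zeros of a nonconstant holomorphic function are isolated and hence countable.
  Uncountability is the criterion common to both claims: it follows from positive Hausdorff measure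
  as well as from vanishing on a nonempty open set.\<close>

lemma holomorphic_zero_if_uncountable_zeros:
  assumes h: "h holomorphic_on S" "open S" "connected S" and "uncountable {z \<in> S. h z = 0}" "z \<in> S"
  shows "h z = 0"
proof -
  have "h constant_on S" using holomorphic_countable_zeros[OF h open_imp_fsigma] h(2) assms(4,5) by blast
  then obtain c where c: "\<And>z. z \<in> S \<Longrightarrow> h z = c" unfolding constant_on_def by blast
  have "{z \<in> S. h z = 0} \<noteq> {}"
  proof
    assume "{z \<in> S. h z = 0} = {}"
    then have "countable {z \<in> S. h z = 0}" by (simp only: countable_empty)
    then show False using assms(4) by blast
  qed
  then obtain w where "w \<in> S" "h w = 0" by blast
  then show ?thesis using c[of w] c[OF assms(5)] by simp
qed

context
  fixes \<gamma>i \<gamma>e :: "real \<Rightarrow> complex" and Li Le :: real and Ui Ue :: "sphere_point set" and K :: "sphere_point set"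
  assumes i: "simple_path \<gamma>i" "pathfinish \<gamma>i = pathstart \<gamma>i" "Li > 0"
      "\<forall>s\<in>{0..1}. \<forall>t\<in>{0..1}. dist (\<gamma>i s) (\<gamma>i t) \<le> Li * \<bar>s - t\<bar>"
    and e: "simple_path \<gamma>e" "pathfinish \<gamma>e = pathstart \<gamma>e" "Le > 0"
      "\<forall>s\<in>{0..1}. \<forall>t\<in>{0..1}. dist (\<gamma>e s) (\<gamma>e t) \<le> Le * \<bar>s - t\<bar>"
    and common: "hausdorff1 (path_image \<gamma>i \<inter> path_image \<gamma>e) \<noteq> 0"
    and Ui: "Ui = Some ` inside (path_image \<gamma>i)" and Ue: "Ue = insert None (Some ` outside (path_image \<gamma>e))"
    and K: "K = riemann_sphere closure_of Ui \<union> riemann_sphere closure_of Ue"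
begin

lemma interior_pieces: "Ui \<subseteq> riemann_sphere interior_of K" "Ue \<subseteq> riemann_sphere interior_of K"
proof -
  have sphere: "A \<subseteq> topspace riemann_sphere" for A :: "sphere_point set" by (auto simp: UNIV_option_conv[symmetric])
  have "Ui \<subseteq> K" "Ue \<subseteq> K" unfolding K
    using closure_of_subset[OF sphere, of Ui] closure_of_subset[OF sphere, of Ue] by blast+
  then show "Ui \<subseteq> riemann_sphere interior_of K" "Ue \<subseteq> riemann_sphere interior_of K"
    using openin_In[OF i(1,2)] openin_Out[OF e(1,2)] unfolding Ui Ue by (blast intro: interior_of_maximal[THEN subsetD])+
qed

lemma closure_pieces: "riemann_sphere closure_of Ui \<subseteq> K" "riemann_sphere closure_of Ue \<subseteq> K"
  unfolding K by blast+

text \<open>Infinity is a limit of finite outside points, so arguments about the closure can be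
  carried out with finite points alone, even at infinity.\<close>

lemma dense_outside: "riemann_sphere closure_of Ue = riemann_sphere closure_of (Some ` outside (path_image \<gamma>e))"
proof
  have "Some ` outside (path_image \<gamma>e) \<subseteq> riemann_sphere closure_of (Some ` outside (path_image \<gamma>e))"
    by (rule closure_of_subset) auto
  then have "Ue \<subseteq> riemann_sphere closure_of (Some ` outside (path_image \<gamma>e))"
    using None_closure_Out[OF e(1,2)] unfolding Ue by blast
  then show "riemann_sphere closure_of Ue \<subseteq> riemann_sphere closure_of (Some ` outside (path_image \<gamma>e))"
    by (intro closure_of_minimal) auto
  show "riemann_sphere closure_of (Some ` outside (path_image \<gamma>e)) \<subseteq> riemann_sphere closure_of Ue"
    unfolding Ue by (rule closure_of_mono) blast
qed

context
  fixes h :: "sphere_point \<Rightarrow> complex"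
  assumes h: "h \<in> holomorphic_space K"
begin

lemma zero_inside_closure:
  assumes "\<And>z. z \<in> inside (path_image \<gamma>i) \<Longrightarrow> h (Some z) = 0" "q \<in> riemann_sphere closure_of Ui"
  shows "h q = 0"
  using closure_within_zero_set[OF holomorphic_spaceD(1)[OF h] _ closure_pieces(1) assms(2)] assms(1) Ui by blast

lemma zero_outside_closure:
  assumes "\<And>z. z \<in> outside (path_image \<gamma>e) \<Longrightarrow> h (Some z) = 0" "q \<in> riemann_sphere closure_of Ue"
  shows "h q = 0"
proof (rule closure_within_zero_set[OF holomorphic_spaceD(1)[OF h]])
  show "riemann_sphere closure_of (Some ` outside (path_image \<gamma>e)) \<subseteq> K"
    using closure_pieces(2) unfolding dense_outside .
  show "q \<in> riemann_sphere closure_of (Some ` outside (path_image \<gamma>e))" using assms(2) unfolding dense_outside .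
qed (use assms(1) in blast)

text \<open>Vanishing on one open piece extends by continuity to its closure, which contains its
  whole boundary curve and therefore the common part of positive measure. That part then lies on the
  boundary of the other piece, where boundary uniqueness applies.\<close>

lemma zero_inside_iff_zero_outside:
  "(\<forall>z \<in> inside (path_image \<gamma>i). h (Some z) = 0) \<longleftrightarrow> (\<forall>z \<in> outside (path_image \<gamma>e). h (Some z) = 0)"
proof
  assume "\<forall>z \<in> inside (path_image \<gamma>i). h (Some z) = 0"
  then have "h q = 0" if "q \<in> riemann_sphere closure_of Ui" for q using zero_inside_closure[OF _ that] by blast
  then have "path_image \<gamma>i \<inter> path_image \<gamma>e \<subseteq> {z \<in> path_image \<gamma>e. h (Some z) = 0}"
    using path_image_closures(1)[OF i(1,2)] unfolding Ui by blast
  then have "hausdorff1 {z \<in> path_image \<gamma>e. h (Some z) = 0} \<noteq> 0" using common by (rule hausdorff1_nonzero_mono)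
  then show "\<forall>z \<in> outside (path_image \<gamma>e). h (Some z) = 0"
    using boundary_zeros_outside[OF e(1,2) h closure_pieces(2)[unfolded Ue] e(3) e(4)[rule_format]] by blast
next
  assume "\<forall>z \<in> outside (path_image \<gamma>e). h (Some z) = 0"
  then have "h q = 0" if "q \<in> riemann_sphere closure_of Ue" for q using zero_outside_closure[OF _ that] by blast
  then have "path_image \<gamma>i \<inter> path_image \<gamma>e \<subseteq> {z \<in> path_image \<gamma>i. h (Some z) = 0}"
    using path_image_closures(2)[OF e(1,2)] unfolding Ue by blast
  then have "hausdorff1 {z \<in> path_image \<gamma>i. h (Some z) = 0} \<noteq> 0" using common by (rule hausdorff1_nonzero_mono)
  then show "\<forall>z \<in> inside (path_image \<gamma>i). h (Some z) = 0"
    using boundary_zeros_inside[OF i(1,2) h closure_pieces(1)[unfolded Ui] i(3) i(4)[rule_format]] by blast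
qed

lemma zero_spreads:
  assumes "(\<forall>z \<in> inside (path_image \<gamma>i). h (Some z) = 0) \<or> (\<forall>z \<in> outside (path_image \<gamma>e). h (Some z) = 0)" "q \<in> K"
  shows "h q = 0"
proof -
  have "\<And>z. z \<in> inside (path_image \<gamma>i) \<Longrightarrow> h (Some z) = 0" "\<And>z. z \<in> outside (path_image \<gamma>e) \<Longrightarrow> h (Some z) = 0"
    using assms(1) zero_inside_iff_zero_outside by blast+
  then show ?thesis using assms(2) zero_inside_closure zero_outside_closure unfolding K by blast
qed

lemma zero_if_uncountable_zeros:
  assumes "uncountable {z \<in> inside (path_image \<gamma>i). h (Some z) = 0} \<or> uncountable {z \<in> outside (path_image \<gamma>e). h (Some z) = 0}"
    and "q \<in> K"
  shows "h q = 0"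
proof (rule zero_spreads[OF _ assms(2)])
  have oi: "open (inside (path_image \<gamma>i))" "connected (inside (path_image \<gamma>i))"
    using Jordan_inside_outside[OF i(1,2)] by blast+
  have oe: "open (outside (path_image \<gamma>e))" "connected (outside (path_image \<gamma>e))"
    using Jordan_inside_outside[OF e(1,2)] by blast+
  have hi: "(\<lambda>z. h (Some z)) holomorphic_on inside (path_image \<gamma>i)"
    using interior_pieces(1) unfolding Ui by (rule holomorphic_space_finite[OF h oi(1)])
  have he: "(\<lambda>z. h (Some z)) holomorphic_on outside (path_image \<gamma>e)"
    using interior_pieces(2) unfolding Ue by (intro holomorphic_space_finite[OF h oe(1)]) blast
  from assms(1) show "(\<forall>z \<in> inside (path_image \<gamma>i). h (Some z) = 0) \<or> (\<forall>z \<in> outside (path_image \<gamma>e). h (Some z) = 0)"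
    using holomorphic_zero_if_uncountable_zeros[OF hi oi] holomorphic_zero_if_uncountable_zeros[OF he oe] by blast
qed

text \<open>The zeros are distributed over the two open pieces and the two curves, and null sets are
  closed under finite unions, so one of the four parts is not null. In an open piece it is
  uncountable and the identity theorem applies; on a curve boundary uniqueness does. Enlarging
  \<open>T\<close> to full zero sets avoids any question of measurability.\<close>

lemma zero_if_H1_positive_zeros:
  assumes T: "T \<subseteq> K" "sphere_H1 T \<noteq> 0" "\<And>q. q \<in> T \<Longrightarrow> h q = 0" and q: "q \<in> K"
  shows "h q = 0"
proof -
  define Zi where "Zi = {z \<in> inside (path_image \<gamma>i). h (Some z) = 0}"
  define Ze where "Ze = {z \<in> outside (path_image \<gamma>e). h (Some z) = 0}"
  define Bi where "Bi = {z \<in> path_image \<gamma>i. h (Some z) = 0}"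
  define Be where "Be = {z \<in> path_image \<gamma>e. h (Some z) = 0}"
  have "Some -` T \<subseteq> (Zi \<union> Bi) \<union> (Ze \<union> Be)"
  proof
    fix z assume "z \<in> Some -` T"
    then have z: "Some z \<in> K" "h (Some z) = 0" using T by auto
    have "z \<in> inside (path_image \<gamma>i) \<or> z \<in> path_image \<gamma>i \<or> z \<in> outside (path_image \<gamma>e) \<or> z \<in> path_image \<gamma>e"
      using z(1) closure_In(2)[OF i(1,2)] closure_Out(2)[OF e(1,2)] unfolding K Ui Ue by blast
    then show "z \<in> (Zi \<union> Bi) \<union> (Ze \<union> Be)" using z(2) by (auto simp only: Zi_def Ze_def Bi_def Be_def mem_Collect_eq Un_iff)
  qed
  then have "hausdorff1 ((Zi \<union> Bi) \<union> (Ze \<union> Be)) \<noteq> 0"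
    using T(2) unfolding sphere_H1_def by (rule hausdorff1_nonzero_mono)
  then consider "hausdorff1 Zi \<noteq> 0" | "hausdorff1 Ze \<noteq> 0" | "hausdorff1 Bi \<noteq> 0" | "hausdorff1 Be \<noteq> 0"
    using hausdorff1_zero_Un by metis
  then show ?thesis
  proof cases
    case 1
    then have "uncountable Zi" using hausdorff1_countable by blast
    then show ?thesis using zero_if_uncountable_zeros[OF _ q] unfolding Zi_def by blast
  next
    case 2
    then have "uncountable Ze" using hausdorff1_countable by blast
    then show ?thesis using zero_if_uncountable_zeros[OF _ q] unfolding Ze_def by blast
  next
    case 3
    then show ?thesis
      using boundary_zeros_inside[OF i(1,2) h closure_pieces(1)[unfolded Ui] i(3) i(4)[rule_format]]
      unfolding Bi_def by (intro zero_spreads[OF _ q]) blast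
  next
    case 4
    then show ?thesis
      using boundary_zeros_outside[OF e(1,2) h closure_pieces(2)[unfolded Ue] e(3) e(4)[rule_format]]
      unfolding Be_def by (intro zero_spreads[OF _ q]) blast
  qed
qed

text \<open>Flatness kills \<open>h\<close> on a neighbourhood of \<open>P\<close>, but
  \<open>P\<close> may lie on the curves and belong to neither open piece. It is still in the
  closure of one of them, so the neighbourhood meets that piece in a nonempty open set of
  zeros.\<close>

lemma zero_if_flat:
  assumes P: "P \<in> riemann_sphere interior_of K" and q: "q \<in> K"
    and flat: "\<And>N. ((\<lambda>u. inverse (u ^ N) * h (chart P u)) \<longlongrightarrow> 0) (at 0)"
  shows "h q = 0"
proof -
  obtain r where r: "r > 0" "chart P ` ball 0 r \<subseteq> riemann_sphere interior_of K" using interior_chart_ball[OF P] .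
  have hol: "(\<lambda>u. h (chart P u)) holomorphic_on ball 0 r" by (rule holomorphic_space_chart[OF h _ r(2)]) simp
  have zero: "h (chart P u) = 0" if "u \<in> ball 0 r" for u
    using flat by (intro flat_holomorphic_zero[OF hol r(1) _ that]) simp
  have "eventually (\<lambda>u. u \<in> ball 0 r) (at (0::complex))" using r(1) by (intro eventually_at_in_open') auto
  then have "eventually (\<lambda>p. h p = 0) (atin riemann_sphere P)"
    unfolding eventually_atin_chart using zero by (auto elim: eventually_mono)
  then obtain U where U: "openin riemann_sphere U" "P \<in> U" "\<And>p. p \<in> U - {P} \<Longrightarrow> h p = 0"
    unfolding eventually_atin by auto
  have hU: "h p = 0" if "p \<in> U" for p
    using U(3)[of p] zero[of 0] r(1) that by (cases "p = P") auto
  have "P \<in> K" by (rule subsetD[OF interior_of_subset P])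
  then consider "P \<in> riemann_sphere closure_of (Some ` inside (path_image \<gamma>i))"
    | "P \<in> riemann_sphere closure_of (Some ` outside (path_image \<gamma>e))"
    unfolding K dense_outside unfolding Ui by blast
  then have "\<exists>z. Some z \<in> U \<and> (z \<in> inside (path_image \<gamma>i) \<or> z \<in> outside (path_image \<gamma>e))"
    using U(1,2) unfolding in_closure_of by cases blast+
  then obtain z where z: "Some z \<in> U" "z \<in> inside (path_image \<gamma>i) \<or> z \<in> outside (path_image \<gamma>e)" by blast
  have oU: "open (Some -` U)" using U(1) unfolding openin_sphere_iff by blast
  have unc: "uncountable {w \<in> S. h (Some w) = 0}" if S: "open S" "z \<in> S" for S
  proof
    assume "countable {w \<in> S. h (Some w) = 0}"
    moreover have "Some -` U \<inter> S \<subseteq> {w \<in> S. h (Some w) = 0}" using hU by blast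
    ultimately have "countable (Some -` U \<inter> S)" by (metis countable_subset)
    moreover have "open (Some -` U \<inter> S)" "z \<in> Some -` U \<inter> S" using oU S z(1) by auto
    then obtain d where "d > 0" "ball z d \<subseteq> Some -` U \<inter> S" by (meson open_contains_ball)
    ultimately show False using uncountable_ball[of d z] by (metis countable_subset)
  qed
  have "open (inside (path_image \<gamma>i))" "open (outside (path_image \<gamma>e))"
    using Jordan_inside_outside[OF i(1,2)] Jordan_inside_outside[OF e(1,2)] by blast+
  then show ?thesis using zero_if_uncountable_zeros[OF _ q] unc z(2) by blast
qed

end

end

text \<open>The expansion is the Taylor series in the chart at \<open>P\<close>, where on a small
  disc the function is defined throughout. The notion also demands that \<open>P\<close> is not
  isolated in \<open>K\<close>, which small nonzero chart values show.\<close>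

lemma asymptotic_expansion_exists:
  fixes f :: "sphere_point \<Rightarrow> 'b::complex_banach"
  assumes f: "f \<in> holomorphic_space K" and P: "P \<in> riemann_sphere interior_of K"
  shows "\<exists>a. has_asymptotic_expansion K f P a"
proof -
  obtain r where r: "r > 0" "chart P ` ball 0 r \<subseteq> riemann_sphere interior_of K" using interior_chart_ball[OF P] .
  have "chart P ` ball 0 r \<subseteq> K" using r(2) interior_of_subset by (rule order_trans)
  then have "continuous_on (ball 0 r) (\<lambda>u. f (chart P u))"
    by (rule continuous_on_chart_compose[OF holomorphic_spaceD(1)[OF f] continuous_map_chart])
  moreover have "(\<lambda>u. \<phi> (f (chart P u))) holomorphic_on ball 0 r" if "cfunctional \<phi>" for \<phi>
    by (rule holomorphic_space_chart[OF cfunctional_compose[OF that f] _ r(2)]) simp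
  ultimately have "\<exists>a. \<forall>N. ((\<lambda>u. inverse ((u - 0) ^ N) *\<^sub>C (f (chart P u) - (\<Sum>n\<le>N. (u - 0) ^ n *\<^sub>C a n))) \<longlongrightarrow> 0) (at 0)"
    by (rule cfunctional_taylor[OF _ r(1), of 0 "\<lambda>u. f (chart P u)"])
  then obtain a where a: "\<forall>N. ((\<lambda>u. inverse ((u - 0) ^ N) *\<^sub>C (f (chart P u) - (\<Sum>n\<le>N. (u - 0) ^ n *\<^sub>C a n))) \<longlongrightarrow> 0) (at 0)"
    by (elim exE)
  have "P \<in> riemann_sphere derived_set_of K"
    unfolding in_derived_set_of
  proof (intro conjI allI impI)
    show "P \<in> topspace riemann_sphere" using P interior_of_subset_topspace by (rule subsetD[rotated])
    fix T assume T: "P \<in> T \<and> openin riemann_sphere T"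
    have "P \<in> riemann_sphere interior_of (T \<inter> K)"
      using P T by (simp add: interior_of_Int interior_of_openin)
    then obtain s where s: "s > 0" "chart P ` ball 0 s \<subseteq> riemann_sphere interior_of (T \<inter> K)" by (rule interior_chart_ball)
    define u where "u = complex_of_real (s/2)"
    have "u \<in> ball 0 s" "u \<noteq> 0" using s(1) by (simp_all add: u_def)
    then have "chart P u \<in> riemann_sphere interior_of (T \<inter> K)" using s(2) by blast
    then have "chart P u \<in> T \<inter> K" by (rule subsetD[OF interior_of_subset])
    moreover have "chart P u \<noteq> P" using chart_inj \<open>u \<noteq> 0\<close> by blast
    ultimately show "\<exists>y. y \<noteq> P \<and> y \<in> K \<and> y \<in> T" by blast
  qed
  moreover have "P \<in> K" by (rule subsetD[OF interior_of_subset P])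
  ultimately show ?thesis
    using a unfolding has_asymptotic_expansion_def atin_within_interior[OF P] tendsto_atin_chart
    by (intro exI[of _ a]) simp
qed

lemma zero_expansion_cfunctional:
  fixes f :: "sphere_point \<Rightarrow> 'b::complex_banach"
  assumes "has_asymptotic_expansion K f P (\<lambda>_. 0)" and P: "P \<in> riemann_sphere interior_of K" and \<phi>: "cfunctional \<phi>"
  shows "((\<lambda>u. inverse (u ^ N) * \<phi> (f (chart P u))) \<longlongrightarrow> 0) (at 0)"
proof -
  have "((\<lambda>u. inverse (u ^ N) *\<^sub>C f (chart P u)) \<longlongrightarrow> 0) (at 0)"
    using assms(1) unfolding has_asymptotic_expansion_def atin_within_interior[OF P] tendsto_atin_chart by simp
  then have "((\<lambda>u. norm (inverse (u ^ N) *\<^sub>C f (chart P u))) \<longlongrightarrow> 0) (at 0)" by (rule tendsto_norm_zero)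
  moreover have "norm (inverse (u ^ N) * \<phi> (f (chart P u))) \<le> norm (inverse (u ^ N) *\<^sub>C f (chart P u))" for u
    using cfunctionalD(3)[OF \<phi>, of "f (chart P u)"] unfolding norm_mult norm_scaleC by (intro mult_left_mono) auto
  ultimately show ?thesis by (intro Lim_null_comparison[where f = "\<lambda>u. inverse (u ^ N) * \<phi> (f (chart P u))"] always_eventually allI)
qed

theorem theoremA:
  fixes \<Gamma>i \<Gamma>e K :: "sphere_point set"
    and E :: "(sphere_point \<Rightarrow> 'b::complex_banach) set"
  assumes "nested_pair \<Gamma>i \<Gamma>e"
    and "K = nested_compact \<Gamma>i \<Gamma>e"
    and "E = holomorphic_space K"
  shows "H1_quasianalytic K E K \<and> (\<forall>p \<in> riemann_sphere interior_of K. quasianalytic_at K E p)"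
proof -
  have rect: "rectifiable_jordan_curve \<Gamma>i" "rectifiable_jordan_curve \<Gamma>e" and H: "sphere_H1 (\<Gamma>i \<inter> \<Gamma>e) > 0"
    using assms(1) by (simp_all add: nested_pair_def)
  obtain \<gamma>i Li where i: "simple_path \<gamma>i" "pathfinish \<gamma>i = pathstart \<gamma>i" "Li > 0"
      "\<forall>s\<in>{0..1}. \<forall>t\<in>{0..1}. dist (\<gamma>i s) (\<gamma>i t) \<le> Li * \<bar>s - t\<bar>" and \<Gamma>i: "\<Gamma>i = Some ` path_image \<gamma>i"
    using rect(1) by (rule Jordan_curve_lipschitz)
  obtain \<gamma>e Le where e: "simple_path \<gamma>e" "pathfinish \<gamma>e = pathstart \<gamma>e" "Le > 0"
      "\<forall>s\<in>{0..1}. \<forall>t\<in>{0..1}. dist (\<gamma>e s) (\<gamma>e t) \<le> Le * \<bar>s - t\<bar>" and \<Gamma>e: "\<Gamma>e = Some ` path_image \<gamma>e"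
    using rect(2) by (rule Jordan_curve_lipschitz)
  have "Some -` (\<Gamma>i \<inter> \<Gamma>e) = path_image \<gamma>i \<inter> path_image \<gamma>e" unfolding \<Gamma>i \<Gamma>e by blast
  then have common: "hausdorff1 (path_image \<gamma>i \<inter> path_image \<gamma>e) \<noteq> 0" using H by (simp add: sphere_H1_def)
  have K: "K = riemann_sphere closure_of (Some ` inside (path_image \<gamma>i)) \<union>
      riemann_sphere closure_of (insert None (Some ` outside (path_image \<gamma>e)))"
    unfolding assms(2) nested_compact_def \<Gamma>i \<Gamma>e inner_outer_component[OF i(1,2)] inner_outer_component[OF e(1,2)] ..
  note H1 = zero_if_H1_positive_zeros[OF i e common refl refl K]
  note flat = zero_if_flat[OF i e common refl refl K]
  have "uniqueness_set K E T" if T: "T \<subseteq> K" "sphere_H1 T > 0" for T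
    unfolding uniqueness_set_def assms(3)
  proof (intro conjI ballI impI T(1))
    fix f :: "sphere_point \<Rightarrow> 'b" and q assume f: "f \<in> holomorphic_space K" "\<forall>q\<in>T. f q = 0" and q: "q \<in> K"
    show "f q = 0"
    \<comment> \<open>Functionals separate the points of the Banach space and carry its functions to
      scalar functions of the same kind on the same \<open>K\<close>, so the scalar result applies
      to each \<open>\<phi>\<close> separately.\<close>
    proof (rule zero_if_cfunctionals_zero)
      fix \<phi> :: "'b \<Rightarrow> complex" assume \<phi>: "cfunctional \<phi>"
      show "\<phi> (f q) = 0"
        by (rule H1[where h = "\<lambda>q. \<phi> (f q)" and T = T, OF cfunctional_compose[OF \<phi> f(1)] T(1) _ _ q])
          (use T(2) f(2) cfunctionalD(4)[OF \<phi>] in auto)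
    qed
  qed
  then have "H1_quasianalytic K E K" by (simp add: H1_quasianalytic_def)
  moreover have "quasianalytic_at K E P" if P: "P \<in> riemann_sphere interior_of K" for P
    unfolding quasianalytic_at_def assms(3)
  proof (intro conjI ballI impI)
    fix f :: "sphere_point \<Rightarrow> 'b" assume f: "f \<in> holomorphic_space K"
    show "\<exists>a. has_asymptotic_expansion K f P a" by (rule asymptotic_expansion_exists[OF f P])
    assume zero: "has_asymptotic_expansion K f P (\<lambda>_. 0)"
    fix q assume q: "q \<in> K"
    show "f q = 0"
    proof (rule zero_if_cfunctionals_zero)
      fix \<phi> :: "'b \<Rightarrow> complex" assume \<phi>: "cfunctional \<phi>"
      show "\<phi> (f q) = 0"
        by (rule flat[OF cfunctional_compose[OF \<phi> f] P q zero_expansion_cfunctional[OF zero P \<phi>]])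
    qed
  qed
  ultimately show ?thesis by blast
qed

end
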